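(* Let $(T,\varphi)$ be admissible and suppose that for some fixed $N\in\mathbb N$ there is $\delta_N>0$ for which $T^N$ has the uniform covering property and such that $T^N$ satisfies (1c* ) and $(T^N,S_N\varphi)$ satisfies (1g) with constant $\delta_N$, and that $T^N$ satisfies (1e) (see context). Then: (1) there exist $\mu\in\mathcal M(X)$ and $\lambda>0$ such that $\mathcal L_\varphi^*(\mu)=\lambda\mu$ and $\lambda e^{-\varphi}$ is the Jacobian of $T$ with respect to $\mu$. The pair $(\lambda,\mu)$ is uniquely determined by the conditions $\lambda>0$, $\mu\in\mathcal M(X)$ and $\mathcal L_\varphi^*(\mu)=\lambda\mu$; (2) there exists $h\in\mathcal C(\widehat X)$ with $h>0$ such that $\mu(h)=1$ and $\mathcal L_\varphi(h)=\lambda h$; (3) $h$ satisfies $h(x)\le e^{C_\varphi(x,x')}h(x')$ for $x,x'\in X$ with $d(x,x')<\delta_N$, and $h$ is uniquely determined by this condition and the properties $h>0$, $\mu(h)=1$ and $\mathcal L_\varphi(h)=\lambda h$; (4) $\lambda^{-n}\mathcal L_\varphi^n(f)\to h\cdot\mu(f)$ uniformly on $\widehat X$ for every $f\in\mathcal C(\widehat X)$; (5) $m=h\cdot\mu$ is a Gibbs invariant measure for $T$ and $\mathcal L_\psi^*(m)=m$, where $\psi=\varphi-\log\lambda+\log h-\log h\circ T$; (6) $\log\lambda=P(T,\varphi)=\sup\{\nu(I_\nu(\mathcal B|T^{-1}\mathcal B)+\varphi):\nu\in\mathcal M(X,T)\}$ and $m$ is the equilibrium state (it attains the supremum); (7)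 $m$ and $\mu$ are positive on nonempty open sets and have no atoms.
   Context: Setting: $(\widehat X,d)$ is a compact metric space, $X$ is an open dense subset of $\widehat X$, $X_0$ is an open dense subset of $X$, and $T:X_0\to X$ is continuous. $B(x,r)$ is the open ball, $B_X(x,r)=B(x,r)\cap X$. $\mathcal C(\Omega)$ is the set of real-valued continuous functions on $\Omega$ (sup norm on $\mathcal C(\widehat X)$); $\mathcal M(\Omega)$ is the set of Borel probability measures on $\Omega$; a $\mu\in\mathcal M(X)$ is regarded as a measure on $\widehat X$ with $\mu(\widehat X\setminus X)=0$. $\mu(f)=\int f\,d\mu$, and $h\cdot\mu$ is the measure with $(h\cdot\mu)(f)=\mu(hf)$. $T^n$ is defined on $T^{-n}(X)=T^{-n+1}X_0$, and $T^{-n}(A)$ is the set of $y$ in this domain with $T^n(y)\in A$. $S_n\varphi=\sum_{i=0}^{n-1}\varphi\circ T^i$. Conditions: (1a) $T^{-1}(x)$ is at most countable for each $x\in X$. (1b) (uniform covering property) There is $\delta>0$ such that for each $x\in X$, $T^{-1}(B_X(x,\delta))$ can be written uniquely as a disjoint union of finitely or countably many open subsets $A_i(x)$ of $X_0$, each mapped by $T$ homeomorphically onto $B_X(x,\delta)$. For $T(y)=x$, $T_y^{-1}$ is the branch of $T^{-1}$ on $B_X(x,\delta)$ sending $x$ to $y$. (1c) For every $\varepsilon>0$ there is $0<\delta_0<\delta$ such that for each $x\in X$ and $y$ with $T(y)=x$, if $x'\in X$, $d(x,x')<\delta_0$, then $d(T_y^{-1}(x),T_y^{-1}(x'))<\varepsilon$.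 (1d) For every $\varepsilon>0$ there is $0<\delta_1<\delta$ such that for $x,x'\in X$ with $d(x,x')<\delta_1$, $\sum_{T(y)=x}|\exp(\varphi(T_y^{-1}(x)))-\exp(\varphi(T_y^{-1}(x')))|<\varepsilon$. $(T,\varphi)$ is admissible if (1a)–(1d) hold, $\varphi\in\mathcal C(X_0)$, and $\sup_{x\in X}\sum_{T(y)=x}\exp(\varphi(y))<\infty$. Hypotheses on $T^N$ (a map from $T^{-N}(X)$ to $X$), with constant $\delta_N$: the uniform covering property (1b) holds for $T^N$ with $\delta_N$ in place of $\delta$, with injective components $A_i^{(N)}(x)$. (1c* ) $d(T^N(y),T^N(y'))\ge d(y,y')$ whenever $y,y'$ lie in one $A_i^{(N)}(x)$. (1g) There is $C_\varphi>0$ such that $$C_\varphi(x,x'):=\sup_{n\ge1}\ \sup_{T^{nN}(y)=x}|S_{nN}\varphi(y)-S_{nN}\varphi(y')|\le C_\varphi$$ whenever $x,x'\in X$, $d(x,x')<\delta_N$, where $y'=T_y^{-nN}(x')$ and $T_y^{-nN}$ is the branch of $T^{-nN}$ over $B_X(x,\delta_N)$ sending $x$ to $y$; moreover $C_\varphi(x,x')\to0$ as $d(x,x')\to0$. (1e) For every $\varepsilon>0$ there is $m\ge1$ such that $T^{-Nm}(x)$ is $\varepsilon$-dense in $X$ for each $x\in X$. Operator: $\mathcal L_\varphi(f)(x)=\sum_{T(y)=x}f(y)\exp(\varphi(y))$, $x\in X$. For admissible $(T,\varphi)$ and $f\in\mathcal C(\widehat X)$, $\mathcal L_\varphi(f)$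 extends continuously to $\widehat X$, so $\mathcal L_\varphi$ is a linear operator of $\mathcal C(\widehat X)$ to itself; $\mathcal L_\varphi^*$ is its dual. The same notation is used for $\psi$. $P(T,\varphi)$ is the common value of $\lim_n\frac1n\log\mathcal L_\varphi^n(1)(x)$, assumed (as part of the assertion) to exist and be independent of $x\in X$. A function $g$ is the Jacobian of $T$ with respect to $\mu$ if $\mu(T(A))=\int_Ag\,d\mu$ for every Borel $A\subseteq X_0$ on which $T$ is injective. $\mathcal M(X,T)$ is the set of $\nu\in\mathcal M(X)$ with $\nu(T^{-1}B)=\nu(B)$ for all Borel $B\subseteq X$. $\mathcal B$ is the Borel $\sigma$-algebra of $X$, and $I_\nu(\mathcal B|T^{-1}\mathcal B)$ is the conditional information function of $\mathcal B$ given $T^{-1}\mathcal B$ with respect to $\nu$ (minus the logarithm of the conditional probability of the point $y$ given $T^{-1}\mathcal B$). An invariant measure $m$ is Gibbs (for $\varphi$) if there are $r>0$ and $c\ge1$ such that for all $n$ and $x\in T^{-n}(X)$, with $T_x^{-n}$ the branch of $T^{-n}$ over $B_X(T^n(x),r)$ sending $T^n(x)$ to $x$, $c^{-1}\le m(T_x^{-n}(B_X(T^n(x),r)))/\exp(S_n\varphi(x)-nP(T,\varphi))\le c$.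
   Formalization: In (7), "have no atoms" is stated only when X is not a single point: for a one-point X with T the identity all hypotheses hold, but μ and m are the point mass. *)

theory Defs
  imports "HOL-Probability.Probability"
begin

(* The compact metric space is the whole type 'a; X and X0 are subsets of it, and maps and
   potentials are total functions of which only the values on their domains matter. *)

section \<open>Iterates and preimages\<close>

(* The domain of T^n; its value at n = 0 is X and at n = 1 is X0. *)
definition iter_dom :: "'a set \<Rightarrow> 'a set \<Rightarrow> ('a \<Rightarrow> 'a) \<Rightarrow> nat \<Rightarrow> 'a set" where
  "iter_dom X X0 T n = {y \<in> X. \<forall>i<n. (T ^^ i) y \<in> X0}"

definition iter_preimage ::
    "'a set \<Rightarrow> 'a set \<Rightarrow> ('a \<Rightarrow> 'a) \<Rightarrow> nat \<Rightarrow> 'a set \<Rightarrow> 'a set" where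
  "iter_preimage X X0 T n A = {y \<in> iter_dom X X0 T n. (T ^^ n) y \<in> A}"

definition birkhoff_sum :: "('a \<Rightarrow> 'a) \<Rightarrow> nat \<Rightarrow> ('a \<Rightarrow> real) \<Rightarrow> 'a \<Rightarrow> real" where
  "birkhoff_sum T n \<phi> y = (\<Sum>i<n. \<phi> ((T ^^ i) y))"

definition ball_in :: "'a::metric_space set \<Rightarrow> 'a \<Rightarrow> real \<Rightarrow> 'a set" where
  "ball_in X x r = ball x r \<inter> X"


section \<open>Uniform coverings and inverse branches\<close>

(* Here and below S is a map with domain D; it will be T on X0 or T^N on iter_dom X X0 T N.
   These domains are open, so openness of a sheet relative to the domain is openness. *)
definition is_sheets ::
    "('a::metric_space \<Rightarrow> 'a) \<Rightarrow> 'a set \<Rightarrow> 'a set \<Rightarrow> 'a set set \<Rightarrow> bool" where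
  "is_sheets S D B \<A> \<longleftrightarrow>
     countable \<A> \<and> disjoint \<A> \<and> \<Union>\<A> = {y \<in> D. S y \<in> B} \<and>
     (\<forall>A\<in>\<A>. open A \<and> (\<exists>g. homeomorphism A B S g))"

definition uniform_covering ::
    "'a::metric_space set \<Rightarrow> ('a \<Rightarrow> 'a) \<Rightarrow> 'a set \<Rightarrow> real \<Rightarrow> bool" where
  "uniform_covering X S D \<delta> \<longleftrightarrow> (\<forall>x\<in>X. \<exists>!\<A>. is_sheets S D (ball_in X x \<delta>) \<A>)"

definition sheets ::
    "'a::metric_space set \<Rightarrow> ('a \<Rightarrow> 'a) \<Rightarrow> 'a set \<Rightarrow> real \<Rightarrow> 'a \<Rightarrow> 'a set set" where
  "sheets X S D \<delta> x = (THE \<A>. is_sheets S D (ball_in X x \<delta>) \<A>)"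

(* The branch of the inverse of S on the ball of radius \<delta> around S y which sends S y to y. *)
definition inv_branch ::
    "'a::metric_space set \<Rightarrow> ('a \<Rightarrow> 'a) \<Rightarrow> 'a set \<Rightarrow> real \<Rightarrow> 'a \<Rightarrow> 'a \<Rightarrow> 'a" where
  "inv_branch X S D \<delta> y =
     the_inv_into (THE A. A \<in> sheets X S D \<delta> (S y) \<and> y \<in> A) S"

(* If b y is a branch of the inverse of S sending S y to y, then iter_branch S b k y is the
   composition b y o b (S y) o ... o b (S^(k-1) y), which sends S^k y to y. *)
fun iter_branch ::
    "('a \<Rightarrow> 'a) \<Rightarrow> ('a \<Rightarrow> 'a \<Rightarrow> 'a) \<Rightarrow> nat \<Rightarrow> 'a \<Rightarrow> 'a \<Rightarrow> 'a" where
  "iter_branch S b 0 y z = z"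
| "iter_branch S b (Suc k) y z = b y (iter_branch S b k (S y) z)"


section \<open>Conditions on T and the potential\<close>

definition cond_1c ::
    "'a::metric_space set \<Rightarrow> 'a set \<Rightarrow> ('a \<Rightarrow> 'a) \<Rightarrow> real \<Rightarrow> bool" where
  "cond_1c X X0 T \<delta> \<longleftrightarrow>
     (\<forall>\<epsilon>>0. \<exists>\<delta>0>0. \<delta>0 < \<delta> \<and>
        (\<forall>x\<in>X. \<forall>y\<in>X0. T y = x \<longrightarrow> (\<forall>x'\<in>X. dist x x' < \<delta>0 \<longrightarrow>
           dist (inv_branch X T X0 \<delta> y x) (inv_branch X T X0 \<delta> y x') < \<epsilon>)))"

(* For real-valued infsum the value of a divergent sum is 0, hence the explicit summability. *)
definition cond_1d ::
    "'a::metric_space set \<Rightarrow> 'a set \<Rightarrow> ('a \<Rightarrow> 'a) \<Rightarrow> ('a \<Rightarrow> real) \<Rightarrow> real \<Rightarrow> bool" where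
  "cond_1d X X0 T \<phi> \<delta> \<longleftrightarrow>
     (\<forall>\<epsilon>>0. \<exists>\<delta>1>0. \<delta>1 < \<delta> \<and>
        (\<forall>x\<in>X. \<forall>x'\<in>X. dist x x' < \<delta>1 \<longrightarrow>
           (\<lambda>y. \<bar>exp (\<phi> (inv_branch X T X0 \<delta> y x)) - exp (\<phi> (inv_branch X T X0 \<delta> y x'))\<bar>)
             summable_on {y \<in> X0. T y = x} \<and>
           (\<Sum>\<^sub>\<infinity>y\<in>{y \<in> X0. T y = x}.
              \<bar>exp (\<phi> (inv_branch X T X0 \<delta> y x)) - exp (\<phi> (inv_branch X T X0 \<delta> y x'))\<bar>) < \<epsilon>))"

definition admissible ::
    "'a::metric_space set \<Rightarrow> 'a set \<Rightarrow> ('a \<Rightarrow> 'a) \<Rightarrow> ('a \<Rightarrow> real) \<Rightarrow> real \<Rightarrow> bool" where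
  "admissible X X0 T \<phi> \<delta> \<longleftrightarrow>
     (\<forall>x\<in>X. countable {y \<in> X0. T y = x}) \<and>
     \<delta> > 0 \<and> uniform_covering X T X0 \<delta> \<and>
     cond_1c X X0 T \<delta> \<and>
     cond_1d X X0 T \<phi> \<delta> \<and>
     continuous_on X0 \<phi> \<and>
     (\<exists>K. \<forall>x\<in>X. (\<lambda>y. exp (\<phi> y)) summable_on {y \<in> X0. T y = x} \<and>
                 (\<Sum>\<^sub>\<infinity>y\<in>{y \<in> X0. T y = x}. exp (\<phi> y)) \<le> K)"

definition cond_1c_star ::
    "'a::metric_space set \<Rightarrow> 'a set \<Rightarrow> ('a \<Rightarrow> 'a) \<Rightarrow> nat \<Rightarrow> real \<Rightarrow> bool" where
  "cond_1c_star X X0 T N \<delta>N \<longleftrightarrow>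
     (\<forall>x\<in>X. \<forall>A\<in>sheets X (T ^^ N) (iter_dom X X0 T N) \<delta>N x. \<forall>y\<in>A. \<forall>y'\<in>A.
        dist ((T ^^ N) y) ((T ^^ N) y') \<ge> dist y y')"

(* The branch of the inverse of T^(k N) on the ball of radius \<delta>N around T^(k N) y sending
   T^(k N) y to y. By the expansion condition each branch of the inverse of T^N maps this ball into the ball of
   the same radius on which the next branch is defined, so the composition makes sense. *)
definition branch_N ::
    "'a::metric_space set \<Rightarrow> 'a set \<Rightarrow> ('a \<Rightarrow> 'a) \<Rightarrow> nat \<Rightarrow> real \<Rightarrow> nat \<Rightarrow> 'a \<Rightarrow> 'a \<Rightarrow> 'a" where
  "branch_N X X0 T N \<delta>N k y =
     iter_branch (T ^^ N) (inv_branch X (T ^^ N) (iter_dom X X0 T N) \<delta>N) k y"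

definition distortion ::
    "'a::metric_space set \<Rightarrow> 'a set \<Rightarrow> ('a \<Rightarrow> 'a) \<Rightarrow> ('a \<Rightarrow> real) \<Rightarrow> nat \<Rightarrow> real
      \<Rightarrow> 'a \<Rightarrow> 'a \<Rightarrow> ennreal" where
  "distortion X X0 T \<phi> N \<delta>N x x' =
     (SUP n\<in>{1..}. SUP y\<in>iter_preimage X X0 T (n * N) {x}.
        ennreal \<bar>birkhoff_sum T (n * N) \<phi> y
                 - birkhoff_sum T (n * N) \<phi> (branch_N X X0 T N \<delta>N n y x')\<bar>)"

definition cond_1g ::
    "'a::metric_space set \<Rightarrow> 'a set \<Rightarrow> ('a \<Rightarrow> 'a) \<Rightarrow> ('a \<Rightarrow> real) \<Rightarrow> nat \<Rightarrow> real \<Rightarrow> bool" where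
  "cond_1g X X0 T \<phi> N \<delta>N \<longleftrightarrow>
     (\<exists>C>0. \<forall>x\<in>X. \<forall>x'\<in>X. dist x x' < \<delta>N \<longrightarrow>
        distortion X X0 T \<phi> N \<delta>N x x' \<le> ennreal C) \<and>
     (\<forall>\<epsilon>>0. \<exists>\<eta>>0. \<eta> \<le> \<delta>N \<and> (\<forall>x\<in>X. \<forall>x'\<in>X. dist x x' < \<eta> \<longrightarrow>
        distortion X X0 T \<phi> N \<delta>N x x' < ennreal \<epsilon>))"

definition cond_1e ::
    "'a::metric_space set \<Rightarrow> 'a set \<Rightarrow> ('a \<Rightarrow> 'a) \<Rightarrow> nat \<Rightarrow> bool" where
  "cond_1e X X0 T N \<longleftrightarrow>
     (\<forall>\<epsilon>>0. \<exists>m\<ge>1. \<forall>x\<in>X. \<forall>z\<in>X. \<exists>y\<in>iter_preimage X X0 T (N * m) {x}. dist z y < \<epsilon>)"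


section \<open>The transfer operator\<close>

definition transfer_sum ::
    "'a set \<Rightarrow> ('a \<Rightarrow> 'a) \<Rightarrow> ('a \<Rightarrow> real) \<Rightarrow> ('a \<Rightarrow> real) \<Rightarrow> 'a \<Rightarrow> real" where
  "transfer_sum X0 T \<phi> f x = (\<Sum>\<^sub>\<infinity>y\<in>{y \<in> X0. T y = x}. f y * exp (\<phi> y))"

(* The continuous extension to the whole space; it is unique because X is dense. *)
definition transfer_op ::
    "'a::metric_space set \<Rightarrow> 'a set \<Rightarrow> ('a \<Rightarrow> 'a) \<Rightarrow> ('a \<Rightarrow> real) \<Rightarrow> ('a \<Rightarrow> real) \<Rightarrow> 'a \<Rightarrow> real" where
  "transfer_op X X0 T \<phi> f =
     (THE g. continuous_on UNIV g \<and> (\<forall>x\<in>X. g x = transfer_sum X0 T \<phi> f x))"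

(* The dual operator applied to a measure, as a functional on continuous functions. *)
definition transfer_dual ::
    "'a::metric_space set \<Rightarrow> 'a set \<Rightarrow> ('a \<Rightarrow> 'a) \<Rightarrow> ('a \<Rightarrow> real) \<Rightarrow> 'a measure
      \<Rightarrow> ('a \<Rightarrow> real) \<Rightarrow> real" where
  "transfer_dual X X0 T \<phi> \<mu> f = (\<integral>x. transfer_op X X0 T \<phi> f x \<partial>\<mu>)"

definition dual_eigen ::
    "'a::metric_space set \<Rightarrow> 'a set \<Rightarrow> ('a \<Rightarrow> 'a) \<Rightarrow> ('a \<Rightarrow> real) \<Rightarrow> real \<Rightarrow> 'a measure \<Rightarrow> bool" where
  "dual_eigen X X0 T \<phi> lam \<mu> \<longleftrightarrow>
     (\<forall>f. continuous_on UNIV f \<longrightarrow> transfer_dual X X0 T \<phi> \<mu> f = lam * (\<integral>x. f x \<partial>\<mu>))"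

definition is_pressure ::
    "'a::metric_space set \<Rightarrow> 'a set \<Rightarrow> ('a \<Rightarrow> 'a) \<Rightarrow> ('a \<Rightarrow> real) \<Rightarrow> real \<Rightarrow> bool" where
  "is_pressure X X0 T \<phi> p \<longleftrightarrow>
     (\<forall>x\<in>X. (\<lambda>n. ln ((transfer_op X X0 T \<phi> ^^ n) (\<lambda>_. 1) x) / real n) \<longlonglongrightarrow> p)"

definition pressure ::
    "'a::metric_space set \<Rightarrow> 'a set \<Rightarrow> ('a \<Rightarrow> 'a) \<Rightarrow> ('a \<Rightarrow> real) \<Rightarrow> real" where
  "pressure X X0 T \<phi> = (THE p. is_pressure X X0 T \<phi> p)"


section \<open>Measures\<close>

(* Borel probability measures on X, regarded as measures on the whole space. *)
definition prob_measures :: "'a::metric_space set \<Rightarrow> 'a measure set" where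
  "prob_measures X = {\<mu>. prob_space \<mu> \<and> sets \<mu> = sets borel \<and> emeasure \<mu> (UNIV - X) = 0}"

definition invariant_measures ::
    "'a::metric_space set \<Rightarrow> 'a set \<Rightarrow> ('a \<Rightarrow> 'a) \<Rightarrow> 'a measure set" where
  "invariant_measures X X0 T = {\<nu> \<in> prob_measures X.
     \<forall>B\<in>sets borel. B \<subseteq> X \<longrightarrow> emeasure \<nu> {y \<in> X0. T y \<in> B} = emeasure \<nu> B}"

definition is_jacobian ::
    "'a::metric_space set \<Rightarrow> ('a \<Rightarrow> 'a) \<Rightarrow> 'a measure \<Rightarrow> ('a \<Rightarrow> real) \<Rightarrow> bool" where
  "is_jacobian X0 T \<mu> g \<longleftrightarrow>
     (\<forall>A\<in>sets borel. A \<subseteq> X0 \<longrightarrow> inj_on T A \<longrightarrow>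
        emeasure \<mu> (T ` A) = (\<integral>\<^sup>+y\<in>A. ennreal (g y) \<partial>\<mu>))"

(* The branch of the inverse of T^n sending T^n x to x, composed of the branches provided by
   the covering properties of T (with constant \<delta>) and of T^N (with constant \<delta>N): for
   n = q N + j with j < N, first q branches for T^N and then j branches for T. *)
definition branch ::
    "'a::metric_space set \<Rightarrow> 'a set \<Rightarrow> ('a \<Rightarrow> 'a) \<Rightarrow> real \<Rightarrow> nat \<Rightarrow> real \<Rightarrow> nat \<Rightarrow> 'a \<Rightarrow> 'a \<Rightarrow> 'a" where
  "branch X X0 T \<delta> N \<delta>N n x =
     iter_branch T (inv_branch X T X0 \<delta>) (n mod N) x
       \<circ> branch_N X X0 T N \<delta>N (n div N) ((T ^^ (n mod N)) x)"

(* The first conjunct of the body says that r is small enough for the branch to be defined on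
   the ball of radius r; it forces the image of the ball to be open. *)
definition gibbs ::
    "'a::metric_space set \<Rightarrow> 'a set \<Rightarrow> ('a \<Rightarrow> 'a) \<Rightarrow> real \<Rightarrow> nat \<Rightarrow> real \<Rightarrow> ('a \<Rightarrow> real)
      \<Rightarrow> 'a measure \<Rightarrow> bool" where
  "gibbs X X0 T \<delta> N \<delta>N \<phi> m \<longleftrightarrow>
     (\<exists>r>0. \<exists>c\<ge>1. \<forall>n. \<forall>x\<in>iter_dom X X0 T n.
        let B = ball_in X ((T ^^ n) x) r; s = branch X X0 T \<delta> N \<delta>N n x;
            q = measure m (s ` B) / exp (birkhoff_sum T n \<phi> x - real n * pressure X X0 T \<phi>)
        in (continuous_on B s \<and> (\<forall>z\<in>B. s z \<in> iter_dom X X0 T n \<and> (T ^^ n) (s z) = z) \<and>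
            s ((T ^^ n) x) = x) \<and>
           1 / c \<le> q \<and> q \<le> c)"


section \<open>Conditional information\<close>

(* \<kappa> is a system of conditional probabilities (regular conditional distribution) of \<nu> given the
   pullback under T of the Borel sigma-algebra of X. An invariant \<nu> gives full measure to X0,
   the preimage of X, so everything takes place on X0. *)
definition cond_probs ::
    "'a::metric_space set \<Rightarrow> 'a set \<Rightarrow> ('a \<Rightarrow> 'a) \<Rightarrow> 'a measure \<Rightarrow> ('a \<Rightarrow> 'a measure) \<Rightarrow> bool" where
  "cond_probs X X0 T \<nu> \<kappa> \<longleftrightarrow>
     (let M = restrict_space \<nu> X0; F = vimage_algebra X0 T (restrict_space borel X)
      in \<kappa> \<in> measurable F (prob_algebra (restrict_space borel X0)) \<and>
         (\<forall>A\<in>sets M. AE y in M. measure (\<kappa> y) A = real_cond_exp M F (indicator A) y))"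

(* Since the Borel sigma-algebra is countably generated, two systems of conditional
   probabilities agree almost everywhere, so the choice affects only a null set. *)
definition cond_information ::
    "'a::metric_space set \<Rightarrow> 'a set \<Rightarrow> ('a \<Rightarrow> 'a) \<Rightarrow> 'a measure \<Rightarrow> 'a \<Rightarrow> ereal" where
  "cond_information X X0 T \<nu> y =
     (let p = measure ((SOME \<kappa>. cond_probs X X0 T \<nu> \<kappa>) y) {y}
      in if p = 0 then \<infinity> else ereal (- ln p))"

(* The integral with values in the extended reals. The potential may be unbounded below, so the
   value - \<infinity> can occur for the integrals in the variational principle. *)
definition ext_integral :: "'a measure \<Rightarrow> ('a \<Rightarrow> ereal) \<Rightarrow> ereal" where
  "ext_integral M f =
     enn2ereal (\<integral>\<^sup>+x. e2ennreal (f x) \<partial>M) - enn2ereal (\<integral>\<^sup>+x. e2ennreal (- f x) \<partial>M)"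

definition info_energy ::
    "'a::metric_space set \<Rightarrow> 'a set \<Rightarrow> ('a \<Rightarrow> 'a) \<Rightarrow> ('a \<Rightarrow> real) \<Rightarrow> 'a measure \<Rightarrow> ereal" where
  "info_energy X X0 T \<phi> \<nu> =
     ext_integral (restrict_space \<nu> X0) (\<lambda>y. cond_information X X0 T \<nu> y + ereal (\<phi> y))"

end

(* The proof replaces quasi-compactness by a direct contraction argument. By (1g) the ratios
   L^n f / L^n 1 of positive functions are equicontinuous, and by (1e) a fixed power of L averages
   them with weights bounded below over an eps-dense set, so their oscillation tends to 0. Their limits
   J f form a positive functional with J (L f) = lam * J f; Riesz' theorem turns J into the
   eigenmeasure mu, and L^n 1 / lam^n converges uniformly to h. The restriction of m = h * mu to the
   boundary of X is again fixed by the dual of the normalised operator, hence a multiple of m; since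
   m(X) > 0, the boundary is null.

   For the variational principle, an invariant measure nu has conditional weights p on the fibres of T,
   and with q = exp psi / p the integrand - ln p + phi equals ln q + ln lam up to the coboundary of
   ln h. The integral of q is at most 1, so ln q <= q - 1 gives the upper bound, and equality forces
   p = exp psi, whence nu is invariant under the dual of the normalised operator and equals m. *)
theory Submission
  imports Defs
begin

subsection \<open>The Riesz representation theorem on a compact metric space\<close>

text \<open>Distortion is controlled only along multiples of \<open>N\<close>, and this shapes two
  places. The eigenfunction is built from \<open>L ^^ (k * N)\<close> and is at first only an
  eigenfunction of \<open>L ^^ N\<close>; a separate argument with the ratios makes it one of
  \<open>L\<close>. The Gibbs bound concerns every \<open>n\<close>, so a bound for single steps of
  \<open>T\<close> has to be extracted from the one for \<open>T ^^ N\<close>. Summing over a fibre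
  of \<open>T ^^ (N - 1)\<close> does this up to a function bounded above and below, provided that
  the branches of \<open>T\<close> and of \<open>T ^^ N\<close> fit together. The second obstacle is
  that fibres may be infinite and \<open>T\<close> has no continuous extension to the boundary.
  Estimates are therefore made on the dense set \<open>X\<close> and extended, while Borel functions
  are treated by fibre sums in \<open>ennreal\<close>.\<close>

lemma ex_approx_from_below:
  fixes x :: ennreal
  assumes "x = (SUP i\<in>A. f i)" "x < top" "0 < e" "A \<noteq> {}"
  shows "\<exists>i\<in>A. x \<le> f i + ennreal e"
proof (rule ccontr)
  assume "\<not> ?thesis"
  then have lt: "f i + ennreal e \<le> x" if "i \<in> A" for i
    using that by (auto simp: not_le intro: less_imp_le)
  have "x + ennreal e = (SUP i\<in>A. f i + ennreal e)"
    using assms by (simp add: ennreal_SUP_add_left)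
  also have "\<dots> \<le> x" using lt by (intro SUP_least) auto
  finally have "x + ennreal e \<le> x + 0" by simp
  then show False
    using assms(2,3) by (simp add: ennreal_add_left_cancel_le)
qed

text \<open>The case split is forced by \<open>infdist x {} = 0\<close>, which would make the
  function of the whole space vanish. Only continuity, sign and zero set are used, so the value 1 is
  an arbitrary positive constant.\<close>

definition off_dist :: "'a::metric_space set \<Rightarrow> 'a \<Rightarrow> real" where
  "off_dist U x = (if U = UNIV then 1 else infdist x (- U))"

lemma continuous_on_off_dist: "continuous_on S (off_dist U)"
  unfolding off_dist_def by (cases "U = UNIV") (auto intro!: continuous_intros)

lemma off_dist_nonneg: "0 \<le> off_dist U x"
  by (auto simp: off_dist_def infdist_nonneg)

lemma off_dist_pos_iff:
  assumes "open U"
  shows "0 < off_dist U x \<longleftrightarrow> x \<in> U"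
proof (cases "U = UNIV")
  case False
  then have "closed (- U)" "- U \<noteq> {}" using assms by auto
  then have "x \<in> - U \<longleftrightarrow> infdist x (- U) = 0" by (rule in_closed_iff_infdist_zero)
  then show ?thesis using False infdist_nonneg[of x "- U"] by (auto simp: off_dist_def less_le)
qed (auto simp: off_dist_def)

lemma off_dist_eq_0: "open U \<Longrightarrow> x \<notin> U \<Longrightarrow> off_dist U x = 0"
  using off_dist_pos_iff[of U x] off_dist_nonneg[of U x] by auto

text \<open>The laws are imposed on continuous functions only, because the functional to which this
  is applied is a limit that is controlled only there. The normalisation \<open>one\<close> makes
  the measure built below a probability measure.\<close>

locale positive_functional =
  fixes J :: "('a::metric_space \<Rightarrow> real) \<Rightarrow> real"
  assumes compact_UNIV: "compact (UNIV :: 'a set)"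
    and add: "continuous_on UNIV f \<Longrightarrow> continuous_on UNIV g \<Longrightarrow> J (\<lambda>x. f x + g x) = J f + J g"
    and scale: "continuous_on UNIV f \<Longrightarrow> J (\<lambda>x. c * f x) = c * J f"
    and nonneg: "continuous_on UNIV f \<Longrightarrow> (\<And>x. 0 \<le> f x) \<Longrightarrow> 0 \<le> J f"
    and one: "J (\<lambda>_. 1) = 1"
begin

lemma const: "J (\<lambda>_. c) = c"
  using scale[of "\<lambda>_. 1" c] one by auto

lemma diff:
  assumes "continuous_on UNIV f" "continuous_on UNIV g"
  shows "J (\<lambda>x. f x - g x) = J f - J g"
proof -
  have "J (\<lambda>x. f x + (-1) * g x) = J f + J (\<lambda>x. (-1) * g x)"
    using assms by (intro add continuous_intros)
  also have "J (\<lambda>x. (-1) * g x) = (-1) * J g" by (rule scale[OF assms(2)])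
  finally have "J (\<lambda>x. f x + (-1) * g x) = J f + (-1) * J g" .
  then show ?thesis by simp
qed

lemma mono:
  assumes "continuous_on UNIV f" "continuous_on UNIV g" "\<And>x. f x \<le> g x"
  shows "J f \<le> J g"
proof -
  have "0 \<le> J (\<lambda>x. g x - f x)"
    using assms by (intro nonneg) (auto intro!: continuous_intros)
  then show ?thesis using assms by (simp add: diff)
qed

lemma sum:
  assumes "finite I" "\<And>i. i \<in> I \<Longrightarrow> continuous_on UNIV (f i)"
  shows "J (\<lambda>x. \<Sum>i\<in>I. f i x) = (\<Sum>i\<in>I. J (f i))"
  using assms
proof (induction I)
  case empty then show ?case using const[of 0] by simp
next
  case (insert i I)
  then have "J (\<lambda>x. f i x + (\<Sum>i\<in>I. f i x)) = J (f i) + J (\<lambda>x. \<Sum>i\<in>I. f i x)"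
    by (intro add continuous_on_sum) auto
  with insert show ?case by simp
qed

section \<open>Content of open sets and the induced outer measure\<close>

text \<open>Membership asks only for vanishing off \<open>U\<close>. The usual demand of a support
  inside \<open>U\<close> is recovered by \<open>cut\<close> where compactness enters.\<close>

definition tests :: "'a set \<Rightarrow> ('a \<Rightarrow> real) set" where
  "tests U = {f. continuous_on UNIV f \<and> (\<forall>x. 0 \<le> f x \<and> f x \<le> 1) \<and> (\<forall>x. x \<notin> U \<longrightarrow> f x = 0)}"

definition content :: "'a set \<Rightarrow> ennreal" where
  "content U = (SUP f\<in>tests U. ennreal (J f))"

definition outer :: "'a set \<Rightarrow> ennreal" where
  "outer A = (INF U\<in>{U. open U \<and> A \<subseteq> U}. content U)"

lemma tests_zero: "(\<lambda>_. 0) \<in> tests U"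
  by (auto simp: tests_def)

lemma tests_J: "f \<in> tests U \<Longrightarrow> 0 \<le> J f \<and> J f \<le> 1"
  using nonneg[of f] mono[of f "\<lambda>_. 1"] one by (auto simp: tests_def)

lemma J_le_content: "f \<in> tests U \<Longrightarrow> ennreal (J f) \<le> content U"
  unfolding content_def by (rule SUP_upper)

lemma content_mono: "U \<subseteq> V \<Longrightarrow> content U \<le> content V"
  unfolding content_def by (rule SUP_subset_mono) (auto simp: tests_def)

lemma content_le_1: "content U \<le> 1"
  unfolding content_def using tests_J by (intro SUP_least) (auto simp: ennreal_le_1)

lemma content_finite: "content U < top"
  using content_le_1[of U] by (rule le_less_trans) simp

lemma content_empty: "content {} = 0"
proof -
  have "tests {} = {\<lambda>_. 0}" by (auto simp: tests_def)
  then show ?thesis using const[of 0] by (simp add: content_def)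
qed

lemma content_UNIV: "content UNIV = 1"
proof (rule antisym[OF content_le_1])
  have "(\<lambda>_. 1) \<in> tests UNIV" by (auto simp: tests_def)
  from J_le_content[OF this] show "1 \<le> content UNIV" by (simp add: one)
qed

lemma outer_mono: "A \<subseteq> B \<Longrightarrow> outer A \<le> outer B"
  unfolding outer_def by (rule INF_superset_mono) auto

lemma outer_open: "open U \<Longrightarrow> outer U = content U"
  unfolding outer_def by (intro antisym INF_lower INF_greatest) (auto intro: content_mono)

lemma outer_le_content: "open U \<Longrightarrow> A \<subseteq> U \<Longrightarrow> outer A \<le> content U"
  unfolding outer_def by (rule INF_lower) auto

lemma outer_finite: "outer A < top"
  using outer_le_content[of UNIV A] content_finite[of UNIV] by (auto intro: le_less_trans)

text \<open>Lowering \<open>f\<close> by \<open>e\<close> leaves a function that vanishes off the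
  compact set \<open>{x. e \<le> f x}\<close>, which lies in \<open>U\<close> for a test function of
  \<open>U\<close>. The price in \<open>J\<close> is at most \<open>e\<close>, since
  \<open>J\<close> of the constant 1 is 1.\<close>

definition cut :: "real \<Rightarrow> ('a \<Rightarrow> real) \<Rightarrow> 'a \<Rightarrow> real" where
  "cut e f x = max (f x - e) 0"

lemma cut_tests: "f \<in> tests U \<Longrightarrow> 0 < e \<Longrightarrow> cut e f \<in> tests U"
  unfolding tests_def cut_def mem_Collect_eq
  by (intro conjI allI impI continuous_intros) (auto simp: max_def diff_le_eq intro: add_increasing2 order_trans)

lemma J_le_cut:
  assumes "f \<in> tests U" "0 < e"
  shows "J f \<le> J (cut e f) + e"
proof -
  have c: "continuous_on UNIV f" "continuous_on UNIV (cut e f)"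
    using assms cut_tests[OF assms] by (auto simp: tests_def)
  have "J f \<le> J (\<lambda>x. cut e f x + e)"
    using c by (intro mono) (auto intro!: continuous_intros simp: cut_def)
  also have "\<dots> = J (cut e f) + e"
    using c by (subst add) (auto simp: const)
  finally show ?thesis .
qed

lemma compact_level:
  fixes f :: "'a \<Rightarrow> real"
  assumes "continuous_on UNIV f"
  shows "compact {x. e \<le> f x}"
proof -
  have "closed {x. e \<le> f x}"
    using assms by (intro closed_Collect_le continuous_on_const)
  then show ?thesis using compact_Int_closed[OF compact_UNIV, of "{x. e \<le> f x}"] by simp
qed

text \<open>A test function of the union is cut down to a compact level set, which finitely many
  \<open>U i\<close> cover. A partition of unity distributes it among these, and additivity of
  \<open>J\<close> gives the bound.\<close>

lemma content_UN:
  assumes U: "\<And>i::nat. open (U i)"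
  shows "content (\<Union>i. U i) \<le> (\<Sum>i. content (U i))"
  unfolding content_def[of "\<Union>i. U i"]
proof (rule SUP_least)
  fix f assume f: "f \<in> tests (\<Union>i. U i)"
  have cf: "continuous_on UNIV f" and f01: "\<And>x. 0 \<le> f x" "\<And>x. f x \<le> 1"
    using f by (auto simp: tests_def)
  show "ennreal (J f) \<le> (\<Sum>i. content (U i))"
  proof (rule ennreal_le_epsilon)
    fix e :: real assume e: "0 < e"
    let ?K = "{x. e \<le> f x}"
    have K: "compact ?K" by (rule compact_level[OF cf])
    have "x \<in> (\<Union>i. U i)" if "x \<in> ?K" for x
      using f e that by (auto simp: tests_def simp del: UN_iff)
    then have KU: "?K \<subseteq> (\<Union>i\<in>UNIV. U i)" by blast
    then obtain I where I: "finite I" "?K \<subseteq> (\<Union>i\<in>I. U i)"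
      using compactE_image[OF K _ KU] U by metis
    define s where "s x = (\<Sum>i\<in>I. off_dist (U i) x)" for x
    have cs: "continuous_on S s" for S
      unfolding s_def by (intro continuous_intros continuous_on_off_dist)
    have spos: "0 < s x" if x: "x \<in> ?K" for x
    proof -
      obtain i where "i \<in> I" "x \<in> U i" using I x by auto
      then show ?thesis unfolding s_def
        using I(1) off_dist_pos_iff[OF U] by (intro sum_pos2) (auto simp: off_dist_nonneg)
    qed
    \<comment> \<open>A positive lower bound of \<open>s\<close> on \<open>?K\<close>; if
      \<open>?K\<close> is empty, any positive number will do.\<close>
    obtain c where c: "0 < c" "\<And>x. x \<in> ?K \<Longrightarrow> c \<le> s x"
    proof (cases "?K = {}")
      case False
      from continuous_attains_inf[OF K this cs] obtain x0 where
        "x0 \<in> ?K" "\<forall>x\<in>?K. s x0 \<le> s x" by auto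
      then show thesis using spos that by blast
    qed (auto intro: that[of 1])
    \<comment> \<open>Dividing by \<open>max (s x) c\<close> instead of \<open>s x\<close> keeps the
      quotient continuous where \<open>s\<close> vanishes. Both agree on \<open>?K\<close>, and
      \<open>cut e f\<close> is zero elsewhere.\<close>
    define g where "g i x = cut e f x * (off_dist (U i) x / max (s x) c)" for i x
    have cc: "continuous_on UNIV (cut e f)" using cut_tests[OF f e] by (auto simp: tests_def)
    have gc: "continuous_on UNIV (g i)" for i
      unfolding g_def using c(1)
      by (intro continuous_intros cc continuous_on_off_dist cs) (auto simp: max_def)
    have s0: "0 \<le> s x" for x unfolding s_def by (intro sum_nonneg) (auto simp: off_dist_nonneg)
    have gt: "g i \<in> tests (U i)" if i: "i \<in> I" for i
    proof -
      have "off_dist (U i) x \<le> s x" for x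
        unfolding s_def using I(1) i by (intro member_le_sum) (auto simp: off_dist_nonneg)
      then have *: "0 \<le> off_dist (U i) x / max (s x) c" "off_dist (U i) x / max (s x) c \<le> 1" for x
        using c(1) off_dist_nonneg[of "U i" x]
        by (auto simp: divide_le_eq_1 max_def intro!: divide_nonneg_nonneg)
          (metis less_le_trans less_le_not_le linorder_linear order_trans)+
      have "0 \<le> cut e f x" "cut e f x \<le> 1" for x
        using cut_tests[OF f e] by (auto simp: tests_def)
      then show ?thesis
        using * gc[of i] off_dist_eq_0[OF U] by (auto simp: tests_def g_def simp del: times_divide_eq_right intro!: mult_le_one)
    qed
    have sum_g: "(\<Sum>i\<in>I. g i x) = cut e f x" for x
    proof (cases "x \<in> ?K")
      case True
      then have "max (s x) c = s x" "s x > 0" using c spos by auto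
      then show ?thesis
        unfolding g_def by (simp add: sum_distrib_left[symmetric] sum_divide_distrib[symmetric] s_def[symmetric])
    qed (auto simp: g_def cut_def)
    have "J f \<le> J (cut e f) + e" by (rule J_le_cut[OF f e])
    also have "J (cut e f) = (\<Sum>i\<in>I. J (g i))"
      using sum[OF I(1), of g] gc by (simp add: sum_g)
    finally have "ennreal (J f) \<le> ennreal ((\<Sum>i\<in>I. J (g i)) + e)" by (rule ennreal_leI)
    also have "\<dots> = (\<Sum>i\<in>I. ennreal (J (g i))) + ennreal e"
      using e gt tests_J by (subst ennreal_plus) (auto intro!: sum_nonneg sum_ennreal[symmetric])
    also have "(\<Sum>i\<in>I. ennreal (J (g i))) \<le> (\<Sum>i\<in>I. content (U i))"
      using gt by (auto intro!: sum_mono J_le_content)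
    also have "\<dots> \<le> (\<Sum>i. content (U i))" by (rule sum_le_suminf) (auto simp: I)
    finally show "ennreal (J f) \<le> (\<Sum>i. content (U i)) + ennreal e" by simp
  qed
qed

lemma outer_UN: "outer (\<Union>i. A i) \<le> (\<Sum>i::nat. outer (A i))"
proof (rule ennreal_le_epsilon)
  fix e :: real assume e: "0 < e"
  have "\<exists>U. open U \<and> A i \<subseteq> U \<and> content U \<le> outer (A i) + ennreal (e * (1/2) ^ Suc i)" for i
  proof -
    have "0 < ennreal (e * (1/2) ^ Suc i)" using e by (simp del: power_Suc)
    then have "outer (A i) + 0 < outer (A i) + ennreal (e * (1/2) ^ Suc i)"
      using outer_finite[of "A i"] by (subst ennreal_add_left_cancel_less) auto
    then have "(INF U\<in>{U. open U \<and> A i \<subseteq> U}. content U) < outer (A i) + ennreal (e * (1/2) ^ Suc i)"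
      by (simp add: outer_def)
    then show ?thesis unfolding INF_less_iff by (auto intro: less_imp_le)
  qed
  then obtain U where U: "\<And>i. open (U i)" "\<And>i. A i \<subseteq> U i"
    "\<And>i. content (U i) \<le> outer (A i) + ennreal (e * (1/2) ^ Suc i)" by metis
  have "outer (\<Union>i. A i) \<le> content (\<Union>i. U i)"
    using U by (intro outer_le_content UN_mono open_UN) auto
  also have "\<dots> \<le> (\<Sum>i. content (U i))" by (rule content_UN[OF U(1)])
  also have "\<dots> \<le> (\<Sum>i. outer (A i) + ennreal (e * (1/2) ^ Suc i))"
    using U by (intro suminf_le) auto
  also have "\<dots> = (\<Sum>i. outer (A i)) + ennreal e"
  proof -
    have "(\<lambda>i. e * (1/2) ^ Suc i) sums (e * 1)" by (intro sums_mult power_half_series)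
    then have "(\<Sum>i. ennreal (e * (1/2) ^ Suc i)) = ennreal e"
      using e by (subst suminf_ennreal_eq[where x="e"]) auto
    then show ?thesis by (subst suminf_add[symmetric]) auto
  qed
  finally show "outer (\<Union>i. A i) \<le> (\<Sum>i. outer (A i)) + ennreal e" .
qed

lemma outer_measure_space: "outer_measure_space UNIV outer"
  unfolding outer_measure_space_def positive_def increasing_def countably_subadditive_def
  using outer_mono outer_UN outer_open[of "{}"] content_empty by auto

text \<open>Take an almost optimal \<open>f\<close> for \<open>V \<inter> U\<close> and an almost
  optimal \<open>g\<close> for \<open>V\<close> minus the level set \<open>{x. e \<le> f x}\<close>.
  After cutting \<open>f\<close> the two are nowhere both nonzero, so their sum is a test function
  of \<open>V\<close>. The set for \<open>g\<close> contains \<open>V - U\<close>, since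
  \<open>f\<close> vanishes off \<open>U\<close>.\<close>

lemma outer_split_open:
  assumes U: "open U" and V: "open V"
  shows "content (V \<inter> U) + outer (V - U) \<le> content V"
proof (rule ennreal_le_epsilon)
  fix e' :: real assume "0 < e'"
  \<comment> \<open>Three losses occur: in the approximation of two contents and in the cut of
    \<open>f\<close>.\<close>
  define e where "e = e' / 3"
  have e: "0 < e" using \<open>0 < e'\<close> by (simp add: e_def)
  have ne: "tests W \<noteq> {}" for W using tests_zero by auto
  obtain f where f: "f \<in> tests (V \<inter> U)" "content (V \<inter> U) \<le> ennreal (J f) + ennreal e"
    using ex_approx_from_below[OF content_def content_finite e ne] by blast
  let ?W = "V - {x. e \<le> f x}"
  have "open ?W" using V compact_level[of f e] f by (auto simp: tests_def compact_imp_closed)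
  obtain g where g: "g \<in> tests ?W" "content ?W \<le> ennreal (J g) + ennreal e"
    using ex_approx_from_below[OF content_def content_finite e ne] by blast
  have "outer (V - U) \<le> content ?W"
    using f e \<open>open ?W\<close> by (intro outer_le_content) (auto simp: tests_def)
  also note g(2)
  finally have *: "outer (V - U) \<le> ennreal (J g) + ennreal e" .
  have c: "cut e f \<in> tests (V \<inter> U)" by (rule cut_tests[OF f(1) e])
  have cont: "continuous_on UNIV (cut e f)" "continuous_on UNIV g"
    using c g by (auto simp: tests_def)
  have "cut e f x + g x \<le> 1 \<and> 0 \<le> cut e f x + g x \<and> (x \<notin> V \<longrightarrow> cut e f x + g x = 0)" for x
  proof (cases "e \<le> f x")
    case True
    then have "g x = 0" using g by (auto simp: tests_def)
    then show ?thesis using c by (auto simp: tests_def)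
  next
    case False
    then have "cut e f x = 0" by (simp add: cut_def)
    then show ?thesis using g by (auto simp: tests_def)
  qed
  then have t: "(\<lambda>x. cut e f x + g x) \<in> tests V"
    using cont by (auto simp: tests_def intro!: continuous_intros)
  have "content (V \<inter> U) + outer (V - U) \<le> (ennreal (J f) + ennreal e) + (ennreal (J g) + ennreal e)"
    by (intro add_mono f *)
  also have "\<dots> = ennreal (J f + e + (J g + e))"
    using tests_J[OF f(1)] tests_J[OF g(1)] e by (simp add: ennreal_plus[symmetric] del: ennreal_plus)
  also have "\<dots> \<le> ennreal (J (\<lambda>x. cut e f x + g x) + e')"
    using J_le_cut[OF f(1) e] cont by (intro ennreal_leI) (simp add: add e_def)
  also have "\<dots> = ennreal (J (\<lambda>x. cut e f x + g x)) + ennreal e'"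
    using tests_J[OF t] \<open>0 < e'\<close> by simp
  also have "\<dots> \<le> content V + ennreal e'"
    by (intro add_mono J_le_content t order_refl)
  finally show "content (V \<inter> U) + outer (V - U) \<le> content V + ennreal e'" .
qed

lemma outer_Un: "outer (A \<union> B) \<le> outer A + outer B"
proof -
  have "outer (A \<union> B) = outer (\<Union>i. binaryset A B i)" by (simp add: UN_binaryset_eq)
  also have "\<dots> \<le> (\<Sum>i. outer (binaryset A B i))" by (rule outer_UN)
  also have "\<dots> = outer A + outer B"
    using outer_measure_space
    by (intro suminf_binaryset_eq) (auto simp: outer_measure_space_def positive_def)
  finally show ?thesis .
qed

text \<open>\<open>lambda_system\<close> collects the Caratheodory measurable sets. Splitting
  \<open>A\<close> reduces to splitting the open sets \<open>V\<close> containing \<open>A\<close>,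
  since \<open>outer A\<close> is the infimum of their contents.\<close>

lemma open_in_lambda_system:
  assumes U: "open U"
  shows "U \<in> lambda_system UNIV UNIV outer"
proof -
  have "outer (U \<inter> A) + outer ((UNIV - U) \<inter> A) = outer A" for A
  proof (rule antisym)
    show "outer (U \<inter> A) + outer ((UNIV - U) \<inter> A) \<le> outer A"
      unfolding outer_def[of A]
    proof (rule INF_greatest)
      fix V assume "V \<in> {V. open V \<and> A \<subseteq> V}"
      then have V: "open V" "A \<subseteq> V" by auto
      have "outer (U \<inter> A) + outer ((UNIV - U) \<inter> A) \<le> content (V \<inter> U) + outer (V - U)"
        using U V by (intro add_mono outer_le_content outer_mono) auto
      also have "\<dots> \<le> content V" by (rule outer_split_open[OF U V(1)])
      finally show "outer (U \<inter> A) + outer ((UNIV - U) \<inter> A) \<le> content V" .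
    qed
    have "U \<inter> A \<union> (UNIV - U) \<inter> A = A" by auto
    then show "outer A \<le> outer (U \<inter> A) + outer ((UNIV - U) \<inter> A)"
      using outer_Un[of "U \<inter> A" "(UNIV - U) \<inter> A"] by simp
  qed
  then show ?thesis by (auto simp: lambda_system_def)
qed

definition riesz_measure :: "'a measure" where
  "riesz_measure = measure_of UNIV (sets borel) outer"

lemma sets_riesz [simp, measurable_cong]: "sets riesz_measure = sets borel"
  unfolding riesz_measure_def by (simp add: sets.sigma_sets_eq[of borel, simplified])

lemma space_riesz [simp]: "space riesz_measure = UNIV"
  using sets_eq_imp_space_eq[OF sets_riesz] by simp

lemma emeasure_riesz:
  assumes "A \<in> sets borel"
  shows "emeasure riesz_measure A = outer A"
proof -
  interpret sigma_algebra UNIV "UNIV :: 'a set set"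
    using sigma_algebra_Pow[of "UNIV :: 'a set"] by simp
  let ?L = "lambda_system UNIV UNIV outer"
  have ms: "measure_space UNIV ?L outer"
    using caratheodory_lemma[OF outer_measure_space] .
  then have "sigma_algebra UNIV ?L" by (simp add: measure_space_def)
  then have "sigma_sets UNIV {S. open S} \<subseteq> ?L"
    using open_in_lambda_system by (intro sigma_algebra.sigma_sets_subset) auto
  then have sub: "sets (borel :: 'a measure) \<subseteq> ?L"
    by (simp add: sets_borel)
  have "measure_space UNIV (sets (borel :: 'a measure)) outer"
    using measure_down[OF ms _ sub] sets.sigma_algebra_axioms[of "borel :: 'a measure"] by simp
  then have "countably_additive (sets (borel :: 'a measure)) outer" "positive (sets (borel :: 'a measure)) outer"
    by (auto simp: measure_space_def)
  then show ?thesis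
    using assms by (intro emeasure_measure_of[OF riesz_measure_def])
      (auto simp: countably_additive_def positive_def)
qed

lemma prob_space_riesz: "prob_space riesz_measure"
  by (rule prob_spaceI) (simp add: emeasure_riesz outer_open content_UNIV)

lemma integrable_riesz:
  fixes f :: "'a \<Rightarrow> real"
  assumes "continuous_on UNIV f"
  shows "integrable riesz_measure f"
proof -
  interpret prob_space riesz_measure by (rule prob_space_riesz)
  have "bounded (range f)"
    using compact_continuous_image[OF assms compact_UNIV] by (rule compact_imp_bounded)
  then obtain B where "\<And>x. norm (f x) \<le> B" by (auto simp: bounded_iff)
  moreover have "f \<in> borel_measurable riesz_measure"
    using assms by (simp add: borel_measurable_continuous_onI measurable_cong_sets[OF sets_riesz refl])
  ultimately show ?thesis by (intro integrable_const_bound[of _ B]) auto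
qed

text \<open>Slicing \<open>f = (1/n) \<Sum> f\<^sub>k\<close> with \<open>f\<^sub>k\<close> between the indicators of
  \<open>f > k/n\<close> and \<open>f \<ge> (k+1)/n\<close> bounds \<open>J f\<close> by a lower sum plus \<open>1/n\<close>.\<close>

lemma J_le_integral:
  assumes cf: "continuous_on UNIV f" and f01: "\<And>x. 0 \<le> f x" "\<And>x. f x \<le> 1"
  shows "J f \<le> (\<integral>x. f x \<partial>riesz_measure)"
proof (rule field_le_epsilon)
  fix e :: real assume "0 < e"
  interpret prob_space riesz_measure by (rule prob_space_riesz)
  obtain n0 where n0: "1 / real (Suc n0) < e" using nat_approx_posE[OF \<open>0 < e\<close>] by metis
  define n where "n = Suc n0"
  have n: "0 < n" "1 / real n < e" using n0 by (auto simp: n_def)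
  define s where "s k x = min (max (real n * f x - real k) 0) 1" for k x
  have cs: "continuous_on UNIV (s k)" for k
    unfolding s_def by (intro continuous_intros cf)
  have s01: "0 \<le> s k x" "s k x \<le> 1" for k x by (auto simp: s_def)
  have ssum: "(\<Sum>k<m. s k x) = min (real n * f x) (real m)" for m x
  proof (induction m)
    case 0 then show ?case using f01[of x] by (simp add: min_absorb2)
  next
    case (Suc m) then show ?case by (auto simp: s_def min_def max_def)
  qed
  have fs: "real n * f x = (\<Sum>k<n. s k x)" for x
    using f01(2)[of x] by (simp add: ssum min_def mult_left_le)
  \<comment> \<open>The shift of the index makes this work: \<open>s (Suc k)\<close> is a test
    function of \<open>?U\<close>, while \<open>s k\<close> equals 1 on \<open>?U\<close>.\<close>
  have step: "J (s (Suc k)) \<le> (\<integral>x. s k x \<partial>riesz_measure)" for k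
  proof -
    let ?U = "{x. real (Suc k) < real n * f x}"
    have oU: "open ?U" by (intro open_Collect_less continuous_intros cf)
    have "s (Suc k) x = 0" if "x \<notin> ?U" for x using that by (simp add: s_def)
    then have "s (Suc k) \<in> tests ?U" using cs s01 by (auto simp: tests_def)
    then have "ennreal (J (s (Suc k))) \<le> content ?U" by (rule J_le_content)
    also have "\<dots> = emeasure riesz_measure ?U" using oU by (simp add: emeasure_riesz outer_open)
    also have "\<dots> = ennreal (measure riesz_measure ?U)" by (simp add: emeasure_eq_measure)
    finally have "J (s (Suc k)) \<le> measure riesz_measure ?U" by simp
    also have "\<dots> = (\<integral>x. indicator ?U x \<partial>riesz_measure)" using oU by simp
    also have "\<dots> \<le> (\<integral>x. s k x \<partial>riesz_measure)"
    proof (rule integral_mono)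
      show "integrable riesz_measure (\<lambda>x. indicator ?U x :: real)"
        using oU by (intro integrable_real_indicator) (auto simp: emeasure_eq_measure)
      show "integrable riesz_measure (s k)" by (rule integrable_riesz[OF cs])
      show "indicator ?U x \<le> s k x" for x by (auto simp: s_def indicator_def)
    qed
    finally show ?thesis .
  qed
  have "real n * J f = (\<Sum>k<n. J (s k))"
    using sum[of "{..<n}" s] scale[OF cf, of "real n"] cs fs by simp
  also have "\<dots> = J (s 0) + (\<Sum>k<n0. J (s (Suc k)))"
    unfolding n_def by (rule sum.lessThan_Suc_shift)
  \<comment> \<open>The slice \<open>s 0\<close> has no predecessor and is bounded by 1; after
    division by \<open>n\<close> it becomes the error \<open>1 / n\<close>.\<close>
  also have "\<dots> \<le> 1 + (\<Sum>k<n0. \<integral>x. s k x \<partial>riesz_measure)"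
    using mono[OF cs[of 0], of "\<lambda>_. 1"] s01 one step by (intro add_mono sum_mono) auto
  also have "\<dots> \<le> 1 + (\<Sum>k<n. \<integral>x. s k x \<partial>riesz_measure)"
    unfolding n_def by (simp add: s01)
  also have "(\<Sum>k<n. \<integral>x. s k x \<partial>riesz_measure) = (\<integral>x. real n * f x \<partial>riesz_measure)"
    unfolding fs by (rule Bochner_Integration.integral_sum[symmetric]) (rule integrable_riesz[OF cs])
  finally have "real n * J f \<le> 1 + real n * (\<integral>x. f x \<partial>riesz_measure)" by simp
  then have "J f \<le> 1 / real n + (\<integral>x. f x \<partial>riesz_measure)"
    using n(1) by (simp add: field_simps)
  then show "J f \<le> (\<integral>x. f x \<partial>riesz_measure) + e" using n(2) by simp
qed

text \<open>For values in [0,1] the inequalities for a function and for 1 minus that function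
  combine to an equality. An affine change of scale gives the general case.\<close>

theorem riesz:
  assumes cf: "continuous_on UNIV f"
  shows "J f = (\<integral>x. f x \<partial>riesz_measure)"
proof -
  interpret prob_space riesz_measure by (rule prob_space_riesz)
  have unit: "J g = (\<integral>x. g x \<partial>riesz_measure)"
    if cg: "continuous_on UNIV g" and g01: "\<And>x. 0 \<le> g x" "\<And>x. g x \<le> 1" for g
  proof (rule antisym)
    show "J g \<le> (\<integral>x. g x \<partial>riesz_measure)" by (rule J_le_integral[OF that])
    have "J (\<lambda>x. 1 - g x) \<le> (\<integral>x. 1 - g x \<partial>riesz_measure)"
      using that by (intro J_le_integral) (auto intro!: continuous_intros)
    then show "(\<integral>x. g x \<partial>riesz_measure) \<le> J g"
      using cg integrable_riesz[OF cg] prob_space by (simp add: diff const)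
  qed
  have "bounded (range f)"
    using compact_continuous_image[OF assms compact_UNIV] by (rule compact_imp_bounded)
  then obtain B where B: "0 < B" "\<And>x. \<bar>f x\<bar> \<le> B" by (auto simp: bounded_pos)
  define g where "g x = (f x + B) / (2 * B)" for x
  have cg: "continuous_on UNIV g" unfolding g_def using B by (intro continuous_intros cf) auto
  have fg: "f = (\<lambda>x. 2 * B * g x + (- B))" using B by (auto simp: g_def field_simps)
  have "0 \<le> g x" "g x \<le> 1" for x using B(1) B(2)[of x] by (auto simp: g_def field_simps)
  then have "J g = (\<integral>x. g x \<partial>riesz_measure)" by (rule unit[OF cg])
  moreover have "J f = 2 * B * J g - B"
    unfolding fg using cg scale[OF cg, of "2 * B"] by (subst add) (auto intro!: continuous_intros simp: const)
  moreover have "(\<integral>x. f x \<partial>riesz_measure) = 2 * B * (\<integral>x. g x \<partial>riesz_measure) - B"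
    unfolding fg using integrable_riesz[OF cg] prob_space by simp
  ultimately show ?thesis by simp
qed

end

text \<open>The functions \<open>bump K k\<close> decrease to the indicator of the closed set \<open>K\<close>.\<close>

definition bump :: "'a::metric_space set \<Rightarrow> nat \<Rightarrow> 'a \<Rightarrow> real" where
  "bump K k x = max 0 (1 - real k * off_dist (- K) x)"

lemma continuous_on_bump: "continuous_on S (bump K k)"
  unfolding bump_def by (intro continuous_intros continuous_on_off_dist)

lemma bump_bounds: "0 \<le> bump K k x" "bump K k x \<le> 1"
  using off_dist_nonneg[of "- K" x] by (auto simp: bump_def)

lemma bump_eq_1: "closed K \<Longrightarrow> x \<in> K \<Longrightarrow> bump K k x = 1"
  by (simp add: bump_def off_dist_eq_0 open_closed)

lemma bump_tendsto_0:
  assumes "closed K" "x \<notin> K"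
  shows "(\<lambda>k. bump K k x) \<longlonglongrightarrow> 0"
proof -
  have p: "0 < off_dist (- K) x" using assms by (subst off_dist_pos_iff) auto
  obtain k0 :: nat where k0: "1 / off_dist (- K) x < real k0" using reals_Archimedean2 by blast
  have "bump K k x = 0" if "k0 \<le> k" for k
  proof -
    have "1 / off_dist (- K) x \<le> real k" using k0 that by linarith
    then have "1 \<le> real k * off_dist (- K) x" using p by (simp add: field_simps)
    then show ?thesis by (simp add: bump_def)
  qed
  then show ?thesis by (intro tendsto_eventually) (auto simp: eventually_sequentially)
qed

lemma bump_tendsto: "closed K \<Longrightarrow> (\<lambda>k. bump K k x) \<longlonglongrightarrow> indicator K x"
  using bump_tendsto_0[of K x] bump_eq_1[of K x] by (cases "x \<in> K") auto

lemma integrable_continuous_compact: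
  fixes f :: "'a::metric_space \<Rightarrow> real"
  assumes "compact (UNIV :: 'a set)" "finite_measure M" "sets M = sets borel" "continuous_on UNIV f"
  shows "integrable M f"
proof -
  interpret finite_measure M by fact
  have "bounded (range f)"
    using compact_continuous_image[OF assms(4,1)] by (rule compact_imp_bounded)
  then obtain B where "\<And>x. norm (f x) \<le> B" by (auto simp: bounded_iff)
  moreover have "f \<in> borel_measurable M"
    using assms by (simp add: borel_measurable_continuous_onI measurable_cong_sets[OF assms(3) refl])
  ultimately show ?thesis by (intro integrable_const_bound[of _ B]) auto
qed

text \<open>Integrals of \<open>bump K k\<close> converge to the measure of the closed set
  \<open>K\<close>, and the closed sets are a generator of the Borel sets stable under
  intersection.\<close>

lemma measure_eqI_continuous:
  fixes M M' :: "'a::metric_space measure"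
  assumes cpt: "compact (UNIV :: 'a set)"
    and fin: "finite_measure M" "finite_measure M'"
    and sets: "sets M = sets borel" "sets M' = sets borel"
    and eq: "\<And>f :: 'a \<Rightarrow> real. continuous_on UNIV f \<Longrightarrow> (\<And>x. 0 \<le> f x) \<Longrightarrow> (\<integral>x. f x \<partial>M) = (\<integral>x. f x \<partial>M')"
  shows "M = M'"
proof -
  have closed: "emeasure M K = emeasure M' K" if K: "closed K" for K
  proof -
    have lim: "(\<lambda>k. \<integral>x. bump K k x \<partial>N) \<longlonglongrightarrow> measure N K"
      if N: "finite_measure N" "sets N = sets borel" for N
    proof -
      interpret finite_measure N by fact
      have meas: "bump K k \<in> borel_measurable N" "K \<in> sets N" for k
        using K N(2) by (auto simp: measurable_cong_sets[OF N(2) refl] intro!: borel_measurable_continuous_onI continuous_on_bump)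
      have "(\<lambda>k. \<integral>x. bump K k x \<partial>N) \<longlonglongrightarrow> (\<integral>x. indicator K x \<partial>N)"
        using bump_bounds[of K] bump_tendsto[OF K] meas
        by (intro integral_dominated_convergence[where w="\<lambda>_. 1"]) auto
      then show ?thesis using meas sets.sets_into_space[of K N] by (simp add: Int_absorb2)
    qed
    have "measure M K = measure M' K"
      using LIMSEQ_unique[OF lim[OF fin(1) sets(1), unfolded eq[OF continuous_on_bump bump_bounds(1)]]]
        lim[OF fin(2) sets(2)] by blast
    then show ?thesis using fin by (simp add: finite_measure.emeasure_eq_measure)
  qed
  show ?thesis
  proof (rule measure_eqI_generator_eq[where \<Omega>=UNIV and A="\<lambda>_. UNIV" and E="{K. closed K}"])
    show "sets M = sigma_sets UNIV {K. closed K}" "sets M' = sigma_sets UNIV {K. closed K}"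
      using sets by (simp_all add: borel_eq_closed)
    show "emeasure M UNIV \<noteq> \<infinity>"
      using finite_measure.emeasure_finite[OF fin(1)] by simp
  qed (auto simp: Int_stable_def closed)
qed

subsection \<open>Operators that contract oscillation\<close>

lemma compact_UNIV_bounded:
  fixes f :: "'a::metric_space \<Rightarrow> real"
  assumes cpt: "compact (UNIV :: 'a set)" and f: "continuous_on UNIV f"
  obtains B where "0 < B" "\<And>x. \<bar>f x\<bar> \<le> B"
proof -
  have "bounded (range f)"
    using compact_continuous_image[OF f cpt] by (rule compact_imp_bounded)
  then show thesis using that by (auto simp: bounded_pos)
qed

lemma compact_UNIV_uniform:
  fixes f :: "'a::metric_space \<Rightarrow> real"
  assumes cpt: "compact (UNIV :: 'a set)" and f: "continuous_on UNIV f" and e: "0 < e"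
  obtains d where "0 < d" "\<And>y y'. dist y y' < d \<Longrightarrow> f y \<le> f y' + e"
proof -
  obtain d where d: "0 < d" "\<And>x x'. dist x' x < d \<Longrightarrow> dist (f x') (f x) < e"
    using compact_uniformly_continuous[OF f cpt] e
    unfolding uniformly_continuous_on_def by (metis UNIV_I)
  show thesis
    by (rule that[OF d(1)]) (use d(2) in \<open>fastforce simp: dist_real_def\<close>)
qed

text \<open>\<open>L_reg\<close> abstracts bounded distortion: values of \<open>L ^^ (n * N)\<close>
  at points closer than \<open>r\<close> compare up to the factor \<open>1 + \<epsilon>\<close>, and
  the defect \<open>w\<close> of \<open>f\<close> at scale \<open>r\<close> does not grow, since
  inverse branches do not increase distances. \<open>L_mix\<close> abstracts the density of
  preimages: a lower bound on one ball becomes a lower bound everywhere. The constants depend on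
  \<open>\<epsilon>\<close> or \<open>r\<close> only, not on \<open>f\<close>, \<open>n\<close> or
  the centre of the ball.\<close>

locale mixing_operator =
  fixes L :: "('a::metric_space \<Rightarrow> real) \<Rightarrow> 'a \<Rightarrow> real" and N :: nat
  assumes compact_UNIV: "compact (UNIV :: 'a set)"
    and N_pos: "1 \<le> N"
    and L_cont: "continuous_on UNIV f \<Longrightarrow> continuous_on UNIV (L f)"
    and L_add: "continuous_on UNIV f \<Longrightarrow> continuous_on UNIV g \<Longrightarrow>
        L (\<lambda>x. f x + g x) = (\<lambda>x. L f x + L g x)"
    and L_scale: "continuous_on UNIV f \<Longrightarrow> L (\<lambda>x. c * f x) = (\<lambda>x. c * L f x)"
    and L_nonneg: "continuous_on UNIV f \<Longrightarrow> (\<And>x. 0 \<le> f x) \<Longrightarrow> 0 \<le> L f x"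
    and L_reg: "0 < \<epsilon> \<Longrightarrow> \<exists>\<eta>>0. \<forall>n f w r x x'. continuous_on UNIV f \<and> (\<forall>y. 0 \<le> f y) \<and> 0 \<le> w \<and> r \<le> \<eta> \<and>
        (\<forall>y y'. dist y y' < r \<longrightarrow> f y \<le> f y' + w) \<and> dist x x' < r \<longrightarrow>
        (L ^^ (n * N)) f x \<le> (1 + \<epsilon>) * ((L ^^ (n * N)) f x' + w * (L ^^ (n * N)) (\<lambda>_. 1) x')"
    and L_mix: "0 < r \<Longrightarrow> \<exists>m\<ge>1. \<exists>c>0. \<forall>f a z. continuous_on UNIV f \<and> (\<forall>y. 0 \<le> f y) \<and> 0 \<le> a \<and>
        (\<forall>y. dist z y < r \<longrightarrow> a \<le> f y) \<longrightarrow> (\<forall>x. c * a \<le> (L ^^ (m * N)) f x)"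
begin

lemmas bounded_cont = compact_UNIV_bounded[OF compact_UNIV]
lemmas unif_cont = compact_UNIV_uniform[OF compact_UNIV]

lemma attains_inf:
  fixes f :: "'a \<Rightarrow> real"
  assumes "continuous_on UNIV f"
  obtains x0 where "\<And>x. f x0 \<le> f x"
  using continuous_attains_inf[OF compact_UNIV _ assms] by auto

lemma attains_sup:
  fixes f :: "'a \<Rightarrow> real"
  assumes "continuous_on UNIV f"
  obtains x0 where "\<And>x. f x \<le> f x0"
  using continuous_attains_sup[OF compact_UNIV _ assms] by auto

lemma it_cont: "continuous_on UNIV f \<Longrightarrow> continuous_on UNIV ((L ^^ n) f)"
  by (induction n) (auto simp: L_cont)

lemma it_add: "continuous_on UNIV f \<Longrightarrow> continuous_on UNIV g \<Longrightarrow>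
    (L ^^ n) (\<lambda>x. f x + g x) = (\<lambda>x. (L ^^ n) f x + (L ^^ n) g x)"
  by (induction n) (auto simp: L_add it_cont)

lemma it_scale: "continuous_on UNIV f \<Longrightarrow> (L ^^ n) (\<lambda>x. c * f x) = (\<lambda>x. c * (L ^^ n) f x)"
  by (induction n) (auto simp: L_scale it_cont)

lemma it_nonneg: "continuous_on UNIV f \<Longrightarrow> (\<And>x. 0 \<le> f x) \<Longrightarrow> 0 \<le> (L ^^ n) f x"
  by (induction n arbitrary: x) (auto intro!: L_nonneg it_cont)

lemma it_diff:
  assumes "continuous_on UNIV f" "continuous_on UNIV g"
  shows "(L ^^ n) (\<lambda>x. f x - g x) = (\<lambda>x. (L ^^ n) f x - (L ^^ n) g x)"
proof -
  have "(L ^^ n) (\<lambda>x. f x + (-1) * g x) = (\<lambda>x. (L ^^ n) f x + (L ^^ n) (\<lambda>x. (-1) * g x) x)"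
    using assms by (intro it_add continuous_intros)
  also have "(L ^^ n) (\<lambda>x. (-1) * g x) = (\<lambda>x. (-1) * (L ^^ n) g x)" by (rule it_scale[OF assms(2)])
  finally show ?thesis by simp
qed

lemma it_mono:
  assumes "continuous_on UNIV f" "continuous_on UNIV g" "\<And>x. f x \<le> g x"
  shows "(L ^^ n) f x \<le> (L ^^ n) g x"
proof -
  have "0 \<le> (L ^^ n) (\<lambda>x. g x - f x) x"
    using assms by (intro it_nonneg continuous_intros) auto
  then show ?thesis using assms by (simp add: it_diff)
qed

lemma it_it: "(L ^^ n) ((L ^^ m) f) = (L ^^ (n + m)) f"
  by (simp add: funpow_add)

abbreviation one :: "nat \<Rightarrow> 'a \<Rightarrow> real" where
  "one n \<equiv> (L ^^ n) (\<lambda>_. 1)"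

lemma one_cont: "continuous_on UNIV (one n)"
  by (rule it_cont) simp

lemma it_le_one:
  assumes "continuous_on UNIV f" "\<And>x. f x \<le> B"
  shows "(L ^^ n) f x \<le> B * one n x"
proof -
  have "(L ^^ n) f x \<le> (L ^^ n) (\<lambda>x. B * 1) x"
    using assms by (intro it_mono) auto
  also have "\<dots> = B * one n x" by (subst it_scale) auto
  finally show ?thesis .
qed

lemma it_ge_one:
  assumes "continuous_on UNIV f" "\<And>x. B \<le> f x"
  shows "B * one n x \<le> (L ^^ n) f x"
proof -
  have "(L ^^ n) (\<lambda>x. B * 1) x \<le> (L ^^ n) f x"
    using assms by (intro it_mono) auto
  moreover have "(L ^^ n) (\<lambda>x. B * 1) x = B * one n x" by (subst it_scale) auto
  ultimately show ?thesis by simp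
qed

lemma one_nonneg: "0 \<le> one n x"
  by (rule it_nonneg) auto

text \<open>Mixing gives a positive lower bound at \<open>m * N\<close>, hence at its multiples. A
  general \<open>n\<close> is completed by \<open>k\<close> further steps to such a multiple, and
  the bound is divided by an upper bound of \<open>one k\<close>.\<close>

lemma one_lower: "\<exists>c>0. \<forall>x. c \<le> one n x"
proof -
  obtain m c where m: "1 \<le> m" and c: "0 < c" and
    mix: "\<forall>f a z. continuous_on UNIV f \<and> (\<forall>y. 0 \<le> f y) \<and> 0 \<le> a \<and>
        (\<forall>y. dist z y < 1 \<longrightarrow> a \<le> f y) \<longrightarrow> (\<forall>x. c * a \<le> (L ^^ (m * N)) f x)"
    using L_mix[of 1] by auto
  have c1: "c \<le> one (m * N) x" for x
    using mix[rule_format, of "\<lambda>_. 1" 1] by auto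
  have cj: "c ^ j \<le> one (j * (m * N)) x" for j x
  proof (induction j arbitrary: x)
    case (Suc j)
    have "c ^ Suc j \<le> c ^ j * one (m * N) x" using c c1[of x] by (simp add: mult.commute mult_right_mono)
    also have "\<dots> \<le> (L ^^ (m * N)) (one (j * (m * N))) x"
      by (rule it_ge_one[OF one_cont Suc.IH])
    finally show ?case by (simp add: it_it)
  qed simp
  define k where "k = n * (m * N) - n"
  have nk: "n + k = n * (m * N)" using m N_pos by (simp add: k_def)
  obtain B where B: "0 < B" "\<And>x. \<bar>one k x\<bar> \<le> B" using bounded_cont[OF one_cont] by blast
  have "c ^ n / B \<le> one n x" for x
  proof -
    have "c ^ n \<le> (L ^^ n) (one k) x" using cj[of n x] by (simp add: it_it nk)
    also have "\<dots> \<le> B * one n x" using B(2) by (intro it_le_one one_cont) (auto simp: abs_le_iff)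
    finally show ?thesis using B(1) by (simp add: divide_le_eq mult.commute)
  qed
  then show ?thesis using c B(1) by (intro exI[of _ "c ^ n / B"]) auto
qed

lemma one_pos: "0 < one n x"
  using one_lower[of n] by (auto intro: less_le_trans)

text \<open>The constant must not depend on \<open>n\<close>. For \<open>m \<le> n\<close>, mixing
  is applied to \<open>one ((n - m) * N)\<close>. Near its maximum this function is at least half
  the maximum by regularity, so \<open>m * N\<close> more iterations bound
  \<open>one (n * N)\<close> below everywhere by a multiple of that maximum, which also bounds it
  from above. The finitely many smaller \<open>n\<close> are settled by compactness.\<close>

lemma harnack: "\<exists>Q\<ge>1. \<forall>n x x'. one (n * N) x \<le> Q * one (n * N) x'"
proof -
  obtain \<eta> where \<eta>: "0 < \<eta>" and
    reg: "\<forall>n f w r x x'. continuous_on UNIV f \<and> (\<forall>y. 0 \<le> f y) \<and> 0 \<le> w \<and> r \<le> \<eta> \<and>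
        (\<forall>y y'. dist y y' < r \<longrightarrow> f y \<le> f y' + w) \<and> dist x x' < r \<longrightarrow>
        (L ^^ (n * N)) f x \<le> (1 + 1) * ((L ^^ (n * N)) f x' + w * (L ^^ (n * N)) (\<lambda>_. 1) x')"
    using L_reg[of 1] by auto
  have near: "one (n * N) x \<le> 2 * one (n * N) x'" if "dist x x' < \<eta>" for n x x'
    using reg[rule_format, of "\<lambda>_. 1" 0 \<eta> x x' n] that by simp
  obtain m c where m: "1 \<le> m" and c: "0 < c" and
    mix: "\<forall>f a z. continuous_on UNIV f \<and> (\<forall>y. 0 \<le> f y) \<and> 0 \<le> a \<and>
        (\<forall>y. dist z y < \<eta> \<longrightarrow> a \<le> f y) \<longrightarrow> (\<forall>x. c * a \<le> (L ^^ (m * N)) f x)"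
    using L_mix[OF \<eta>] by auto
  obtain M where M: "0 < M" "\<And>x. \<bar>one (m * N) x\<bar> \<le> M" using bounded_cont[OF one_cont] by blast
  have large: "one (n * N) x \<le> (2 * M / c) * one (n * N) x'" if n: "m \<le> n" for n x x'
  proof -
    define f where "f = one ((n - m) * N)"
    have cf: "continuous_on UNIV f" unfolding f_def by (rule one_cont)
    have it: "one (n * N) = (L ^^ (m * N)) f"
      using n by (simp add: f_def it_it distrib_right[symmetric])
    obtain z where z: "\<And>y. f y \<le> f z" using attains_sup[OF cf] by blast
    have f0: "0 \<le> f y" for y unfolding f_def by (rule one_nonneg)
    have "f z / 2 \<le> f y" if "dist z y < \<eta>" for y
      using near[OF that, of "n - m"] by (simp add: f_def)
    then have "c * (f z / 2) \<le> one (n * N) x'"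
      unfolding it using mix[rule_format, of f "f z / 2" z x'] cf f0 by auto
    moreover have "one (n * N) x \<le> f z * M"
    proof -
      have "one (n * N) x \<le> f z * one (m * N) x" unfolding it by (rule it_le_one[OF cf z])
      also have "\<dots> \<le> f z * M" using M(2)[of x] f0 by (intro mult_left_mono) auto
      finally show ?thesis .
    qed
    moreover have "f z * M = (2 * M / c) * (c * (f z / 2))" using c by simp
    moreover have "(2 * M / c) * (c * (f z / 2)) \<le> (2 * M / c) * one (n * N) x'"
      using c M(1) calculation(1) by (intro mult_left_mono) auto
    ultimately show ?thesis by linarith
  qed
  have "\<forall>n. \<exists>q. \<forall>x x'. one (n * N) x \<le> q * one (n * N) x'"
  proof
    fix n
    obtain B where B: "0 < B" "\<And>x. \<bar>one (n * N) x\<bar> \<le> B" using bounded_cont[OF one_cont] by blast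
    obtain b where b: "0 < b" "\<And>x. b \<le> one (n * N) x" using one_lower by blast
    have "one (n * N) x \<le> B / b * one (n * N) x'" for x x'
    proof -
      have "one (n * N) x \<le> B / b * b" using B(2)[of x] b(1) by auto
      also have "\<dots> \<le> B / b * one (n * N) x'" using b B(1) by (intro mult_left_mono) auto
      finally show ?thesis .
    qed
    then show "\<exists>q. \<forall>x x'. one (n * N) x \<le> q * one (n * N) x'" by blast
  qed
  then obtain q where q: "\<And>n x x'. one (n * N) x \<le> q n * one (n * N) x'" by metis
  define Q where "Q = Max (insert 1 (insert (2 * M / c) (q ` {..<m})))"
  have Qge: "1 \<le> Q" "2 * M / c \<le> Q" "n < m \<Longrightarrow> q n \<le> Q" for n
    unfolding Q_def by (intro Max_ge; simp)+
  have "one (n * N) x \<le> Q * one (n * N) x'" for n x x'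
  proof (cases "n < m")
    case True
    have "one (n * N) x \<le> q n * one (n * N) x'" by (rule q)
    also have "\<dots> \<le> Q * one (n * N) x'" by (intro mult_right_mono Qge True one_nonneg)
    finally show ?thesis .
  next
    case False
    then have "one (n * N) x \<le> (2 * M / c) * one (n * N) x'" by (intro large) simp
    also have "\<dots> \<le> Q * one (n * N) x'" by (intro mult_right_mono Qge one_nonneg)
    finally show ?thesis .
  qed
  then show ?thesis using Qge(1) by blast
qed

section \<open>Normalised iterates and the decay of their oscillation\<close>

text \<open>Dividing by \<open>one n\<close> makes the iteration an averaging process:
  \<open>ratio (k + n) f x\<close> is a weighted mean of values of \<open>ratio n f\<close>. Hence
  the maximum over \<open>x\<close> decreases and the minimum increases with
  \<open>n\<close>.\<close>

definition ratio :: "nat \<Rightarrow> ('a \<Rightarrow> real) \<Rightarrow> 'a \<Rightarrow> real" where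
  "ratio n f x = (L ^^ n) f x / one n x"

definition spread :: "nat \<Rightarrow> ('a \<Rightarrow> real) \<Rightarrow> real \<Rightarrow> bool" where
  "spread n f e \<longleftrightarrow> (\<forall>x x'. ratio n f x \<le> ratio n f x' + e)"

lemma ratio_cont: "continuous_on UNIV f \<Longrightarrow> continuous_on UNIV (ratio n f)"
  unfolding ratio_def using one_pos[of n]
  by (intro continuous_intros it_cont one_cont) (auto simp: less_le)

lemma it_eq_ratio: "(L ^^ n) f x = ratio n f x * one n x"
  using one_pos[of n x] by (simp add: ratio_def)

lemma ratio_upper:
  assumes "continuous_on UNIV f" "\<And>x. ratio n f x \<le> b"
  shows "ratio (k + n) f x \<le> b"
proof -
  have "(L ^^ (k + n)) f x \<le> (L ^^ k) (\<lambda>x. b * one n x) x"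
    unfolding it_it[symmetric] using assms one_pos[of n]
    by (intro it_mono it_cont continuous_intros one_cont) (auto simp: ratio_def divide_le_eq)
  also have "\<dots> = b * one (k + n) x" by (subst it_scale[OF one_cont]) (simp add: it_it)
  finally show ?thesis using one_pos[of "k + n" x] by (simp add: ratio_def divide_le_eq)
qed

lemma ratio_lower:
  assumes "continuous_on UNIV f" "\<And>x. b \<le> ratio n f x"
  shows "b \<le> ratio (k + n) f x"
proof -
  have "b * one (k + n) x = (L ^^ k) (\<lambda>x. b * one n x) x"
    by (subst it_scale[OF one_cont]) (simp add: it_it)
  also have "\<dots> \<le> (L ^^ (k + n)) f x"
    unfolding it_it[symmetric] using assms one_pos[of n]
    by (intro it_mono it_cont continuous_intros one_cont) (auto simp: ratio_def le_divide_eq)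
  finally show ?thesis using one_pos[of "k + n" x] by (simp add: ratio_def le_divide_eq)
qed

lemma spread_close:
  assumes f: "continuous_on UNIV f" and s: "spread n f e"
  shows "\<bar>ratio n f x - ratio (k + n) f x'\<bar> \<le> e"
proof -
  obtain x0 where x0: "\<And>x. ratio n f x0 \<le> ratio n f x" using attains_inf[OF ratio_cont[OF f]] by blast
  obtain x1 where x1: "\<And>x. ratio n f x \<le> ratio n f x1" using attains_sup[OF ratio_cont[OF f]] by blast
  have "ratio n f x0 \<le> ratio (k + n) f x'" "ratio (k + n) f x' \<le> ratio n f x1"
    using ratio_lower[OF f x0] ratio_upper[OF f x1] by auto
  moreover have "ratio n f x \<le> ratio n f x0 + e" "ratio n f x1 \<le> ratio n f x + e"
    using s by (auto simp: spread_def)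
  ultimately show ?thesis by linarith
qed

lemma spread_mono:
  assumes f: "continuous_on UNIV f" and s: "spread n f e" and "n \<le> n'"
  shows "spread n' f e"
proof -
  obtain k where k: "n' = k + n" using \<open>n \<le> n'\<close> by (metis le_add_diff_inverse2)
  obtain x0 where x0: "\<And>x. ratio n f x0 \<le> ratio n f x" using attains_inf[OF ratio_cont[OF f]] by blast
  obtain x1 where x1: "\<And>x. ratio n f x \<le> ratio n f x1" using attains_sup[OF ratio_cont[OF f]] by blast
  have "ratio n' f x \<le> ratio n' f x' + e" for x x'
  proof -
    have "ratio n f x0 \<le> ratio n' f x'" "ratio n' f x \<le> ratio n f x1"
      unfolding k using ratio_lower[OF f x0] ratio_upper[OF f x1] by auto
    moreover have "ratio n f x1 \<le> ratio n f x0 + e" using s by (auto simp: spread_def)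
    ultimately show ?thesis by linarith
  qed
  then show ?thesis by (auto simp: spread_def)
qed

text \<open>As long as the oscillation of \<open>L\<^sup>n f / L\<^sup>n 1\<close> is at least \<open>e\<close>, equicontinuity keeps this ratio
  away from its maximum on a ball of fixed radius, and by mixing every later
  ratio gives this ball a weight bounded below; so the maximum drops by a fixed amount.\<close>

lemma uniform_spread:
  assumes F: "\<And>f. f \<in> F \<Longrightarrow> continuous_on UNIV f" "\<And>f x. f \<in> F \<Longrightarrow> 0 \<le> f x" "\<And>f x. f \<in> F \<Longrightarrow> f x \<le> B"
    and equi: "\<And>e. 0 < e \<Longrightarrow> \<exists>d>0. \<forall>f\<in>F. \<forall>y y'. dist y y' < d \<longrightarrow> f y \<le> f y' + e"
    and B: "0 < B" and e: "0 < e"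
  shows "\<exists>n0. \<forall>n\<ge>n0. \<forall>f\<in>F. spread n f e"
proof -
  \<comment> \<open>With these constants the error \<open>3 * (\<epsilon> * B) + 4 * w\<close>
    arising in \<open>near\<close> is at most \<open>e / 2\<close>.\<close>
  define w where "w = e / 16"
  define \<epsilon> where "\<epsilon> = min 1 (e / (12 * B))"
  have w: "0 < w" and \<epsilon>: "0 < \<epsilon>" "\<epsilon> \<le> 1" "\<epsilon> * B \<le> e / 12"
    using e B by (auto simp: w_def \<epsilon>_def min_def field_simps)
  obtain d1 where d1: "0 < d1" "\<And>f y y'. f \<in> F \<Longrightarrow> dist y y' < d1 \<Longrightarrow> f y \<le> f y' + w"
    using equi[OF w] by metis
  obtain d2 where d2: "0 < d2" and
    reg: "\<forall>n f w r x x'. continuous_on UNIV f \<and> (\<forall>y. 0 \<le> f y) \<and> 0 \<le> w \<and> r \<le> d2 \<and>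
        (\<forall>y y'. dist y y' < r \<longrightarrow> f y \<le> f y' + w) \<and> dist x x' < r \<longrightarrow>
        (L ^^ (n * N)) f x \<le> (1 + \<epsilon>) * ((L ^^ (n * N)) f x' + w * (L ^^ (n * N)) (\<lambda>_. 1) x')"
    using L_reg[OF \<epsilon>(1)] by auto
  define d where "d = min d1 d2"
  have d: "0 < d" using d1 d2 by (simp add: d_def)
  have ratio0: "0 \<le> ratio n f x" and ratioB: "ratio n f x \<le> B" if "f \<in> F" for n f x
    using it_nonneg[OF F(1)[OF that] F(2)[OF that]] it_le_one[OF F(1)[OF that] F(3)[OF that], of n x] one_pos[of n x]
    by (auto simp: ratio_def divide_le_eq)
  \<comment> \<open>Numerator and denominator of the ratio are compared separately, hence two
    factors \<open>1 + \<epsilon>\<close>. The scale \<open>d\<close> depends neither on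
    \<open>n\<close> nor on \<open>f\<close>.\<close>
  have near: "ratio (n * N) f x \<le> ratio (n * N) f x' + e / 2" if f: "f \<in> F" and dx: "dist x x' < d" for n f x x'
  proof -
    let ?o = "one (n * N)" and ?q = "ratio (n * N) f x'"
    have "(L ^^ (n * N)) f x \<le> (1 + \<epsilon>) * ((L ^^ (n * N)) f x' + w * ?o x')"
      using reg[rule_format, of f w d x x' n] F(1,2)[OF f] w d1(2)[OF f] dx by (auto simp: d_def)
    also have "\<dots> = ((1 + \<epsilon>) * (?q + w)) * ?o x'"
      unfolding it_eq_ratio[of "n * N" f x'] by (simp only: algebra_simps)
    also have "\<dots> \<le> ((1 + \<epsilon>) * (?q + w)) * ((1 + \<epsilon>) * ?o x)"
      using reg[rule_format, of "\<lambda>_. 1" 0 d x' x n] dx ratio0[OF f, of "n * N" x'] w \<epsilon>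
      by (intro mult_left_mono) (auto simp: d_def dist_commute)
    finally have "ratio (n * N) f x \<le> (1 + \<epsilon>) * (1 + \<epsilon>) * (?q + w)"
      using one_pos[of "n * N" x] by (simp add: ratio_def divide_le_eq mult_ac)
    also have "\<dots> \<le> (1 + 3 * \<epsilon>) * (?q + w)"
    proof (rule mult_right_mono)
      have "\<epsilon> * \<epsilon> \<le> \<epsilon> * 1" using \<epsilon> by (intro mult_left_mono) auto
      then show "(1 + \<epsilon>) * (1 + \<epsilon>) \<le> 1 + 3 * \<epsilon>" by (simp add: algebra_simps)
    qed (use ratio0[OF f] w in auto)
    also have "\<dots> = ?q + 3 * (\<epsilon> * ?q) + (1 + 3 * \<epsilon>) * w" by (simp add: algebra_simps)
    also have "\<dots> \<le> ?q + 3 * (\<epsilon> * B) + 4 * w"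
      using \<epsilon> w ratioB[OF f, of "n * N" x'] by (intro add_mono mult_mono mult_left_mono) auto
    also have "\<dots> \<le> ?q + e / 2" using \<epsilon>(3) by (simp add: w_def)
    finally show ?thesis .
  qed
  obtain m c where m: "1 \<le> m" and c: "0 < c" and
    mix: "\<forall>f a z. continuous_on UNIV f \<and> (\<forall>y. 0 \<le> f y) \<and> 0 \<le> a \<and>
        (\<forall>y. dist z y < d \<longrightarrow> a \<le> f y) \<longrightarrow> (\<forall>x. c * a \<le> (L ^^ (m * N)) f x)"
    using L_mix[OF d] by auto
  obtain M where M: "0 < M" "\<And>x. \<bar>one (m * N) x\<bar> \<le> M" using bounded_cont[OF one_cont] by blast
  obtain Q where Q: "1 \<le> Q" "\<And>n x x'. one (n * N) x \<le> Q * one (n * N) x'" using harnack by blast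
  \<comment> \<open>The gain \<open>c * a\<close> that mixing yields in \<open>drop\<close>, divided
    by the upper bound \<open>?o xs * M\<close> of \<open>one ((m + n) * N)\<close>; the factor
    \<open>?o xs\<close> cancels.\<close>
  define \<kappa> where "\<kappa> = c * (e / 2) / (Q * M)"
  have \<kappa>: "0 < \<kappa>" using c e Q M by (simp add: \<kappa>_def)
  have drop: "ratio ((m + n) * N) f x \<le> b - \<kappa>"
    if f: "f \<in> F" and ns: "\<not> spread (n * N) f e" and b: "\<And>x. ratio (n * N) f x \<le> b" for f n b x
  proof -
    let ?o = "one (n * N)"
    obtain y0 z where yz: "ratio (n * N) f z + e < ratio (n * N) f y0"
      using ns by (auto simp: spread_def not_le)
    obtain xs where xs: "\<And>x. ?o x \<le> ?o xs" using attains_sup[OF one_cont] by blast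
    \<comment> \<open>The gap below the bound \<open>b\<close>, weighted by
      \<open>one (n * N)\<close>. It is nonnegative, and bounded away from 0 around the point
      \<open>z\<close> where the ratio is small, so mixing applies to it.\<close>
    define g where "g y = b * ?o y - (L ^^ (n * N)) f y" for y
    have g_eq: "g y = (b - ratio (n * N) f y) * ?o y" for y
      unfolding g_def it_eq_ratio[of "n * N" f y] by (simp only: algebra_simps)
    have cg: "continuous_on UNIV g" unfolding g_def
      by (intro continuous_intros one_cont it_cont F(1)[OF f])
    have g0: "0 \<le> g y" for y unfolding g_eq using b[of y] one_nonneg by (intro mult_nonneg_nonneg) auto
    define a where "a = e / 2 * (?o xs / Q)"
    have a0: "0 \<le> a" using e Q one_nonneg by (simp add: a_def)
    have "a \<le> g y" if "dist z y < d" for y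
    proof -
      have "ratio (n * N) f y \<le> ratio (n * N) f z + e / 2"
        using near[OF f, of y z n] that by (simp add: dist_commute)
      then have "e / 2 \<le> b - ratio (n * N) f y" using yz b[of y0] by linarith
      moreover have "?o xs / Q \<le> ?o y" using Q(1) Q(2)[of n xs y] by (simp add: divide_le_eq mult.commute[of _ Q])
      ultimately show ?thesis unfolding a_def g_eq using e Q one_nonneg by (intro mult_mono) auto
    qed
    then have "c * a \<le> (L ^^ (m * N)) g x"
      using mix[rule_format, of g a z x] cg g0 a0 by auto
    also have "\<dots> = b * one ((m + n) * N) x - (L ^^ ((m + n) * N)) f x"
      unfolding g_def using it_cont[OF F(1)[OF f]] one_cont
      by (subst it_diff) (auto intro!: continuous_intros simp: it_scale it_it distrib_right)
    finally have *: "(L ^^ ((m + n) * N)) f x \<le> b * one ((m + n) * N) x - c * a" by simp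
    have "one ((m + n) * N) x = (L ^^ (m * N)) ?o x" by (simp add: it_it distrib_right)
    also have "\<dots> \<le> ?o xs * one (m * N) x" by (rule it_le_one[OF one_cont xs])
    also have "\<dots> \<le> ?o xs * M" using M(2)[of x] one_nonneg by (intro mult_left_mono) auto
    finally have "\<kappa> * one ((m + n) * N) x \<le> \<kappa> * (?o xs * M)" using \<kappa> by simp
    also have "\<dots> = c * a" using Q M by (simp add: \<kappa>_def a_def)
    finally have "(L ^^ ((m + n) * N)) f x \<le> (b - \<kappa>) * one ((m + n) * N) x"
      using * by (simp add: algebra_simps)
    then show ?thesis using one_pos[of "(m + n) * N" x] by (simp add: ratio_def divide_le_eq)
  qed
  have iter: "(\<exists>i\<le>j. spread (i * m * N) f e) \<or> (\<forall>x. ratio (j * m * N) f x \<le> B - real j * \<kappa>)"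
    if f: "f \<in> F" for f j
  proof (induction j)
    case 0 then show ?case using ratioB[OF f] by auto
  next
    case (Suc j)
    show ?case
    proof (cases "\<exists>i\<le>j. spread (i * m * N) f e")
      case True then show ?thesis using le_SucI by blast
    next
      case False
      then have "\<not> spread (j * m * N) f e" "\<And>x. ratio (j * m * N) f x \<le> B - real j * \<kappa>"
        using Suc by auto
      then have "ratio ((m + j * m) * N) f x \<le> B - real j * \<kappa> - \<kappa>" for x
        by (rule drop[OF f])
      then show ?thesis by (auto simp: algebra_simps)
    qed
  qed
  \<comment> \<open>After \<open>j\<close> drops the bound \<open>B - real j * \<kappa>\<close>
    would be negative, which is impossible for a nonnegative ratio.\<close>
  obtain j :: nat where j: "B / \<kappa> < real j" using reals_Archimedean2 by blast
  have "spread n f e" if n: "j * m * N \<le> n" and f: "f \<in> F" for n f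
  proof -
    have "B < real j * \<kappa>" using j \<kappa> by (simp add: divide_less_eq)
    then have "\<not> ratio (j * m * N) f x \<le> B - real j * \<kappa>" for x
      using ratio0[OF f, of "j * m * N" x] by linarith
    then obtain i where i: "i \<le> j" "spread (i * m * N) f e" using iter[OF f, of j] by blast
    have "i * m * N \<le> j * m * N" using i(1) by simp
    then show ?thesis using spread_mono[OF F(1)[OF f] i(2)] n le_trans by blast
  qed
  then show ?thesis by blast
qed

lemma ratio_shift:
  assumes "continuous_on UNIV f"
  shows "ratio n (\<lambda>x. f x + B) x = ratio n f x + B"
proof -
  have "(L ^^ n) (\<lambda>x. f x + B * 1) = (\<lambda>x. (L ^^ n) f x + (L ^^ n) (\<lambda>x. B * 1) x)"
    using assms by (intro it_add) auto
  also have "(L ^^ n) (\<lambda>x. B * 1) = (\<lambda>x. B * one n x)" by (rule it_scale) auto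
  finally show ?thesis using one_pos[of n x] by (simp add: ratio_def field_simps)
qed

lemma eventually_spread:
  assumes f: "continuous_on UNIV f" and e: "0 < e"
  shows "\<exists>n0. \<forall>n\<ge>n0. spread n f e"
proof -
  obtain B where B: "0 < B" "\<And>x. \<bar>f x\<bar> \<le> B" using bounded_cont[OF f] by blast
  \<comment> \<open>\<open>uniform_spread\<close> is about nonnegative functions; adding a constant
    shifts every ratio by that constant and keeps its oscillation.\<close>
  define g where "g x = f x + B" for x
  have cg: "continuous_on UNIV g" unfolding g_def by (intro continuous_intros f)
  have "0 \<le> g x" "g x \<le> 2 * B" for x using B(2)[of x] by (auto simp: g_def)
  moreover have "\<exists>d>0. \<forall>f\<in>{g}. \<forall>y y'. dist y y' < d \<longrightarrow> f y \<le> f y' + e'" if "0 < e'" for e'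
    using unif_cont[OF cg that] by (metis singletonD)
  ultimately have "\<exists>n0. \<forall>n\<ge>n0. \<forall>f\<in>{g}. spread n f e"
    using B e cg by (intro uniform_spread[where B="2 * B"]) auto
  moreover have "ratio n g x = ratio n f x + B" for n x
    unfolding g_def by (rule ratio_shift[OF f])
  ultimately show ?thesis by (simp add: spread_def)
qed

section \<open>The limit functional and its eigenvalue\<close>

text \<open>Evaluation at \<open>undefined\<close> merely picks some point of the space: by
  \<open>ratio_tendsto_J\<close> every point gives the same limit for a continuous
  \<open>f\<close>.\<close>

definition J :: "('a \<Rightarrow> real) \<Rightarrow> real" where
  "J f = lim (\<lambda>n. ratio n f undefined)"

lemma J_limit:
  assumes f: "continuous_on UNIV f"
  shows "(\<lambda>n. ratio n f undefined) \<longlonglongrightarrow> J f"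
proof -
  have "Cauchy (\<lambda>n. ratio n f undefined)"
    unfolding Cauchy_altdef2
  proof (intro allI impI)
    fix e :: real assume "0 < e"
    then obtain n0 where "spread n0 f (e / 3)" using eventually_spread[OF f, of "e / 3"] by auto
    then have "dist (ratio n f undefined) (ratio n0 f undefined) < e" if "n \<ge> n0" for n
      using spread_close[OF f, of n0 "e / 3" undefined "n - n0" undefined] that \<open>0 < e\<close>
      unfolding dist_real_def by (subst abs_minus_commute) simp
    then show "\<exists>N. \<forall>n\<ge>N. dist (ratio n f undefined) (ratio N f undefined) < e" by blast
  qed
  then show ?thesis
    unfolding J_def using Cauchy_convergent convergent_LIMSEQ_iff by blast
qed

lemma ratio_close_J:
  assumes f: "continuous_on UNIV f" and s: "spread n f e"
  shows "\<bar>ratio n f x - J f\<bar> \<le> e"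
proof -
  have "(\<lambda>k. \<bar>ratio n f x - ratio (k + n) f undefined\<bar>) \<longlonglongrightarrow> \<bar>ratio n f x - J f\<bar>"
    by (intro tendsto_intros LIMSEQ_ignore_initial_segment J_limit f)
  then show ?thesis by (rule LIMSEQ_le_const2) (auto intro!: exI[of _ 0] spread_close f s)
qed

lemma ratio_tendsto_J:
  assumes f: "continuous_on UNIV f"
  shows "(\<lambda>n. ratio n f x) \<longlonglongrightarrow> J f"
proof (rule metric_LIMSEQ_I)
  fix e :: real assume "0 < e"
  then obtain n0 where "\<forall>n\<ge>n0. spread n f (e / 2)" using eventually_spread[OF f, of "e / 2"] by auto
  then have "dist (ratio n f x) (J f) < e" if "n0 \<le> n" for n
    using ratio_close_J[OF f, of n "e / 2" x] that \<open>0 < e\<close> by (auto simp: dist_real_def)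
  then show "\<exists>n0. \<forall>n\<ge>n0. dist (ratio n f x) (J f) < e" by blast
qed

lemma J_unique: "continuous_on UNIV f \<Longrightarrow> (\<lambda>n. ratio n f x) \<longlonglongrightarrow> a \<Longrightarrow> J f = a"
  using ratio_tendsto_J[of f x] LIMSEQ_unique by blast

sublocale J: positive_functional J
proof
  show "compact (UNIV :: 'a set)" by (rule compact_UNIV)
  show "J (\<lambda>x. f x + g x) = J f + J g"
    if "continuous_on UNIV f" "continuous_on UNIV g" for f g
  proof (rule J_unique)
    show "(\<lambda>n. ratio n (\<lambda>x. f x + g x) undefined) \<longlonglongrightarrow> J f + J g"
      using tendsto_add[OF ratio_tendsto_J[OF that(1), of undefined] ratio_tendsto_J[OF that(2), of undefined]] that
      by (simp add: ratio_def it_add add_divide_distrib)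
  qed (intro continuous_intros that)
  show "J (\<lambda>x. c * f x) = c * J f" if "continuous_on UNIV f" for f c
  proof (rule J_unique)
    show "(\<lambda>n. ratio n (\<lambda>x. c * f x) undefined) \<longlonglongrightarrow> c * J f"
      using tendsto_mult_left[OF ratio_tendsto_J[OF that, of undefined], of c] that
      by (simp add: ratio_def it_scale)
  qed (intro continuous_intros that)
  show "0 \<le> J f" if "continuous_on UNIV f" "\<And>x. 0 \<le> f x" for f
    using ratio_tendsto_J[OF that(1), of undefined]
    by (rule LIMSEQ_le_const)
      (use it_nonneg[OF that] one_nonneg in \<open>auto simp: ratio_def\<close>)
  show "J (\<lambda>_. 1) = 1"
  proof (rule J_unique)
    have "ratio n (\<lambda>_. 1) undefined = 1" for n using one_pos[of n undefined] by (simp add: ratio_def)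
    then show "(\<lambda>n. ratio n (\<lambda>_. 1) undefined) \<longlonglongrightarrow> 1" by simp
  qed simp
qed

definition lam :: real where "lam = J (L (\<lambda>_. 1))"

text \<open>\<open>ratio n (L f)\<close> equals
  \<open>ratio (Suc n) f * ratio n (L (\<lambda>_. 1))\<close>, because the second factor is
  \<open>one (Suc n)\<close> divided by \<open>one n\<close>. The eigenvalue \<open>lam\<close> is
  the limit of these quotients.\<close>

lemma J_L:
  assumes f: "continuous_on UNIV f"
  shows "J (L f) = lam * J f"
proof (rule J_unique[OF L_cont[OF f]])
  have "ratio (Suc n) f undefined * ratio n (L (\<lambda>_. 1)) undefined = ratio n (L f) undefined" for n
    using one_pos[of "Suc n" undefined] by (simp add: ratio_def funpow_Suc_right del: funpow.simps)
  moreover have "(\<lambda>n. ratio (Suc n) f undefined * ratio n (L (\<lambda>_. 1)) undefined) \<longlonglongrightarrow> J f * lam"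
    unfolding lam_def by (intro tendsto_mult LIMSEQ_Suc ratio_tendsto_J f L_cont) simp
  ultimately show "(\<lambda>n. ratio n (L f) undefined) \<longlonglongrightarrow> lam * J f" by (simp add: mult.commute)
qed

lemma lam_pos: "0 < lam"
proof -
  obtain c where c: "0 < c" "\<And>x. c \<le> one 1 x" using one_lower[of 1] by blast
  have "J (\<lambda>_. c) \<le> lam" unfolding lam_def using c L_cont[of "\<lambda>_. 1"] by (intro J.mono) auto
  then show ?thesis using c by (simp add: J.const)
qed

lemma J_it: "continuous_on UNIV f \<Longrightarrow> J ((L ^^ n) f) = lam ^ n * J f"
  by (induction n) (auto simp: J_L it_cont)

section \<open>The eigenfunction and the convergence of all iterates\<close>

definition approx :: "nat \<Rightarrow> 'a \<Rightarrow> real" where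
  "approx k x = one (k * N) x / lam ^ (k * N)"

lemma approx_cont: "continuous_on UNIV (approx k)"
  unfolding approx_def using lam_pos by (intro continuous_intros one_cont) auto

lemma J_approx: "J (approx k) = 1"
proof -
  have "J (\<lambda>x. inverse (lam ^ (k * N)) * one (k * N) x) = inverse (lam ^ (k * N)) * J (one (k * N))"
    by (rule J.scale[OF one_cont])
  also have "\<dots> = 1" using lam_pos by (simp add: J_it J.one)
  finally show ?thesis by (simp add: approx_def[abs_def] divide_inverse mult.commute)
qed

text \<open>By the Harnack inequality any two values of \<open>approx k\<close> are comparable.
  Applying \<open>J\<close> in one of the two variables, where \<open>J (approx k) = 1\<close>,
  compares each value with 1.\<close>

lemma approx_bounds: "\<exists>Q\<ge>1. \<forall>k x. approx k x \<le> Q \<and> 1 \<le> Q * approx k x"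
proof -
  obtain Q where Q: "1 \<le> Q" "\<And>n x x'. one (n * N) x \<le> Q * one (n * N) x'" using harnack by blast
  have har: "approx k x \<le> Q * approx k x'" for k x x'
    using divide_right_mono[OF Q(2), of "lam ^ (k * N)" k x x'] lam_pos by (simp add: approx_def)
  have "approx k x \<le> Q" for k x
  proof -
    have "J (\<lambda>_. approx k x) \<le> J (\<lambda>x'. Q * approx k x')"
      by (intro J.mono continuous_intros approx_cont har)
    then show ?thesis by (simp add: J.const J.scale[OF approx_cont] J_approx)
  qed
  moreover have "1 \<le> Q * approx k x'" for k x'
  proof -
    have "J (approx k) \<le> J (\<lambda>_. Q * approx k x')"
      by (intro J.mono continuous_intros approx_cont har)
    then show ?thesis by (simp add: J.const J_approx)
  qed
  ultimately show ?thesis using Q(1) by blast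
qed

lemma approx_equi:
  assumes "0 < e"
  shows "\<exists>d>0. \<forall>k y y'. dist y y' < d \<longrightarrow> approx k y \<le> approx k y' + e"
proof -
  obtain Q where Q: "1 \<le> Q" "\<And>k x. approx k x \<le> Q" using approx_bounds by blast
  have "0 < e / Q" using assms Q by simp
  from L_reg[OF this] obtain d where d: "0 < d" and
    reg: "\<forall>n f w r x x'. continuous_on UNIV f \<and> (\<forall>y. 0 \<le> f y) \<and> 0 \<le> w \<and> r \<le> d \<and>
        (\<forall>y y'. dist y y' < r \<longrightarrow> f y \<le> f y' + w) \<and> dist x x' < r \<longrightarrow>
        (L ^^ (n * N)) f x \<le> (1 + e / Q) * ((L ^^ (n * N)) f x' + w * (L ^^ (n * N)) (\<lambda>_. 1) x')"
    by auto
  have "approx k y \<le> approx k y' + e" if "dist y y' < d" for k y y'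
  proof -
    have "one (k * N) y \<le> (1 + e / Q) * one (k * N) y'"
      using reg[rule_format, of "\<lambda>_. 1" 0 d y y' k] that by simp
    then have "approx k y \<le> (1 + e / Q) * approx k y'"
      using divide_right_mono[of "one (k * N) y" _ "lam ^ (k * N)"] lam_pos by (simp add: approx_def)
    also have "\<dots> = approx k y' + e / Q * approx k y'" by (simp add: algebra_simps)
    also have "e / Q * approx k y' \<le> e / Q * Q" using Q assms by (intro mult_left_mono) auto
    finally show ?thesis using Q by simp
  qed
  then show ?thesis using d by blast
qed

text \<open>\<open>approx (n + k)\<close> is the product of \<open>approx n\<close> and
  \<open>ratio (n * N) (approx k)\<close>. For large \<open>n\<close> the ratio is close to
  \<open>J (approx k) = 1\<close>, uniformly in \<open>k\<close> because the functions
  \<open>approx k\<close> are bounded and equicontinuous. This is why \<open>uniform_spread\<close>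
  treats families.\<close>

lemma approx_Cauchy: "uniformly_Cauchy_on UNIV approx"
proof (rule uniformly_Cauchy_onI')
  fix e :: real assume e: "0 < e"
  obtain Q where Q: "1 \<le> Q" "\<And>k x. approx k x \<le> Q" using approx_bounds by blast
  have approx0: "0 \<le> approx k x" for k x using one_nonneg lam_pos by (simp add: approx_def)
  have "\<exists>n0. \<forall>n\<ge>n0. \<forall>f\<in>range approx. spread n f (e / (2 * Q))"
    using approx_cont approx0 Q e approx_equi
    by (intro uniform_spread[where B=Q]) (auto simp del: approx_def)
  then obtain n0 where n0: "\<And>n k. n0 \<le> n \<Longrightarrow> spread n (approx k) (e / (2 * Q))" by auto
  have "dist (approx n x) (approx n' x) < e" if n: "n0 \<le> n" "n < n'" for n n' x
  proof -
    obtain k where k: "n' = n + k" using n(2) by (metis less_imp_add_positive)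
    have "n0 \<le> n * N" using n N_pos by (metis le_trans mult.right_neutral mult_le_mono2)
    then have "\<bar>ratio (n * N) (approx k) x - 1\<bar> \<le> e / (2 * Q)"
      using ratio_close_J[OF approx_cont n0] by (simp add: J_approx)
    moreover have "ratio (n * N) (approx k) x * approx n x = approx n' x"
    proof -
      have "(L ^^ (n * N)) (\<lambda>x. inverse (lam ^ (k * N)) * one (k * N) x) x
          = inverse (lam ^ (k * N)) * one (n' * N) x"
        by (subst it_scale[OF one_cont]) (simp add: it_it k distrib_right)
      then have "(L ^^ (n * N)) (approx k) x = one (n' * N) x / lam ^ (k * N)"
        by (simp add: approx_def[abs_def] divide_inverse mult.commute)
      then show ?thesis
        using one_pos[of "n * N" x] lam_pos by (simp add: ratio_def approx_def k distrib_right power_add)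
    qed
    then have "approx n' x - approx n x = (ratio (n * N) (approx k) x - 1) * approx n x"
      by (simp add: algebra_simps)
    ultimately have "\<bar>approx n' x - approx n x\<bar> \<le> e / (2 * Q) * approx n x"
      using approx0[of n x] by (simp only: abs_mult abs_of_nonneg mult_right_mono)
    also have "\<dots> \<le> e / (2 * Q) * Q" using e Q by (intro mult_left_mono) auto
    also have "\<dots> < e" using e Q by simp
    finally show ?thesis by (simp add: dist_real_def abs_minus_commute)
  qed
  then show "\<exists>M. \<forall>x\<in>UNIV. \<forall>m\<ge>M. \<forall>n>m. dist (approx m x) (approx n x) < e" by blast
qed

definition h :: "'a \<Rightarrow> real" where
  "h = (SOME h. uniform_limit UNIV approx h sequentially)"

lemma approx_limit: "uniform_limit UNIV approx h sequentially"
  unfolding h_def using approx_Cauchy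
  by (intro someI_ex[of "\<lambda>h. uniform_limit UNIV approx h sequentially"])
    (auto simp: uniformly_convergent_eq_Cauchy[symmetric] uniformly_convergent_on_def)

lemma approx_tendsto: "(\<lambda>k. approx k x) \<longlonglongrightarrow> h x"
  using tendsto_uniform_limitI[OF approx_limit] by simp

lemma h_cont: "continuous_on UNIV h"
  by (rule uniform_limit_theorem[OF _ approx_limit]) (auto simp: approx_cont)

lemma h_bounds: "\<exists>Q\<ge>1. \<forall>x. h x \<le> Q \<and> 1 \<le> Q * h x"
proof -
  obtain Q where Q: "1 \<le> Q" "\<And>k x. approx k x \<le> Q" "\<And>k x. 1 \<le> Q * approx k x" using approx_bounds by blast
  have "h x \<le> Q" for x using approx_tendsto by (rule LIMSEQ_le_const2) (use Q in auto)
  moreover have "1 \<le> Q * h x" for x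
    using tendsto_mult_left[OF approx_tendsto, of Q x] by (rule LIMSEQ_le_const) (use Q in auto)
  ultimately show ?thesis using Q(1) by blast
qed

lemma h_pos: "0 < h x"
proof -
  obtain Q where "1 \<le> Q" "1 \<le> Q * h x" using h_bounds by blast
  then show ?thesis by (smt (verit) mult_le_0_iff mult_nonneg_nonpos)
qed

lemma approx_close:
  assumes "0 < e"
  shows "\<exists>k0. \<forall>k\<ge>k0. \<forall>x. \<bar>approx k x - h x\<bar> \<le> e"
  using uniform_limitD[OF approx_limit assms]
  by (auto simp: eventually_sequentially dist_real_def intro: less_imp_le)

lemma J_h: "J h = 1"
proof -
  have "\<bar>J h - 1\<bar> \<le> e" if e: "0 < e" for e
  proof -
    obtain k where k: "\<And>x. \<bar>approx k x - h x\<bar> \<le> e" using approx_close[OF e] by blast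
    have "h x \<le> approx k x + e" "approx k x \<le> h x + e" for x using k[of x] by linarith+
    then have "J h \<le> J (\<lambda>x. approx k x + e)" "J (approx k) \<le> J (\<lambda>x. h x + e)"
      by (auto intro!: J.mono continuous_intros h_cont approx_cont)
    then show ?thesis
      by (simp add: J.add approx_cont h_cont J.const J_approx)
  qed
  then show ?thesis by (metis abs_le_zero_iff dense_ge eq_iff_diff_eq_0)
qed

lemma it_N_h: "(L ^^ N) h = (\<lambda>x. lam ^ N * h x)"
proof
  fix x
  have approx_Suc: "(L ^^ N) (approx k) x = lam ^ N * approx (Suc k) x" for k
  proof -
    have "(L ^^ N) (\<lambda>x. inverse (lam ^ (k * N)) * one (k * N) x) x = inverse (lam ^ (k * N)) * one (Suc k * N) x"
      by (subst it_scale[OF one_cont]) (simp add: it_it)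
    then show ?thesis using lam_pos
      by (simp add: approx_def[abs_def] divide_inverse mult.commute power_add)
  qed
  have "(\<lambda>k. (L ^^ N) (approx k) x) \<longlonglongrightarrow> (L ^^ N) h x"
  proof (rule metric_LIMSEQ_I)
    fix e :: real assume e: "0 < e"
    define e' where "e' = e / (2 * one N x)"
    have "0 < e'" using e one_pos by (simp add: e'_def)
    then obtain k0 where k0: "\<And>k x. k0 \<le> k \<Longrightarrow> \<bar>approx k x - h x\<bar> \<le> e'" using approx_close by blast
    have "dist ((L ^^ N) (approx k) x) ((L ^^ N) h x) < e" if "k0 \<le> k" for k
    proof -
      have c: "continuous_on UNIV (\<lambda>x. approx k x - h x)" by (intro continuous_intros approx_cont h_cont)
      have "approx k y - h y \<le> e'" "- e' \<le> approx k y - h y" for y using k0[OF that, of y] by linarith+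
      then have "\<bar>(L ^^ N) (\<lambda>x. approx k x - h x) x\<bar> \<le> e' * one N x"
        using it_le_one[OF c, of e' N x] it_ge_one[OF c, of "- e'" N x] by auto
      also have "\<dots> < e" using e one_pos[of N x] by (simp add: e'_def)
      finally show ?thesis by (simp add: it_diff approx_cont h_cont dist_real_def)
    qed
    then show "\<exists>k0. \<forall>k\<ge>k0. dist ((L ^^ N) (approx k) x) ((L ^^ N) h x) < e" by blast
  qed
  moreover have "(\<lambda>k. (L ^^ N) (approx k) x) \<longlonglongrightarrow> lam ^ N * h x"
    unfolding approx_Suc by (intro tendsto_intros LIMSEQ_Suc approx_tendsto)
  ultimately show "(L ^^ N) h x = lam ^ N * h x" by (rule LIMSEQ_unique)
qed

lemma it_nN_h: "(L ^^ (n * N)) h = (\<lambda>x. lam ^ (n * N) * h x)"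
proof (induction n)
  case (Suc n)
  have "(L ^^ (Suc n * N)) h = (L ^^ N) ((L ^^ (n * N)) h)" by (simp add: it_it)
  also have "\<dots> = (\<lambda>x. lam ^ (Suc n * N) * h x)"
    by (simp add: Suc it_scale[OF h_cont] it_N_h power_add mult.assoc mult.left_commute)
  finally show ?case .
qed simp

text \<open>So far \<open>h\<close> is an eigenfunction of \<open>L ^^ N\<close> only. Since
  \<open>L\<close> commutes with its powers, \<open>L h\<close> is another one with the same
  eigenvalue, so \<open>ratio (n * N) (L h) x * h x = ratio (n * N) h x * L h x\<close>. In the
  limit both ratios are constants, and \<open>L h\<close> is a multiple of \<open>h\<close>.\<close>

lemma L_h: "L h = (\<lambda>x. lam * h x)"
proof
  fix x
  have sub: "strict_mono (\<lambda>n. n * N)" using N_pos by (auto simp: strict_mono_def)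
  have "(L ^^ (n * N)) (L h) = (\<lambda>x. lam ^ (n * N) * L h x)" for n
  proof -
    have "(L ^^ (n * N)) (L h) = L ((L ^^ (n * N)) h)"
      using it_it[of "n * N" 1 h] it_it[of 1 "n * N" h] by simp
    then show ?thesis by (simp add: it_nN_h L_scale h_cont)
  qed
  then have eq: "ratio (n * N) (L h) x * h x = ratio (n * N) h x * L h x" for n
    by (simp add: ratio_def it_nN_h)
  have lim: "(\<lambda>n. ratio (n * N) f x) \<longlonglongrightarrow> J f" if "continuous_on UNIV f" for f
    using LIMSEQ_subseq_LIMSEQ[OF ratio_tendsto_J[OF that] sub] by (simp add: comp_def)
  have "(\<lambda>n. ratio (n * N) (L h) x * h x) \<longlonglongrightarrow> J (L h) * h x"
    by (intro tendsto_intros lim L_cont h_cont)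
  moreover have "(\<lambda>n. ratio (n * N) h x * L h x) \<longlonglongrightarrow> J h * L h x"
    by (intro tendsto_intros lim h_cont)
  ultimately have "J (L h) * h x = J h * L h x" unfolding eq by (rule LIMSEQ_unique)
  then show "L h x = lam * h x" by (simp add: J_L h_cont J_h)
qed

lemma it_h: "(L ^^ n) h = (\<lambda>x. lam ^ n * h x)"
  by (induction n) (auto simp: L_scale h_cont L_h)

text \<open>Subtracting \<open>J f * h\<close> leaves a function \<open>g\<close> with
  \<open>J g = 0\<close>, whose ratios tend to 0 uniformly. The bound for \<open>one n\<close> turns
  these ratios back into iterates.\<close>

theorem it_limit:
  assumes f: "continuous_on UNIV f"
  shows "uniform_limit UNIV (\<lambda>n x. (L ^^ n) f x / lam ^ n) (\<lambda>x. h x * J f) sequentially"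
proof (rule uniform_limitI)
  fix e :: real assume e: "0 < e"
  obtain Q where Q: "1 \<le> Q" "\<And>x. h x \<le> Q" "\<And>x. 1 \<le> Q * h x" using h_bounds by blast
  define g where "g x = f x - J f * h x" for x
  have cg: "continuous_on UNIV g" unfolding g_def by (intro continuous_intros f h_cont)
  have Jg: "J g = 0"
    unfolding g_def using f h_cont by (subst J.diff) (auto intro!: continuous_intros simp: J.scale J_h)
  have it_g: "(L ^^ n) g x = (L ^^ n) f x - J f * (lam ^ n * h x)" for n x
    unfolding g_def using f h_cont by (subst it_diff) (auto intro!: continuous_intros simp: it_scale it_h)
  \<comment> \<open>This holds for every \<open>n\<close> and not only for multiples of
    \<open>N\<close>: the constant 1 is dominated by \<open>Q * h\<close>, and \<open>h\<close> is
    an eigenfunction of \<open>L\<close> itself.\<close>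
  have one_le: "one n x \<le> Q * Q * lam ^ n" for n x
  proof -
    have "one n x \<le> (L ^^ n) (\<lambda>x. Q * h x) x"
      using Q(3) by (intro it_mono) (auto intro!: continuous_intros h_cont)
    also have "\<dots> = Q * (lam ^ n * h x)" by (simp add: it_scale h_cont it_h)
    also have "\<dots> \<le> Q * (lam ^ n * Q)" using Q lam_pos by (intro mult_left_mono) auto
    finally show ?thesis by (simp add: mult_ac)
  qed
  define e' where "e' = e / (2 * (Q * Q))"
  have "0 < e'" using e Q by (simp add: e'_def)
  then obtain n0 where n0: "\<And>n. n0 \<le> n \<Longrightarrow> spread n g e'" using eventually_spread[OF cg] by blast
  have "dist ((L ^^ n) f x / lam ^ n) (h x * J f) < e" if n: "n0 \<le> n" for n x
  proof -
    have "\<bar>(L ^^ n) g x\<bar> = \<bar>ratio n g x\<bar> * one n x"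
      using one_pos[of n x] by (simp add: it_eq_ratio[of n g x] abs_mult)
    also have "\<dots> \<le> e' * (Q * Q * lam ^ n)"
      using ratio_close_J[OF cg n0[OF n], of x] one_le[of n x] one_nonneg[of n x] \<open>0 < e'\<close>
      by (intro mult_mono) (auto simp: Jg)
    also have "\<dots> = e / 2 * lam ^ n" using Q by (simp add: e'_def)
    finally have "\<bar>(L ^^ n) g x / lam ^ n\<bar> \<le> e / 2" using lam_pos by (simp add: divide_le_eq abs_mult)
    moreover have "(L ^^ n) g x / lam ^ n = (L ^^ n) f x / lam ^ n - h x * J f"
      using lam_pos by (simp add: it_g diff_divide_distrib)
    ultimately show ?thesis using e by (simp add: dist_real_def)
  qed
  then show "\<forall>\<^sub>F n in sequentially. \<forall>x\<in>UNIV. dist ((L ^^ n) f x / lam ^ n) (h x * J f) < e"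
    by (auto simp: eventually_sequentially)
qed

end

subsection \<open>Covering maps\<close>

text \<open>Instantiated with \<open>T\<close> on \<open>X0\<close> and with \<open>T ^^ N\<close>
  on its domain, so that the results on sheets serve both covering properties.\<close>

locale covering =
  fixes X :: "'a::metric_space set" and S :: "'a \<Rightarrow> 'a" and D :: "'a set" and \<delta> :: real
  assumes cover: "uniform_covering X S D \<delta>"
    and \<delta>_pos: "0 < \<delta>"
    and openD: "open D"
    and contS: "continuous_on D S"
    and S_into: "S ` D \<subseteq> X"
begin

abbreviation B where "B w \<equiv> ball_in X w \<delta>"
abbreviation sh where "sh w \<equiv> sheets X S D \<delta> w"
abbreviation br where "br y \<equiv> inv_branch X S D \<delta> y"

lemma is_sheets: "w \<in> X \<Longrightarrow> is_sheets S D (B w) (sh w)"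
  unfolding sheets_def by (rule theI') (use cover in \<open>auto simp: uniform_covering_def\<close>)

lemma sheets_unique: "w \<in> X \<Longrightarrow> is_sheets S D (B w) \<A> \<Longrightarrow> \<A> = sh w"
  using cover is_sheets[of w] unfolding uniform_covering_def by blast

lemma sheetE:
  assumes "w \<in> X" "A \<in> sh w"
  obtains g where "open A" "A \<subseteq> D" "homeomorphism A (B w) S g"
  using is_sheets[OF assms(1)] assms(2) unfolding is_sheets_def by blast

lemma sheet_eqI: "w \<in> X \<Longrightarrow> A \<in> sh w \<Longrightarrow> A' \<in> sh w \<Longrightarrow> y \<in> A \<Longrightarrow> y \<in> A' \<Longrightarrow> A = A'"
  using is_sheets[of w] unfolding is_sheets_def disjoint_def by blast

lemma sheet_exists: "w \<in> X \<Longrightarrow> y \<in> D \<Longrightarrow> S y \<in> B w \<Longrightarrow> \<exists>A\<in>sh w. y \<in> A"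
  using is_sheets[of w] unfolding is_sheets_def by blast

lemma center: "w \<in> X \<Longrightarrow> w \<in> B w"
  using \<delta>_pos by (simp add: ball_in_def)

lemma inv_branchE:
  assumes y: "y \<in> D"
  obtains A where "A \<in> sh (S y)" "y \<in> A" "open A" "A \<subseteq> D" "inj_on S A" "S ` A = B (S y)"
    "continuous_on (B (S y)) (br y)" "\<And>z. z \<in> B (S y) \<Longrightarrow> br y z \<in> A"
    "\<And>z. z \<in> B (S y) \<Longrightarrow> S (br y z) = z" "\<And>a. a \<in> A \<Longrightarrow> br y (S a) = a"
proof -
  have w: "S y \<in> X" using y S_into by auto
  obtain A where A: "A \<in> sh (S y)" "y \<in> A" using sheet_exists[OF w y center[OF w]] by blast
  obtain g where g: "open A" "A \<subseteq> D" "homeomorphism A (B (S y)) S g" using sheetE[OF w A(1)] .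
  have the: "(THE A. A \<in> sh (S y) \<and> y \<in> A) = A"
    using A sheet_eqI[OF w] by (intro the_equality) auto
  have br: "br y = the_inv_into A S" unfolding inv_branch_def the ..
  have inj: "inj_on S A" using g(3) unfolding homeomorphism_def by (metis inj_on_inverseI)
  have im: "S ` A = B (S y)" using g(3) unfolding homeomorphism_def by auto
  have eq: "br y z = g z" if "z \<in> B (S y)" for z
    unfolding br using inj g(3) that unfolding homeomorphism_def
    by (metis imageI the_inv_into_f_f)
  have "continuous_on (B (S y)) (br y)"
    using g(3) eq unfolding homeomorphism_def by (metis continuous_on_cong)
  moreover have "br y z \<in> A" "S (br y z) = z" if "z \<in> B (S y)" for z
    using g(3) eq[OF that] that unfolding homeomorphism_def by auto
  moreover have "br y (S a) = a" if "a \<in> A" for a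
    unfolding br using inj that by (rule the_inv_into_f_f)
  ultimately show thesis using that A g inj im by blast
qed

lemma br_props:
  assumes y: "y \<in> D" and z: "z \<in> X" "dist (S y) z < \<delta>"
  shows "br y z \<in> D" "S (br y z) = z"
  using inv_branchE[OF y] z unfolding ball_in_def by (metis IntI mem_ball subsetD)+

lemma br_center: "y \<in> D \<Longrightarrow> br y (S y) = y"
  by (metis inv_branchE)

lemma br_cont: "y \<in> D \<Longrightarrow> continuous_on (B (S y)) (br y)"
  by (metis inv_branchE)

lemma br_open_image:
  assumes y: "y \<in> D" and U: "open U" "U \<subseteq> B (S y)"
  shows "open (br y ` U)"
proof -
  obtain A where A: "open A" "A \<subseteq> D" "S ` A = B (S y)" "\<And>z. z \<in> B (S y) \<Longrightarrow> br y z \<in> A"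
    "\<And>z. z \<in> B (S y) \<Longrightarrow> S (br y z) = z" "\<And>a. a \<in> A \<Longrightarrow> br y (S a) = a"
    using inv_branchE[OF y] by metis
  have eq: "br y ` U = A \<inter> S -` U"
  proof (intro equalityI subsetI)
    fix a assume "a \<in> br y ` U"
    then show "a \<in> A \<inter> S -` U" using A U by auto
  next
    fix a assume a: "a \<in> A \<inter> S -` U"
    then have "a = br y (S a)" using A(6) by simp
    then show "a \<in> br y ` U" using a by blast
  qed
  have "continuous_on A S" using contS A(2) continuous_on_subset by blast
  then show ?thesis unfolding eq using A(1) U(1) by (rule continuous_open_preimage)
qed

text \<open>Each sheet over \<open>B w\<close> meets the fibres of \<open>w\<close> and of
  \<open>w'\<close> in one point each, and \<open>br y w'\<close> stays in the sheet of
  \<open>y\<close>. Only sheets over \<open>B w\<close> are involved; those over \<open>B w'\<close>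
  may be different sets.\<close>

lemma br_bij:
  assumes w: "w \<in> X" "w' \<in> X" "dist w w' < \<delta>"
  shows "bij_betw (\<lambda>y. br y w') {y \<in> D. S y = w} {y \<in> D. S y = w'}"
proof -
  have w': "w' \<in> B w" using w by (simp add: ball_in_def)
  show ?thesis
    unfolding bij_betw_def
  proof (intro conjI inj_onI equalityI subsetI)
    fix y1 y2 assume y: "y1 \<in> {y \<in> D. S y = w}" "y2 \<in> {y \<in> D. S y = w}" and eq: "br y1 w' = br y2 w'"
    have yD: "y1 \<in> D" "S y1 = w" "y2 \<in> D" "S y2 = w" using y by auto
    obtain A1 where A1: "A1 \<in> sh w" "y1 \<in> A1" "inj_on S A1" "br y1 w' \<in> A1"
      by (rule inv_branchE[OF yD(1)]) (use w' in \<open>simp add: yD\<close>)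
    obtain A2 where A2: "A2 \<in> sh w" "y2 \<in> A2" "inj_on S A2" "br y2 w' \<in> A2"
      by (rule inv_branchE[OF yD(3)]) (use w' in \<open>simp add: yD\<close>)
    have "A1 = A2" using sheet_eqI[OF w(1) A1(1) A2(1) A1(4)] A2(4) eq by simp
    then show "y1 = y2" using A1 A2 y by (auto dest: inj_onD)
  next
    fix y' assume "y' \<in> (\<lambda>y. br y w') ` {y \<in> D. S y = w}"
    then show "y' \<in> {y \<in> D. S y = w'}" using br_props w by auto
  next
    fix y' assume "y' \<in> {y \<in> D. S y = w'}"
    then have y': "y' \<in> D" "S y' = w'" by auto
    obtain A where A: "A \<in> sh w" "y' \<in> A" using sheet_exists[OF w(1) y'(1)] y'(2) w' by auto
    obtain g where g: "open A" "A \<subseteq> D" "homeomorphism A (B w) S g" using sheetE[OF w(1) A(1)] .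
    define y where "y = g w"
    have y: "y \<in> A" "y \<in> D" "S y = w"
      using g center[OF w(1)] unfolding homeomorphism_def y_def by auto
    obtain A' where A': "A' \<in> sh w" "y \<in> A'" "\<And>a. a \<in> A' \<Longrightarrow> br y (S a) = a"
      using inv_branchE[OF y(2)] y(3) by metis
    have "A' = A" using sheet_eqI[OF w(1) A'(1) A(1) A'(2) y(1)] .
    then have "br y w' = y'" using A'(3) A(2) y'(2) by auto
    then show "y' \<in> (\<lambda>y. br y w') ` {y \<in> D. S y = w}" using y by force
  qed
qed

text \<open>If a ball is disconnected, say \<open>B = U \<union> V\<close>, and carries two sheets, then exchanging the parts of
  these sheets above \<open>V\<close> yields another decomposition. So uniqueness of the sheets forces
  the following alternative.\<close>

lemma connected_or_single:
  assumes w: "w \<in> X"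
  shows "connected (B w) \<or> (\<forall>A\<in>sh w. \<forall>A'\<in>sh w. A = A')"
proof (rule ccontr)
  assume neg: "\<not> ?thesis"
  then obtain A1 A2 where A: "A1 \<in> sh w" "A2 \<in> sh w" "A1 \<noteq> A2" by blast
  from neg obtain U0 V0 where UV0: "open U0" "open V0" "B w \<subseteq> U0 \<union> V0" "U0 \<inter> V0 \<inter> B w = {}"
    "U0 \<inter> B w \<noteq> {}" "V0 \<inter> B w \<noteq> {}"
    unfolding connected_def by blast
  obtain g1 where g1: "open A1" "A1 \<subseteq> D" "homeomorphism A1 (B w) S g1" using sheetE[OF w A(1)] .
  obtain g2 where g2: "open A2" "A2 \<subseteq> D" "homeomorphism A2 (B w) S g2" using sheetE[OF w A(2)] .
  have disj: "A1 \<inter> A2 = {}" using A sheet_eqI[OF w A(1,2)] by blast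
  define swap where "swap P Q = (P \<inter> S -` U0) \<union> (Q \<inter> S -` V0)" for P Q
  have swap_ok: "open (swap P Q) \<and> (\<exists>g. homeomorphism (swap P Q) (B w) S g)"
    if P: "open P" "P \<subseteq> D" "homeomorphism P (B w) S p" and Q: "open Q" "Q \<subseteq> D" "homeomorphism Q (B w) S q"
      for P Q p q
  proof
    have "continuous_on P S" "continuous_on Q S" using contS P(2) Q(2) continuous_on_subset by blast+
    then show op: "open (swap P Q)"
      unfolding swap_def using P(1) Q(1) UV0(1,2) by (intro open_Un continuous_open_preimage)
    define g where "g z = (if z \<in> U0 then p z else q z)" for z
    have Pf: "S ` P = B w" "p ` B w = P" "\<And>x. x \<in> P \<Longrightarrow> p (S x) = x" "\<And>y. y \<in> B w \<Longrightarrow> S (p y) = y"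
        "continuous_on (B w) p"
      and Qf: "S ` Q = B w" "q ` B w = Q" "\<And>x. x \<in> Q \<Longrightarrow> q (S x) = x" "\<And>y. y \<in> B w \<Longrightarrow> S (q y) = y"
        "continuous_on (B w) q"
      using P Q unfolding homeomorphism_def by auto
    have "homeomorphism (swap P Q) (B w) S g"
    proof (rule homeomorphismI)
      show "continuous_on (swap P Q) S"
        using contS P(2) Q(2) by (rule_tac continuous_on_subset[of D]) (auto simp: swap_def)
      have Bw: "B w = (B w \<inter> U0) \<union> (B w \<inter> V0)" using UV0(3) by blast
      have "continuous_on ((B w \<inter> U0) \<union> (B w \<inter> V0)) g"
        unfolding g_def
      proof (rule continuous_on_cases_local_open)
        show "openin (top_of_set (B w \<inter> U0 \<union> B w \<inter> V0)) (B w \<inter> U0)"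
          "openin (top_of_set (B w \<inter> U0 \<union> B w \<inter> V0)) (B w \<inter> V0)"
          unfolding Bw[symmetric] using UV0(1,2) by (auto intro: openin_open_Int)
        show "continuous_on (B w \<inter> U0) p" "continuous_on (B w \<inter> V0) q"
          using Pf(5) Qf(5) continuous_on_subset by blast+
      qed (use UV0(4) in auto)
      then show "continuous_on (B w) g" using Bw by simp
      show "S ` swap P Q \<subseteq> B w" using Pf(1) Qf(1) by (auto simp: swap_def)
      show "g ` B w \<subseteq> swap P Q"
      proof
        fix a assume "a \<in> g ` B w"
        then obtain z where z: "z \<in> B w" "a = g z" by blast
        show "a \<in> swap P Q"
        proof (cases "z \<in> U0")
          case True
          then show ?thesis using z Pf(2,4) by (auto simp: g_def swap_def)
        next
          case False
          then have "z \<in> V0" using z UV0(3) by blast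
          then show ?thesis using False z Qf(2,4) by (auto simp: g_def swap_def)
        qed
      qed
      show "g (S x) = x" if "x \<in> swap P Q" for x
      proof (cases "S x \<in> U0")
        case True
        have "x \<in> P"
        proof (rule ccontr)
          assume "x \<notin> P"
          then have "x \<in> Q" "S x \<in> V0" using that by (auto simp: swap_def)
          then show False using True UV0(4) Qf(1) by blast
        qed
        then show ?thesis using True Pf(3) by (simp add: g_def)
      next
        case False
        then show ?thesis using that Qf(3) by (auto simp: g_def swap_def)
      qed
      show "S (g y) = y" if "y \<in> B w" for y
        using that Pf(4) Qf(4) by (simp add: g_def)
    qed
    then show "\<exists>g. homeomorphism (swap P Q) (B w) S g" by blast
  qed
  define \<A> where "\<A> = insert (swap A1 A2) (insert (swap A2 A1) (sh w - {A1, A2}))"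
  have im: "S ` A1 = B w" "S ` A2 = B w" using g1 g2 unfolding homeomorphism_def by auto
  have un: "swap A1 A2 \<union> swap A2 A1 = A1 \<union> A2"
  proof -
    have "S x \<in> U0 \<or> S x \<in> V0" if "x \<in> A1 \<union> A2" for x using that im UV0(3) by blast
    then show ?thesis by (auto simp: swap_def)
  qed
  have "x \<in> A1 \<union> A2 \<Longrightarrow> \<not> (S x \<in> U0 \<and> S x \<in> V0)" for x using im UV0(4) by blast
  then have dj: "swap A1 A2 \<inter> swap A2 A1 = {}"
    using disj by (auto simp: swap_def)
  have sh: "countable (sh w)" "disjoint (sh w)" "\<Union>(sh w) = {y \<in> D. S y \<in> B w}"
    "\<And>A. A \<in> sh w \<Longrightarrow> open A \<and> (\<exists>g. homeomorphism A (B w) S g)"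
    using is_sheets[OF w] unfolding is_sheets_def by auto
  have "is_sheets S D (B w) \<A>"
    unfolding is_sheets_def
  proof (intro conjI ballI)
    show "countable \<A>" using sh(1) by (simp add: \<A>_def)
    have other: "C \<inter> (A1 \<union> A2) = {}" if "C \<in> sh w - {A1, A2}" for C
      using that sh(2) A unfolding disjoint_def by blast
    have "disjoint (sh w - {A1, A2})" using sh(2) unfolding disjoint_def by blast
    moreover have "swap A1 A2 \<inter> C = {}" "swap A2 A1 \<inter> C = {}" if "C \<in> sh w - {A1, A2}" for C
      using other[OF that] un by blast+
    ultimately show "disjoint \<A>"
      using dj unfolding \<A>_def disjoint_def by (auto simp: Int_commute)
    have "\<Union>\<A> = (A1 \<union> A2) \<union> \<Union>(sh w - {A1, A2})" unfolding \<A>_def using un by auto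
    also have "\<dots> = \<Union>(sh w)" using A by blast
    finally show "\<Union>\<A> = {y \<in> D. S y \<in> B w}" using sh(3) by simp
    fix C assume "C \<in> \<A>"
    then have "C = swap A1 A2 \<or> C = swap A2 A1 \<or> C \<in> sh w" by (auto simp: \<A>_def)
    then show "open C" "\<exists>g. homeomorphism C (B w) S g"
      using swap_ok[OF g1 g2] swap_ok[OF g2 g1] sh(4) by blast+
  qed
  then have "\<A> = sh w" by (rule sheets_unique[OF w])
  then have s: "swap A1 A2 \<in> sh w" by (auto simp: \<A>_def)
  \<comment> \<open>The swapped sheet meets \<open>A1\<close> above \<open>U0\<close> and
    \<open>A2\<close> above \<open>V0\<close>. Being one of the disjoint sheets itself, it would
    have to equal both.\<close>
  obtain u v where uv: "u \<in> U0 \<inter> B w" "v \<in> V0 \<inter> B w" using UV0(5,6) by blast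
  have "u \<in> S ` A1" "v \<in> S ` A2" using uv im by auto
  then obtain a1 a2 where a: "a1 \<in> A1" "S a1 = u" "a2 \<in> A2" "S a2 = v" by blast
  then have "a1 \<in> swap A1 A2" "a2 \<in> swap A1 A2" using uv by (auto simp: swap_def)
  then have "swap A1 A2 = A1" "swap A1 A2 = A2"
    using sheet_eqI[OF w s A(1)] sheet_eqI[OF w s A(2)] a by blast+
  then show False using A(3) by simp
qed

text \<open>The image of \<open>C\<close> is connected and meets the sheet of \<open>y\<close>. The
  other sheets over the ball form an open set disjoint from that sheet, so the image cannot leave
  it, and within a sheet the section is determined by injectivity.\<close>

lemma section_eq_branch_connected:
  assumes y: "y \<in> D" and C: "connected C" "S y \<in> C" "C \<subseteq> B (S y)"
    and g: "continuous_on C g" "\<And>z. z \<in> C \<Longrightarrow> g z \<in> D \<and> S (g z) = z" "g (S y) = y" and z: "z \<in> C"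
  shows "g z = br y z"
proof -
  have w: "S y \<in> X" using y S_into by auto
  obtain A where A: "A \<in> sh (S y)" "y \<in> A" "open A" "\<And>a. a \<in> A \<Longrightarrow> br y (S a) = a"
    using inv_branchE[OF y] by metis
  have conn: "connected (g ` C)" using g(1) C(1) by (rule connected_continuous_image)
  let ?V = "\<Union>(sh (S y) - {A})"
  have "open ?V" using is_sheets[OF w] unfolding is_sheets_def by blast
  moreover have sub: "g ` C \<subseteq> A \<union> ?V"
  proof
    fix a assume "a \<in> g ` C"
    then have "a \<in> D" "S a \<in> B (S y)" using g(2) C(3) by auto
    then show "a \<in> A \<union> ?V" using sheet_exists[OF w] by blast
  qed
  moreover have "A \<inter> ?V \<inter> g ` C = {}" using sheet_eqI[OF w A(1)] by blast
  moreover have "A \<inter> g ` C \<noteq> {}" using g(3) A(2) C(2) by (metis IntI emptyE imageI)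
  ultimately have "?V \<inter> g ` C = {}"
    using conn A(3) unfolding connected_def by blast
  then have "g z \<in> A" using sub z by blast
  then show ?thesis using A(4)[of "g z"] g(2)[OF z] by simp
qed

text \<open>On a disconnected ball the topological argument fails, but then there is a single sheet.
  It contains all preimages of the ball, hence all values of a section.\<close>

lemma section_eq_branch:
  assumes y: "y \<in> D" and g: "continuous_on (B (S y)) g" "\<And>z. z \<in> B (S y) \<Longrightarrow> g z \<in> D \<and> S (g z) = z" "g (S y) = y"
    and z: "z \<in> B (S y)"
  shows "g z = br y z"
proof -
  have w: "S y \<in> X" using y S_into by auto
  from connected_or_single[OF w] show ?thesis
  proof
    assume "connected (B (S y))"
    then show ?thesis using center[OF w] g z by (intro section_eq_branch_connected[OF y]) auto
  next
    assume single: "\<forall>A\<in>sh (S y). \<forall>A'\<in>sh (S y). A = A'"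
    obtain A where A: "A \<in> sh (S y)" "\<And>a. a \<in> A \<Longrightarrow> br y (S a) = a"
      using inv_branchE[OF y] by metis
    have "g z \<in> A" using sheet_exists[OF w, of "g z"] g(2)[OF z] z A(1) single by auto
    then show ?thesis using A(2)[of "g z"] g(2)[OF z] by simp
  qed
qed

end

subsection \<open>The iterates of an expanding system\<close>

text \<open>Tonelli for counting measures, applied to the kernel \<open>F\<close> that records the
  value \<open>g y\<close> by an indicator.\<close>

lemma nn_integral_count_space_partition:
  fixes f :: "'b \<Rightarrow> ennreal"
  assumes "g ` A \<subseteq> C"
  shows "(\<integral>\<^sup>+y. f y \<partial>count_space A) = (\<integral>\<^sup>+w. (\<integral>\<^sup>+y. f y \<partial>count_space {y \<in> A. g y = w}) \<partial>count_space C)"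
proof -
  define F where "F w y = f y * indicator A y * indicator {g y} w" for w y
  have "(\<integral>\<^sup>+w. (\<integral>\<^sup>+y. f y \<partial>count_space {y \<in> A. g y = w}) \<partial>count_space C)
      = (\<integral>\<^sup>+w. (\<integral>\<^sup>+y. F w y \<partial>count_space UNIV) \<partial>count_space C)"
    by (intro nn_integral_cong) (auto simp: F_def nn_integral_count_space_indicator indicator_def intro!: nn_integral_cong)
  also have "\<dots> = (\<integral>\<^sup>+w. (\<integral>\<^sup>+y. F w y \<partial>count_space UNIV) \<partial>count_space UNIV)"
  proof (rule nn_integral_count_space_eq)
    fix w assume "w \<in> UNIV - C"
    then have "F w y = 0" for y using assms by (auto simp: F_def indicator_def)
    then show "(\<integral>\<^sup>+y. F w y \<partial>count_space UNIV) = 0" by simp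
  qed auto
  also have "\<dots> = (\<integral>\<^sup>+y. (\<integral>\<^sup>+w. F w y \<partial>count_space UNIV) \<partial>count_space UNIV)"
    using nn_integral_fst_count_space[of "\<lambda>(w, y). F w y"] nn_integral_snd_count_space[of "\<lambda>(w, y). F w y"]
    by simp
  also have "(\<integral>\<^sup>+w. F w y \<partial>count_space UNIV) = f y * indicator A y" for y
    by (simp add: F_def nn_integral_cmult nn_integral_cmult_indicator)
  then have "(\<integral>\<^sup>+y. (\<integral>\<^sup>+w. F w y \<partial>count_space UNIV) \<partial>count_space UNIV) = (\<integral>\<^sup>+y. f y * indicator A y \<partial>count_space UNIV)"
    by simp
  also have "\<dots> = (\<integral>\<^sup>+y. f y \<partial>count_space A)" by (simp add: nn_integral_count_space_indicator)
  finally show ?thesis by simp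
qed

lemma nn_integral_count_space_eq_infsum:
  fixes f :: "'b \<Rightarrow> real"
  assumes "f summable_on A" "\<And>y. y \<in> A \<Longrightarrow> 0 \<le> f y"
  shows "(\<integral>\<^sup>+y. ennreal (f y) \<partial>count_space A) = ennreal (infsum f A)"
proof -
  have "(\<lambda>y. norm (f y)) summable_on A"
    using assms(1) summable_on_iff_abs_summable_on_real by blast
  then have a: "Infinite_Set_Sum.abs_summable_on f A" by (simp add: abs_summable_equivalent[symmetric])
  show ?thesis
    unfolding infsetsum_infsum[OF a, symmetric] by (rule nn_integral_conv_infsetsum[OF a assms(2)])
qed

locale expanding_system =
  fixes X X0 :: "'a::metric_space set"
    and T :: "'a \<Rightarrow> 'a"
    and \<phi> :: "'a \<Rightarrow> real"
    and \<delta> \<delta>N :: real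
    and N :: nat
  assumes compact_UNIV: "compact (UNIV :: 'a set)"
    and open_X: "open X" and closure_X: "closure X = UNIV"
    and open_X0: "open X0" and X0_sub: "X0 \<subseteq> X"
    and contT: "continuous_on X0 T" and T_into: "T ` X0 \<subseteq> X"
    and adm: "admissible X X0 T \<phi> \<delta>"
    and N_pos: "N \<ge> 1" and \<delta>N_pos: "\<delta>N > 0"
    and coverN: "uniform_covering X (T ^^ N) (iter_dom X X0 T N) \<delta>N"
    and expand: "cond_1c_star X X0 T N \<delta>N"
    and distort: "cond_1g X X0 T \<phi> N \<delta>N"
    and mixing: "cond_1e X X0 T N"
begin

abbreviation "dm n \<equiv> iter_dom X X0 T n"
abbreviation "fib n x \<equiv> iter_preimage X X0 T n {x}"
abbreviation "S n y \<equiv> birkhoff_sum T n \<phi> y"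
abbreviation "bN n y \<equiv> branch_N X X0 T N \<delta>N n y"
abbreviation "L \<equiv> transfer_op X X0 T \<phi>"

section \<open>Domains, fibres and weighted sums of the iterates\<close>

lemma dm_0: "dm 0 = X" by (simp add: iter_dom_def)

lemma dm_1: "dm (Suc 0) = X0" using X0_sub by (auto simp: iter_dom_def)

lemma dm_sub: "dm n \<subseteq> X" by (auto simp: iter_dom_def)

lemma dm_into: "y \<in> dm n \<Longrightarrow> (T ^^ n) y \<in> X"
  using T_into by (cases n) (auto simp: iter_dom_def)

lemma dm_add: "y \<in> dm (n + m) \<longleftrightarrow> y \<in> dm m \<and> (T ^^ m) y \<in> dm n"
proof
  assume y: "y \<in> dm (n + m)"
  then have m: "y \<in> dm m" by (auto simp: iter_dom_def)
  moreover have "(T ^^ i) ((T ^^ m) y) \<in> X0" if "i < n" for i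
  proof -
    have "(T ^^ (i + m)) y \<in> X0" using y that by (simp add: iter_dom_def)
    then show ?thesis by (simp add: funpow_add)
  qed
  ultimately show "y \<in> dm m \<and> (T ^^ m) y \<in> dm n" using dm_into by (auto simp: iter_dom_def)
next
  assume y: "y \<in> dm m \<and> (T ^^ m) y \<in> dm n"
  have "(T ^^ i) y \<in> X0" if "i < n + m" for i
  proof (cases "i < m")
    case False
    then have "i = (i - m) + m" "i - m < n" using that by auto
    then have "(T ^^ i) y = (T ^^ (i - m)) ((T ^^ m) y)" by (metis comp_apply funpow_add)
    then show ?thesis using y \<open>i - m < n\<close> by (simp add: iter_dom_def)
  qed (use y in \<open>auto simp: iter_dom_def\<close>)
  then show "y \<in> dm (n + m)" using y by (auto simp: iter_dom_def)
qed

lemma dm_Suc: "y \<in> dm (Suc n) \<longleftrightarrow> y \<in> X0 \<and> T y \<in> dm n"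
  using dm_add[of y n 1] by (simp add: dm_1)

lemma dm_mono: "m \<le> n \<Longrightarrow> dm n \<subseteq> dm m"
  by (auto simp: iter_dom_def)

lemma open_dm: "open (dm n)"
proof (induction n)
  case (Suc n)
  have "dm (Suc n) = X0 \<inter> T -` dm n" using dm_Suc by blast
  then show ?case using continuous_open_preimage[OF contT open_X0 Suc] by simp
qed (simp add: dm_0 open_X)

lemma cont_iter: "continuous_on (dm n) (T ^^ n)"
proof (induction n)
  case (Suc n)
  have "continuous_on (dm (Suc n)) (T ^^ n)"
    using Suc dm_mono[of n "Suc n"] continuous_on_subset by auto
  moreover have "(T ^^ n) ` dm (Suc n) \<subseteq> X0" by (auto simp: iter_dom_def)
  ultimately show ?case
    using continuous_on_compose2[OF contT] by (auto simp: comp_def)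
qed auto

sublocale T1: covering X T X0 \<delta>
  by unfold_locales (use adm open_X0 contT T_into in \<open>auto simp: admissible_def\<close>)

sublocale TN: covering X "T ^^ N" "dm N" \<delta>N
  by unfold_locales (use coverN \<delta>N_pos open_dm cont_iter dm_into in auto)

lemma S_add: "S (n + m) y = S m y + S n ((T ^^ m) y)"
  by (induction n) (auto simp: birkhoff_sum_def funpow_add)

lemma S_0: "S 0 y = 0" by (simp add: birkhoff_sum_def)

lemma S_1: "S (Suc 0) y = \<phi> y" by (simp add: birkhoff_sum_def)

lemma mem_fib: "y \<in> fib n x \<longleftrightarrow> y \<in> dm n \<and> (T ^^ n) y = x"
  by (auto simp: iter_preimage_def)

lemma fib_1: "fib (Suc 0) x = {y \<in> X0. T y = x}"
  by (auto simp: mem_fib dm_1)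

lemma fib_add: "y \<in> fib (n + m) x \<longleftrightarrow> y \<in> dm m \<and> (T ^^ m) y \<in> fib n x"
  by (auto simp: mem_fib dm_add funpow_add)

text \<open>The iterate of the transfer operator in \<open>ennreal\<close>. Sums over infinite
  fibres can then be regrouped and integrated without summability conditions, and \<open>F\<close>
  may be any function.\<close>

definition W :: "nat \<Rightarrow> ('a \<Rightarrow> ennreal) \<Rightarrow> 'a \<Rightarrow> ennreal" where
  "W n F x = (\<integral>\<^sup>+y. ennreal (exp (S n y)) * F y \<partial>count_space (fib n x))"

lemma W_0: "x \<in> X \<Longrightarrow> W 0 F x = F x"
proof -
  assume "x \<in> X"
  then have "fib 0 x = {x}" by (auto simp: mem_fib dm_0)
  then show ?thesis by (simp add: W_def S_0 nn_integral_count_space_finite)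
qed

text \<open>The fibre is regrouped by the intermediate point \<open>(T ^^ m) y\<close>, at which the
  Birkhoff sum splits.\<close>

lemma W_add: "W (n + m) F x = W n (W m F) x"
proof -
  have "W (n + m) F x = (\<integral>\<^sup>+w. (\<integral>\<^sup>+y. ennreal (exp (S (n + m) y)) * F y \<partial>count_space {y \<in> fib (n + m) x. (T ^^ m) y = w}) \<partial>count_space (fib n x))"
    unfolding W_def by (rule nn_integral_count_space_partition) (auto simp: fib_add)
  also have "\<dots> = (\<integral>\<^sup>+w. ennreal (exp (S n w)) * W m F w \<partial>count_space (fib n x))"
  proof (rule nn_integral_cong)
    fix w assume "w \<in> space (count_space (fib n x))"
    then have w: "w \<in> fib n x" by simp
    then have "{y \<in> fib (n + m) x. (T ^^ m) y = w} = fib m w"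
      by (auto simp: fib_add) (auto simp: mem_fib)
    then have "(\<integral>\<^sup>+y. ennreal (exp (S (n + m) y)) * F y \<partial>count_space {y \<in> fib (n + m) x. (T ^^ m) y = w})
      = (\<integral>\<^sup>+y. ennreal (exp (S n w)) * (ennreal (exp (S m y)) * F y) \<partial>count_space (fib m w))"
      by (auto intro!: nn_integral_cong simp: mem_fib S_add exp_add ennreal_mult mult_ac)
    then show "(\<integral>\<^sup>+y. ennreal (exp (S (n + m) y)) * F y \<partial>count_space {y \<in> fib (n + m) x. (T ^^ m) y = w})
      = ennreal (exp (S n w)) * W m F w"
      by (simp add: W_def nn_integral_cmult)
  qed
  finally show ?thesis by (simp add: W_def)
qed

lemma W_mono: "(\<And>y. y \<in> dm n \<Longrightarrow> F y \<le> G y) \<Longrightarrow> W n F x \<le> W n G x"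
  unfolding W_def by (intro nn_integral_mono mult_left_mono) (auto simp: mem_fib)

lemma W_cong: "(\<And>y. y \<in> dm n \<Longrightarrow> F y = G y) \<Longrightarrow> W n F x = W n G x"
  using W_mono[of n F G x] W_mono[of n G F x] by (auto intro!: antisym)

lemma W_ge_point: "y \<in> fib n x \<Longrightarrow> ennreal (exp (S n y)) * F y \<le> W n F x"
  unfolding W_def by (rule nn_integral_ge_point)

lemma bN_0: "bN 0 y z = z" by (simp add: branch_N_def)

section \<open>Inverse branches and distortion along multiples of N\<close>

lemma bN_Suc: "bN (Suc n) y z = TN.br y (bN n ((T ^^ N) y) z)"
  by (simp add: branch_N_def)

lemma fib_SucN: "y \<in> fib (Suc n * N) x \<longleftrightarrow> y \<in> dm N \<and> (T ^^ N) y \<in> fib (n * N) x"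
  using fib_add[of y "n * N" N x] by (simp add: add.commute)

lemma TN_contract:
  assumes y: "y \<in> dm N" and z: "z \<in> X" "dist ((T ^^ N) y) z < \<delta>N"
  shows "dist y (TN.br y z) \<le> dist ((T ^^ N) y) z"
proof -
  obtain A where A: "A \<in> TN.sh ((T ^^ N) y)" "y \<in> A" "\<And>z. z \<in> TN.B ((T ^^ N) y) \<Longrightarrow> TN.br y z \<in> A"
    using TN.inv_branchE[OF y] by metis
  have "z \<in> TN.B ((T ^^ N) y)" using z by (simp add: ball_in_def)
  then have "dist ((T ^^ N) y) ((T ^^ N) (TN.br y z)) \<ge> dist y (TN.br y z)"
    using expand dm_into[OF y] A unfolding cond_1c_star_def by blast
  then show ?thesis using TN.br_props[OF y z] by simp
qed

text \<open>By the expansion condition no inverse branch of \<open>T ^^ N\<close> enlarges the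
  distance to the orbit of \<open>y\<close>. The moved point therefore stays within
  \<open>\<delta>N\<close>, where the next branch is defined.\<close>

lemma bN_props:
  assumes "y \<in> fib (n * N) x" "z \<in> X" "dist x z < \<delta>N"
  shows "bN n y z \<in> fib (n * N) z" "dist y (bN n y z) \<le> dist x z"
proof -
  have "bN n y z \<in> fib (n * N) z \<and> dist y (bN n y z) \<le> dist x z"
    using assms(1)
  proof (induction n arbitrary: y)
    case 0 then show ?case using assms(2) by (auto simp: mem_fib dm_0 bN_0)
  next
    case (Suc n)
    then have y: "y \<in> dm N" "(T ^^ N) y \<in> fib (n * N) x" by (auto simp only: fib_SucN)
    define w w' where "w = (T ^^ N) y" and "w' = bN n w z"
    have w': "w' \<in> fib (n * N) z" "dist w w' \<le> dist x z"
      using Suc.IH[of w] y by (auto simp: w_def w'_def)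
    have w'X: "w' \<in> X" using w'(1) dm_sub by (auto simp: mem_fib)
    have d: "dist ((T ^^ N) y) w' < \<delta>N" using w'(2) assms(3) by (simp add: w_def)
    have "TN.br y w' \<in> fib (Suc n * N) z"
      using TN.br_props[OF y(1) w'X d] w' by (auto simp only: fib_SucN)
    moreover have "dist y (TN.br y w') \<le> dist x z"
      using TN_contract[OF y(1) w'X d] w'(2) by (simp add: w_def)
    ultimately show ?case by (simp only: bN_Suc w'_def w_def)
  qed
  then show "bN n y z \<in> fib (n * N) z" "dist y (bN n y z) \<le> dist x z" by auto
qed

lemma bN_center: "y \<in> dm (n * N) \<Longrightarrow> bN n y ((T ^^ (n * N)) y) = y"
proof (induction n arbitrary: y)
  case (Suc n)
  then have y: "y \<in> dm N" "(T ^^ N) y \<in> dm (n * N)"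
    using dm_add[of y "n * N" N] by (auto simp: add.commute)
  have "(T ^^ (Suc n * N)) y = (T ^^ (n * N)) ((T ^^ N) y)"
    using funpow_add[of "n * N" N T] by (simp add: add.commute)
  then show ?case using Suc.IH[OF y(2)] TN.br_center[OF y(1)] by (simp only: bN_Suc)
qed (simp add: bN_0)

text \<open>\<open>TN.br_bij\<close> is applied level by level: a fibre of
  \<open>T ^^ (Suc n * N)\<close> is partitioned by the intermediate point, which itself moves by
  the bijection of the previous level.\<close>

lemma bN_bij:
  assumes x: "x \<in> X" "x' \<in> X" "dist x x' < \<delta>N"
  shows "bij_betw (\<lambda>y. bN n y x') (fib (n * N) x) (fib (n * N) x')"
proof (induction n)
  case 0
  have "fib 0 x = {x}" "fib 0 x' = {x'}" using x by (auto simp: mem_fib dm_0)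
  then show ?case by (simp add: bN_0 bij_betw_def)
next
  case (Suc n)
  have near: "bN n w x' \<in> fib (n * N) x'" "bN n w x' \<in> X" "dist w (bN n w x') < \<delta>N" "w \<in> X"
    if "w \<in> fib (n * N) x" for w
    using bN_props[OF that x(2,3)] x(3) that dm_sub by (auto simp: mem_fib)
  show ?case
    unfolding bij_betw_def
  proof (intro conjI inj_onI equalityI subsetI)
    fix y1 y2 assume "y1 \<in> fib (Suc n * N) x" "y2 \<in> fib (Suc n * N) x" and eq: "bN (Suc n) y1 x' = bN (Suc n) y2 x'"
    then have y: "y1 \<in> dm N" "(T ^^ N) y1 \<in> fib (n * N) x" "y2 \<in> dm N" "(T ^^ N) y2 \<in> fib (n * N) x"
      by (auto simp only: fib_SucN)
    have "(T ^^ N) (bN (Suc n) y1 x') = bN n ((T ^^ N) y1) x'" "(T ^^ N) (bN (Suc n) y2 x') = bN n ((T ^^ N) y2) x'"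
      unfolding bN_Suc using TN.br_props(2)[OF y(1) near(2,3)[OF y(2)]] TN.br_props(2)[OF y(3) near(2,3)[OF y(4)]] by auto
    then have "bN n ((T ^^ N) y1) x' = bN n ((T ^^ N) y2) x'" using eq by simp
    then have w: "(T ^^ N) y1 = (T ^^ N) y2"
      using Suc y by (auto simp: bij_betw_def dest: inj_onD)
    have "inj_on (\<lambda>y. TN.br y (bN n ((T ^^ N) y1) x')) {y \<in> dm N. (T ^^ N) y = (T ^^ N) y1}"
      using TN.br_bij[OF near(4)[OF y(2)] near(2,3)[OF y(2)]] by (simp add: bij_betw_def)
    then show "y1 = y2"
      using eq w y by (auto simp: bN_Suc dest: inj_onD)
  next
    fix y' assume "y' \<in> (\<lambda>y. bN (Suc n) y x') ` fib (Suc n * N) x"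
    then show "y' \<in> fib (Suc n * N) x'" using bN_props(1)[OF _ x(2,3)] by blast
  next
    fix y' assume "y' \<in> fib (Suc n * N) x'"
    then have y': "y' \<in> dm N" "(T ^^ N) y' \<in> fib (n * N) x'" by (auto simp only: fib_SucN)
    then obtain w where w: "w \<in> fib (n * N) x" "bN n w x' = (T ^^ N) y'"
      using Suc unfolding bij_betw_def by (metis (no_types, lifting) imageE)
    have "(\<lambda>y. TN.br y (bN n w x')) ` {y \<in> dm N. (T ^^ N) y = w} = {y \<in> dm N. (T ^^ N) y = bN n w x'}"
      using TN.br_bij[OF near(4,2,3)[OF w(1)]] by (simp add: bij_betw_def)
    then obtain y where y: "y \<in> dm N" "(T ^^ N) y = w" "TN.br y (bN n w x') = y'"
      using y' w(2) by (smt (verit) imageE mem_Collect_eq)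
    then have "bN (Suc n) y x' = y'" "y \<in> fib (Suc n * N) x"
      using w(1) by (simp only: bN_Suc, simp only: fib_SucN)
    then show "y' \<in> (\<lambda>y. bN (Suc n) y x') ` fib (Suc n * N) x" by blast
  qed
qed

text \<open>\<open>enn2real\<close> sends an infinite value to 0. This is harmless, because
  \<open>Cd\<close> is used at distances below \<open>\<delta>N\<close>, where (1g) makes the
  distortion finite.\<close>

definition Cd :: "'a \<Rightarrow> 'a \<Rightarrow> real" where
  "Cd x x' = enn2real (distortion X X0 T \<phi> N \<delta>N x x')"

lemma Cd_nonneg: "0 \<le> Cd x x'" by (simp add: Cd_def)

lemma Cd_bounded: "\<exists>C>0. \<forall>x\<in>X. \<forall>x'\<in>X. dist x x' < \<delta>N \<longrightarrow> Cd x x' \<le> C"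
proof -
  obtain C where C: "C > 0" "\<forall>x\<in>X. \<forall>x'\<in>X. dist x x' < \<delta>N \<longrightarrow> distortion X X0 T \<phi> N \<delta>N x x' \<le> ennreal C"
    using distort unfolding cond_1g_def by blast
  have "Cd x x' \<le> C" if "x \<in> X" "x' \<in> X" "dist x x' < \<delta>N" for x x'
    unfolding Cd_def using C that by (intro enn2real_leI) auto
  then show ?thesis using C(1) by blast
qed

lemma Cd_small:
  assumes "0 < e"
  shows "\<exists>\<eta>>0. \<eta> \<le> \<delta>N \<and> (\<forall>x\<in>X. \<forall>x'\<in>X. dist x x' < \<eta> \<longrightarrow> Cd x x' < e)"
proof -
  obtain \<eta> where \<eta>: "\<eta> > 0" "\<eta> \<le> \<delta>N" "\<forall>x\<in>X. \<forall>x'\<in>X. dist x x' < \<eta> \<longrightarrow> distortion X X0 T \<phi> N \<delta>N x x' < ennreal e"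
    using distort assms unfolding cond_1g_def by blast
  have "Cd x x' < e" if "x \<in> X" "x' \<in> X" "dist x x' < \<eta>" for x x'
    using \<eta>(3) that assms unfolding Cd_def
    by (metis enn2real_less_iff ennreal_less_top less_imp_le order.strict_trans)
  then show ?thesis using \<eta> by blast
qed

lemma S_distortion:
  assumes x: "x \<in> X" "x' \<in> X" "dist x x' < \<delta>N" and y: "y \<in> fib (n * N) x"
  shows "\<bar>S (n * N) y - S (n * N) (bN n y x')\<bar> \<le> Cd x x'"
proof (cases "n = 0")
  case False
  obtain C where "distortion X X0 T \<phi> N \<delta>N x x' \<le> ennreal C"
    using distort x unfolding cond_1g_def by blast
  then have fin: "distortion X X0 T \<phi> N \<delta>N x x' < top" using ennreal_less_top le_less_trans by blast
  have "ennreal \<bar>S (n * N) y - S (n * N) (bN n y x')\<bar> \<le> distortion X X0 T \<phi> N \<delta>N x x'"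
    unfolding distortion_def using False y by (intro SUP_upper2[of n] SUP_upper) auto
  then show ?thesis
    unfolding Cd_def using fin by (metis abs_ge_zero enn2real_ennreal enn2real_mono)
qed (simp add: S_0 Cd_nonneg)

text \<open>The bijection \<open>\<lambda>y. bN n y x'\<close> carries the fibre of \<open>x\<close>
  to that of \<open>x'\<close>. It changes the weights by at most the factor
  \<open>exp (Cd x x')\<close> and moves the arguments of \<open>F\<close> by at most
  \<open>dist x x'\<close>, which costs \<open>w\<close>.\<close>

lemma W_compare:
  assumes x: "x \<in> X" "x' \<in> X" "dist x x' < \<delta>N"
    and F: "\<And>y y'. y \<in> X \<Longrightarrow> y' \<in> X \<Longrightarrow> dist y y' \<le> dist x x' \<Longrightarrow> F y \<le> F y' + w"
  shows "W (n * N) F x \<le> ennreal (exp (Cd x x')) * (W (n * N) F x' + w * W (n * N) (\<lambda>_. 1) x')"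
proof -
  let ?b = "\<lambda>y. bN n y x'" and ?S = "S (n * N)" and ?A = "fib (n * N) x"
  have "W (n * N) F x \<le> (\<integral>\<^sup>+y. ennreal (exp (Cd x x')) * (ennreal (exp (?S (?b y))) * (F (?b y) + w)) \<partial>count_space ?A)"
    unfolding W_def
  proof (rule nn_integral_mono)
    fix y assume "y \<in> space (count_space ?A)"
    then have y: "y \<in> ?A" by simp
    have b: "?b y \<in> fib (n * N) x'" "dist y (?b y) \<le> dist x x'" using bN_props[OF y x(2,3)] by auto
    have "?S y \<le> Cd x x' + ?S (?b y)" using S_distortion[OF x y] by linarith
    then have "exp (?S y) \<le> exp (Cd x x') * exp (?S (?b y))" by (simp add: exp_add[symmetric])
    then have "ennreal (exp (?S y)) \<le> ennreal (exp (Cd x x')) * ennreal (exp (?S (?b y)))"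
      by (simp add: ennreal_mult[symmetric])
    moreover have "F y \<le> F (?b y) + w" using F[OF _ _ b(2)] y b(1) dm_sub by (auto simp: mem_fib)
    ultimately show "ennreal (exp (?S y)) * F y \<le> ennreal (exp (Cd x x')) * (ennreal (exp (?S (?b y))) * (F (?b y) + w))"
      unfolding mult.assoc[symmetric] by (intro mult_mono) auto
  qed
  also have "\<dots> = (\<integral>\<^sup>+y. ennreal (exp (Cd x x')) * (ennreal (exp (?S y)) * (F y + w)) \<partial>count_space (fib (n * N) x'))"
    by (rule nn_integral_bij_count_space[OF bN_bij[OF x]])
  also have "\<dots> = ennreal (exp (Cd x x')) * (W (n * N) F x' + w * W (n * N) (\<lambda>_. 1) x')"
    by (simp add: W_def nn_integral_cmult distrib_left nn_integral_add mult.commute[of _ w])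
  finally show ?thesis .
qed

lemma finite_net:
  assumes "0 < r"
  obtains E where "finite E" "E \<subseteq> X" "\<And>x. \<exists>e\<in>E. dist e x < r"
proof -
  have "\<exists>e\<in>X. dist e x < r" for x
    using closure_X assms closure_approachable[of x X] by auto
  then have "(UNIV :: 'a set) \<subseteq> (\<Union>e\<in>X. ball e r)" by auto
  then obtain E where "E \<subseteq> X" "finite E" "(UNIV :: 'a set) \<subseteq> (\<Union>e\<in>E. ball e r)"
    using compactE_image[OF compact_UNIV, of X "\<lambda>e. ball e r"] by (metis open_ball)
  then show thesis using that[of E] by fastforce
qed

lemma X_nonempty: "X \<noteq> {}" using closure_X by auto

text \<open>Condition (1e) says nothing about weights. It is therefore applied only to the finitely
  many pairs of points of a net, where a least weight exists. Branches starting at a net point then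
  carry the chosen preimages to every nearby \<open>x\<close>, at a bounded cost in the Birkhoff
  sum.\<close>

lemma reach:
  assumes r: "0 < r"
  shows "\<exists>m\<ge>1. \<exists>c>0. \<forall>x\<in>X. \<forall>z\<in>X. \<exists>y\<in>fib (m * N) x. dist z y < r \<and> c \<le> exp (S (m * N) y)"
proof -
  obtain m where m: "1 \<le> m" and pre: "\<forall>x\<in>X. \<forall>z\<in>X. \<exists>y\<in>fib (N * m) x. dist z y < r / 3"
    using mixing r unfolding cond_1e_def by (metis divide_pos_pos zero_less_numeral)
  \<comment> \<open>One third of \<open>r\<close> each pays for moving \<open>z\<close> to the net,
    for (1e) and for moving \<open>x\<close> to the net. The bound \<open>\<delta>N\<close> makes
    the branch from the net point to \<open>x\<close> available.\<close>
  define q where "q = min (r / 3) \<delta>N"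
  have q: "0 < q" using r \<delta>N_pos by (simp add: q_def)
  obtain E where E: "finite E" "E \<subseteq> X" "\<And>x. \<exists>e\<in>E. dist e x < q" using finite_net[OF q] by metis
  have "\<forall>e\<in>E. \<forall>e'\<in>E. \<exists>y\<in>fib (m * N) e. dist e' y < r / 3" using pre E(2) by (auto simp: mult.commute)
  then obtain p where p: "\<And>e e'. e \<in> E \<Longrightarrow> e' \<in> E \<Longrightarrow> p e e' \<in> fib (m * N) e \<and> dist e' (p e e') < r / 3" by metis
  obtain C where C: "0 < C" "\<And>x x'. x \<in> X \<Longrightarrow> x' \<in> X \<Longrightarrow> dist x x' < \<delta>N \<Longrightarrow> Cd x x' \<le> C" using Cd_bounded by blast
  define c where "c = Min ((\<lambda>(e, e'). exp (S (m * N) (p e e') - C)) ` (E \<times> E))"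
  have ne: "E \<noteq> {}" using E(3) by auto
  have cpos: "0 < c" unfolding c_def using E(1) ne by (subst Min_gr_iff) auto
  have "\<exists>y\<in>fib (m * N) x. dist z y < r \<and> c \<le> exp (S (m * N) y)" if x: "x \<in> X" and z: "z \<in> X" for x z
  proof -
    obtain e where e: "e \<in> E" "dist e x < q" using E(3) by blast
    obtain e' where e': "e' \<in> E" "dist e' z < q" using E(3) by blast
    have d: "dist e x < \<delta>N" "dist e x < r / 3" "dist e' z < r / 3" using e e' by (auto simp: q_def)
    have eX: "e \<in> X" using e E by auto
    let ?y = "bN m (p e e') x"
    have y: "?y \<in> fib (m * N) x" "dist (p e e') ?y \<le> dist e x"
      using bN_props[OF _ x d(1)] p[OF e(1) e'(1)] by auto
    have "dist z ?y \<le> dist z e' + dist e' (p e e') + dist (p e e') ?y"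
      using dist_triangle[of z ?y e'] dist_triangle[of e' ?y "p e e'"] by linarith
    also have "\<dots> < r" using p[OF e(1) e'(1)] d y(2) by (simp add: dist_commute)
    finally have "dist z ?y < r" .
    moreover have "c \<le> exp (S (m * N) (p e e') - C)" unfolding c_def using E(1) e e' by (intro Min_le) auto
    moreover have "S (m * N) (p e e') - C \<le> S (m * N) ?y"
      using S_distortion[OF eX x d(1), of "p e e'" m] p[OF e(1) e'(1)] C(2)[OF eX x d(1)] by auto
    ultimately show ?thesis using y(1) by (metis exp_le_cancel_iff order_trans)
  qed
  then show ?thesis using m cpos by blast
qed

subsection \<open>The transfer operator\<close>

lemma weights_summable: "x \<in> X \<Longrightarrow> (\<lambda>y. exp (\<phi> y)) summable_on {y \<in> X0. T y = x}"
  using adm unfolding admissible_def by blast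

lemma W1_bounded: "\<exists>K>0. \<forall>x\<in>X. W 1 (\<lambda>_. 1) x \<le> ennreal K"
proof -
  obtain K where K: "\<forall>x\<in>X. (\<Sum>\<^sub>\<infinity>y\<in>{y \<in> X0. T y = x}. exp (\<phi> y)) \<le> K"
    using adm unfolding admissible_def by blast
  have "W 1 (\<lambda>_. 1) x \<le> ennreal (max K 1)" if x: "x \<in> X" for x
  proof -
    have "W 1 (\<lambda>_. 1) x = ennreal (\<Sum>\<^sub>\<infinity>y\<in>{y \<in> X0. T y = x}. exp (\<phi> y))"
      unfolding W_def One_nat_def fib_1 S_1 mult_1_right
      by (rule nn_integral_count_space_eq_infsum[OF weights_summable[OF x]]) simp
    also have "\<dots> \<le> ennreal (max K 1)" using K x by (intro ennreal_leI) auto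
    finally show ?thesis .
  qed
  then show ?thesis by (intro exI[of _ "max K 1"]) auto
qed

lemmas bounded_cont = compact_UNIV_bounded[OF compact_UNIV]
lemmas unif_cont = compact_UNIV_uniform[OF compact_UNIV]

lemma weighted_summable:
  assumes f: "continuous_on UNIV f" and x: "x \<in> X"
  shows "(\<lambda>y. f y * exp (\<phi> y)) summable_on {y \<in> X0. T y = x}"
proof -
  obtain B where B: "0 < B" "\<And>x. \<bar>f x\<bar> \<le> B" using bounded_cont[OF f] by blast
  have "(\<lambda>y. B * exp (\<phi> y)) summable_on {y \<in> X0. T y = x}"
    by (rule summable_on_cmult_right[OF weights_summable[OF x]])
  then have "(\<lambda>y. norm (f y * exp (\<phi> y))) summable_on {y \<in> X0. T y = x}"
    by (rule Infinite_Sum.abs_summable_on_comparison_test') (auto simp: abs_mult B intro!: mult_right_mono)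
  then show ?thesis by (rule abs_summable_summable)
qed

lemma transfer_sum_eq_W:
  assumes f: "continuous_on UNIV f" and f0: "\<And>y. 0 \<le> f y" and x: "x \<in> X"
  shows "ennreal (transfer_sum X0 T \<phi> f x) = W 1 (\<lambda>y. ennreal (f y)) x"
proof -
  have "W 1 (\<lambda>y. ennreal (f y)) x = (\<integral>\<^sup>+y. ennreal (f y * exp (\<phi> y)) \<partial>count_space {y \<in> X0. T y = x})"
    unfolding W_def One_nat_def fib_1 S_1
    by (intro nn_integral_cong) (simp add: ennreal_mult f0 mult.commute)
  also have "\<dots> = ennreal (transfer_sum X0 T \<phi> f x)"
    unfolding transfer_sum_def
    by (rule nn_integral_count_space_eq_infsum[OF weighted_summable[OF f x]]) (simp add: f0)
  finally show ?thesis by simp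
qed

lemma transfer_sum_nonneg: "(\<And>y. 0 \<le> f y) \<Longrightarrow> 0 \<le> transfer_sum X0 T \<phi> f x"
  unfolding transfer_sum_def by (intro infsum_nonneg) auto

lemma transfer_sum_add:
  assumes "continuous_on UNIV f" "continuous_on UNIV g" "x \<in> X"
  shows "transfer_sum X0 T \<phi> (\<lambda>y. f y + g y) x = transfer_sum X0 T \<phi> f x + transfer_sum X0 T \<phi> g x"
  unfolding transfer_sum_def distrib_right
  by (rule infsum_add[OF weighted_summable[OF assms(1,3)] weighted_summable[OF assms(2,3)]])

lemma transfer_sum_scale: "transfer_sum X0 T \<phi> (\<lambda>y. c * f y) x = c * transfer_sum X0 T \<phi> f x"
  unfolding transfer_sum_def mult.assoc by (rule infsum_cmult_right')

text \<open>Once the fibre of \<open>x\<close> is transported to that of \<open>x'\<close>, the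
  change of \<open>f\<close> is controlled by (1c) and the change of the weights by (1d). Each gets
  half of \<open>e\<close>: \<open>w\<close> multiplies a sum of weights of size at most
  \<open>K\<close>, and \<open>\<epsilon>\<close> multiplies the bound \<open>B\<close> of
  \<open>f\<close>.\<close>

lemma transfer_sum_modulus:
  assumes f: "continuous_on UNIV f" and f0: "\<And>y. 0 \<le> f y" and e: "0 < e"
  shows "\<exists>d>0. \<forall>x\<in>X. \<forall>x'\<in>X. dist x x' < d \<longrightarrow> transfer_sum X0 T \<phi> f x \<le> transfer_sum X0 T \<phi> f x' + e"
proof -
  obtain K where K: "0 < K" "\<And>x. x \<in> X \<Longrightarrow> W 1 (\<lambda>_. 1) x \<le> ennreal K" using W1_bounded by blast
  obtain B where B: "0 < B" "\<And>x. \<bar>f x\<bar> \<le> B" using bounded_cont[OF f] by blast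
  define w where "w = e / (2 * K)"
  have w: "0 < w" "w * K = e / 2" using e K by (auto simp: w_def)
  obtain d0 where d0: "0 < d0" "\<And>y y'. dist y y' < d0 \<Longrightarrow> f y \<le> f y' + w" using unif_cont[OF f w(1)] by blast
  have "cond_1c X X0 T \<delta>" "cond_1d X X0 T \<phi> \<delta>" using adm by (auto simp: admissible_def)
  obtain d1 where d1: "0 < d1" "d1 < \<delta>" "\<And>x y x'. x \<in> X \<Longrightarrow> y \<in> X0 \<Longrightarrow> T y = x \<Longrightarrow> x' \<in> X \<Longrightarrow> dist x x' < d1 \<Longrightarrow>
      dist (T1.br y x) (T1.br y x') < d0"
    using \<open>cond_1c X X0 T \<delta>\<close> d0(1) unfolding cond_1c_def by metis
  define \<epsilon> where "\<epsilon> = e / (2 * B)"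
  have \<epsilon>: "0 < \<epsilon>" "B * \<epsilon> = e / 2" using e B by (auto simp: \<epsilon>_def)
  obtain d2 where d2: "0 < d2" "d2 < \<delta>" "\<forall>x\<in>X. \<forall>x'\<in>X. dist x x' < d2 \<longrightarrow>
           (\<lambda>y. \<bar>exp (\<phi> (T1.br y x)) - exp (\<phi> (T1.br y x'))\<bar>) summable_on {y \<in> X0. T y = x} \<and>
           (\<Sum>\<^sub>\<infinity>y\<in>{y \<in> X0. T y = x}. \<bar>exp (\<phi> (T1.br y x)) - exp (\<phi> (T1.br y x'))\<bar>) < \<epsilon>"
    using \<open>cond_1d X X0 T \<phi> \<delta>\<close> \<epsilon>(1) unfolding cond_1d_def by blast
  have "transfer_sum X0 T \<phi> f x \<le> transfer_sum X0 T \<phi> f x' + e"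
    if x: "x \<in> X" "x' \<in> X" "dist x x' < min d1 d2" for x x'
  proof -
    let ?A = "{y \<in> X0. T y = x}" and ?b = "\<lambda>y. T1.br y x'"
    let ?D = "\<lambda>y. \<bar>exp (\<phi> (T1.br y x)) - exp (\<phi> (?b y))\<bar>"
    have D: "?D summable_on ?A" "infsum ?D ?A < \<epsilon>" using d2(3) x by auto
    have "ennreal (transfer_sum X0 T \<phi> f x) = (\<integral>\<^sup>+y. ennreal (exp (\<phi> y)) * ennreal (f y) \<partial>count_space ?A)"
      by (simp add: transfer_sum_eq_W[OF f f0 x(1)] W_def fib_1 S_1)
    also have "\<dots> \<le> (\<integral>\<^sup>+y. (ennreal (exp (\<phi> (?b y))) * ennreal (f (?b y)) + ennreal w * ennreal (exp (\<phi> (?b y)))) + ennreal B * ennreal (?D y) \<partial>count_space ?A)"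
    proof (rule nn_integral_mono)
      fix y assume "y \<in> space (count_space ?A)"
      then have y: "y \<in> X0" "T y = x" by auto
      have c: "T1.br y x = y" using T1.br_center[OF y(1)] y(2) by simp
      have "f y \<le> f (?b y) + w" using d1(3)[OF x(1) y x(2)] x(3) by (intro d0(2)) (simp add: c)
      then have "exp (\<phi> (?b y)) * f y \<le> exp (\<phi> (?b y)) * (f (?b y) + w)" by simp
      moreover have "(exp (\<phi> y) - exp (\<phi> (?b y))) * f y \<le> ?D y * B"
        using B(2)[of y] f0[of y] by (intro mult_mono) (auto simp: c)
      ultimately have "exp (\<phi> y) * f y \<le> (exp (\<phi> (?b y)) * f (?b y) + w * exp (\<phi> (?b y))) + B * ?D y"
        by (simp add: algebra_simps)
      then show "ennreal (exp (\<phi> y)) * ennreal (f y) \<le>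
        (ennreal (exp (\<phi> (?b y))) * ennreal (f (?b y)) + ennreal w * ennreal (exp (\<phi> (?b y)))) + ennreal B * ennreal (?D y)"
        using f0 w B by (simp add: ennreal_mult[symmetric] ennreal_plus[symmetric] del: ennreal_plus)
    qed
    also have "\<dots> = (\<integral>\<^sup>+y. ennreal (exp (\<phi> (?b y))) * ennreal (f (?b y)) + ennreal w * ennreal (exp (\<phi> (?b y))) \<partial>count_space ?A) + ennreal B * ennreal (infsum ?D ?A)"
      by (simp add: nn_integral_add nn_integral_cmult nn_integral_count_space_eq_infsum[OF D(1)])
    also have "(\<integral>\<^sup>+y. ennreal (exp (\<phi> (?b y))) * ennreal (f (?b y)) + ennreal w * ennreal (exp (\<phi> (?b y))) \<partial>count_space ?A)
       = (\<integral>\<^sup>+y. ennreal (exp (\<phi> y)) * ennreal (f y) + ennreal w * ennreal (exp (\<phi> y)) \<partial>count_space {y \<in> X0. T y = x'})"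
      using x d1(2) by (intro nn_integral_bij_count_space T1.br_bij) auto
    also have "\<dots> = ennreal (transfer_sum X0 T \<phi> f x') + ennreal w * W 1 (\<lambda>_. 1) x'"
      by (simp add: transfer_sum_eq_W[OF f f0 x(2)] W_def fib_1 S_1 nn_integral_add nn_integral_cmult)
    also have "\<dots> \<le> ennreal (transfer_sum X0 T \<phi> f x') + ennreal w * ennreal K"
      by (intro add_left_mono mult_left_mono K x) simp
    also have "ennreal B * ennreal (infsum ?D ?A) \<le> ennreal B * ennreal \<epsilon>"
      using D(2) by (intro mult_left_mono ennreal_leI) auto
    also have "ennreal (transfer_sum X0 T \<phi> f x') + ennreal w * ennreal K + ennreal B * ennreal \<epsilon>
      = ennreal (transfer_sum X0 T \<phi> f x' + e)"
      using w K B \<epsilon> e transfer_sum_nonneg[of f x'] f0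
      by (simp add: ennreal_mult[symmetric] ennreal_plus[symmetric] del: ennreal_plus)
    finally have "ennreal (transfer_sum X0 T \<phi> f x) \<le> ennreal (transfer_sum X0 T \<phi> f x' + e)"
      by (simp add: add_left_mono add_right_mono)
    moreover have "0 \<le> transfer_sum X0 T \<phi> f x' + e" using transfer_sum_nonneg[of f x'] f0 e by simp
    ultimately show ?thesis by (simp only: ennreal_le_iff)
  qed
  then show ?thesis using d1(1) d2(1) by (intro exI[of _ "min d1 d2"]) auto
qed

lemma transfer_sum_extends:
  assumes f: "continuous_on UNIV f"
  shows "\<exists>g. continuous_on UNIV g \<and> (\<forall>x\<in>X. g x = transfer_sum X0 T \<phi> f x)"
proof -
  have pos: "\<exists>g. continuous_on UNIV g \<and> (\<forall>x\<in>X. g x = transfer_sum X0 T \<phi> f x)"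
    if f: "continuous_on UNIV f" and f0: "\<And>y. 0 \<le> f y" for f
  proof -
    have "uniformly_continuous_on X (transfer_sum X0 T \<phi> f)"
      unfolding uniformly_continuous_on_def
    proof (intro allI impI)
      fix e :: real assume "0 < e"
      then obtain d where d: "d > 0" "\<And>x x'. x \<in> X \<Longrightarrow> x' \<in> X \<Longrightarrow> dist x x' < d \<Longrightarrow>
          transfer_sum X0 T \<phi> f x \<le> transfer_sum X0 T \<phi> f x' + e / 2"
        using transfer_sum_modulus[OF f f0, of "e / 2"] by auto
      have "dist (transfer_sum X0 T \<phi> f x') (transfer_sum X0 T \<phi> f x) < e"
        if "x \<in> X" "x' \<in> X" "dist x' x < d" for x x'
        using d(2)[of x x'] d(2)[of x' x] that \<open>0 < e\<close> by (auto simp: dist_real_def dist_commute)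
      then show "\<exists>d>0. \<forall>x\<in>X. \<forall>x'\<in>X. dist x' x < d \<longrightarrow> dist (transfer_sum X0 T \<phi> f x') (transfer_sum X0 T \<phi> f x) < e"
        using d(1) by blast
    qed
    then obtain g where "uniformly_continuous_on (closure X) g" "\<And>x. x \<in> X \<Longrightarrow> transfer_sum X0 T \<phi> f x = g x"
      by (rule uniformly_continuous_on_extension_on_closure) blast
    then show ?thesis using uniformly_continuous_imp_continuous closure_X by metis
  qed
  \<comment> \<open>The general \<open>f\<close> is the difference of the nonnegative functions
    \<open>f + B\<close> and \<open>B\<close>.\<close>
  obtain B where B: "0 < B" "\<And>x. \<bar>f x\<bar> \<le> B" using bounded_cont[OF f] by blast
  have cB: "continuous_on UNIV (\<lambda>x. f x + B)" by (intro continuous_intros f)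
  have "0 \<le> f y + B" for y using B(2)[of y] by linarith
  then obtain g1 where g1: "continuous_on UNIV g1" "\<forall>x\<in>X. g1 x = transfer_sum X0 T \<phi> (\<lambda>x. f x + B) x"
    using pos[OF cB] by blast
  obtain g2 where g2: "continuous_on UNIV g2" "\<forall>x\<in>X. g2 x = transfer_sum X0 T \<phi> (\<lambda>_. B) x"
    using pos[of "\<lambda>_. B"] B(1) by auto
  have "g1 x - g2 x = transfer_sum X0 T \<phi> f x" if "x \<in> X" for x
    using g1(2) g2(2) that transfer_sum_add[OF f, of "\<lambda>_. B" x] by simp
  then show ?thesis
    by (intro exI[of _ "\<lambda>x. g1 x - g2 x"]) (auto intro!: continuous_intros g1 g2)
qed

lemma dense_le:
  fixes g g' :: "'a \<Rightarrow> real"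
  assumes "continuous_on UNIV g" "continuous_on UNIV g'" "\<And>x. x \<in> X \<Longrightarrow> g x \<le> g' x"
  shows "g x \<le> g' x"
proof -
  have "closed {x. g x \<le> g' x}" using assms by (intro closed_Collect_le)
  then have "closure X \<subseteq> {x. g x \<le> g' x}" using assms(3) by (intro closure_minimal) auto
  then show ?thesis using closure_X by auto
qed

lemma dense_eq:
  fixes g g' :: "'a \<Rightarrow> real"
  assumes "continuous_on UNIV g" "continuous_on UNIV g'" "\<And>x. x \<in> X \<Longrightarrow> g x = g' x"
  shows "g = g'"
  using dense_le[OF assms(1,2)] dense_le[OF assms(2,1)] assms(3) by (auto intro!: ext antisym)

lemma L_spec:
  assumes f: "continuous_on UNIV f"
  shows "continuous_on UNIV (L f) \<and> (\<forall>x\<in>X. L f x = transfer_sum X0 T \<phi> f x)"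
  unfolding transfer_op_def
proof (rule theI'[where P="\<lambda>g. continuous_on UNIV g \<and> (\<forall>x\<in>X. g x = transfer_sum X0 T \<phi> f x)"])
  obtain g where g: "continuous_on UNIV g \<and> (\<forall>x\<in>X. g x = transfer_sum X0 T \<phi> f x)"
    using transfer_sum_extends[OF f] by blast
  show "\<exists>!g. continuous_on UNIV g \<and> (\<forall>x\<in>X. g x = transfer_sum X0 T \<phi> f x)"
    by (rule ex1I[where a=g]) (use g in \<open>auto intro!: dense_eq\<close>)
qed

lemma L_cont: "continuous_on UNIV f \<Longrightarrow> continuous_on UNIV (L f)"
  using L_spec by blast

lemma L_eq: "continuous_on UNIV f \<Longrightarrow> x \<in> X \<Longrightarrow> L f x = transfer_sum X0 T \<phi> f x"
  using L_spec by blast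

lemma L_add:
  assumes "continuous_on UNIV f" "continuous_on UNIV g"
  shows "L (\<lambda>x. f x + g x) = (\<lambda>x. L f x + L g x)"
  by (intro dense_eq continuous_intros L_cont assms)
    (use assms in \<open>simp add: L_eq transfer_sum_add continuous_on_add\<close>)

lemma L_scale:
  assumes "continuous_on UNIV f"
  shows "L (\<lambda>x. c * f x) = (\<lambda>x. c * L f x)"
  by (intro dense_eq continuous_intros L_cont assms)
    (use assms in \<open>simp add: L_eq transfer_sum_scale continuous_on_mult_left\<close>)

lemma L_nonneg:
  assumes "continuous_on UNIV f" "\<And>x. 0 \<le> f x"
  shows "0 \<le> L f x"
  by (rule dense_le[where g="\<lambda>_. 0"]) (use assms in \<open>auto simp: L_cont L_eq transfer_sum_nonneg\<close>)

lemma Lit_cont: "continuous_on UNIV f \<Longrightarrow> continuous_on UNIV ((L ^^ n) f)"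
  by (induction n) (auto simp: L_cont)

lemma Lit_nonneg: "continuous_on UNIV f \<Longrightarrow> (\<And>x. 0 \<le> f x) \<Longrightarrow> 0 \<le> (L ^^ n) f x"
  by (induction n arbitrary: x) (auto intro!: L_nonneg Lit_cont)

lemma Lit_eq_W:
  assumes f: "continuous_on UNIV f" and f0: "\<And>y. 0 \<le> f y" and x: "x \<in> X"
  shows "ennreal ((L ^^ n) f x) = W n (\<lambda>y. ennreal (f y)) x"
  using x
proof (induction n arbitrary: x)
  case (Suc n)
  have "ennreal ((L ^^ Suc n) f x) = W 1 (\<lambda>y. ennreal ((L ^^ n) f y)) x"
    using Suc.prems Lit_cont[OF f, of n] Lit_nonneg[OF f f0, of n] by (simp add: L_eq transfer_sum_eq_W)
  also have "\<dots> = W 1 (W n (\<lambda>y. ennreal (f y))) x"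
    using Suc.IH dm_sub by (intro W_cong) auto
  finally show ?case using W_add[of 1 n "\<lambda>y. ennreal (f y)" x] by simp
qed (simp add: W_0)

lemma Lit_compare:
  fixes f :: "'a \<Rightarrow> real"
  assumes x: "x \<in> X" "x' \<in> X" "dist x x' < \<delta>N" and f: "continuous_on UNIV f" "\<And>y. 0 \<le> f y" and w: "0 \<le> w"
    and fw: "\<And>y y'. dist y y' \<le> dist x x' \<Longrightarrow> f y \<le> f y' + w"
  shows "(L ^^ (n * N)) f x \<le> exp (Cd x x') * ((L ^^ (n * N)) f x' + w * (L ^^ (n * N)) (\<lambda>_. 1) x')"
proof -
  have "ennreal ((L ^^ (n * N)) f x) \<le> ennreal (exp (Cd x x')) *
    (W (n * N) (\<lambda>y. ennreal (f y)) x' + ennreal w * W (n * N) (\<lambda>_. 1) x')"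
    unfolding Lit_eq_W[OF f x(1)]
  proof (rule W_compare[OF x])
    fix y y' :: 'a assume "dist y y' \<le> dist x x'"
    then have "ennreal (f y) \<le> ennreal (f y' + w)" using fw by (intro ennreal_leI) auto
    then show "ennreal (f y) \<le> ennreal (f y') + ennreal w" using f w by simp
  qed
  also have "\<dots> = ennreal (exp (Cd x x') * ((L ^^ (n * N)) f x' + w * (L ^^ (n * N)) (\<lambda>_. 1) x'))"
    using Lit_eq_W[OF f x(2), of "n * N"] Lit_eq_W[of "\<lambda>_. 1" x' "n * N"] x w
      Lit_nonneg[OF f, of "n * N"] Lit_nonneg[of "\<lambda>_. 1" "n * N" x']
    by (simp add: ennreal_mult)
  finally show ?thesis
    using w Lit_nonneg[OF f, of "n * N" x'] Lit_nonneg[of "\<lambda>_. 1" "n * N" x']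
    by (subst (asm) ennreal_le_iff) auto
qed

lemma L_reg:
  assumes e: "0 < \<epsilon>"
  shows "\<exists>\<eta>>0. \<forall>n f w r x x'. continuous_on UNIV f \<and> (\<forall>y. 0 \<le> f y) \<and> 0 \<le> w \<and> r \<le> \<eta> \<and>
        (\<forall>y y'. dist y y' < r \<longrightarrow> f y \<le> f y' + w) \<and> dist x x' < r \<longrightarrow>
        (L ^^ (n * N)) f x \<le> (1 + \<epsilon>) * ((L ^^ (n * N)) f x' + w * (L ^^ (n * N)) (\<lambda>_. 1) x')"
proof -
  have "0 < ln (1 + \<epsilon>)" using e by simp
  then obtain \<eta> where \<eta>: "0 < \<eta>" "\<eta> \<le> \<delta>N" "\<forall>x\<in>X. \<forall>x'\<in>X. dist x x' < \<eta> \<longrightarrow> Cd x x' < ln (1 + \<epsilon>)"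
    using Cd_small by metis
  have "(L ^^ (n * N)) f x \<le> (1 + \<epsilon>) * ((L ^^ (n * N)) f x' + w * (L ^^ (n * N)) (\<lambda>_. 1) x')"
    if f: "continuous_on UNIV f" "\<And>y. 0 \<le> f y" and w: "0 \<le> w" and r: "r \<le> \<eta>"
      and fw: "\<And>y y'. dist y y' < r \<Longrightarrow> f y \<le> f y' + w" and d: "dist x x' < r" for n f w r x x'
  proof -
    define F G where "F = (L ^^ (n * N)) f" and "G z = (1 + \<epsilon>) * ((L ^^ (n * N)) f z + w * (L ^^ (n * N)) (\<lambda>_. 1) z)" for z
    have cF: "continuous_on UNIV F" unfolding F_def by (rule Lit_cont[OF f(1)])
    have cG: "continuous_on UNIV G" unfolding G_def by (intro continuous_intros Lit_cont f)
    have on_X: "F z \<le> G z'" if z: "z \<in> X" "z' \<in> X" "dist z z' < r" for z z'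
    proof -
      have "F z \<le> exp (Cd z z') * ((L ^^ (n * N)) f z' + w * (L ^^ (n * N)) (\<lambda>_. 1) z')"
        unfolding F_def using z r \<eta>(2) fw by (intro Lit_compare f w) auto
      also have "\<dots> \<le> G z'" unfolding G_def
      proof (rule mult_right_mono)
        have "exp (Cd z z') \<le> exp (ln (1 + \<epsilon>))" using \<eta>(3) z r by (simp del: exp_ln add: less_imp_le)
        then show "exp (Cd z z') \<le> 1 + \<epsilon>" using e by simp
      qed (use w Lit_nonneg[OF f, of "n * N" z'] Lit_nonneg[of "\<lambda>_. 1" "n * N" z'] in auto)
      finally show ?thesis .
    qed
    \<comment> \<open>The two points may lie on the boundary, which the fibre sums do not reach. The
      estimate is carried over along sequences in \<open>X\<close>, whose distances are eventually
      below \<open>r\<close> because \<open>dist x x' < r\<close> is strict.\<close>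
    obtain p where p: "\<And>k. p k \<in> X" "p \<longlonglongrightarrow> x" using closure_X closure_sequential[of x X] by auto
    obtain p' where p': "\<And>k. p' k \<in> X" "p' \<longlonglongrightarrow> x'" using closure_X closure_sequential[of x' X] by auto
    have "(\<lambda>k. dist (p k) (p' k)) \<longlonglongrightarrow> dist x x'" by (intro tendsto_intros p p')
    then have "\<forall>\<^sub>F k in sequentially. dist (p k) (p' k) < r" using d by (rule order_tendstoD)
    then have ev: "\<forall>\<^sub>F k in sequentially. F (p k) \<le> G (p' k)"
      by eventually_elim (use on_X p p' in auto)
    have "(\<lambda>k. F (p k)) \<longlonglongrightarrow> F x" "(\<lambda>k. G (p' k)) \<longlonglongrightarrow> G x'"
      using continuous_on_tendsto_compose[OF cF p(2)] continuous_on_tendsto_compose[OF cG p'(2)] by auto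
    then have "F x \<le> G x'" using ev by (metis tendsto_le trivial_limit_sequentially)
    then show ?thesis by (simp add: F_def G_def)
  qed
  then show ?thesis using \<eta>(1) by (intro exI[of _ \<eta>]) blast
qed

lemma L_mix:
  assumes r: "0 < r"
  shows "\<exists>m\<ge>1. \<exists>c>0. \<forall>f a z. continuous_on UNIV f \<and> (\<forall>y. 0 \<le> f y) \<and> 0 \<le> a \<and>
        (\<forall>y. dist z y < r \<longrightarrow> a \<le> f y) \<longrightarrow> (\<forall>x. c * a \<le> (L ^^ (m * N)) f x)"
proof -
  have "0 < r / 2" using r by simp
  from reach[OF this] obtain m c where m: "1 \<le> m" and c: "0 < c" and
    y: "\<And>x z. x \<in> X \<Longrightarrow> z \<in> X \<Longrightarrow> \<exists>y\<in>fib (m * N) x. dist z y < r / 2 \<and> c \<le> exp (S (m * N) y)"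
    by blast
  have "c * a \<le> (L ^^ (m * N)) f x"
    if f: "continuous_on UNIV f" "\<And>y. 0 \<le> f y" and a: "0 \<le> a" "\<And>y. dist z y < r \<Longrightarrow> a \<le> f y" for f a z x
  proof (rule dense_le[where g="\<lambda>_. c * a"])
    show "continuous_on UNIV ((L ^^ (m * N)) f)" by (rule Lit_cont[OF f(1)])
    fix x assume x: "x \<in> X"
    \<comment> \<open>The centre \<open>z\<close> may be a boundary point, hence the passage to a
      nearby point of \<open>X\<close> and the halved radius.\<close>
    obtain z' where z': "z' \<in> X" "dist z' z < r / 2"
      using closure_X \<open>0 < r / 2\<close> closure_approachable[of z X] by (metis UNIV_I)
    obtain y where y: "y \<in> fib (m * N) x" "dist z' y < r / 2" "c \<le> exp (S (m * N) y)" using y[OF x z'(1)] by blast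
    have "dist z y < r" using dist_triangle[of z y z'] z' y by (simp add: dist_commute)
    then have "ennreal (c * a) \<le> ennreal (exp (S (m * N) y)) * ennreal (f y)"
      using a y(3) c f by (subst ennreal_mult[symmetric]) (auto intro!: ennreal_leI mult_mono)
    also have "\<dots> \<le> ennreal ((L ^^ (m * N)) f x)"
      unfolding Lit_eq_W[OF f x] by (rule W_ge_point[OF y(1)])
    finally show "c * a \<le> (L ^^ (m * N)) f x"
      using Lit_nonneg[OF f, of "m * N" x] by (simp add: ennreal_le_iff)
  qed simp
  then show ?thesis using m c by blast
qed

sublocale mix: mixing_operator L N
  by unfold_locales (fact compact_UNIV N_pos L_cont L_add L_scale L_nonneg L_reg L_mix)+

end

subsection \<open>Borel sections and the eigenmeasure\<close>

lemma integral_uniform_limit: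
  fixes f :: "nat \<Rightarrow> 'a::metric_space \<Rightarrow> real"
  assumes cpt: "compact (UNIV :: 'a set)" and M: "finite_measure M" "sets M = sets borel"
    and f: "\<And>n. continuous_on UNIV (f n)" and lim: "uniform_limit UNIV f g sequentially"
  shows "(\<lambda>n. \<integral>x. f n x \<partial>M) \<longlonglongrightarrow> (\<integral>x. g x \<partial>M)"
proof -
  interpret finite_measure M by fact
  have g: "continuous_on UNIV g"
    by (rule uniform_limit_theorem[OF _ lim]) (auto simp: f)
  have int: "integrable M (f n)" "integrable M g" for n
    using integrable_continuous_compact[OF cpt M] f g by auto
  show ?thesis
  proof (rule metric_LIMSEQ_I)
    fix e :: real assume e: "0 < e"
    obtain V where V: "V = measure M UNIV" "0 \<le> V" using measure_nonneg by blast
    \<comment> \<open>Adding 1 covers the zero measure.\<close>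
    define e' where "e' = e / (2 * (V + 1))"
    have e': "0 < e'" "e' * V < e" using e V(2) by (auto simp: e'_def divide_less_eq algebra_simps intro!: add_nonneg_pos)
    obtain n0 where n0: "\<And>n x. n0 \<le> n \<Longrightarrow> dist (f n x) (g x) < e'"
      using uniform_limitD[OF lim e'(1)] by (auto simp: eventually_sequentially)
    have sp: "space M = UNIV" using sets_eq_imp_space_eq[OF M(2)] by simp
    have "dist (\<integral>x. f n x \<partial>M) (\<integral>x. g x \<partial>M) < e" if "n0 \<le> n" for n
    proof -
      have "\<bar>(\<integral>x. f n x \<partial>M) - (\<integral>x. g x \<partial>M)\<bar> = \<bar>\<integral>x. f n x - g x \<partial>M\<bar>" using int by simp
      also have "\<dots> \<le> (\<integral>x. \<bar>f n x - g x\<bar> \<partial>M)" by (rule integral_abs_bound)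
      also have "\<dots> \<le> (\<integral>x. e' \<partial>M)"
        using int n0[OF that] by (intro integral_mono) (auto simp: dist_real_def less_imp_le)
      also have "\<dots> < e" using e' V(1) by (simp add: sp mult.commute)
      finally show ?thesis by (simp add: dist_real_def)
    qed
    then show "\<exists>n0. \<forall>n\<ge>n0. dist (\<integral>x. f n x \<partial>M) (\<integral>x. g x \<partial>M) < e" by blast
  qed
qed

context expanding_system
begin

text \<open>Finitely many balls of radius \<open>\<delta>\<close> cover \<open>X\<close>, and over
  each there are countably many open sheets. So \<open>X0\<close> is a countable union of sets on
  which \<open>T\<close> is invertible. Made disjoint, they turn the sum over a fibre into a
  countable sum of compositions with Borel sections.\<close>

lemma ex_sections:
  "\<exists>(E :: nat \<Rightarrow> 'a set) s. (\<forall>i. E i \<in> sets borel \<and> E i \<subseteq> X0 \<and> inj_on T (E i) \<and> T ` E i \<in> sets borel \<and>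
      s i \<in> borel_measurable (restrict_space borel (T ` E i)) \<and> (\<forall>y\<in>E i. s i (T y) = y)) \<and>
    disjoint_family E \<and> (\<Union>i. E i) = X0"
proof -
  obtain Q where Q: "finite Q" "Q \<subseteq> X" "\<And>x. \<exists>e\<in>Q. dist e x < \<delta>" using finite_net[OF T1.\<delta>_pos] by metis
  \<comment> \<open>The empty set is added so that the family to be enumerated is nonempty.\<close>
  define \<S> where "\<S> = insert {} (\<Union>e\<in>Q. T1.sh e)"
  have "countable \<S>" unfolding \<S>_def
    using Q(2) T1.is_sheets countable_finite[OF Q(1)]
    by (intro countable_insert countable_UN) (auto simp: is_sheets_def)
  define A where "A = from_nat_into \<S>"
  have rA: "range A = \<S>" unfolding A_def using \<open>countable \<S>\<close> by (intro range_from_nat_into) (auto simp: \<S>_def)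
  have "\<exists>g B. open (A i) \<and> A i \<subseteq> X0 \<and> open B \<and> homeomorphism (A i) B T g" for i
  proof -
    have "A i \<in> \<S>" using rA by auto
    then consider "A i = {}" | e where "e \<in> Q" "A i \<in> T1.sh e" by (auto simp: \<S>_def)
    then show ?thesis
    proof cases
      case 1 then show ?thesis by (auto simp: homeomorphism_def intro!: exI[of _ "{}"])
    next
      case 2
      then obtain g where "open (A i)" "A i \<subseteq> X0" "homeomorphism (A i) (T1.B e) T g"
        using T1.sheetE[of e "A i"] Q(2) by blast
      moreover have "open (T1.B e)" using open_X by (auto simp: ball_in_def)
      ultimately show ?thesis by blast
    qed
  qed
  then obtain s B where sB: "\<And>i. open (A i)" "\<And>i. A i \<subseteq> X0" "\<And>i. open (B i)" "\<And>i. homeomorphism (A i) (B i) T (s i)"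
    by metis
  have sT: "s i (T y) = y" if "y \<in> A i" for i y using sB(4)[of i] that by (auto simp: homeomorphism_def)
  have UA: "(\<Union>i. A i) = X0"
  proof (intro equalityI subsetI)
    fix y assume y: "y \<in> X0"
    obtain e where e: "e \<in> Q" "dist e (T y) < \<delta>" using Q(3) by blast
    have "T y \<in> T1.B e" using e y T_into by (auto simp: ball_in_def)
    then obtain C where "C \<in> T1.sh e" "y \<in> C" using T1.sheet_exists[OF _ y] e Q(2) by blast
    then show "y \<in> (\<Union>i. A i)" using rA e(1) by (auto simp: \<S>_def)
  qed (use sB(2) in auto)
  define E where "E = disjointed A"
  have EA: "E i \<subseteq> A i" for i unfolding E_def by (rule disjointed_subset)
  have bE: "E i \<in> sets borel" for i
  proof -
    have "range A \<subseteq> sets borel" using sB(1) by auto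
    then have "range (disjointed A) \<subseteq> sets borel" by (rule sets.range_disjointed_sets)
    then show ?thesis by (auto simp: E_def)
  qed
  have inj: "inj_on T (A i)" for i using sT by (metis inj_on_inverseI)
  have ms: "s i \<in> borel_measurable (restrict_space borel (B i))" for i
    using sB(4)[of i] by (intro borel_measurable_continuous_on_restrict) (auto simp: homeomorphism_def)
  have im: "T ` E i \<in> sets borel" and sub: "T ` E i \<subseteq> B i" for i
  proof -
    have TA: "T ` A i = B i" "s i ` B i = A i" "\<And>y. y \<in> B i \<Longrightarrow> T (s i y) = y"
      using sB(4)[of i] by (auto simp: homeomorphism_def)
    show "T ` E i \<subseteq> B i" using TA(1) EA by blast
    have "T ` E i = s i -` E i \<inter> B i"
    proof (intro equalityI subsetI)
      fix x assume "x \<in> T ` E i"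
      then obtain y where y: "y \<in> E i" "x = T y" by blast
      then have "y \<in> A i" using EA by blast
      then show "x \<in> s i -` E i \<inter> B i" using y sT[of y i] TA(1) by auto
    next
      fix x assume "x \<in> s i -` E i \<inter> B i"
      then show "x \<in> T ` E i" using TA(3) by (metis Int_iff image_eqI vimageE)
    qed
    moreover have "s i -` E i \<inter> B i \<in> sets (restrict_space borel (B i))"
      using measurable_sets[OF ms bE, of i i] by (simp add: space_restrict_space)
    ultimately show "T ` E i \<in> sets borel"
      using sB(3)[of i] by (simp add: sets_restrict_space_iff)
  qed
  have "E i \<in> sets borel \<and> E i \<subseteq> X0 \<and> inj_on T (E i) \<and> T ` E i \<in> sets borel \<and>
      s i \<in> borel_measurable (restrict_space borel (T ` E i)) \<and> (\<forall>y\<in>E i. s i (T y) = y)" for i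
    using bE[of i] im[of i] inj_on_subset[OF inj EA, of i] EA[of i] sB(2)[of i] sT[of _ i]
      measurable_restrict_mono[OF ms sub, of i] by blast
  moreover have "disjoint_family E" unfolding E_def by (rule disjoint_family_disjointed)
  moreover have "(\<Union>i. E i) = X0" unfolding E_def UN_disjointed_eq UA ..
  ultimately show ?thesis by blast
qed

definition sec :: "(nat \<Rightarrow> 'a set) \<times> (nat \<Rightarrow> 'a \<Rightarrow> 'a)" where
  "sec = (SOME (E, s). (\<forall>i. E i \<in> sets borel \<and> E i \<subseteq> X0 \<and> inj_on T (E i) \<and> T ` E i \<in> sets borel \<and>
      s i \<in> borel_measurable (restrict_space borel (T ` E i)) \<and> (\<forall>y\<in>E i. s i (T y) = y)) \<and>
    disjoint_family E \<and> (\<Union>i. E i) = X0)"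

definition piece :: "nat \<Rightarrow> 'a set" where "piece = fst sec"
definition sct :: "nat \<Rightarrow> 'a \<Rightarrow> 'a" where "sct = snd sec"

lemma sec_props:
  "(\<forall>i. piece i \<in> sets borel \<and> piece i \<subseteq> X0 \<and> inj_on T (piece i) \<and> T ` piece i \<in> sets borel \<and>
      sct i \<in> borel_measurable (restrict_space borel (T ` piece i)) \<and> (\<forall>y\<in>piece i. sct i (T y) = y)) \<and>
    disjoint_family piece \<and> (\<Union>i. piece i) = X0"
proof -
  have "case sec of (E, s) \<Rightarrow> (\<forall>i. E i \<in> sets borel \<and> E i \<subseteq> X0 \<and> inj_on T (E i) \<and> T ` E i \<in> sets borel \<and>
      s i \<in> borel_measurable (restrict_space borel (T ` E i)) \<and> (\<forall>y\<in>E i. s i (T y) = y)) \<and>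
    disjoint_family E \<and> (\<Union>i. E i) = X0"
    unfolding sec_def by (rule someI_ex) (use ex_sections in auto)
  then show ?thesis by (simp add: piece_def sct_def case_prod_beta)
qed

lemma piece_borel [measurable]: "piece i \<in> sets borel"
  and piece_sub: "piece i \<subseteq> X0"
  and inj_piece: "inj_on T (piece i)"
  and image_borel [measurable]: "T ` piece i \<in> sets borel"
  and sct_meas: "sct i \<in> borel_measurable (restrict_space borel (T ` piece i))"
  and sct_T: "y \<in> piece i \<Longrightarrow> sct i (T y) = y"
  and disj_piece: "disjoint_family piece"
  and UN_piece: "(\<Union>i. piece i) = X0"
  using sec_props by auto

definition NL :: "('a \<Rightarrow> ennreal) \<Rightarrow> 'a \<Rightarrow> ennreal" where
  "NL F x = (\<integral>\<^sup>+y. F y \<partial>count_space (fib (Suc 0) x))"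

text \<open>Indexing the points of a fibre by the piece that contains them leaves at most one point
  per index. This formula is what makes fibre sums measurable.\<close>

lemma NL_sections: "NL F x = (\<Sum>i. F (sct i x) * indicator (T ` piece i) x)"
proof -
  define idx where "idx y = (THE i. y \<in> piece i)" for y
  have idx: "idx y = i" if "y \<in> piece i" for y i
    unfolding idx_def
  proof (rule the_equality)
    show "y \<in> piece i" by (rule that)
    fix j assume "y \<in> piece j"
    then show "j = i" using that disj_piece unfolding disjoint_family_on_def by blast
  qed
  have fibre: "{y \<in> fib (Suc 0) x. idx y = i} = (if x \<in> T ` piece i then {sct i x} else {})" for i
  proof -
    have "{y \<in> fib (Suc 0) x. idx y = i} = {y \<in> piece i. T y = x}"
    proof (intro equalityI subsetI)
      fix y assume "y \<in> {y \<in> fib (Suc 0) x. idx y = i}"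
      then have y: "y \<in> X0" "T y = x" "idx y = i" by (auto simp: fib_1)
      then obtain j where "y \<in> piece j" using UN_piece by auto
      then show "y \<in> {y \<in> piece i. T y = x}" using idx y by auto
    next
      fix y assume "y \<in> {y \<in> piece i. T y = x}"
      then show "y \<in> {y \<in> fib (Suc 0) x. idx y = i}" using piece_sub idx by (auto simp: fib_1)
    qed
    also have "\<dots> = (if x \<in> T ` piece i then {sct i x} else {})"
      using sct_T[of _ i] by (auto; metis)
    finally show ?thesis .
  qed
  have "NL F x = (\<integral>\<^sup>+i. (\<integral>\<^sup>+y. F y \<partial>count_space {y \<in> fib (Suc 0) x. idx y = i}) \<partial>count_space UNIV)"
    unfolding NL_def by (rule nn_integral_count_space_partition) simp
  also have "\<dots> = (\<integral>\<^sup>+i. F (sct i x) * indicator (T ` piece i) x \<partial>count_space UNIV)"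
    unfolding fibre by (intro nn_integral_cong) (auto simp: nn_integral_count_space_finite)
  finally show ?thesis by (simp add: nn_integral_count_space_nat)
qed

lemma sct_comp_measurable:
  assumes "F \<in> borel_measurable borel"
  shows "(\<lambda>x. F (sct i x) * indicator (T ` piece i) x :: ennreal) \<in> borel_measurable borel"
proof -
  have "(\<lambda>x. F (sct i x)) \<in> borel_measurable (restrict_space borel (T ` piece i))"
    using sct_meas assms by (rule measurable_compose)
  then show ?thesis by (subst (asm) borel_measurable_restrict_space_iff_ennreal) auto
qed

lemma NL_measurable [measurable]:
  assumes [measurable]: "F \<in> borel_measurable borel"
  shows "NL F \<in> borel_measurable borel"
proof -
  note [measurable] = sct_comp_measurable[OF assms]
  show ?thesis unfolding NL_sections[abs_def] by measurable
qed

lemma NL_cong: "(\<And>y. y \<in> X0 \<Longrightarrow> T y = x \<Longrightarrow> F y = G y) \<Longrightarrow> NL F x = NL G x"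
  unfolding NL_def by (intro nn_integral_cong) (auto simp: fib_1)

lemma NL_mono: "(\<And>y. y \<in> X0 \<Longrightarrow> T y = x \<Longrightarrow> F y \<le> G y) \<Longrightarrow> NL F x \<le> NL G x"
  unfolding NL_def by (intro nn_integral_mono) (auto simp: fib_1)

lemma NL_cmult: "NL (\<lambda>y. c * F y) x = c * NL F x"
  unfolding NL_def by (simp add: nn_integral_cmult)

lemma NL_pull_out: "NL (\<lambda>y. G (T y) * F y) x = G x * NL F x"
  unfolding NL_cmult[symmetric] by (rule NL_cong) auto

lemma NL_indicator:
  assumes "A \<subseteq> X0" "inj_on T A"
  shows "NL (indicator A) x = indicator (T ` A) x"
proof -
  have "NL (indicator A) x = (\<integral>\<^sup>+y. indicator A y \<partial>count_space {y \<in> A. T y = x})"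
    unfolding NL_def using assms(1) by (intro nn_integral_count_space_eq) (auto simp: fib_1)
  also have "\<dots> = indicator (T ` A) x"
  proof (cases "x \<in> T ` A")
    case True
    then obtain y where y: "y \<in> A" "T y = x" by auto
    then have "{y \<in> A. T y = x} = {y}" using assms(2) by (auto dest: inj_onD)
    then show ?thesis using y True by (simp add: nn_integral_count_space_finite)
  next
    case False
    then have e: "{y \<in> A. T y = x} = {}" by auto
    show ?thesis unfolding e using False by (simp add: nn_integral_empty)
  qed
  finally show ?thesis .
qed

lemma image_measurable:
  assumes "A \<in> sets borel" "A \<subseteq> X0" "inj_on T A"
  shows "T ` A \<in> sets borel"
proof -
  have "NL (indicator A) = indicator (T ` A)" by (intro ext NL_indicator assms)
  then have "(indicator (T ` A) :: 'a \<Rightarrow> ennreal) \<in> borel_measurable borel"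
    using NL_measurable[of "indicator A"] assms(1) by simp
  then show ?thesis by (simp add: borel_measurable_indicator_iff)
qed

lemma vimage_T_measurable:
  assumes F: "F \<in> borel_measurable borel"
  shows "(\<lambda>y. F (T y) * indicator X0 y :: ennreal) \<in> borel_measurable borel"
proof -
  have "T \<in> borel_measurable (restrict_space borel X0)"
    by (rule borel_measurable_continuous_on_restrict[OF contT])
  from measurable_compose[OF this F] show ?thesis
    using open_X0 by (subst (asm) borel_measurable_restrict_space_iff_ennreal) auto
qed

definition wt :: "'a \<Rightarrow> ennreal" where
  "wt y = ennreal (exp (\<phi> y)) * indicator X0 y"

lemma wt_measurable [measurable]: "wt \<in> borel_measurable borel"
proof -
  have "continuous_on X0 \<phi>" using adm by (simp add: admissible_def)
  then have "\<phi> \<in> borel_measurable (restrict_space borel X0)"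
    by (rule borel_measurable_continuous_on_restrict)
  then have "(\<lambda>y. ennreal (exp (\<phi> y))) \<in> borel_measurable (restrict_space borel X0)" by measurable
  then show ?thesis unfolding wt_def[abs_def]
    using open_X0 by (subst (asm) borel_measurable_restrict_space_iff_ennreal) auto
qed

lemma W1_eq_NL: "W 1 F x = NL (\<lambda>y. wt y * F y) x"
  unfolding W_def NL_def One_nat_def S_1
  by (intro nn_integral_cong) (auto simp: fib_1 wt_def)

section \<open>The dual operator on measures and the eigenmeasure\<close>

text \<open>The dual of the fibre sum with weight \<open>w\<close>, acting on measures; with the
  weight \<open>wt\<close> it is the dual transfer operator, tested against Borel sets instead of
  continuous functions.\<close>

definition pull :: "('a \<Rightarrow> ennreal) \<Rightarrow> 'a measure \<Rightarrow> 'a measure" where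
  "pull w \<nu> = measure_of UNIV (sets borel) (\<lambda>A. \<integral>\<^sup>+x. NL (\<lambda>y. w y * indicator A y) x \<partial>\<nu>)"

lemma sets_pull [simp, measurable_cong]: "sets (pull w \<nu>) = sets borel"
  unfolding pull_def by (simp add: sets.sigma_sets_eq[of borel, simplified])

lemma emeasure_pull:
  assumes [measurable]: "w \<in> borel_measurable borel" and \<nu>[measurable_cong]: "sets \<nu> = sets borel"
    and A: "A \<in> sets borel"
  shows "emeasure (pull w \<nu>) A = (\<integral>\<^sup>+x. NL (\<lambda>y. w y * indicator A y) x \<partial>\<nu>)"
proof (rule emeasure_measure_of[OF pull_def])
  show "countably_additive (sets (pull w \<nu>)) (\<lambda>A. \<integral>\<^sup>+x. NL (\<lambda>y. w y * indicator A y) x \<partial>\<nu>)"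
  proof (rule countably_additiveI)
    fix A :: "nat \<Rightarrow> 'a set" assume A: "range A \<subseteq> sets (pull w \<nu>)" and d: "disjoint_family A"
    have [measurable]: "A i \<in> sets borel" for i using A by auto
    have "(\<Sum>i. \<integral>\<^sup>+x. NL (\<lambda>y. w y * indicator (A i) y) x \<partial>\<nu>)
        = (\<integral>\<^sup>+x. (\<Sum>i. NL (\<lambda>y. w y * indicator (A i) y) x) \<partial>\<nu>)"
      by (rule nn_integral_suminf[symmetric]) measurable
    also have "\<dots> = (\<integral>\<^sup>+x. NL (\<lambda>y. w y * indicator (\<Union>i. A i) y) x \<partial>\<nu>)"
      unfolding NL_def
      by (intro nn_integral_cong) (simp add: nn_integral_suminf[symmetric] ennreal_suminf_cmult suminf_indicator[OF d])
    finally show "(\<Sum>i. \<integral>\<^sup>+x. NL (\<lambda>y. w y * indicator (A i) y) x \<partial>\<nu>) = (\<integral>\<^sup>+x. NL (\<lambda>y. w y * indicator (\<Union>i. A i) y) x \<partial>\<nu>)" .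
  qed
qed (use A in \<open>auto simp: positive_def NL_def\<close>)

lemma nn_integral_pull:
  assumes w[measurable]: "w \<in> borel_measurable borel" and \<nu>[measurable_cong]: "sets \<nu> = sets borel"
    and F: "F \<in> borel_measurable borel"
  shows "(\<integral>\<^sup>+y. F y \<partial>pull w \<nu>) = (\<integral>\<^sup>+x. NL (\<lambda>y. w y * F y) x \<partial>\<nu>)"
  using F
proof (induction rule: borel_measurable_induct)
  case (cong f g)
  then have "f = g" by auto
  then show ?case using cong by simp
next
  case (set A)
  then show ?case using emeasure_pull[OF w \<nu>, of A] by simp
next
  case (mult u c)
  note [measurable] = mult(2)
  have "(\<integral>\<^sup>+y. c * u y \<partial>pull w \<nu>) = c * (\<integral>\<^sup>+y. u y \<partial>pull w \<nu>)"
    by (rule nn_integral_cmult) measurable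
  also have "\<dots> = (\<integral>\<^sup>+x. c * NL (\<lambda>y. w y * u y) x \<partial>\<nu>)"
    unfolding mult by (rule nn_integral_cmult[symmetric]) measurable
  finally show ?case by (simp add: NL_cmult[symmetric] mult_ac)
next
  case (add u v)
  have [measurable]: "u \<in> borel_measurable borel" "v \<in> borel_measurable borel" by (fact add.hyps)+
  have "(\<integral>\<^sup>+y. v y + u y \<partial>pull w \<nu>) = (\<integral>\<^sup>+y. v y \<partial>pull w \<nu>) + (\<integral>\<^sup>+y. u y \<partial>pull w \<nu>)"
    by (rule nn_integral_add) measurable
  also have "\<dots> = (\<integral>\<^sup>+x. NL (\<lambda>y. w y * v y) x + NL (\<lambda>y. w y * u y) x \<partial>\<nu>)"
    unfolding add.IH by (rule nn_integral_add[symmetric]) measurable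
  finally show ?case by (simp add: NL_def distrib_left nn_integral_add)
next
  case (seq U)
  have [measurable]: "U i \<in> borel_measurable borel" for i by (fact seq.hyps)
  have inc: "incseq U" by (fact seq.hyps)
  have "(\<integral>\<^sup>+y. (SUP i. U i) y \<partial>pull w \<nu>) = (SUP i. \<integral>\<^sup>+y. U i y \<partial>pull w \<nu>)"
    unfolding SUP_apply by (rule nn_integral_monotone_convergence_SUP[OF inc]) measurable
  also have "\<dots> = (SUP i. \<integral>\<^sup>+x. NL (\<lambda>y. w y * U i y) x \<partial>\<nu>)" unfolding seq.IH ..
  also have "\<dots> = (\<integral>\<^sup>+x. (SUP i. NL (\<lambda>y. w y * U i y) x) \<partial>\<nu>)"
  proof (rule nn_integral_monotone_convergence_SUP[symmetric])
    show "incseq (\<lambda>i. NL (\<lambda>y. w y * U i y))"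
      using inc by (auto simp: incseq_def le_fun_def intro!: NL_mono mult_left_mono)
  qed measurable
  also have "\<dots> = (\<integral>\<^sup>+x. NL (\<lambda>y. w y * (SUP i. U i) y) x \<partial>\<nu>)"
  proof (rule nn_integral_cong)
    fix x
    have "NL (\<lambda>y. w y * (SUP i. U i) y) x = NL (\<lambda>y. SUP i. w y * U i y) x"
      by (simp add: SUP_mult_left_ennreal image_comp)
    also have "\<dots> = (SUP i. NL (\<lambda>y. w y * U i y) x)"
      unfolding NL_def using inc
      by (intro nn_integral_monotone_convergence_SUP) (auto simp: incseq_def le_fun_def intro!: mult_left_mono)
    finally show "(SUP i. NL (\<lambda>y. w y * U i y) x) = NL (\<lambda>y. w y * (SUP i. U i) y) x" by simp
  qed
  finally show ?case .
qed

abbreviation "mu \<equiv> mix.J.riesz_measure"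
abbreviation "lam \<equiv> mix.lam"
abbreviation "h \<equiv> mix.h"

lemma J_eq: "continuous_on UNIV f \<Longrightarrow> mix.J f = (\<integral>x. f x \<partial>mu)"
  by (rule mix.J.riesz)

text \<open>Mixing bounds some iterate of \<open>f\<close> below by a positive constant, and
  \<open>J\<close> of the iterate is a positive multiple of \<open>J f\<close>. The full support of
  the measures comes from here.\<close>

lemma J_pos:
  assumes f: "continuous_on UNIV f" "\<And>y. 0 \<le> f y" and z: "0 < f z"
  shows "0 < mix.J f"
proof -
  obtain d where d: "0 < d" "\<And>y y'. dist y y' < d \<Longrightarrow> f y \<le> f y' + f z / 2"
    using unif_cont[OF f(1), of "f z / 2"] z by auto
  have near: "f z / 2 \<le> f y" if "dist z y < d" for y using d(2)[OF that] by simp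
  obtain m c where c: "0 < c" and mx: "\<forall>f a z. continuous_on UNIV f \<and> (\<forall>y. 0 \<le> f y) \<and> 0 \<le> a \<and>
        (\<forall>y. dist z y < d \<longrightarrow> a \<le> f y) \<longrightarrow> (\<forall>x. c * a \<le> (L ^^ (m * N)) f x)"
    using L_mix[OF d(1)] by blast
  have "c * (f z / 2) \<le> (L ^^ (m * N)) f x" for x
    using mx[rule_format, of f "f z / 2" z x] f near z by auto
  then have "c * (f z / 2) \<le> mix.J ((L ^^ (m * N)) f)"
    using mix.J.mono[of "\<lambda>_. c * (f z / 2)", OF _ Lit_cont[OF f(1)]] by (simp add: mix.J.const)
  moreover have "0 < c * (f z / 2)" using c z by simp
  ultimately have "0 < lam ^ (m * N) * mix.J f" using mix.J_it[OF f(1), of "m * N"] by linarith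
  then show ?thesis using mix.lam_pos by (simp add: zero_less_mult_iff)
qed

definition m :: "'a measure" where "m = density mu (\<lambda>x. ennreal (h x))"

lemma sets_m [simp, measurable_cong]: "sets m = sets borel" by (simp add: m_def)

lemma space_m [simp]: "space m = UNIV" by (simp add: m_def)

lemma cont_borel: "continuous_on UNIV f \<Longrightarrow> (f :: 'a \<Rightarrow> real) \<in> borel_measurable borel"
  by (rule borel_measurable_continuous_onI)

lemma h_meas [measurable]: "h \<in> borel_measurable borel"
  by (rule cont_borel[OF mix.h_cont])

lemma prob_mu: "prob_space mu" by (rule mix.J.prob_space_riesz)

lemma integral_m:
  assumes [measurable]: "f \<in> borel_measurable borel"
  shows "(\<integral>x. f x \<partial>m) = (\<integral>x. h x * f x \<partial>mu)"
  unfolding m_def by (subst integral_density) (auto simp: less_imp_le[OF mix.h_pos])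

lemma integral_m_J: "continuous_on UNIV f \<Longrightarrow> (\<integral>x. f x \<partial>m) = mix.J (\<lambda>x. h x * f x)"
  by (subst integral_m) (auto intro!: cont_borel J_eq[symmetric] continuous_intros mix.h_cont)

lemma integral_mu_h: "(\<integral>x. h x \<partial>mu) = 1"
  using J_eq[OF mix.h_cont] mix.J_h by simp

lemma nn_integral_mu_h: "(\<integral>\<^sup>+x. ennreal (h x) \<partial>mu) = 1"
  using nn_integral_eq_integral[OF mix.J.integrable_riesz[OF mix.h_cont]] mix.h_pos
  by (simp add: integral_mu_h less_imp_le)

lemma prob_m: "prob_space m"
  by (rule prob_spaceI) (simp add: m_def emeasure_density nn_integral_mu_h)

lemma finite_m: "finite_measure m"
  using prob_m by (simp add: prob_space_def)

lemma integrable_m: "continuous_on UNIV f \<Longrightarrow> integrable m (f :: 'a \<Rightarrow> real)"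
  by (rule integrable_continuous_compact[OF compact_UNIV finite_m sets_m])

text \<open>The Doob transform of \<open>L\<close> by \<open>h\<close>: a Markov operator that
  preserves integrals against \<open>m\<close>. It is the transfer operator of the normalised
  potential, see \<open>transfer_op_psi\<close>.\<close>

definition P :: "('a \<Rightarrow> real) \<Rightarrow> 'a \<Rightarrow> real" where
  "P f x = L (\<lambda>y. h y * f y) x / (lam * h x)"

lemma P_cont: "continuous_on UNIV f \<Longrightarrow> continuous_on UNIV (P f)"
proof -
  assume f: "continuous_on UNIV f"
  have "lam * h x \<noteq> 0" for x using mix.h_pos[of x] mix.lam_pos by simp
  then show ?thesis unfolding P_def by (intro continuous_intros L_cont mix.h_cont f) auto
qed

lemma P_one: "P (\<lambda>_. 1) x = 1"
  using mix.h_pos[of x] mix.lam_pos by (simp add: P_def mix.L_h)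

lemma P_add:
  assumes "continuous_on UNIV f" "continuous_on UNIV g"
  shows "P (\<lambda>x. f x + g x) x = P f x + P g x"
  unfolding P_def distrib_left using assms
  by (subst L_add) (auto intro!: continuous_intros mix.h_cont simp: add_divide_distrib)

lemma P_nonneg: "continuous_on UNIV f \<Longrightarrow> (\<And>x. 0 \<le> f x) \<Longrightarrow> 0 \<le> P f x"
  unfolding P_def using mix.h_pos mix.lam_pos
  by (intro divide_nonneg_nonneg mult_nonneg_nonneg L_nonneg continuous_intros mix.h_cont) (auto intro: less_imp_le)

lemma P_mono:
  assumes "continuous_on UNIV f" "continuous_on UNIV g" "\<And>x. f x \<le> g x"
  shows "P f x \<le> P g x"
proof -
  have "P g x = P f x + P (\<lambda>x. g x - f x) x"
    using P_add[of f "\<lambda>x. g x - f x" x] assms by (simp add: continuous_intros)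
  then show ?thesis using P_nonneg[of "\<lambda>x. g x - f x" x] assms by (auto intro: continuous_intros)
qed

lemma integral_P:
  assumes f: "continuous_on UNIV f"
  shows "(\<integral>x. P f x \<partial>m) = (\<integral>x. f x \<partial>m)"
proof -
  have c: "continuous_on UNIV (\<lambda>x. h x * f x)" by (intro continuous_intros mix.h_cont f)
  have "(\<lambda>x. h x * P f x) = (\<lambda>x. inverse lam * L (\<lambda>y. h y * f y) x)"
    using mix.h_pos mix.lam_pos by (auto simp: P_def field_simps less_imp_neq[symmetric])
  then show ?thesis
    using mix.lam_pos c by (simp add: integral_m_J P_cont f mix.J.scale[OF L_cont] mix.J_L)
qed

lemma P_it_eq: "continuous_on UNIV f \<Longrightarrow> (P ^^ n) f x = (L ^^ n) (\<lambda>y. h y * f y) x / (lam ^ n * h x)"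
proof (induction n arbitrary: x)
  case 0 then show ?case using mix.h_pos[of x] by simp
next
  case (Suc n)
  have c: "continuous_on UNIV (\<lambda>x. h x * f x)" by (intro continuous_intros mix.h_cont Suc.prems)
  have "h y * (P ^^ n) f y = inverse (lam ^ n) * (L ^^ n) (\<lambda>y. h y * f y) y" for y
    using mix.h_pos[of y] mix.lam_pos by (simp add: Suc field_simps)
  then have "L (\<lambda>y. h y * (P ^^ n) f y) = (\<lambda>x. inverse (lam ^ n) * L ((L ^^ n) (\<lambda>y. h y * f y)) x)"
    by (simp add: L_scale Lit_cont c)
  then show ?case using mix.lam_pos by (simp add: P_def[of "(P ^^ n) f"] field_simps)
qed

lemma P_it_cont: "continuous_on UNIV f \<Longrightarrow> continuous_on UNIV ((P ^^ n) f)"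
  by (induction n) (auto simp: P_cont)

lemma P_it_limit:
  assumes f: "continuous_on UNIV f"
  shows "uniform_limit UNIV (\<lambda>n. (P ^^ n) f) (\<lambda>_. \<integral>x. f x \<partial>m) sequentially"
proof (rule uniform_limitI)
  fix e :: real assume e: "0 < e"
  have c: "continuous_on UNIV (\<lambda>x. h x * f x)" by (intro continuous_intros mix.h_cont f)
  obtain Q where Q: "1 \<le> Q" "\<And>x. 1 \<le> Q * h x" using mix.h_bounds by blast
  have "0 < e / Q" using e Q by simp
  from uniform_limitD[OF mix.it_limit[OF c] this]
  have "\<forall>\<^sub>F n in sequentially. \<forall>x. dist ((L ^^ n) (\<lambda>y. h y * f y) x / lam ^ n) (h x * mix.J (\<lambda>x. h x * f x)) < e / Q" by simp
  then show "\<forall>\<^sub>F n in sequentially. \<forall>x\<in>UNIV. dist ((P ^^ n) f x) (\<integral>x. f x \<partial>m) < e"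
  proof eventually_elim
    case (elim n)
    have "dist ((P ^^ n) f x) (\<integral>x. f x \<partial>m) < e" for x
    proof -
      have hx: "0 < h x" by (rule mix.h_pos)
      have "dist ((L ^^ n) (\<lambda>y. h y * f y) x / lam ^ n) (h x * mix.J (\<lambda>x. h x * f x))
        = h x * \<bar>(P ^^ n) f x - (\<integral>x. f x \<partial>m)\<bar>"
      proof -
        have "(L ^^ n) (\<lambda>y. h y * f y) x / lam ^ n = h x * (P ^^ n) f x"
          using hx mix.lam_pos by (simp add: P_it_eq[OF f])
        then show ?thesis using hx by (simp add: dist_real_def integral_m_J[OF f] right_diff_distrib[symmetric] abs_mult)
      qed
      then have "h x * \<bar>(P ^^ n) f x - (\<integral>x. f x \<partial>m)\<bar> < e / Q" using elim[rule_format, of x] by simp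
      then have "Q * h x * \<bar>(P ^^ n) f x - (\<integral>x. f x \<partial>m)\<bar> < e" using Q(1) by (simp add: field_simps)
      moreover have "1 * \<bar>(P ^^ n) f x - (\<integral>x. f x \<partial>m)\<bar> \<le> Q * h x * \<bar>(P ^^ n) f x - (\<integral>x. f x \<partial>m)\<bar>"
        using Q(2)[of x] by (rule mult_right_mono) simp
      ultimately show ?thesis by (simp add: dist_real_def)
    qed
    then show ?case by blast
  qed
qed

section \<open>The boundary of X is a null set\<close>

text \<open>The fibre of a point of \<open>X\<close> lies in \<open>X0\<close>, so the bumps tend to
  0 at each of its points. The convergent series for \<open>L h x\<close> dominates.\<close>

lemma P_tendsto_0:
  assumes x: "x \<in> X"
  shows "(\<lambda>k. P (bump (UNIV - X) k) x) \<longlonglongrightarrow> 0"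
proof -
  let ?K = "UNIV - X" and ?A = "fib (Suc 0) x"
  have K: "closed ?K" using open_X by auto
  have cb: "continuous_on UNIV (\<lambda>y. h y * bump ?K k y)" for k
    by (intro continuous_intros mix.h_cont continuous_on_bump)
  have hb: "0 \<le> h y * bump ?K k y" "h y * bump ?K k y \<le> h y" for k y
    using bump_bounds[of ?K k y] less_imp_le[OF mix.h_pos, of y] mult_left_mono[of "bump ?K k y" 1 "h y"] by auto
  have eq: "ennreal (L (\<lambda>y. h y * bump ?K k y) x) = (\<integral>\<^sup>+y. ennreal (exp (\<phi> y)) * ennreal (h y * bump ?K k y) \<partial>count_space ?A)" for k
    unfolding L_eq[OF cb x] transfer_sum_eq_W[OF cb hb(1) x] W_def One_nat_def S_1 ..
  have "(\<lambda>k. \<integral>\<^sup>+y. ennreal (exp (\<phi> y)) * ennreal (h y * bump ?K k y) \<partial>count_space ?A) \<longlonglongrightarrow> (\<integral>\<^sup>+y. 0 \<partial>count_space ?A)"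
  proof (rule nn_integral_dominated_convergence[where w="\<lambda>y. ennreal (exp (\<phi> y)) * ennreal (h y)"])
    have "(\<integral>\<^sup>+y. ennreal (exp (\<phi> y)) * ennreal (h y) \<partial>count_space ?A) = ennreal (L h x)"
      unfolding L_eq[OF mix.h_cont x] transfer_sum_eq_W[OF mix.h_cont less_imp_le[OF mix.h_pos] x] W_def One_nat_def S_1 ..
    then show "(\<integral>\<^sup>+y. ennreal (exp (\<phi> y)) * ennreal (h y) \<partial>count_space ?A) < \<infinity>" by simp
    show "AE y in count_space ?A. ennreal (exp (\<phi> y)) * ennreal (h y * bump ?K k y) \<le> ennreal (exp (\<phi> y)) * ennreal (h y)" for k
      using hb by (auto simp: AE_count_space intro!: mult_left_mono ennreal_leI)
    have "(\<lambda>k. ennreal (exp (\<phi> y)) * ennreal (h y * bump ?K k y)) \<longlonglongrightarrow> 0" if "y \<in> ?A" for y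
    proof -
      have "y \<notin> ?K" using that X0_sub by (auto simp: fib_1)
      then have "(\<lambda>k. exp (\<phi> y) * (h y * bump ?K k y)) \<longlonglongrightarrow> exp (\<phi> y) * (h y * 0)"
        by (intro tendsto_intros bump_tendsto_0 K)
      then have "(\<lambda>k. ennreal (exp (\<phi> y) * (h y * bump ?K k y))) \<longlonglongrightarrow> ennreal (exp (\<phi> y) * (h y * 0))"
        by (rule tendsto_ennrealI)
      then show ?thesis using hb by (simp add: ennreal_mult)
    qed
    then show "AE y in count_space ?A. (\<lambda>k. ennreal (exp (\<phi> y)) * ennreal (h y * bump ?K k y)) \<longlonglongrightarrow> 0"
      by (simp add: AE_count_space)
  qed auto
  then have "(\<lambda>k. ennreal (L (\<lambda>y. h y * bump ?K k y) x)) \<longlonglongrightarrow> ennreal 0" unfolding eq by simp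
  then have "(\<lambda>k. L (\<lambda>y. h y * bump ?K k y) x) \<longlonglongrightarrow> 0"
    by (rule tendsto_ennrealD) (auto intro!: always_eventually L_nonneg cb hb)
  from tendsto_divide[OF this tendsto_const, of "lam * h x"] show ?thesis
    unfolding P_def using mix.h_pos[of x] mix.lam_pos by simp
qed

abbreviation "bd \<equiv> UNIV - X"

lemma closed_bd: "closed bd"
  using open_X by auto

lemma bd_sets [measurable]: "bd \<in> sets borel" "X \<in> sets borel"
  using open_X by auto

lemma integrable_part:
  fixes f :: "'a \<Rightarrow> real"
  assumes "continuous_on UNIV f" "A \<in> sets borel"
  shows "integrable m (\<lambda>x. indicator A x * f x)"
  using integrable_real_mult_indicator[OF _ integrable_m[OF assms(1)], of A] assms(2)
  by (simp add: mult.commute)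

lemma integral_split:
  fixes f :: "'a \<Rightarrow> real"
  assumes f: "continuous_on UNIV f"
  shows "(\<integral>x. f x \<partial>m) = (\<integral>x. indicator bd x * f x \<partial>m) + (\<integral>x. indicator X x * f x \<partial>m)"
proof -
  have "(\<integral>x. f x \<partial>m) = (\<integral>x. indicator bd x * f x + indicator X x * f x \<partial>m)"
    by (intro Bochner_Integration.integral_cong) (auto simp: indicator_def)
  also have "\<dots> = (\<integral>x. indicator bd x * f x \<partial>m) + (\<integral>x. indicator X x * f x \<partial>m)"
    by (intro Bochner_Integration.integral_add integrable_part f bd_sets)
  finally show ?thesis .
qed

lemma cont_bump: "continuous_on UNIV (bump bd k)"
  by (rule continuous_on_bump)

lemma P_unit_interval:
  assumes f: "continuous_on UNIV f" and f01: "\<And>x. 0 \<le> f x" "\<And>x. f x \<le> 1"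
  shows "0 \<le> P f x" "P f x \<le> 1"
  using P_nonneg[OF f f01(1), of x] P_mono[OF f continuous_on_const f01(2), of x] P_one[of x] by auto

lemma P_bump: "0 \<le> P (bump bd k) x" "P (bump bd k) x \<le> 1"
  by (rule P_unit_interval[OF cont_bump bump_bounds])+

lemma integral_P_bump_X: "(\<lambda>k. \<integral>x. indicator X x * P (bump bd k) x \<partial>m) \<longlonglongrightarrow> 0"
proof -
  have "(\<lambda>k. \<integral>x. indicator X x * P (bump bd k) x \<partial>m) \<longlonglongrightarrow> (\<integral>x. 0 \<partial>m)"
  proof (rule integral_dominated_convergence[where w="\<lambda>_. 1"])
    show "AE x in m. (\<lambda>k. indicator X x * P (bump bd k) x) \<longlonglongrightarrow> 0"
      using P_tendsto_0 by (intro AE_I2) (simp add: indicator_def)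
    show "(\<lambda>x. indicator X x * P (bump bd k) x) \<in> borel_measurable m" for k
      by (rule borel_measurable_integrable[OF integrable_part[OF P_cont[OF cont_bump] bd_sets(2)]])
    show "AE x in m. norm (indicator X x * P (bump bd k) x) \<le> 1" for k
      using P_bump by (intro AE_I2) (simp add: indicator_def)
    show "integrable m (\<lambda>_. 1::real)" by (rule integrable_m) simp
  qed simp
  then show ?thesis by simp
qed

lemma integral_bump_times:
  fixes f :: "'a \<Rightarrow> real"
  assumes f: "continuous_on UNIV f" and f01: "\<And>x. 0 \<le> f x" "\<And>x. f x \<le> 1"
  shows "(\<lambda>k. \<integral>x. f x * bump bd k x \<partial>m) \<longlonglongrightarrow> (\<integral>x. indicator bd x * f x \<partial>m)"
proof (rule integral_dominated_convergence[where w="\<lambda>_. 1"])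
  have "(\<lambda>k. f x * bump bd k x) \<longlonglongrightarrow> f x * indicator bd x" for x
    by (intro tendsto_intros bump_tendsto closed_bd)
  then show "AE x in m. (\<lambda>k. f x * bump bd k x) \<longlonglongrightarrow> indicator bd x * f x"
    by (simp add: mult.commute)
  show "AE x in m. norm (f x * bump bd k x) \<le> 1" for k
    using f01 bump_bounds[of bd k] by (intro AE_I2) (simp add: abs_mult mult_le_one)
  show "(\<lambda>x. f x * bump bd k x) \<in> borel_measurable m" for k
    by (rule borel_measurable_integrable[OF integrable_m]) (intro continuous_intros f cont_bump)
  show "(\<lambda>x. indicator bd x * f x) \<in> borel_measurable m"
    by (rule borel_measurable_integrable[OF integrable_part[OF f bd_sets(1)]])
  show "integrable m (\<lambda>_. 1::real)" by (rule integrable_m) simp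
qed

text \<open>The integral of \<open>P (bump bd k)\<close> equals that of \<open>bump bd k\<close> and
  tends to \<open>measure m bd\<close>, while its part over \<open>X\<close> tends to 0. So on the
  boundary \<open>P (bump bd k)\<close> approaches its upper bound 1 in the mean.\<close>

lemma integral_defect: "(\<lambda>k. \<integral>x. indicator bd x * (1 - P (bump bd k) x) \<partial>m) \<longlonglongrightarrow> 0"
proof -
  have one: "(\<integral>x. indicator bd x * 1 \<partial>m) = measure m bd" by simp
  have "(\<integral>x. indicator bd x * (1 - P (bump bd k) x) \<partial>m)
      = measure m bd - ((\<integral>x. bump bd k x \<partial>m) - (\<integral>x. indicator X x * P (bump bd k) x \<partial>m))" for k
  proof -
    have "(\<integral>x. indicator bd x * (1 - P (bump bd k) x) \<partial>m)
      = (\<integral>x. indicator bd x * 1 - indicator bd x * P (bump bd k) x \<partial>m)"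
      by (simp add: right_diff_distrib)
    also have "\<dots> = (\<integral>x. indicator bd x * 1 \<partial>m) - (\<integral>x. indicator bd x * P (bump bd k) x \<partial>m)"
      by (intro Bochner_Integration.integral_diff integrable_part P_cont cont_bump continuous_on_const bd_sets)
    finally show ?thesis
      using integral_split[OF P_cont[OF cont_bump], of k] integral_P[OF cont_bump, of k] one by simp
  qed
  moreover have "(\<lambda>k. \<integral>x. bump bd k x \<partial>m) \<longlonglongrightarrow> measure m bd"
    using integral_bump_times[of "\<lambda>_. 1"] by simp
  then have "(\<lambda>k. measure m bd - ((\<integral>x. bump bd k x \<partial>m) - (\<integral>x. indicator X x * P (bump bd k) x \<partial>m)))
      \<longlonglongrightarrow> measure m bd - (measure m bd - 0)"
    by (intro tendsto_diff tendsto_const integral_P_bump_X)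
  ultimately show ?thesis by simp
qed

text \<open>Over \<open>X\<close> the operator only sees points of \<open>X\<close>, so the restriction of \<open>m\<close> to the boundary is
  again invariant under the dual operator. Since the iterates converge to \<open>m\<close>, this restriction is
  a multiple of \<open>m\<close>.\<close>

lemma boundary_invariant:
  assumes f: "continuous_on UNIV f" and f01: "\<And>x. 0 \<le> f x" "\<And>x. f x \<le> 1"
  shows "(\<integral>x. indicator bd x * P f x \<partial>m) = (\<integral>x. indicator bd x * f x \<partial>m)"
proof -
  let ?fb = "\<lambda>k x. f x * bump bd k x" and ?fc = "\<lambda>k x. f x * (1 - bump bd k x)"
  have c: "continuous_on UNIV (?fb k)" "continuous_on UNIV (?fc k)" "continuous_on UNIV (\<lambda>x. 1 - bump bd k x)" for k
    by (intro continuous_on_mult continuous_on_diff continuous_on_const f cont_bump)+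
  have fb: "0 \<le> ?fb k x" "?fb k x \<le> bump bd k x" "0 \<le> ?fc k x" "?fc k x \<le> 1 - bump bd k x" for k x
    using f01[of x] bump_bounds[of bd k x] by (simp_all add: mult_left_le_one_le)
  have Pfb: "0 \<le> P (?fb k) x" "P (?fb k) x \<le> P (bump bd k) x" for k x
    by (rule P_nonneg[OF c(1) fb(1)]) (rule P_mono[OF c(1) cont_bump fb(2)])
  have X_part: "(\<lambda>k. \<integral>x. indicator X x * P (?fb k) x \<partial>m) \<longlonglongrightarrow> 0"
  proof (rule tendsto_sandwich[OF _ _ tendsto_const integral_P_bump_X])
    show "\<forall>\<^sub>F k in sequentially. (\<integral>x. indicator X x * P (?fb k) x \<partial>m) \<le> (\<integral>x. indicator X x * P (bump bd k) x \<partial>m)"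
      by (intro always_eventually allI integral_mono integrable_part P_cont c cont_bump mult_left_mono Pfb bd_sets) simp
    show "\<forall>\<^sub>F k in sequentially. 0 \<le> (\<integral>x. indicator X x * P (?fb k) x \<partial>m)"
      by (intro always_eventually allI Bochner_Integration.integral_nonneg mult_nonneg_nonneg Pfb) simp
  qed
  \<comment> \<open>Multiplying \<open>f\<close> by the bump removes \<open>P\<close> of
    \<open>f\<close> times one minus the bump, which is at most \<open>P\<close> of one minus the
    bump. By \<open>integral_defect\<close> this loss vanishes in the mean on the boundary.\<close>
  have bound: "\<bar>P (?fb k) x - P f x\<bar> \<le> 1 - P (bump bd k) x" for k x
  proof -
    have "P f x = P (?fb k) x + P (?fc k) x"
      using P_add[OF c(1) c(2), of k k x] by (simp add: algebra_simps)
    moreover have "0 \<le> P (?fc k) x" by (rule P_nonneg[OF c(2) fb(3)])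
    moreover have "P (?fc k) x \<le> P (\<lambda>x. 1 - bump bd k x) x" by (rule P_mono[OF c(2) c(3) fb(4)])
    moreover have "P (\<lambda>x. 1 - bump bd k x) x = 1 - P (bump bd k) x"
      using P_add[OF cont_bump c(3), of k k x] P_one[of x] by simp
    ultimately show ?thesis by linarith
  qed
  have "(\<lambda>k. (\<integral>x. indicator bd x * P (?fb k) x \<partial>m) - (\<integral>x. indicator bd x * P f x \<partial>m)) \<longlonglongrightarrow> 0"
  proof (rule Lim_null_comparison[OF _ integral_defect], intro always_eventually allI)
    fix k
    define g w where "g x = indicator bd x * (P (?fb k) x - P f x)" and "w x = indicator bd x * (1 - P (bump bd k) x)"
      for x :: 'a
    have ig: "integrable m g" and iw: "integrable m w"
      unfolding g_def[abs_def] w_def[abs_def]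
      by (rule integrable_part[OF _ bd_sets(1)], rule continuous_on_diff,
          auto intro: P_cont c f cont_bump)+
    have gw: "norm (g x) \<le> w x" for x
      using bound[of k x] by (simp add: g_def w_def indicator_def)
    have "(\<integral>x. indicator bd x * P (?fb k) x \<partial>m) - (\<integral>x. indicator bd x * P f x \<partial>m)
      = (\<integral>x. indicator bd x * P (?fb k) x - indicator bd x * P f x \<partial>m)"
      by (rule Bochner_Integration.integral_diff[symmetric, OF integrable_part[OF P_cont[OF c(1)] bd_sets(1)]
            integrable_part[OF P_cont[OF f] bd_sets(1)]])
    also have "\<dots> = integral\<^sup>L m g"
      by (simp add: g_def[abs_def] right_diff_distrib)
    also have "norm (integral\<^sup>L m g) \<le> (\<integral>x. norm (g x) \<partial>m)"
      by (rule integral_norm_bound)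
    also have "\<dots> \<le> integral\<^sup>L m w"
      by (rule integral_mono[OF integrable_norm[OF ig] iw gw])
    finally show "norm ((\<integral>x. indicator bd x * P (?fb k) x \<partial>m) - (\<integral>x. indicator bd x * P f x \<partial>m))
        \<le> (\<integral>x. indicator bd x * (1 - P (bump bd k) x) \<partial>m)"
      by (simp add: w_def[abs_def])
  qed
  then have "(\<lambda>k. \<integral>x. indicator bd x * P (?fb k) x \<partial>m) \<longlonglongrightarrow> (\<integral>x. indicator bd x * P f x \<partial>m)"
    by (rule LIM_zero_cancel)
  from tendsto_add[OF this X_part]
  have "(\<lambda>k. \<integral>x. ?fb k x \<partial>m) \<longlonglongrightarrow> (\<integral>x. indicator bd x * P f x \<partial>m)"
    by (simp add: integral_split[OF P_cont[OF c(1)], symmetric] integral_P[OF c(1)])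
  then show ?thesis by (rule LIMSEQ_unique[OF _ integral_bump_times[OF f f01]])
qed

lemma P_it_unit_interval:
  assumes f: "continuous_on UNIV f" and f01: "\<And>x. 0 \<le> f x" "\<And>x. f x \<le> 1"
  shows "0 \<le> (P ^^ n) f x \<and> (P ^^ n) f x \<le> 1"
proof (induction n arbitrary: x)
  case (Suc n)
  then show ?case using P_unit_interval[OF P_it_cont[OF f, of n]] by simp
qed (simp add: f01)

lemma boundary_multiple:
  assumes f: "continuous_on UNIV f" and f01: "\<And>x. 0 \<le> f x" "\<And>x. f x \<le> 1"
  shows "(\<integral>x. indicator bd x * f x \<partial>m) = measure m bd * (\<integral>x. f x \<partial>m)"
proof -
  have inv_n: "(\<integral>x. indicator bd x * (P ^^ n) f x \<partial>m) = (\<integral>x. indicator bd x * f x \<partial>m)" for n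
  proof (induction n)
    case (Suc n)
    then show ?case
      using boundary_invariant[OF P_it_cont[OF f, of n]] P_it_unit_interval[OF f f01, of n] by simp
  qed simp
  have "(\<lambda>n. \<integral>x. indicator bd x * (P ^^ n) f x \<partial>m) \<longlonglongrightarrow> (\<integral>x. indicator bd x * (\<integral>x. f x \<partial>m) \<partial>m)"
  proof (rule integral_dominated_convergence[where w="\<lambda>_. 1"])
    have "(\<lambda>n. (P ^^ n) f x) \<longlonglongrightarrow> (\<integral>x. f x \<partial>m)" for x
      using tendsto_uniform_limitI[OF P_it_limit[OF f], of x] by simp
    then show "AE x in m. (\<lambda>n. indicator bd x * (P ^^ n) f x) \<longlonglongrightarrow> indicator bd x * (\<integral>x. f x \<partial>m)"
      by (auto intro!: AE_I2 tendsto_mult tendsto_const simp del: tendsto_mult_right_iff tendsto_mult_left_iff)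
    show "AE x in m. norm (indicator bd x * (P ^^ n) f x) \<le> 1" for n
      using P_it_unit_interval[OF f f01, of n] by (intro AE_I2) (simp add: indicator_def)
    show "(\<lambda>x. indicator bd x * (P ^^ n) f x) \<in> borel_measurable m" for n
      by (rule borel_measurable_integrable[OF integrable_part[OF P_it_cont[OF f] bd_sets(1)]])
    show "integrable m (\<lambda>_. 1::real)" by (rule integrable_m) simp
    show "(\<lambda>x. indicator bd x * (\<integral>x. f x \<partial>m)) \<in> borel_measurable m"
      by (rule borel_measurable_integrable[OF integrable_part[OF continuous_on_const bd_sets(1)]])
  qed
  then show ?thesis unfolding inv_n by (simp add: LIMSEQ_const_iff)
qed

text \<open>Testing \<open>boundary_multiple\<close> with functions decreasing to the indicator of
  the boundary shows that \<open>measure m bd\<close> is its own square. The value 1 is excluded,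
  because the nonempty open set \<open>X\<close> has positive mass by \<open>J_pos\<close>.\<close>

lemma boundary_null: "measure m bd = 0"
proof -
  interpret prob_space m by (rule prob_m)
  have "(\<integral>x. indicator bd x * bump bd k x \<partial>m) = (\<integral>x. indicator bd x \<partial>m)" for k
    using bump_eq_1[OF closed_bd, of _ k]
    by (intro Bochner_Integration.integral_cong) (auto simp: indicator_def)
  then have eq: "measure m bd * (\<integral>x. bump bd k x \<partial>m) = measure m bd" for k
    using boundary_multiple[OF cont_bump bump_bounds, of k] by simp
  have "(\<lambda>k. measure m bd * (\<integral>x. bump bd k x \<partial>m)) \<longlonglongrightarrow> measure m bd * measure m bd"
    using integral_bump_times[of "\<lambda>_. 1"] by (intro tendsto_mult tendsto_const) simp
  then have "measure m bd = measure m bd * measure m bd" unfolding eq by (simp only: LIMSEQ_const_iff)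
  then have "measure m bd = 0 \<or> measure m bd = 1" by simp
  moreover have "measure m bd \<noteq> 1"
  proof
    assume one: "measure m bd = 1"
    then have AE_K: "AE x in m. x \<in> bd" by (subst prob_eq_1[symmetric]) auto
    obtain z where z: "z \<in> X" using X_nonempty by auto
    have "0 < h z * off_dist X z" using z open_X mix.h_pos by (simp add: off_dist_pos_iff)
    moreover have "0 \<le> h y * off_dist X y" for y
      by (intro mult_nonneg_nonneg less_imp_le[OF mix.h_pos] off_dist_nonneg)
    ultimately have "0 < mix.J (\<lambda>x. h x * off_dist X x)"
      by (rule_tac J_pos[where z=z]) (auto intro: continuous_on_mult mix.h_cont continuous_on_off_dist)
    then have "0 < (\<integral>x. off_dist X x \<partial>m)" by (simp add: integral_m_J continuous_on_off_dist)
    moreover have "(\<integral>x. off_dist X x \<partial>m) = (\<integral>x. 0 \<partial>m)"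
    proof (rule integral_cong_AE)
      show "off_dist X \<in> borel_measurable m"
        by (rule borel_measurable_integrable[OF integrable_m[OF continuous_on_off_dist]])
      show "AE x in m. off_dist X x = 0" using AE_K
        by eventually_elim (simp add: off_dist_eq_0 open_X)
    qed simp
    ultimately show False by simp
  qed
  ultimately show ?thesis by blast
qed

end

subsection \<open>The Jacobian, invariance, uniqueness and atoms\<close>

lemma nn_integral_count_space_two_points:
  assumes "y \<in> A" "y' \<in> A" "y \<noteq> y'"
  shows "f y + f y' \<le> (\<integral>\<^sup>+x. f x \<partial>count_space A)"
proof -
  have "f y + f y' = (\<integral>\<^sup>+x. f x \<partial>count_space {y, y'})"
    using assms(3) by (simp add: nn_integral_count_space_finite)
  also have "\<dots> = (\<integral>\<^sup>+x. f x * indicator {y, y'} x \<partial>count_space A)"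
    using assms(1,2)
    by (auto simp: nn_integral_count_space_indicator indicator_def intro!: nn_integral_cong)
  also have "\<dots> \<le> (\<integral>\<^sup>+x. f x \<partial>count_space A)"
    by (intro nn_integral_mono) (auto simp: indicator_def)
  finally show ?thesis .
qed

context expanding_system
begin

lemma AE_mu_iff: "(AE x in m. Q x) \<longleftrightarrow> (AE x in mu. Q x)"
  unfolding m_def by (subst AE_density) (auto simp: mix.h_pos)

lemma AE_X: "AE x in m. x \<in> X" "AE x in mu. x \<in> X"
proof -
  interpret prob_space m by (rule prob_m)
  have "bd \<in> null_sets m" using boundary_null by (auto simp: emeasure_eq_measure intro!: null_setsI)
  then have "AE x in m. x \<notin> bd" by (rule AE_not_in)
  then show "AE x in m. x \<in> X" by simp
  then show "AE x in mu. x \<in> X" by (simp add: AE_mu_iff)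
qed

lemma prob_measures_I:
  assumes "prob_space \<nu>" "sets \<nu> = sets borel" "AE x in \<nu>. x \<in> X"
  shows "\<nu> \<in> prob_measures X"
proof -
  have "emeasure \<nu> (UNIV - X) = 0"
    using assms(3) sets_eq_imp_space_eq[OF assms(2)] assms(2) bd_sets
    by (subst (asm) AE_iff_measurable[of "UNIV - X"]) auto
  then show ?thesis using assms by (simp add: prob_measures_def)
qed

lemma mu_prob_measures: "mu \<in> prob_measures X"
  by (rule prob_measures_I[OF prob_mu mix.J.sets_riesz AE_X(2)])

lemma m_prob_measures: "m \<in> prob_measures X"
  by (rule prob_measures_I[OF prob_m sets_m AE_X(1)])

lemma transfer_mu_continuous:
  assumes f: "continuous_on UNIV f" and f0: "\<And>x. 0 \<le> f x"
  shows "(\<integral>\<^sup>+x. NL (\<lambda>y. wt y * ennreal (f y)) x \<partial>mu) = ennreal (lam * (\<integral>x. f x \<partial>mu))"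
proof -
  have "(\<integral>\<^sup>+x. NL (\<lambda>y. wt y * ennreal (f y)) x \<partial>mu) = (\<integral>\<^sup>+x. ennreal (L f x) \<partial>mu)"
  proof (rule nn_integral_cong_AE)
    show "AE x in mu. NL (\<lambda>y. wt y * ennreal (f y)) x = ennreal (L f x)"
      using AE_X(2)
    proof eventually_elim
      case (elim x)
      then show ?case by (simp only: L_eq[OF f elim] transfer_sum_eq_W[OF f f0 elim] W1_eq_NL)
    qed
  qed
  also have "\<dots> = ennreal (\<integral>x. L f x \<partial>mu)"
    by (rule nn_integral_eq_integral[OF mix.J.integrable_riesz[OF L_cont[OF f]]]) (simp add: L_nonneg f f0)
  also have "(\<integral>x. L f x \<partial>mu) = lam * (\<integral>x. f x \<partial>mu)"
    using mix.J_L[OF f] by (simp add: J_eq f L_cont)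
  finally show ?thesis .
qed

text \<open>Both sides are integrals of \<open>F\<close> against finite Borel measures,
  \<open>pull wt mu\<close> and the multiple of \<open>mu\<close> by \<open>lam\<close>. They agree
  on continuous functions by the eigenvalue equation, so the measures are equal. That the fibre sum
  represents \<open>L f\<close> almost everywhere rests on \<open>AE_X\<close>.\<close>

lemma transfer_mu:
  assumes F: "F \<in> borel_measurable borel"
  shows "(\<integral>\<^sup>+x. NL (\<lambda>y. wt y * F y) x \<partial>mu) = ennreal lam * (\<integral>\<^sup>+x. F x \<partial>mu)"
proof -
  interpret mu: prob_space mu by (rule prob_mu)
  define M1 where "M1 = pull wt mu"
  define M2 where "M2 = density mu (\<lambda>_. ennreal lam)"
  have nn1: "(\<integral>\<^sup>+x. G x \<partial>M1) = (\<integral>\<^sup>+x. NL (\<lambda>y. wt y * G y) x \<partial>mu)" if "G \<in> borel_measurable borel" for G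
    unfolding M1_def by (rule nn_integral_pull[OF wt_measurable mix.J.sets_riesz that])
  have nn2: "(\<integral>\<^sup>+x. G x \<partial>M2) = ennreal lam * (\<integral>\<^sup>+x. G x \<partial>mu)" if [measurable]: "G \<in> borel_measurable borel" for G
    unfolding M2_def by (subst nn_integral_density) (auto simp: nn_integral_cmult)
  have sets: "sets M1 = sets borel" "sets M2 = sets borel" by (auto simp: M1_def M2_def)
  have same: "(\<integral>\<^sup>+x. ennreal (f x) \<partial>M1) = ennreal (lam * (\<integral>x. f x \<partial>mu))"
      "(\<integral>\<^sup>+x. ennreal (f x) \<partial>M2) = ennreal (lam * (\<integral>x. f x \<partial>mu))"
    if f: "continuous_on UNIV f" "\<And>x. 0 \<le> f x" for f
  proof -
    have [measurable]: "f \<in> borel_measurable borel" by (rule cont_borel[OF f(1)])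
    show "(\<integral>\<^sup>+x. ennreal (f x) \<partial>M1) = ennreal (lam * (\<integral>x. f x \<partial>mu))"
      by (subst nn1) (simp_all add: transfer_mu_continuous f)
    have "(\<integral>\<^sup>+x. ennreal (f x) \<partial>mu) = ennreal (\<integral>x. f x \<partial>mu)"
      by (rule nn_integral_eq_integral[OF mix.J.integrable_riesz[OF f(1)]]) (simp add: f(2))
    then show "(\<integral>\<^sup>+x. ennreal (f x) \<partial>M2) = ennreal (lam * (\<integral>x. f x \<partial>mu))"
      using mix.lam_pos by (subst nn2) (simp_all add: ennreal_mult' less_imp_le)
  qed
  have fin: "finite_measure M1" "finite_measure M2"
  proof -
    have "emeasure M1 (space M1) = (\<integral>\<^sup>+x. ennreal 1 \<partial>M1)" "emeasure M2 (space M2) = (\<integral>\<^sup>+x. ennreal 1 \<partial>M2)"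
      by simp_all
    then show "finite_measure M1" "finite_measure M2"
      using same[of "\<lambda>_. 1"] by (auto intro!: finite_measureI)
  qed
  have "M1 = M2"
  proof (rule measure_eqI_continuous[OF compact_UNIV fin sets])
    fix f :: "'a \<Rightarrow> real" assume f: "continuous_on UNIV f" "\<And>x. 0 \<le> f x"
    have [measurable]: "f \<in> borel_measurable borel" by (rule cont_borel[OF f(1)])
    have "f \<in> borel_measurable M1" "f \<in> borel_measurable M2"
      using sets by (auto cong: measurable_cong_sets)
    then show "(\<integral>x. f x \<partial>M1) = (\<integral>x. f x \<partial>M2)"
      using f(2) same[OF f] by (simp add: integral_eq_nn_integral)
  qed
  then show ?thesis using nn1[OF F] nn2[OF F] by simp
qed

lemma integral_W:
  assumes "F \<in> borel_measurable borel"
  shows "(\<integral>\<^sup>+x. W n F x \<partial>mu) = ennreal (lam ^ n) * (\<integral>\<^sup>+x. F x \<partial>mu)"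
  using assms
proof (induction n arbitrary: F)
  case 0
  have "(\<integral>\<^sup>+x. W 0 F x \<partial>mu) = (\<integral>\<^sup>+x. F x \<partial>mu)"
    by (rule nn_integral_cong_AE) (use AE_X(2) in \<open>eventually_elim, simp add: W_0\<close>)
  then show ?case by simp
next
  case (Suc n)
  note [measurable] = Suc.prems
  have eq: "W (Suc n) F = W n (W 1 F)" using W_add[of n 1 F] by auto
  have m1: "W 1 F \<in> borel_measurable borel" unfolding W1_eq_NL[abs_def] by measurable
  have "(\<integral>\<^sup>+x. W (Suc n) F x \<partial>mu) = ennreal (lam ^ n) * (ennreal lam * (\<integral>\<^sup>+x. F x \<partial>mu))"
    unfolding eq Suc.IH[OF m1] unfolding W1_eq_NL transfer_mu[OF Suc.prems] ..
  then show ?case using mix.lam_pos by (simp add: ennreal_mult mult_ac)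
qed

text \<open>No fibre meets the complement of \<open>X0\<close>, so the fibre sum of its indicator is
  0. By \<open>transfer_mu\<close> the integral of this sum is \<open>lam\<close> times the mass of
  the complement.\<close>

lemma AE_X0: "AE x in mu. x \<in> X0" "AE x in m. x \<in> X0"
proof -
  have [measurable]: "X0 \<in> sets borel" using open_X0 by simp
  have "NL (\<lambda>y. wt y * indicator (UNIV - X0) y) x = 0" for x
    unfolding NL_def by (auto simp: nn_integral_0_iff_AE AE_count_space fib_1)
  then have "ennreal lam * emeasure mu (UNIV - X0) = 0"
    using transfer_mu[of "indicator (UNIV - X0)"] by simp
  then have "emeasure mu (UNIV - X0) = 0" using mix.lam_pos by simp
  then have "UNIV - X0 \<in> null_sets mu" by (intro null_setsI) auto
  then show "AE x in mu. x \<in> X0" using AE_not_in by fastforce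
  then show "AE x in m. x \<in> X0" by (simp add: AE_mu_iff)
qed

text \<open>Equal to \<open>exp (psi y)\<close> on \<open>X0\<close> and to 0 elsewhere.
  \<open>T\<close> is known to be Borel only on \<open>X0\<close>, so the factor containing
  \<open>T\<close> carries its own indicator.\<close>

definition gw :: "'a \<Rightarrow> ennreal" where
  "gw y = wt y * ennreal (h y) * (ennreal (inverse (lam * h (T y))) * indicator X0 y)"

lemma gw_measurable [measurable]: "gw \<in> borel_measurable borel"
proof -
  have [measurable]: "(\<lambda>y. ennreal (inverse (lam * h (T y))) * indicator X0 y) \<in> borel_measurable borel"
    by (rule vimage_T_measurable[of "\<lambda>x. ennreal (inverse (lam * h x))"]) measurable
  show ?thesis unfolding gw_def[abs_def] by measurable
qed

lemma gw_eq: "y \<in> X0 \<Longrightarrow> gw y = ennreal (exp (\<phi> y) * h y / (lam * h (T y)))"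
  using mix.h_pos[of y] mix.h_pos[of "T y"] mix.lam_pos
  by (simp add: gw_def wt_def ennreal_mult[symmetric] divide_inverse)

lemma NL_gw:
  assumes x: "x \<in> X"
  shows "NL gw x = 1"
proof -
  have "NL gw x = NL (\<lambda>y. ennreal (inverse (lam * h x)) * (wt y * ennreal (h y))) x"
    by (rule NL_cong) (simp add: gw_def mult_ac)
  also have "\<dots> = ennreal (inverse (lam * h x)) * ennreal (L h x)"
    unfolding NL_cmult W1_eq_NL[symmetric] L_eq[OF mix.h_cont x]
      transfer_sum_eq_W[OF mix.h_cont less_imp_le[OF mix.h_pos] x] ..
  also have "\<dots> = 1" using mix.h_pos[of x] mix.lam_pos
    by (subst ennreal_mult[symmetric]) (simp_all add: mix.L_h field_simps)
  finally show ?thesis .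
qed

lemma transfer_m:
  assumes [measurable]: "F \<in> borel_measurable borel"
  shows "(\<integral>\<^sup>+x. NL (\<lambda>y. gw y * F y) x \<partial>m) = (\<integral>\<^sup>+x. F x \<partial>m)"
proof -
  have "(\<integral>\<^sup>+x. NL (\<lambda>y. gw y * F y) x \<partial>m) = (\<integral>\<^sup>+x. ennreal (h x) * NL (\<lambda>y. gw y * F y) x \<partial>mu)"
    unfolding m_def by (rule nn_integral_density) measurable
  also have "\<dots> = (\<integral>\<^sup>+x. NL (\<lambda>y. wt y * (ennreal (inverse lam) * ennreal (h y) * F y)) x \<partial>mu)"
  proof (rule nn_integral_cong)
    fix x
    have "ennreal (h x) * NL (\<lambda>y. gw y * F y) x = NL (\<lambda>y. ennreal (h (T y)) * (gw y * F y)) x"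
      by (rule NL_pull_out[symmetric])
    also have "\<dots> = NL (\<lambda>y. wt y * (ennreal (inverse lam) * ennreal (h y) * F y)) x"
    proof (rule NL_cong)
      fix y assume y: "y \<in> X0"
      have "ennreal (h (T y)) * ennreal (inverse (lam * h (T y))) = ennreal (inverse lam)"
        using mix.h_pos[of "T y"] mix.lam_pos by (simp add: ennreal_mult[symmetric])
      moreover have "ennreal (h (T y)) * (gw y * F y) =
        (ennreal (h (T y)) * ennreal (inverse (lam * h (T y)))) * (wt y * ennreal (h y) * F y)"
        using y by (simp add: gw_def mult_ac)
      ultimately show "ennreal (h (T y)) * (gw y * F y) = wt y * (ennreal (inverse lam) * ennreal (h y) * F y)"
        by (simp add: mult_ac)
    qed
    finally show "ennreal (h x) * NL (\<lambda>y. gw y * F y) x = NL (\<lambda>y. wt y * (ennreal (inverse lam) * ennreal (h y) * F y)) x" .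
  qed
  also have "\<dots> = ennreal lam * (\<integral>\<^sup>+x. ennreal (inverse lam) * (ennreal (h x) * F x) \<partial>mu)"
    by (subst transfer_mu) (simp_all add: mult.assoc)
  also have "\<dots> = ennreal lam * ennreal (inverse lam) * (\<integral>\<^sup>+x. ennreal (h x) * F x \<partial>mu)"
    by (simp add: nn_integral_cmult mult.assoc)
  also have "ennreal lam * ennreal (inverse lam) = 1"
    using mix.lam_pos by (simp add: ennreal_mult[symmetric])
  also have "1 * (\<integral>\<^sup>+x. ennreal (h x) * F x \<partial>mu) = (\<integral>\<^sup>+x. F x \<partial>m)"
    unfolding m_def by (simp add: nn_integral_density)
  finally show ?thesis .
qed

text \<open>\<open>transfer_mu\<close> is applied to the indicator of \<open>A\<close> divided by
  the weight. As \<open>T\<close> is injective on \<open>A\<close>, the fibre sum is then the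
  indicator of the image.\<close>

lemma jacobian_mu: "is_jacobian X0 T mu (\<lambda>y. lam * exp (- \<phi> y))"
  unfolding is_jacobian_def
proof (intro ballI impI)
  fix A :: "'a set" assume A: "A \<in> sets borel" "A \<subseteq> X0" "inj_on T A"
  have [measurable]: "A \<in> sets borel" "T ` A \<in> sets borel" using A image_measurable by auto
  define F where "F y = inverse (wt y) * indicator A y" for y
  have Fm [measurable]: "F \<in> borel_measurable borel" unfolding F_def[abs_def] by measurable
  have "emeasure mu (T ` A) = (\<integral>\<^sup>+x. NL (\<lambda>y. wt y * F y) x \<partial>mu)"
  proof -
    have "NL (\<lambda>y. wt y * F y) x = NL (indicator A) x" for x
    proof (rule NL_cong)
      fix y assume "y \<in> X0"
      then have "wt y * inverse (wt y) = 1"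
        by (simp add: wt_def inverse_ennreal ennreal_mult[symmetric])
      then show "wt y * F y = indicator A y" by (simp add: F_def mult.assoc[symmetric])
    qed
    then show ?thesis using NL_indicator[OF A(2,3)] by simp
  qed
  also have "\<dots> = ennreal lam * (\<integral>\<^sup>+x. F x \<partial>mu)" by (rule transfer_mu[OF Fm])
  also have "\<dots> = (\<integral>\<^sup>+y. ennreal lam * F y \<partial>mu)" by (rule nn_integral_cmult[symmetric]) measurable
  also have "\<dots> = (\<integral>\<^sup>+y\<in>A. ennreal (lam * exp (- \<phi> y)) \<partial>mu)"
    using A(2) mix.lam_pos
    by (intro nn_integral_cong)
      (auto simp: F_def wt_def indicator_def inverse_ennreal exp_minus ennreal_mult)
  finally show "emeasure mu (T ` A) = (\<integral>\<^sup>+y\<in>A. ennreal (lam * exp (- \<phi> y)) \<partial>mu)" .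
qed

lemma dual_eigen_mu: "dual_eigen X X0 T \<phi> lam mu"
  unfolding dual_eigen_def transfer_dual_def using mix.J_L by (simp add: J_eq L_cont)

lemma vimage_borel: "B \<in> sets borel \<Longrightarrow> {y \<in> X0. T y \<in> B} \<in> sets borel"
proof -
  assume B: "B \<in> sets borel"
  have "T \<in> borel_measurable (restrict_space borel X0)"
    by (rule borel_measurable_continuous_on_restrict[OF contT])
  from measurable_sets[OF this B]
  have "T -` B \<inter> X0 \<in> sets (restrict_space borel X0)" by (simp add: space_restrict_space)
  then have "T -` B \<inter> X0 \<in> sets borel" using open_X0 by (simp add: sets_restrict_space_iff)
  moreover have "T -` B \<inter> X0 = {y \<in> X0. T y \<in> B}" by auto
  ultimately show ?thesis by simp
qed

text \<open>The indicator of a preimage is constant on fibres and can be pulled out of the fibre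
  sum; the weights \<open>gw\<close> sum to 1 over every point of \<open>X\<close>.\<close>

lemma m_invariant: "m \<in> invariant_measures X X0 T"
  unfolding invariant_measures_def
proof (intro CollectI conjI ballI impI m_prob_measures)
  fix B :: "'a set" assume B: "B \<in> sets borel" "B \<subseteq> X"
  note [measurable] = B(1) vimage_borel[OF B(1)]
  have "emeasure m {y \<in> X0. T y \<in> B} = (\<integral>\<^sup>+x. NL (\<lambda>y. gw y * indicator {y \<in> X0. T y \<in> B} y) x \<partial>m)"
    by (subst transfer_m) simp_all
  also have "\<dots> = (\<integral>\<^sup>+x. indicator B x \<partial>m)"
  proof (rule nn_integral_cong_AE)
    show "AE x in m. NL (\<lambda>y. gw y * indicator {y \<in> X0. T y \<in> B} y) x = indicator B x"
      using AE_X(1)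
    proof eventually_elim
      case (elim x)
      have "NL (\<lambda>y. gw y * indicator {y \<in> X0. T y \<in> B} y) x = NL (\<lambda>y. indicator B (T y) * gw y) x"
        by (rule NL_cong) (auto simp: indicator_def)
      then show ?case using NL_gw[OF elim] by (simp add: NL_pull_out)
    qed
  qed
  finally show "emeasure m {y \<in> X0. T y \<in> B} = emeasure m B" by simp
qed

definition psi :: "'a \<Rightarrow> real" where
  "psi y = \<phi> y - ln lam + ln (h y) - ln (h (T y))"

lemma exp_psi: "exp (psi y) = exp (\<phi> y) * h y / (lam * h (T y))"
  using mix.h_pos[of y] mix.h_pos[of "T y"] mix.lam_pos
  by (simp add: psi_def exp_add exp_diff)

lemma transfer_op_psi:
  assumes f: "continuous_on UNIV f"
  shows "transfer_op X X0 T psi f = P f"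
  unfolding transfer_op_def
proof (rule the_equality)
  have c: "continuous_on UNIV (\<lambda>y. h y * f y)" by (intro continuous_intros mix.h_cont f)
  have on_X: "P f x = transfer_sum X0 T psi f x" if x: "x \<in> X" for x
  proof -
    have "transfer_sum X0 T psi f x = (\<Sum>\<^sub>\<infinity>y\<in>{y \<in> X0. T y = x}. inverse (lam * h x) * (h y * f y * exp (\<phi> y)))"
      unfolding transfer_sum_def by (rule infsum_cong) (simp add: exp_psi divide_inverse)
    also have "\<dots> = inverse (lam * h x) * transfer_sum X0 T \<phi> (\<lambda>y. h y * f y) x"
      unfolding transfer_sum_def by (rule infsum_cmult_right')
    finally show ?thesis unfolding P_def L_eq[OF c x] by (metis divide_inverse mult.commute)
  qed
  then show "continuous_on UNIV (P f) \<and> (\<forall>x\<in>X. P f x = transfer_sum X0 T psi f x)"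
    using P_cont[OF f] by blast
  fix g assume "continuous_on UNIV g \<and> (\<forall>x\<in>X. g x = transfer_sum X0 T psi f x)"
  then show "g = P f" using on_X P_cont[OF f] by (intro dense_eq) auto
qed

lemma dual_eigen_m: "dual_eigen X X0 T psi 1 m"
  unfolding dual_eigen_def transfer_dual_def by (simp add: transfer_op_psi integral_P)

lemma J_limit_measure:
  assumes \<nu>: "prob_space \<nu>" "sets \<nu> = sets borel" and f: "continuous_on UNIV f"
  shows "(\<lambda>n. \<integral>x. (L ^^ n) f x / lam ^ n \<partial>\<nu>) \<longlonglongrightarrow> mix.J f * (\<integral>x. h x \<partial>\<nu>)"
proof -
  have "finite_measure \<nu>" using \<nu>(1) by (simp add: prob_space_def)
  then have "(\<lambda>n. \<integral>x. (L ^^ n) f x / lam ^ n \<partial>\<nu>) \<longlonglongrightarrow> (\<integral>x. h x * mix.J f \<partial>\<nu>)"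
    using mix.lam_pos
    by (intro integral_uniform_limit[OF compact_UNIV _ \<nu>(2) _ mix.it_limit[OF f]] continuous_intros Lit_cont f) auto
  then show ?thesis by (simp add: mult.commute)
qed

lemma integral_pos:
  assumes \<nu>: "prob_space \<nu>" "sets \<nu> = sets borel"
  shows "0 < (\<integral>x. h x \<partial>\<nu>)"
proof -
  interpret prob_space \<nu> by fact
  obtain Q where Q: "1 \<le> Q" "\<And>x. 1 \<le> Q * h x" using mix.h_bounds by blast
  have "(\<integral>x. 1 / Q \<partial>\<nu>) \<le> (\<integral>x. h x \<partial>\<nu>)"
    using Q integrable_continuous_compact[OF compact_UNIV finite_measure_axioms \<nu>(2) mix.h_cont]
    by (intro integral_mono) (auto simp: divide_le_eq mult.commute)
  then show ?thesis using Q(1) prob_space by (simp add: less_le_trans[of 0 "1 / Q"])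
qed

text \<open>The integrals of \<open>(L ^^ n) f x / lam ^ n\<close> against \<open>mu'\<close> are
  \<open>(lam' / lam) ^ n\<close> times the integral of \<open>f\<close>, and they converge. For the
  constant 1 the limit is positive, which forces \<open>lam' = lam\<close>. Then the sequence is
  constant, and its limit identifies \<open>mu'\<close> with \<open>mu\<close>.\<close>

lemma eigen_unique:
  assumes lam': "0 < lam'" and mu': "mu' \<in> prob_measures X" and eig: "dual_eigen X X0 T \<phi> lam' mu'"
  shows "lam' = lam \<and> mu' = mu"
proof -
  have p: "prob_space mu'" "sets mu' = sets borel" using mu' by (auto simp: prob_measures_def)
  interpret mu': prob_space mu' by fact
  have L1: "(\<integral>x. L f x \<partial>mu') = lam' * (\<integral>x. f x \<partial>mu')" if "continuous_on UNIV f" for f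
    using eig that unfolding dual_eigen_def transfer_dual_def by blast
  have Ln: "(\<integral>x. (L ^^ n) f x \<partial>mu') = lam' ^ n * (\<integral>x. f x \<partial>mu')" if "continuous_on UNIV f" for f n
    by (induction n) (auto simp: L1 Lit_cont that)
  define c where "c = (\<integral>x. h x \<partial>mu')"
  have c: "0 < c" unfolding c_def by (rule integral_pos[OF p])
  have lim: "(\<lambda>n. (lam' / lam) ^ n * (\<integral>x. f x \<partial>mu')) \<longlonglongrightarrow> mix.J f * c" if f: "continuous_on UNIV f" for f
    using J_limit_measure[OF p f] by (simp add: Ln[OF f] c_def power_divide)
  have l1: "(\<lambda>n. (lam' / lam) ^ n) \<longlonglongrightarrow> c"
    using lim[of "\<lambda>_. 1"] mu'.prob_space by (simp add: mix.J.one)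
  have "(\<lambda>n. (lam' / lam) ^ Suc n) \<longlonglongrightarrow> (lam' / lam) * c"
    using tendsto_mult_left[OF l1, of "lam' / lam"] by simp
  then have "(lam' / lam) * c = c" using LIMSEQ_Suc[OF l1] LIMSEQ_unique by blast
  then have r: "lam' / lam = 1" using c by (metis less_irrefl mult_cancel_right2)
  then have "lam' = lam" using mix.lam_pos by simp
  have c1: "c = 1" using l1 unfolding r by (simp add: LIMSEQ_const_iff)
  have "(\<integral>x. f x \<partial>mu') = (\<integral>x. f x \<partial>mu)" if f: "continuous_on UNIV f" for f :: "'a \<Rightarrow> real"
    using lim[OF f] unfolding r by (simp add: LIMSEQ_const_iff c1 J_eq[OF f])
  then have "mu' = mu"
    using mu'.finite_measure_axioms prob_mu p(2)
    by (intro measure_eqI_continuous[OF compact_UNIV]) (auto simp: prob_space_def)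
  then show ?thesis using \<open>lam' = lam\<close> by simp
qed

lemma h_distortion:
  assumes x: "x \<in> X" "x' \<in> X" "dist x x' < \<delta>N"
  shows "h x \<le> exp (Cd x x') * h x'"
proof -
  have "mix.approx k x \<le> exp (Cd x x') * mix.approx k x'" for k
    using Lit_compare[OF x, of "\<lambda>_. 1" 0 k] mix.lam_pos
      divide_right_mono[of "(L ^^ (k * N)) (\<lambda>_. 1) x" "exp (Cd x x') * (L ^^ (k * N)) (\<lambda>_. 1) x'" "lam ^ (k * N)"]
    by (simp add: mix.approx_def)
  then show ?thesis
    by (intro LIMSEQ_le[OF mix.approx_tendsto tendsto_mult_left[OF mix.approx_tendsto]]) auto
qed

text \<open>The iterates divided by \<open>lam ^ n\<close> leave \<open>h'\<close> unchanged, and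
  they converge to \<open>h\<close> times the integral of \<open>h'\<close>.\<close>

lemma h_unique:
  assumes h': "continuous_on UNIV h'" "(\<integral>x. h' x \<partial>mu) = 1" "L h' = (\<lambda>x. lam * h' x)"
  shows "h' = h"
proof
  fix x
  have "(L ^^ n) h' = (\<lambda>x. lam ^ n * h' x)" for n
    by (induction n) (auto simp: L_scale h')
  then have "(L ^^ n) h' x / lam ^ n = h' x" for n using mix.lam_pos by simp
  moreover have "(\<lambda>n. (L ^^ n) h' x / lam ^ n) \<longlonglongrightarrow> h x * mix.J h'"
    using tendsto_uniform_limitI[OF mix.it_limit[OF h'(1)], of x] by simp
  ultimately show "h' x = h x" using h'(2) by (simp add: J_eq[OF h'(1)] LIMSEQ_const_iff)
qed

lemma pressure_limit: "(\<lambda>n. ln ((L ^^ n) (\<lambda>_. 1) x) / real n) \<longlonglongrightarrow> ln lam"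
proof -
  have pos: "0 < (L ^^ n) (\<lambda>_. 1) x" for n by (rule mix.one_pos)
  have "(\<lambda>n. (L ^^ n) (\<lambda>_. 1) x / lam ^ n) \<longlonglongrightarrow> h x"
    using tendsto_uniform_limitI[OF mix.it_limit[of "\<lambda>_. 1"], of x] by (simp add: mix.J.one)
  then have "(\<lambda>n. ln ((L ^^ n) (\<lambda>_. 1) x / lam ^ n)) \<longlonglongrightarrow> ln (h x)"
    using mix.h_pos[of x] by (intro tendsto_ln) auto
  then have "(\<lambda>n. ln ((L ^^ n) (\<lambda>_. 1) x / lam ^ n) * inverse (real n)) \<longlonglongrightarrow> ln (h x) * 0"
    by (intro tendsto_mult LIMSEQ_inverse_real_of_nat[THEN LIMSEQ_imp_Suc])
  then have "(\<lambda>n. ln lam + ln ((L ^^ n) (\<lambda>_. 1) x / lam ^ n) * inverse (real n)) \<longlonglongrightarrow> ln lam + 0"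
    by (intro tendsto_add tendsto_const) simp
  \<comment> \<open>Only eventually: at \<open>n = 0\<close> the left side is \<open>ln lam\<close>,
    the right side 0.\<close>
  moreover have "\<forall>\<^sub>F n in sequentially. ln lam + ln ((L ^^ n) (\<lambda>_. 1) x / lam ^ n) * inverse (real n)
      = ln ((L ^^ n) (\<lambda>_. 1) x) / real n"
    using eventually_gt_at_top[of 0]
  proof eventually_elim
    case (elim n)
    have "ln ((L ^^ n) (\<lambda>_. 1) x / lam ^ n) = ln ((L ^^ n) (\<lambda>_. 1) x) - real n * ln lam"
      using pos[of n] mix.lam_pos by (simp add: ln_div ln_realpow)
    then show ?case using elim by (simp add: field_simps)
  qed
  ultimately show ?thesis by (simp add: tendsto_cong)
qed

lemma pressure: "is_pressure X X0 T \<phi> (pressure X X0 T \<phi>)" "pressure X X0 T \<phi> = ln lam"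
proof -
  have p: "is_pressure X X0 T \<phi> (ln lam)" unfolding is_pressure_def using pressure_limit by blast
  show "pressure X X0 T \<phi> = ln lam"
    unfolding pressure_def
  proof (rule the_equality[where P="is_pressure X X0 T \<phi>"])
    fix q assume "is_pressure X X0 T \<phi> q"
    moreover obtain x where "x \<in> X" using X_nonempty by auto
    ultimately show "q = ln lam"
      using LIMSEQ_unique[OF _ pressure_limit[of x]] unfolding is_pressure_def by blast
  qed (rule p)
  then show "is_pressure X X0 T \<phi> (pressure X X0 T \<phi>)" using p by simp
qed

section \<open>Support and atoms\<close>

lemma emeasure_pos:
  assumes U: "open U" "U \<noteq> {}"
  shows "0 < emeasure mu U" "0 < emeasure m U"
proof -
  obtain z where z: "z \<in> U" using U(2) by auto
  have "0 < mix.J (off_dist U)"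
    by (rule J_pos[where z=z]) (auto simp: continuous_on_off_dist off_dist_nonneg off_dist_pos_iff U z)
  then have pos: "0 < (\<integral>x. off_dist U x \<partial>mu)" by (simp add: J_eq continuous_on_off_dist)
  have not_null: "\<not> (AE x in mu. x \<notin> U)"
  proof
    assume ae: "AE x in mu. x \<notin> U"
    have "(\<integral>x. off_dist U x \<partial>mu) = (\<integral>x. 0 \<partial>mu)"
    proof (rule integral_cong_AE)
      show "off_dist U \<in> borel_measurable mu"
        by (rule borel_measurable_integrable[OF mix.J.integrable_riesz[OF continuous_on_off_dist]])
      show "AE x in mu. off_dist U x = 0" using ae by eventually_elim (simp add: off_dist_eq_0 U)
    qed simp
    then show False using pos by simp
  qed
  have b: "U \<in> sets borel" using U by simp
  have "emeasure mu U \<noteq> 0" using not_null b by (auto simp: AE_iff_measurable[of U])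
  moreover have "emeasure m U \<noteq> 0" using not_null[folded AE_mu_iff] b by (auto simp: AE_iff_measurable[of U])
  ultimately show "0 < emeasure mu U" "0 < emeasure m U" by (auto simp: zero_less_iff_neq_zero)
qed

lemma emeasure_m_singleton: "emeasure m {y} = ennreal (h y) * emeasure mu {y}"
proof -
  have "emeasure m {y} = (\<integral>\<^sup>+x. ennreal (h x) * indicator {y} x \<partial>mu)"
    unfolding m_def by (rule emeasure_density) auto
  also have "\<dots> = (\<integral>\<^sup>+x. ennreal (h y) * indicator {y} x \<partial>mu)"
    by (intro nn_integral_cong) (simp add: indicator_def)
  finally show ?thesis by (simp add: nn_integral_cmult_indicator)
qed

text \<open>The point \<open>y\<close> lies in the fibre of \<open>(T ^^ n) y\<close> only, so
  \<open>integral_W\<close> for its indicator relates the two masses.\<close>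

lemma atom_step:
  assumes y: "y \<in> dm n"
  shows "ennreal (lam ^ n) * emeasure mu {y} = ennreal (exp (S n y)) * emeasure mu {(T ^^ n) y}"
proof -
  have W: "W n (indicator {y}) x = ennreal (exp (S n y)) * indicator {(T ^^ n) y} x" for x
  proof -
    have "W n (indicator {y}) x = (\<integral>\<^sup>+z. ennreal (exp (S n z)) * indicator {y} z \<partial>count_space (fib n x \<inter> {y}))"
      unfolding W_def by (rule nn_integral_count_space_eq) auto
    moreover have "fib n x \<inter> {y} = (if x = (T ^^ n) y then {y} else {})" using y by (auto simp: mem_fib)
    ultimately show ?thesis by (simp add: nn_integral_count_space_finite)
  qed
  have "ennreal (lam ^ n) * emeasure mu {y} = (\<integral>\<^sup>+x. W n (indicator {y}) x \<partial>mu)"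
    by (subst integral_W) auto
  also have "\<dots> = ennreal (exp (S n y)) * emeasure mu {(T ^^ n) y}"
    unfolding W by (rule nn_integral_cmult_indicator) auto
  finally show ?thesis .
qed

text \<open>A point of positive mass lies in the set \<open>X0\<close> of full mass, and by
  \<open>atom_step\<close> its image has positive mass too. So its orbit never leaves the
  domain.\<close>

lemma atom_domain:
  assumes "0 < emeasure mu {y}"
  shows "y \<in> dm n"
  using assms
proof (induction n arbitrary: y)
  case 0
  have "y \<in> X"
  proof (rule ccontr)
    assume "y \<notin> X"
    then have "AE x in mu. x \<notin> {y}" using AE_X(2) by (auto elim: eventually_mono)
    then show False using 0 by (auto simp: AE_iff_measurable[of "{y}"])
  qed
  then show ?case by (simp add: dm_0)
next
  case (Suc n)
  have y: "y \<in> X0"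
  proof (rule ccontr)
    assume "y \<notin> X0"
    then have "AE x in mu. x \<notin> {y}" using AE_X0(1) by (auto elim: eventually_mono)
    then show False using Suc.prems by (auto simp: AE_iff_measurable[of "{y}"])
  qed
  then have "ennreal lam * emeasure mu {y} = ennreal (exp (\<phi> y)) * emeasure mu {T y}"
    using atom_step[of y "Suc 0"] by (simp add: dm_1 S_1)
  then have "0 < emeasure mu {T y}"
    using Suc.prems mix.lam_pos by (metis ennreal_zero_less_mult_iff ennreal_less_zero_iff)
  then show ?case using Suc.IH y by (simp add: dm_Suc)
qed

text \<open>Every fibre of a suitable \<open>T\<^sup>k\<close> contains two points with weights bounded below, so the mass of a
  point is at most a fixed proportion of the mass of its image.\<close>

lemma no_atoms:
  assumes nonsingle: "\<forall>p. X \<noteq> {p}"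
  shows "emeasure mu {x} = 0" "emeasure m {x} = 0"
proof -
  interpret prob_space m by (rule prob_m)
  obtain p where p: "p \<in> X" using X_nonempty by auto
  obtain q where q: "q \<in> X" "q \<noteq> p" using nonsingle p by auto
  \<comment> \<open>Preimages closer than \<open>r\<close> to \<open>p\<close> and to
    \<open>q\<close> are distinct, so every fibre contains a point of weight at least
    \<open>c\<close> other than a given \<open>y\<close>.\<close>
  define r where "r = dist p q / 2"
  have r: "0 < r" using q by (simp add: r_def)
  obtain k c where c: "0 < c" and
    rch: "\<And>x z. x \<in> X \<Longrightarrow> z \<in> X \<Longrightarrow> \<exists>y\<in>fib (k * N) x. dist z y < r \<and> c \<le> exp (S (k * N) y)"
    using reach[OF r] by blast
  let ?n = "k * N"
  obtain Q where Q: "1 \<le> Q" "\<And>x. h x \<le> Q" "\<And>x. 1 \<le> Q * h x" using mix.h_bounds by blast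
  have hQ: "1 / Q \<le> h x" for x using Q(1) Q(3)[of x] by (simp add: divide_le_eq mult.commute)
  \<comment> \<open>The least share of a second preimage in the fibre total
    \<open>lam ^ ?n * h x\<close>: its term is at least \<open>c / Q\<close>, and the total is at
    most \<open>lam ^ ?n * Q\<close>.\<close>
  define e where "e = c / Q / (lam ^ ?n * Q)"
  have e: "0 < e" using c Q(1) mix.lam_pos by (simp add: e_def)
  have weight: "exp (S ?n y) * h y \<le> (1 - e) * (lam ^ ?n * h x)" if x: "x \<in> X" and y: "y \<in> fib ?n x" for x y
  proof -
    obtain y1 where y1: "y1 \<in> fib ?n x" "dist p y1 < r" "c \<le> exp (S ?n y1)" using rch[OF x p] by blast
    obtain y2 where y2: "y2 \<in> fib ?n x" "dist q y2 < r" "c \<le> exp (S ?n y2)" using rch[OF x q(1)] by blast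
    have "y1 \<noteq> y2"
      using dist_triangle[of p q y1] y1(2) y2(2) by (auto simp: r_def dist_commute)
    then obtain y' where y': "y' \<in> fib ?n x" "y' \<noteq> y" "c \<le> exp (S ?n y')" using y1 y2 by metis
    have "ennreal (exp (S ?n y)) * ennreal (h y) + ennreal (exp (S ?n y')) * ennreal (h y') \<le> W ?n (\<lambda>y. ennreal (h y)) x"
      unfolding W_def using y y'(1,2) by (intro nn_integral_count_space_two_points) auto
    also have "\<dots> = ennreal (lam ^ ?n * h x)"
      using Lit_eq_W[OF mix.h_cont less_imp_le[OF mix.h_pos] x, of ?n] by (simp add: mix.it_h)
    finally have "ennreal (exp (S ?n y) * h y + exp (S ?n y') * h y') \<le> ennreal (lam ^ ?n * h x)"
      using mix.h_pos by (simp add: ennreal_mult less_imp_le)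
    then have "exp (S ?n y) * h y + exp (S ?n y') * h y' \<le> lam ^ ?n * h x"
      using mix.h_pos[of x] mix.lam_pos by (subst (asm) ennreal_le_iff) auto
    moreover have "c * (1 / Q) \<le> exp (S ?n y') * h y'" using y'(3) hQ c Q(1) by (intro mult_mono) auto
    moreover have "e * (lam ^ ?n * h x) \<le> e * (lam ^ ?n * Q)"
      using Q(2) e mix.lam_pos by (intro mult_left_mono) auto
    moreover have "e * (lam ^ ?n * Q) = c * (1 / Q)" using mix.lam_pos Q(1) by (simp add: e_def)
    ultimately show ?thesis by (simp add: left_diff_distrib)
  qed
  have step: "measure m {y} \<le> (1 - e) * measure m {(T ^^ ?n) y}" if y: "y \<in> dm ?n" for y
  proof -
    interpret mu: prob_space mu by (rule prob_mu)
    define y' where "y' = (T ^^ ?n) y"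
    have fy: "y' \<in> X" "y \<in> fib ?n y'" using dm_into[OF y] y by (auto simp: y'_def mem_fib)
    have mm: "measure m {z} = h z * measure mu {z}" for z
      using emeasure_m_singleton[of z] mix.h_pos[of z]
      by (simp add: emeasure_eq_measure mu.emeasure_eq_measure ennreal_mult[symmetric] less_imp_le)
    have "lam ^ ?n * measure mu {y} = exp (S ?n y) * measure mu {y'}"
      using atom_step[OF y] mix.lam_pos
      by (simp add: mu.emeasure_eq_measure ennreal_mult[symmetric] y'_def)
    then have "lam ^ ?n * h y' * measure m {y} = (exp (S ?n y) * h y) * measure m {y'}"
      unfolding mm by (simp add: mult_ac)
    also have "\<dots> \<le> ((1 - e) * (lam ^ ?n * h y')) * measure m {y'}"
      by (intro mult_right_mono weight fy) simp
    finally have "(lam ^ ?n * h y') * measure m {y} \<le> (lam ^ ?n * h y') * ((1 - e) * measure m {y'})"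
      by (simp add: mult_ac)
    moreover have "0 < lam ^ ?n * h y'" using mix.lam_pos mix.h_pos by simp
    ultimately show ?thesis unfolding y'_def by (simp only: mult_le_cancel_left_pos)
  qed
  show mx: "emeasure m {x} = 0"
  proof (rule ccontr)
    assume "emeasure m {x} \<noteq> 0"
    then have "0 < emeasure mu {x}" using emeasure_m_singleton[of x] by (auto simp: zero_less_iff_neq_zero)
    then have dom: "x \<in> dm n" for n by (rule atom_domain)
    have pos: "0 < measure m {x}"
      using \<open>emeasure m {x} \<noteq> 0\<close> by (simp add: emeasure_eq_measure zero_less_measure_iff)
    have e1: "0 \<le> 1 - e"
    proof (rule ccontr)
      assume "\<not> ?thesis"
      then have "(1 - e) * measure m {(T ^^ ?n) x} \<le> 0" by (intro mult_nonpos_nonneg) auto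
      then show False using step[OF dom] pos by linarith
    qed
    have "measure m {x} \<le> (1 - e) ^ j * measure m {(T ^^ (j * ?n)) x}" for j
    proof (induction j)
      case (Suc j)
      let ?z = "(T ^^ (j * ?n)) x"
      have "?z \<in> dm ?n" using dom[of "?n + j * ?n"] dm_add[of x ?n "j * ?n"] by simp
      then have "measure m {?z} \<le> (1 - e) * measure m {(T ^^ ?n) ?z}" by (rule step)
      then have "(1 - e) ^ j * measure m {?z} \<le> (1 - e) ^ j * ((1 - e) * measure m {(T ^^ ?n) ?z})"
        using e1 by (intro mult_left_mono) auto
      moreover have "(T ^^ ?n) ?z = (T ^^ (Suc j * ?n)) x" by (simp add: funpow_add)
      ultimately show ?case using Suc by (simp add: mult_ac)
    qed simp
    then have le: "measure m {x} \<le> (1 - e) ^ j" for j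
      using e1 by (meson mult_left_le order_trans prob_le_1 zero_le_power)
    have "(\<lambda>j. (1 - e) ^ j) \<longlonglongrightarrow> 0" using e e1 by (intro LIMSEQ_power_zero) auto
    then have "measure m {x} \<le> 0" by (rule LIMSEQ_le_const) (use le in auto)
    then show False using pos by simp
  qed
  show "emeasure mu {x} = 0" using mx emeasure_m_singleton[of x] mix.h_pos[of x] by simp
qed

subsection \<open>The Gibbs property\<close>

text \<open>Every ball of radius \<open>r\<close> contains one of finitely many balls of radius
  \<open>r / 2\<close>, each of positive mass.\<close>

lemma ball_lower:
  assumes r: "0 < r"
  shows "\<exists>c>0. \<forall>x\<in>X. c \<le> measure mu (ball_in X x r)"
proof -
  interpret mu: prob_space mu by (rule prob_mu)
  have "0 < r / 2" using r by simp
  then obtain E where E: "finite E" "E \<subseteq> X" "\<And>x. \<exists>e\<in>E. dist e x < r / 2" using finite_net by metis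
  define c where "c = Min ((\<lambda>e. measure mu (ball_in X e (r / 2))) ` E)"
  have ne: "E \<noteq> {}" using E(3) by auto
  have o: "open (ball_in X x s)" for x s using open_X by (auto simp: ball_in_def)
  have "0 < measure mu (ball_in X e (r / 2))" if "e \<in> E" for e
  proof -
    have "e \<in> ball_in X e (r / 2)" using E(2) that r by (auto simp: ball_in_def)
    then have "0 < emeasure mu (ball_in X e (r / 2))" using emeasure_pos(1)[OF o] by blast
    then show ?thesis by (simp add: mu.emeasure_eq_measure)
  qed
  then have "0 < c" unfolding c_def using E(1) ne by (subst Min_gr_iff) auto
  moreover have "c \<le> measure mu (ball_in X x r)" for x
  proof -
    obtain e where e: "e \<in> E" "dist e x < r / 2" using E(3) by blast
    have "c \<le> measure mu (ball_in X e (r / 2))" unfolding c_def using E(1) e(1) by (intro Min_le) auto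
    also have "\<dots> \<le> measure mu (ball_in X x r)"
    proof (rule mu.finite_measure_mono)
      show "ball_in X e (r / 2) \<subseteq> ball_in X x r"
      proof
        fix y assume "y \<in> ball_in X e (r / 2)"
        then show "y \<in> ball_in X x r"
          using e(2) dist_triangle[of x y e] by (auto simp: ball_in_def dist_commute)
      qed
    qed (use o in auto)
    finally show ?thesis .
  qed
  ultimately show ?thesis by blast
qed

text \<open>Density of preimages provides one under some \<open>T ^^ (k * N)\<close>. Repeating this
  goes back at least \<open>n\<close> steps, and the orbit of the point found passes through a
  preimage of order \<open>n\<close>.\<close>

lemma preimage_exists:
  assumes b: "b \<in> X"
  shows "\<exists>t. t \<in> fib n b"
proof -
  obtain k where k: "1 \<le> k" and "\<forall>x\<in>X. \<forall>z\<in>X. \<exists>y\<in>fib (k * N) x. dist z y < 1"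
    using reach[of 1] by (metis zero_less_one)
  then have step: "\<exists>t. t \<in> fib (k * N) x" if "x \<in> X" for x using that by blast
  have many: "\<exists>t. t \<in> fib (j * (k * N)) x" if "x \<in> X" for j x
    using that
  proof (induction j arbitrary: x)
    case 0 then show ?case by (auto simp: mem_fib dm_0)
  next
    case (Suc j)
    obtain w where w: "w \<in> fib (k * N) x" using step[OF Suc.prems] by blast
    then have "w \<in> X" using dm_sub by (auto simp: mem_fib)
    then obtain t where "t \<in> fib (j * (k * N)) w" using Suc.IH by blast
    then have "t \<in> fib (k * N + j * (k * N)) x" using w by (subst fib_add) (auto simp: mem_fib)
    then show ?case by auto
  qed
  have "n \<le> n * (k * N)" using k N_pos by simp
  then obtain i where i: "n * (k * N) = n + i" using le_Suc_ex by blast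
  obtain t where "t \<in> fib (n + i) b" using many[OF b, of n] i by auto
  then show ?thesis by (auto simp: fib_add)
qed

text \<open>This is where the uniqueness of the sheets enters.\<close>

lemma branch_compatible:
  assumes u: "u \<in> dm N" and z: "z \<in> X" "dist ((T ^^ N) u) z < min \<delta> \<delta>N"
  shows "(T ^^ (N - 1)) (TN.br u z) = T1.br ((T ^^ (N - 1)) u) z"
proof -
  obtain N' where N': "N = Suc N'" using N_pos by (cases N) auto
  define v w where "v = (T ^^ N') u" and "w = (T ^^ N) u"
  have Tv: "T v = w" by (simp add: v_def w_def N')
  have v: "v \<in> X0" using u by (auto simp: v_def N' iter_dom_def)
  have w: "w \<in> X" unfolding w_def by (rule dm_into[OF u])
  \<comment> \<open>The branch of \<open>T ^^ N\<close> pushed forward by \<open>N - 1\<close> steps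
    is a section of \<open>T\<close>. It is compared with the branch of \<open>T\<close> on the
    smaller of the two balls.\<close>
  define g where "g z = (T ^^ N') (TN.br u z)" for z
  have g_props: "g z \<in> X0 \<and> T (g z) = z" if "z \<in> TN.B w" for z
  proof -
    have "z \<in> X" "dist ((T ^^ N) u) z < \<delta>N" using that by (auto simp: ball_in_def w_def)
    then have "TN.br u z \<in> dm N" "(T ^^ N) (TN.br u z) = z" using TN.br_props[OF u] by auto
    then show ?thesis by (auto simp: g_def N' iter_dom_def)
  qed
  have g_cont: "continuous_on (TN.B w) g"
    unfolding g_def
  proof (rule continuous_on_compose2[OF cont_iter])
    show "continuous_on (TN.B w) (TN.br u)" using TN.br_cont[OF u] by (simp add: w_def)
    have "TN.br u z \<in> dm N" if "z \<in> TN.B w" for z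
      using TN.br_props(1)[OF u] that by (auto simp: ball_in_def w_def)
    then show "TN.br u ` TN.B w \<subseteq> dm N'" using dm_mono[of N' N] by (auto simp: N')
  qed
  have g_w: "g w = v" using TN.br_center[OF u] by (simp add: g_def v_def w_def)
  have zB: "z \<in> T1.B w" "z \<in> TN.B w" using z by (auto simp: ball_in_def w_def)
  have "g z = T1.br v z"
  proof (cases "\<delta> \<le> \<delta>N")
    case True
    then have sub: "T1.B w \<subseteq> TN.B w" by (auto simp: ball_in_def)
    have "continuous_on (T1.B w) g" using g_cont sub continuous_on_subset by blast
    then show ?thesis
      using T1.section_eq_branch[OF v, of g z] g_props sub g_w zB(1) by (auto simp: Tv)
  next
    case False
    then have sub: "TN.B w \<subseteq> T1.B w" by (auto simp: ball_in_def)
    from TN.connected_or_single[OF w] show ?thesis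
    proof
      assume "connected (TN.B w)"
      then show ?thesis
        using T1.section_eq_branch_connected[OF v, of "TN.B w" g z] TN.center[OF w] sub g_cont g_props g_w zB(2)
        by (auto simp: Tv)
    next
      \<comment> \<open>With a single sheet \<open>T ^^ N\<close> is injective over the ball. A
        preimage \<open>t\<close> of the value \<open>b\<close> of the branch of \<open>T\<close> is
        sent to \<open>z\<close> by \<open>T ^^ N\<close>, so it equals
        \<open>TN.br u z\<close>.\<close>
      assume single: "\<forall>A\<in>TN.sh w. \<forall>A'\<in>TN.sh w. A = A'"
      obtain A where A: "A \<in> TN.sh w" "inj_on (T ^^ N) A" "TN.br u z \<in> A"
        by (rule TN.inv_branchE[OF u]) (use zB(2) in \<open>auto simp: w_def\<close>)
      define b where "b = T1.br v z"
      have b: "b \<in> X0" "T b = z" using T1.br_props[OF v, of z] zB(1) by (auto simp: b_def Tv ball_in_def)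
      obtain t where t: "t \<in> fib N' b" using preimage_exists[of b N'] b(1) X0_sub by blast
      have tN: "t \<in> dm N" "(T ^^ N) t = z"
        using t b dm_add[of t 1 N'] by (auto simp: mem_fib N' dm_1)
      have "t \<in> A" using TN.sheet_exists[OF w tN(1)] tN(2) zB(2) single A(1) by auto
      moreover have "(T ^^ N) (TN.br u z) = z" using TN.br_props(2)[OF u z(1)] z(2) by simp
      ultimately have "t = TN.br u z" using A(2,3) tN(2) by (metis inj_onD)
      then show ?thesis using t by (simp add: g_def mem_fib b_def)
    qed
  qed
  then show ?thesis by (simp add: g_def v_def N')
qed

text \<open>Summing over the fibre of \<open>T\<^sup>N\<^sup>-\<^sup>1\<close> above the two points turns the distortion bound for \<open>S\<^sub>N \<phi>\<close> into
  one for \<open>\<phi>\<close> along branches of \<open>T\<close> itself.\<close>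

lemma phi_distortion:
  "\<exists>C>0. \<forall>x\<in>X0. \<forall>z\<in>X. dist (T x) z < min \<delta> \<delta>N \<longrightarrow> \<bar>\<phi> x - \<phi> (T1.br x z)\<bar> \<le> C"
proof -
  obtain N' where N': "N = Suc N'" using N_pos by (cases N) auto
  obtain C where C: "0 < C" "\<And>x x'. x \<in> X \<Longrightarrow> x' \<in> X \<Longrightarrow> dist x x' < \<delta>N \<Longrightarrow> Cd x x' \<le> C" using Cd_bounded by blast
  define one' where "one' = (L ^^ N') (\<lambda>_. 1)"
  obtain c1 where c1: "0 < c1" "\<And>x. c1 \<le> one' x" using mix.one_lower[of N'] by (auto simp: one'_def)
  obtain c2 where c2: "0 < c2" "\<And>x. one' x \<le> c2"
    using bounded_cont[OF Lit_cont[of "\<lambda>_. 1" N']] unfolding one'_def by (metis abs_le_D1 continuous_on_const)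
  have c12: "c1 \<le> c2" using c1(2) c2(2) order_trans by blast
  have W': "W N' (\<lambda>_. 1) x = ennreal (one' x)" if "x \<in> X" for x
    using Lit_eq_W[of "\<lambda>_. 1" x N'] that by (simp add: one'_def)
  have "\<bar>\<phi> x - \<phi> (T1.br x z)\<bar> \<le> C + ln (c2 / c1)"
    if x: "x \<in> X0" and z: "z \<in> X" "dist (T x) z < min \<delta> \<delta>N" for x z
  proof -
    define w y where "w = T x" and "y = T1.br x z"
    have y: "y \<in> X0" "T y = z" using T1.br_props[OF x z(1)] z(2) by (auto simp: y_def)
    have w: "w \<in> X" "dist w z < \<delta>" "dist w z < \<delta>N" using x T_into z(2) by (auto simp: w_def)
    have up: "t \<in> dm N" "(T ^^ N) t = T a" "t \<in> fib N (T a)" if "t \<in> fib N' a" "a \<in> X0" for t a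
      using that dm_add[of t 1 N'] by (auto simp: mem_fib N' dm_1)
    have comp: "(T ^^ N') (TN.br t z) = T1.br ((T ^^ N') t) z" if "t \<in> dm N" "(T ^^ N) t = w" for t
      using branch_compatible[OF that(1) z(1)] that(2) z(2) by (simp add: w_def N')
    \<comment> \<open>The branches of \<open>T ^^ N\<close> map the part of a fibre that lies above
      \<open>x\<close> to the part above \<open>y\<close>; this uses
      \<open>branch_compatible\<close> through \<open>comp\<close>.\<close>
    have bij: "bij_betw (\<lambda>t. TN.br t z) (fib N' x) (fib N' y)"
      unfolding bij_betw_def
    proof (intro conjI inj_onI equalityI subsetI)
      fix t t' assume "t \<in> fib N' x" "t' \<in> fib N' x" "TN.br t z = TN.br t' z"
      then show "t = t'"
        using TN.br_bij[OF w(1) z(1) w(3)] up[OF _ x] unfolding bij_betw_def w_def by (auto dest: inj_onD)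
    next
      fix a assume "a \<in> (\<lambda>t. TN.br t z) ` fib N' x"
      then obtain t where t: "t \<in> fib N' x" "a = TN.br t z" by blast
      have "a \<in> dm N" using TN.br_props(1)[OF up(1)[OF t(1) x] z(1)] up(2)[OF t(1) x] w(3) t(2) by (simp add: w_def)
      moreover have "(T ^^ N') a = y"
        using comp[OF up(1)[OF t(1) x]] up(2)[OF t(1) x] t by (simp add: w_def y_def mem_fib)
      ultimately show "a \<in> fib N' y" using dm_mono[of N' N] by (auto simp: mem_fib N')
    next
      fix a assume a: "a \<in> fib N' y"
      have "a \<in> {t \<in> dm N. (T ^^ N) t = z}" using up[OF a y(1)] y(2) by simp
      then obtain t where t: "t \<in> dm N" "(T ^^ N) t = w" "a = TN.br t z"
        using TN.br_bij[OF w(1) z(1) w(3)] unfolding bij_betw_def by blast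
      have "T1.br ((T ^^ N') t) z = T1.br x z"
        using comp[OF t(1,2)] t(3) a by (simp add: mem_fib y_def)
      moreover have "(T ^^ N') t \<in> X0" "T ((T ^^ N') t) = w" using t by (auto simp: N' iter_dom_def)
      ultimately have "(T ^^ N') t = x"
        using T1.br_bij[OF w(1) z(1) w(2)] x unfolding bij_betw_def w_def by (auto dest: inj_onD)
      then have "t \<in> fib N' x" using t(1) dm_mono[of N' N] by (auto simp: mem_fib N')
      then show "a \<in> (\<lambda>t. TN.br t z) ` fib N' x" using t(3) by blast
    qed
    have S_split: "S N t = S N' t + \<phi> a" if "t \<in> fib N' a" for t a
      using S_add[of 1 N' t] that by (simp add: N' S_1 mem_fib)
    have sumform: "ennreal (exp (\<phi> a) * one' a) = (\<integral>\<^sup>+t. ennreal (exp (S N t)) \<partial>count_space (fib N' a))"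
      if "a \<in> X0" for a
    proof -
      have "ennreal (exp (\<phi> a) * one' a) = ennreal (exp (\<phi> a)) * W N' (\<lambda>_. 1) a"
        using that X0_sub c1(1) c1(2)[of a] by (simp add: W' subsetD ennreal_mult)
      also have "\<dots> = (\<integral>\<^sup>+t. ennreal (exp (\<phi> a)) * ennreal (exp (S N' t)) \<partial>count_space (fib N' a))"
        by (simp add: W_def nn_integral_cmult)
      also have "\<dots> = (\<integral>\<^sup>+t. ennreal (exp (S N t)) \<partial>count_space (fib N' a))"
        by (intro nn_integral_cong) (simp add: S_split exp_add ennreal_mult[symmetric] mult.commute)
      finally show ?thesis .
    qed
    have dist_t: "\<bar>S N t - S N (TN.br t z)\<bar> \<le> C" if "t \<in> fib N' x" for t
    proof -
      have "t \<in> fib (1 * N) w" using up[OF that x] by (simp add: w_def)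
      from S_distortion[OF w(1) z(1) w(3) this] have "\<bar>S N t - S N (TN.br t z)\<bar> \<le> Cd w z"
        using bN_Suc[of 0 t z] by (simp add: bN_0)
      also have "\<dots> \<le> C" by (rule C(2)[OF w(1) z(1) w(3)])
      finally show ?thesis .
    qed
    have transport: "ennreal (exp (\<phi> y) * one' y) = (\<integral>\<^sup>+t. ennreal (exp (S N (TN.br t z))) \<partial>count_space (fib N' x))"
      unfolding sumform[OF y(1)] by (rule nn_integral_bij_count_space[OF bij, symmetric])
    have le1: "ennreal (exp (\<phi> x) * one' x) \<le> ennreal (exp C) * ennreal (exp (\<phi> y) * one' y)"
      unfolding transport sumform[OF x]
      by (subst nn_integral_cmult[symmetric], simp, rule nn_integral_mono)
        (use dist_t in \<open>force simp: ennreal_mult[symmetric] exp_add[symmetric] abs_le_iff intro!: ennreal_leI\<close>)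
    have le2: "ennreal (exp (\<phi> y) * one' y) \<le> ennreal (exp C) * ennreal (exp (\<phi> x) * one' x)"
      unfolding transport sumform[OF x]
      by (subst nn_integral_cmult[symmetric], simp, rule nn_integral_mono)
        (use dist_t in \<open>force simp: ennreal_mult[symmetric] exp_add[symmetric] abs_le_iff intro!: ennreal_leI\<close>)
    \<comment> \<open>\<open>exp (\<phi> a) * one' a\<close> is a sum of weights
      \<open>exp (S N t)\<close>, which change by at most the factor \<open>exp C\<close>. Replacing
      \<open>one'\<close> by its bounds \<open>c1\<close> and \<open>c2\<close> costs the factor
      \<open>c2 / c1\<close>.\<close>
    have key: "\<phi> a \<le> \<phi> b + (C + ln (c2 / c1))"
      if "ennreal (exp (\<phi> a) * one' a) \<le> ennreal (exp C) * ennreal (exp (\<phi> b) * one' b)" for a b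
    proof -
      have "0 \<le> one' a" "0 \<le> one' b" using c1(1) c1(2)[of a] c1(2)[of b] by linarith+
      then have "exp (\<phi> a) * one' a \<le> exp C * (exp (\<phi> b) * one' b)"
        using that by (simp add: ennreal_mult[symmetric])
      moreover have "exp (\<phi> a) * c1 \<le> exp (\<phi> a) * one' a" using c1(2) by simp
      moreover have "exp C * (exp (\<phi> b) * one' b) \<le> exp C * (exp (\<phi> b) * c2)" using c2(2) by simp
      ultimately have "exp (\<phi> a) * c1 \<le> exp C * (exp (\<phi> b) * c2)" by linarith
      then have "exp (\<phi> a) \<le> exp C * exp (\<phi> b) * (c2 / c1)" using c1(1) by (simp add: field_simps)
      also have "\<dots> = exp (\<phi> b + (C + ln (c2 / c1)))" using c1(1) c2(1) by (simp add: exp_add)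
      finally show ?thesis by simp
    qed
    show ?thesis using key[OF le1] key[OF le2] by (simp add: y_def abs_le_iff)
  qed
  moreover have "0 < C + ln (c2 / c1)" using C(1) c12 c1(1) by (simp add: add_pos_nonneg)
  ultimately show ?thesis by blast
qed

abbreviation "ib j x \<equiv> iter_branch T (\<lambda>y. T1.br y) j x"

text \<open>A single step of \<open>T\<close> need not contract, so the radius from (1c) may shrink
  at every step. The induction runs over all \<open>\<rho>\<close>, since the previous stage must
  bring the moved point close enough for the next branch and for the bound \<open>C\<close>. The
  radius depends on \<open>j\<close>, but it will be used for \<open>j < N\<close> only.\<close>

lemma short_branches:
  assumes C: "0 < C" "\<And>x z. x \<in> X0 \<Longrightarrow> z \<in> X \<Longrightarrow> dist (T x) z < min \<delta> \<delta>N \<Longrightarrow> \<bar>\<phi> x - \<phi> (T1.br x z)\<bar> \<le> C"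
    and "0 < \<rho>"
  shows "\<exists>r>0. \<forall>x\<in>dm j. continuous_on (ball_in X ((T ^^ j) x) r) (ib j x) \<and> ib j x ((T ^^ j) x) = x \<and>
    (\<forall>U. open U \<longrightarrow> U \<subseteq> ball_in X ((T ^^ j) x) r \<longrightarrow> open (ib j x ` U)) \<and>
    (\<forall>z\<in>ball_in X ((T ^^ j) x) r. ib j x z \<in> fib j z \<and> dist x (ib j x z) < \<rho> \<and> \<bar>S j x - S j (ib j x z)\<bar> \<le> real j * C)"
  using \<open>0 < \<rho>\<close>
proof (induction j arbitrary: \<rho>)
  case 0
  then show ?case
    by (intro exI[of _ \<rho>]) (auto simp: mem_fib dm_0 ball_in_def S_0 image_def)
next
  case (Suc j)
  have "cond_1c X X0 T \<delta>" using adm by (simp add: admissible_def)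
  then obtain d where d: "0 < d" "\<And>x z. x \<in> X0 \<Longrightarrow> z \<in> X \<Longrightarrow> dist (T x) z < d \<Longrightarrow> dist (T1.br x (T x)) (T1.br x z) < \<rho>"
    using Suc.prems T_into unfolding cond_1c_def by (metis image_subset_iff)
  define d' where "d' = min d (min \<delta> \<delta>N)"
  have d': "0 < d'" using d(1) T1.\<delta>_pos \<delta>N_pos by (simp add: d'_def)
  from Suc.IH[OF this] obtain r where r: "0 < r" and
    IH: "\<And>x. x \<in> dm j \<Longrightarrow> continuous_on (ball_in X ((T ^^ j) x) r) (ib j x)" "\<And>x. x \<in> dm j \<Longrightarrow> ib j x ((T ^^ j) x) = x"
    "\<And>x U. x \<in> dm j \<Longrightarrow> open U \<Longrightarrow> U \<subseteq> ball_in X ((T ^^ j) x) r \<Longrightarrow> open (ib j x ` U)"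
    "\<And>x z. x \<in> dm j \<Longrightarrow> z \<in> ball_in X ((T ^^ j) x) r \<Longrightarrow> ib j x z \<in> fib j z \<and> dist x (ib j x z) < d' \<and> \<bar>S j x - S j (ib j x z)\<bar> \<le> real j * C"
    by blast
  show ?case
  proof (intro exI[of _ r] conjI ballI allI impI r)
    fix x assume "x \<in> dm (Suc j)"
    then have x: "x \<in> X0" "T x \<in> dm j" by (auto simp: dm_Suc)
    let ?B = "ball_in X ((T ^^ Suc j) x) r"
    have B: "?B = ball_in X ((T ^^ j) (T x)) r" by (simp add: funpow_swap1)
    have ib: "ib (Suc j) x z = T1.br x (ib j (T x) z)" for z by simp
    have near: "ib j (T x) z \<in> X" "dist (T x) (ib j (T x) z) < d'" if "z \<in> ?B" for z
      using IH(4)[OF x(2)] that dm_sub unfolding B by (auto simp: mem_fib)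
    then have inB: "ib j (T x) ` ?B \<subseteq> T1.B (T x)" by (auto simp: ball_in_def d'_def)
    show "continuous_on ?B (ib (Suc j) x)"
      unfolding ib[abs_def]
      by (rule continuous_on_compose2[OF T1.br_cont[OF x(1)] IH(1)[OF x(2), folded B] inB])
    show "ib (Suc j) x ((T ^^ Suc j) x) = x"
      using IH(2)[OF x(2)] T1.br_center[OF x(1)] by (simp add: funpow_swap1)
    show "open (ib (Suc j) x ` U)" if U: "open U" "U \<subseteq> ?B" for U
    proof -
      have "open (ib j (T x) ` U)" using IH(3)[OF x(2) U(1)] U(2) unfolding B by blast
      moreover have "ib j (T x) ` U \<subseteq> T1.B (T x)" using inB U(2) by blast
      ultimately have "open (T1.br x ` (ib j (T x) ` U))" by (rule T1.br_open_image[OF x(1)])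
      then show ?thesis by (simp add: image_image)
    qed
    fix z assume z: "z \<in> ?B"
    let ?w = "ib j (T x) z"
    have w: "?w \<in> fib j z" "\<bar>S j (T x) - S j ?w\<bar> \<le> real j * C" using IH(4)[OF x(2) z[unfolded B]] by auto
    have dd: "dist (T x) ?w < d" "dist (T x) ?w < min \<delta> \<delta>N" using near(2)[OF z] by (auto simp: d'_def)
    have b: "T1.br x ?w \<in> X0" "T (T1.br x ?w) = ?w" using T1.br_props[OF x(1) near(1)[OF z]] dd(2) by auto
    show "ib (Suc j) x z \<in> fib (Suc j) z"
      unfolding ib using b w(1) fib_add[of "T1.br x ?w" j 1 z] by (simp add: dm_1)
    show "dist x (ib (Suc j) x z) < \<rho>"
      using d(2)[OF x(1) near(1)[OF z] dd(1)] T1.br_center[OF x(1)] by simp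
    have "\<bar>\<phi> x - \<phi> (T1.br x ?w)\<bar> \<le> C" by (rule C(2)[OF x(1) near(1)[OF z] dd(2)])
    moreover have "S (Suc j) y = \<phi> y + S j (T y)" for y using S_add[of j 1 y] by (simp add: S_1)
    ultimately show "\<bar>S (Suc j) x - S (Suc j) (ib (Suc j) x z)\<bar> \<le> real (Suc j) * C"
      unfolding ib using w(2) b(2) by (simp add: distrib_right)
  qed
qed

lemma bN_cont_open:
  assumes "y \<in> dm (n * N)"
  shows "continuous_on (TN.B ((T ^^ (n * N)) y)) (bN n y) \<and>
    (\<forall>U. open U \<longrightarrow> U \<subseteq> TN.B ((T ^^ (n * N)) y) \<longrightarrow> open (bN n y ` U))"
  using assms
proof (induction n arbitrary: y)
  case 0
  then show ?case by (auto simp: bN_0[abs_def] image_def)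
next
  case (Suc n)
  then have y: "y \<in> dm N" "(T ^^ N) y \<in> dm (n * N)"
    using dm_add[of y "n * N" N] by (auto simp: add.commute)
  have pw: "(T ^^ (Suc n * N)) y = (T ^^ (n * N)) ((T ^^ N) y)"
    using funpow_add[of "n * N" N T] by (simp add: add.commute)
  let ?w = "(T ^^ N) y" and ?B = "TN.B ((T ^^ (Suc n * N)) y)"
  have fw: "?w \<in> fib (n * N) ((T ^^ (Suc n * N)) y)" using y(2) by (simp only: mem_fib pw)
  have "bN n ?w z \<in> TN.B ?w" if "z \<in> ?B" for z
  proof -
    have z: "z \<in> X" "dist ((T ^^ (Suc n * N)) y) z < \<delta>N" using that by (auto simp: ball_in_def)
    show ?thesis using bN_props[OF fw z] z(2) dm_sub by (auto simp: ball_in_def mem_fib)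
  qed
  then have inB: "bN n ?w ` ?B \<subseteq> TN.B ?w" by blast
  have IH: "continuous_on ?B (bN n ?w)" "\<And>U. open U \<Longrightarrow> U \<subseteq> ?B \<Longrightarrow> open (bN n ?w ` U)"
    using Suc.IH[OF y(2)] by (auto simp only: pw)
  have eq: "bN (Suc n) y = (\<lambda>z. TN.br y (bN n ?w z))" by (rule ext) (rule bN_Suc)
  show ?case
  proof (intro conjI allI impI)
    show "continuous_on ?B (bN (Suc n) y)"
      unfolding eq by (rule continuous_on_compose2[OF TN.br_cont[OF y(1)] IH(1) inB])
    fix U assume U: "open U" "U \<subseteq> ?B"
    have "open (TN.br y ` (bN n ?w ` U))"
      using inB U(2) by (intro TN.br_open_image[OF y(1) IH(2)[OF U]]) blast
    then show "open (bN (Suc n) y ` U)" by (simp add: eq image_image)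
  qed
qed

text \<open>Write \<open>n = q * N + j\<close>. The branches of \<open>T ^^ N\<close> do not enlarge
  distances, so they map a ball of radius \<open>r\<close> into such a ball, whatever
  \<open>q\<close> is. The remaining \<open>j < N\<close> single steps involve finitely many
  radii.\<close>

lemma long_branches:
  "\<exists>r>0. \<exists>D>0. \<forall>n. \<forall>x\<in>dm n. let B = ball_in X ((T ^^ n) x) r; s = branch X X0 T \<delta> N \<delta>N n x in
    continuous_on B s \<and> open (s ` B) \<and> s ((T ^^ n) x) = x \<and>
    (\<forall>z\<in>B. s z \<in> fib n z \<and> \<bar>S n x - S n (s z)\<bar> \<le> D)"
proof -
  obtain C where C: "0 < C" "\<And>x z. x \<in> X0 \<Longrightarrow> z \<in> X \<Longrightarrow> dist (T x) z < min \<delta> \<delta>N \<Longrightarrow> \<bar>\<phi> x - \<phi> (T1.br x z)\<bar> \<le> C"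
    using phi_distortion by blast
  obtain C' where C': "0 < C'" "\<And>x x'. x \<in> X \<Longrightarrow> x' \<in> X \<Longrightarrow> dist x x' < \<delta>N \<Longrightarrow> Cd x x' \<le> C'" using Cd_bounded by blast
  define good where "good j r \<longleftrightarrow> (\<forall>x\<in>dm j. continuous_on (ball_in X ((T ^^ j) x) r) (ib j x) \<and> ib j x ((T ^^ j) x) = x \<and>
    (\<forall>U. open U \<longrightarrow> U \<subseteq> ball_in X ((T ^^ j) x) r \<longrightarrow> open (ib j x ` U)) \<and>
    (\<forall>z\<in>ball_in X ((T ^^ j) x) r. ib j x z \<in> fib j z \<and> dist x (ib j x z) < 1 \<and> \<bar>S j x - S j (ib j x z)\<bar> \<le> real j * C))" for j r
  have "\<forall>j. \<exists>r>0. good j r" using short_branches[OF C, of 1] unfolding good_def by auto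
  then obtain R where R: "\<And>j. 0 < R j" "\<And>j. good j (R j)" by metis
  define r where "r = Min (insert \<delta>N (R ` {..<N}))"
  have r: "0 < r" "r \<le> \<delta>N" "\<And>j. j < N \<Longrightarrow> r \<le> R j"
    unfolding r_def using R(1) \<delta>N_pos by (auto simp: Min_gr_iff intro: Min_le)
  \<comment> \<open>At most \<open>N\<close> single steps at cost \<open>C\<close> each, and
    \<open>C'\<close> for all steps of \<open>T ^^ N\<close> together by (1g).\<close>
  define D where "D = real N * C + C'"
  have D: "0 < D" using C(1) C'(1) by (simp add: D_def add_nonneg_pos)
  have "continuous_on (ball_in X ((T ^^ n) x) r) (branch X X0 T \<delta> N \<delta>N n x) \<and>
      open (branch X X0 T \<delta> N \<delta>N n x ` ball_in X ((T ^^ n) x) r) \<and>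
      branch X X0 T \<delta> N \<delta>N n x ((T ^^ n) x) = x \<and>
      (\<forall>z\<in>ball_in X ((T ^^ n) x) r. branch X X0 T \<delta> N \<delta>N n x z \<in> fib n z \<and>
         \<bar>S n x - S n (branch X X0 T \<delta> N \<delta>N n x z)\<bar> \<le> D)"
    if x: "x \<in> dm n" for n x
  proof -
    define q j where "q = n div N" and "j = n mod N"
    have n: "n = q * N + j" by (simp add: q_def j_def)
    have j: "j < N" using N_pos by (simp add: j_def)
    define v w where "v = (T ^^ j) x" and "w = (T ^^ n) x"
    have xj: "x \<in> dm j" and v: "v \<in> dm (q * N)" using x dm_add[of x "q * N" j] by (auto simp: n v_def)
    have w: "w = (T ^^ (q * N)) v" by (simp add: w_def v_def n funpow_add)
    have wX: "w \<in> X" unfolding w_def by (rule dm_into[OF x])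
    let ?B = "ball_in X w r"
    have s: "branch X X0 T \<delta> N \<delta>N n x = (\<lambda>z. ib j x (bN q v z))"
      by (simp add: branch_def q_def j_def v_def comp_def)
    have sub: "?B \<subseteq> TN.B w" using r(2) by (auto simp: ball_in_def)
    have fv: "v \<in> fib (q * N) w" using v by (simp add: mem_fib w)
    have bz: "bN q v z \<in> fib (q * N) z" "bN q v z \<in> ball_in X v r" if "z \<in> ?B" for z
    proof -
      have z: "z \<in> X" "dist w z < \<delta>N" "dist w z < r" using that r(2) by (auto simp: ball_in_def)
      show "bN q v z \<in> fib (q * N) z" by (rule bN_props(1)[OF fv z(1,2)])
      then show "bN q v z \<in> ball_in X v r"
        using bN_props(2)[OF fv z(1,2)] z(3) dm_sub by (auto simp: ball_in_def mem_fib)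
    qed
    have sub2: "ball_in X v r \<subseteq> ball_in X ((T ^^ j) x) (R j)" using r(3)[OF j] by (auto simp: ball_in_def v_def)
    have bN_im: "bN q v ` ?B \<subseteq> ball_in X ((T ^^ j) x) (R j)" using bz(2) sub2 by blast
    have G: "continuous_on (ball_in X ((T ^^ j) x) (R j)) (ib j x)" "ib j x ((T ^^ j) x) = x"
      "\<And>U. open U \<Longrightarrow> U \<subseteq> ball_in X ((T ^^ j) x) (R j) \<Longrightarrow> open (ib j x ` U)"
      "\<And>z. z \<in> ball_in X ((T ^^ j) x) (R j) \<Longrightarrow> ib j x z \<in> fib j z \<and> \<bar>S j x - S j (ib j x z)\<bar> \<le> real j * C"
      using R(2)[of j] xj unfolding good_def by blast+
    have bc: "continuous_on ?B (bN q v)" "open (bN q v ` ?B)"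
    proof -
      have bo: "continuous_on (TN.B w) (bN q v)" "\<And>U. open U \<Longrightarrow> U \<subseteq> TN.B w \<Longrightarrow> open (bN q v ` U)"
        using bN_cont_open[OF v] by (auto simp: w)
      show "continuous_on ?B (bN q v)" using bo(1) sub continuous_on_subset by blast
      show "open (bN q v ` ?B)" using sub open_X by (intro bo(2)) (auto simp: ball_in_def)
    qed
    have "continuous_on ?B (branch X X0 T \<delta> N \<delta>N n x)"
      unfolding s by (rule continuous_on_compose2[OF G(1) bc(1) bN_im])
    moreover have "open (branch X X0 T \<delta> N \<delta>N n x ` ?B)"
      unfolding s using G(3)[OF bc(2) bN_im] by (simp add: image_image)
    moreover have "branch X X0 T \<delta> N \<delta>N n x w = x"
      unfolding s using bN_center[OF v, folded w] G(2) by (simp add: v_def[symmetric])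
    moreover have "branch X X0 T \<delta> N \<delta>N n x z \<in> fib n z \<and> \<bar>S n x - S n (branch X X0 T \<delta> N \<delta>N n x z)\<bar> \<le> D"
      if z: "z \<in> ?B" for z
    proof -
      let ?b = "bN q v z"
      have zX: "z \<in> X" "dist w z < \<delta>N" using z r(2) by (auto simp: ball_in_def)
      have g: "ib j x ?b \<in> fib j ?b" "\<bar>S j x - S j (ib j x ?b)\<bar> \<le> real j * C" using G(4) bN_im z by blast+
      have "ib j x ?b \<in> fib n z" unfolding n using g(1) bz(1)[OF z] by (subst fib_add) (auto simp: mem_fib)
      moreover have "S n x = S j x + S (q * N) v" unfolding n v_def by (rule S_add)
      moreover have "S n (ib j x ?b) = S j (ib j x ?b) + S (q * N) ?b"
        unfolding n using S_add[of "q * N" j "ib j x ?b"] g(1) by (simp add: mem_fib)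
      moreover have "\<bar>S (q * N) v - S (q * N) ?b\<bar> \<le> C'"
        using S_distortion[OF wX zX fv] C'(2)[OF wX zX] by linarith
      moreover have "real j * C \<le> real N * C" using j C(1) by simp
      ultimately show ?thesis unfolding s D_def using g(2) by auto
    qed
    ultimately show ?thesis by (auto simp: w_def)
  qed
  then show ?thesis unfolding Let_def using r(1) D by blast
qed

text \<open>For the indicator of the image of the ball \<open>B\<close> under the branch
  \<open>s\<close>, the fibre sum \<open>W n\<close> is \<open>exp (S n (s z))\<close> for
  \<open>z\<close> in \<open>B\<close> and 0 elsewhere. Its integral is \<open>lam ^ n\<close> times
  the mass of the image for \<open>mu\<close>, and by bounded distortion it is
  \<open>exp (S n x) * measure mu B\<close> up to the factor \<open>exp D\<close>.\<close>

lemma gibbs_m: "gibbs X X0 T \<delta> N \<delta>N \<phi> m"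
proof -
  interpret prob_space m by (rule prob_m)
  interpret mu: prob_space mu by (rule prob_mu)
  obtain r D where r: "0 < r" and D: "0 < D" and
    br: "\<And>n x. x \<in> dm n \<Longrightarrow> continuous_on (ball_in X ((T ^^ n) x) r) (branch X X0 T \<delta> N \<delta>N n x) \<and>
      open (branch X X0 T \<delta> N \<delta>N n x ` ball_in X ((T ^^ n) x) r) \<and>
      branch X X0 T \<delta> N \<delta>N n x ((T ^^ n) x) = x \<and>
      (\<forall>z\<in>ball_in X ((T ^^ n) x) r. branch X X0 T \<delta> N \<delta>N n x z \<in> fib n z \<and>
         \<bar>S n x - S n (branch X X0 T \<delta> N \<delta>N n x z)\<bar> \<le> D)"
    using long_branches unfolding Let_def by blast
  obtain b where b: "0 < b" "\<And>x. x \<in> X \<Longrightarrow> b \<le> measure mu (ball_in X x r)" using ball_lower[OF r] by blast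
  obtain Q where Q: "1 \<le> Q" "\<And>x. h x \<le> Q" "\<And>x. 1 \<le> Q * h x" using mix.h_bounds by blast
  have hQ: "1 / Q \<le> h x" for x using Q(1) Q(3)[of x] by (simp add: divide_le_eq mult.commute)
  \<comment> \<open>For the upper bound: \<open>h \<le> Q\<close>, distortion \<open>exp D\<close>,
    mass of the ball at most 1. For the lower bound: \<open>1 / Q \<le> h\<close>, distortion
    \<open>exp D\<close>, mass of the ball at least \<open>b\<close>.\<close>
  define c where "c = max 1 (max (Q * exp D) (Q * exp D / b))"
  have c: "1 \<le> c" "Q * exp D \<le> c" "Q * exp D / b \<le> c" by (auto simp: c_def)
  have "1 / c \<le> measure m (s ` B) / exp (S n x - real n * pressure X X0 T \<phi>) \<and>
      measure m (s ` B) / exp (S n x - real n * pressure X X0 T \<phi>) \<le> c"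
    if x: "x \<in> dm n" and B: "B = ball_in X ((T ^^ n) x) r" and s: "s = branch X X0 T \<delta> N \<delta>N n x" for n x B s
  proof -
    have xX: "(T ^^ n) x \<in> X" by (rule dm_into[OF x])
    have [measurable]: "B \<in> sets borel" "s ` B \<in> sets borel"
      using br[OF x] open_X by (auto simp: B s ball_in_def)
    have sz: "s z \<in> fib n z" "\<bar>S n x - S n (s z)\<bar> \<le> D" if "z \<in> B" for z using br[OF x] that by (auto simp: B s)
    have W: "W n (indicator (s ` B)) z = ennreal (exp (S n (s z))) * indicator B z" for z
    proof -
      have "W n (indicator (s ` B)) z
        = (\<integral>\<^sup>+y. ennreal (exp (S n y)) * indicator (s ` B) y \<partial>count_space (if z \<in> B then {s z} else {}))"
        unfolding W_def
      proof (rule nn_integral_count_space_eq)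
        fix y assume y: "y \<in> fib n z - (if z \<in> B then {s z} else {})"
        have "y \<notin> s ` B"
        proof
          assume "y \<in> s ` B"
          then obtain z' where z': "z' \<in> B" "y = s z'" by blast
          then have "z' = z" using sz(1)[OF z'(1)] y by (auto simp: mem_fib)
          then show False using y z' by simp
        qed
        then show "ennreal (exp (S n y)) * indicator (s ` B) y = 0" by simp
      next
        fix y assume "y \<in> (if z \<in> B then {s z} else {}) - fib n z"
        then show "ennreal (exp (S n y)) * indicator (s ` B) y = 0" using sz(1) by (auto split: if_splits)
      qed
      also have "\<dots> = ennreal (exp (S n (s z))) * indicator B z"
      proof (cases "z \<in> B")
        case True
        then have "indicator (s ` B) (s z) = (1 :: ennreal)" by simp
        then show ?thesis using True by (simp add: nn_integral_count_space_finite del: sum_mult_indicator)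
      qed (simp add: nn_integral_count_space_finite)
      finally show ?thesis .
    qed
    have eq: "ennreal (lam ^ n) * emeasure mu (s ` B) = (\<integral>\<^sup>+z. ennreal (exp (S n (s z))) * indicator B z \<partial>mu)"
      unfolding W[symmetric] by (subst integral_W) auto
    have "(\<integral>\<^sup>+z. ennreal (exp (S n (s z))) * indicator B z \<partial>mu) \<le> (\<integral>\<^sup>+z. ennreal (exp (S n x + D)) * indicator B z \<partial>mu)"
      using sz(2) by (intro nn_integral_mono) (force simp: indicator_def abs_le_iff intro!: ennreal_leI)
    then have "ennreal (lam ^ n * measure mu (s ` B)) \<le> ennreal (exp (S n x + D) * measure mu B)"
      using eq mix.lam_pos by (simp add: nn_integral_cmult_indicator mu.emeasure_eq_measure ennreal_mult)
    then have up: "lam ^ n * measure mu (s ` B) \<le> exp (S n x + D) * measure mu B" by simp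
    have "(\<integral>\<^sup>+z. ennreal (exp (S n x - D)) * indicator B z \<partial>mu) \<le> (\<integral>\<^sup>+z. ennreal (exp (S n (s z))) * indicator B z \<partial>mu)"
      using sz(2) by (intro nn_integral_mono) (force simp: indicator_def abs_le_iff intro!: ennreal_leI)
    then have "ennreal (exp (S n x - D) * measure mu B) \<le> ennreal (lam ^ n * measure mu (s ` B))"
      using eq mix.lam_pos by (simp add: nn_integral_cmult_indicator mu.emeasure_eq_measure ennreal_mult)
    then have lo: "exp (S n x - D) * measure mu B \<le> lam ^ n * measure mu (s ` B)"
      using mix.lam_pos by simp
    have em: "emeasure m (s ` B) = (\<integral>\<^sup>+z. ennreal (h z) * indicator (s ` B) z \<partial>mu)"
      unfolding m_def by (rule emeasure_density) auto
    have "(\<integral>\<^sup>+z. ennreal (h z) * indicator (s ` B) z \<partial>mu) \<le> (\<integral>\<^sup>+z. ennreal Q * indicator (s ` B) z \<partial>mu)"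
      using Q(2) by (intro nn_integral_mono) (auto simp: indicator_def intro!: ennreal_leI)
    then have "ennreal (measure m (s ` B)) \<le> ennreal (Q * measure mu (s ` B))"
      using em Q(1) by (simp add: nn_integral_cmult_indicator mu.emeasure_eq_measure emeasure_eq_measure ennreal_mult)
    then have mu1: "measure m (s ` B) \<le> Q * measure mu (s ` B)" using Q(1) by simp
    have "(\<integral>\<^sup>+z. ennreal (1 / Q) * indicator (s ` B) z \<partial>mu) \<le> (\<integral>\<^sup>+z. ennreal (h z) * indicator (s ` B) z \<partial>mu)"
      using hQ by (intro nn_integral_mono) (auto simp: indicator_def simp del: ennreal_divide_numeral intro!: ennreal_leI)
    then have "ennreal (1 / Q * measure mu (s ` B)) \<le> ennreal (measure m (s ` B))"
      using em Q(1) by (simp add: nn_integral_cmult_indicator mu.emeasure_eq_measure emeasure_eq_measure ennreal_mult del: times_divide_eq_left)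
    then have mu2: "1 / Q * measure mu (s ` B) \<le> measure m (s ` B)" by (simp del: times_divide_eq_left)
    have den: "exp (S n x - real n * pressure X X0 T \<phi>) = exp (S n x) / lam ^ n"
      using mix.lam_pos by (simp add: pressure exp_diff exp_of_nat_mult)
    have lp: "0 < lam ^ n" using mix.lam_pos by simp
    have "lam ^ n * measure m (s ` B) \<le> Q * (exp (S n x + D) * measure mu B)"
    proof -
      have "lam ^ n * measure m (s ` B) \<le> lam ^ n * (Q * measure mu (s ` B))"
        using mu1 lp by (intro mult_left_mono) auto
      also have "\<dots> = Q * (lam ^ n * measure mu (s ` B))" by (rule mult.left_commute)
      also have "\<dots> \<le> Q * (exp (S n x + D) * measure mu B)" using up Q(1) by (intro mult_left_mono) auto
      finally show ?thesis .
    qed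
    also have "\<dots> \<le> Q * (exp (S n x + D) * 1)" using Q(1) by (intro mult_left_mono) auto
    also have "\<dots> = (Q * exp D) * exp (S n x)" by (simp add: exp_add)
    also have "\<dots> \<le> c * exp (S n x)" using c(2) by simp
    finally have A1: "lam ^ n * measure m (s ` B) \<le> c * exp (S n x)" .
    have cb: "Q * exp D \<le> c * b" using c(3) b(1) by (simp add: divide_le_eq)
    have "exp (S n x) * (Q * exp D) \<le> exp (S n x) * (c * b)" using cb by simp
    also have "\<dots> \<le> exp (S n x) * (c * measure mu B)" using b(2)[OF xX] c(1) by (simp add: B)
    finally have "exp (S n x) * (Q * exp D) \<le> exp (S n x) * (c * measure mu B)" .
    then have "exp (S n x) * Q \<le> c * (exp (S n x - D) * measure mu B)"
      by (simp add: exp_diff field_simps)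
    also have "\<dots> \<le> c * (lam ^ n * measure mu (s ` B))" using lo c(1) by (intro mult_left_mono) auto
    also have "\<dots> \<le> c * (lam ^ n * (Q * measure m (s ` B)))"
      using mu2 Q(1) lp c(1) by (intro mult_left_mono) (auto simp: field_simps)
    finally have "exp (S n x) \<le> c * (lam ^ n * measure m (s ` B))" using Q(1) by simp
    then show ?thesis
      unfolding den using A1 lp c(1) by (auto simp: field_simps)
  qed
  then show ?thesis
    unfolding gibbs_def Let_def
    using r c(1) br by (intro exI[of _ r] conjI exI[of _ c] allI ballI) (auto simp: mem_fib)
qed

end

subsection \<open>The variational principle\<close>

text \<open>Conditional probabilities of a fixed set agree almost everywhere, but the set
  \<open>{y}\<close> varies with the point. It is therefore approximated by balls around net points,
  so that agreement on countably many sets is enough.\<close>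

lemma finite_measures_singleton_le:
  fixes M1 M2 :: "'a::metric_space measure"
  assumes fin: "finite_measure M1" "finite_measure M2"
    and sets: "sets M1 = sets (restrict_space borel A)" "sets M2 = sets (restrict_space borel A)"
    and A: "A \<in> sets borel" "y \<in> A"
    and net: "\<And>k::nat. \<exists>e\<in>E k. dist e y < inverse (real (Suc k))"
    and eq: "\<And>k e. e \<in> E k \<Longrightarrow> measure M1 (ball e (inverse (real (Suc k))) \<inter> A) = measure M2 (ball e (inverse (real (Suc k))) \<inter> A)"
  shows "measure M1 {y} \<le> measure M2 {y}"
proof -
  interpret M1: finite_measure M1 by fact
  interpret M2: finite_measure M2 by fact
  \<comment> \<open>The radius is doubled so that \<open>C k\<close> contains the whole trace on
    \<open>A\<close> of the ball around a net point as soon as that ball contains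
    \<open>y\<close>.\<close>
  define C where "C k = cball y (2 * inverse (real (Suc k))) \<inter> A" for k
  have s: "B \<inter> A \<in> sets M1" "B \<inter> A \<in> sets M2" if "B \<in> sets borel" for B
    using that A(1) unfolding sets by (auto simp: sets_restrict_space_iff)
  have "(\<lambda>k. measure M2 (C k)) \<longlonglongrightarrow> measure M2 (\<Inter>k. C k)"
  proof (rule M2.finite_Lim_measure_decseq)
    show "range C \<subseteq> sets M2" unfolding C_def using s(2) by auto
    show "decseq C" unfolding C_def
      by (intro decseq_SucI Int_mono subset_cball) (auto simp: frac_le inverse_eq_divide)
  qed
  moreover have "(\<Inter>k. C k) = {y}"
  proof (intro equalityI subsetI)
    fix z assume z: "z \<in> (\<Inter>k. C k)"
    have "(\<lambda>k. 2 * inverse (real (Suc k))) \<longlonglongrightarrow> 2 * 0"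
      by (intro tendsto_mult tendsto_const LIMSEQ_inverse_real_of_nat)
    then have "dist y z \<le> 2 * 0" by (rule LIMSEQ_le_const) (use z in \<open>auto simp: C_def\<close>)
    then show "z \<in> {y}" by simp
  qed (use A(2) in \<open>auto simp: C_def\<close>)
  ultimately have lim: "(\<lambda>k. measure M2 (C k)) \<longlonglongrightarrow> measure M2 {y}" by simp
  have "measure M1 {y} \<le> measure M2 (C k)" for k
  proof -
    obtain e where e: "e \<in> E k" "dist e y < inverse (real (Suc k))" using net by blast
    let ?b = "ball e (inverse (real (Suc k))) \<inter> A"
    have "measure M1 {y} \<le> measure M1 ?b"
      using e(2) A(2) s(1) by (intro M1.finite_measure_mono) auto
    also have "\<dots> = measure M2 ?b" by (rule eq[OF e(1)])
    also have "\<dots> \<le> measure M2 (C k)"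
    proof (rule M2.finite_measure_mono)
      show "?b \<subseteq> C k"
      proof
        fix z assume "z \<in> ?b"
        then show "z \<in> C k"
          using e(2) dist_triangle[of y z e] by (auto simp: C_def dist_commute)
      qed
    qed (use s(2) in \<open>auto simp: C_def\<close>)
    finally show ?thesis .
  qed
  then show ?thesis using lim by (intro LIMSEQ_le_const[OF lim]) auto
qed

lemma ext_integral_cong_AE:
  "(AE x in M. f x = g x) \<Longrightarrow> ext_integral M f = ext_integral M g"
  unfolding ext_integral_def
  by (intro arg_cong2[where f="(-)"] arg_cong[where f=enn2ereal] nn_integral_cong_AE)
    (auto elim: eventually_mono)

lemma ext_integral_real:
  assumes f: "integrable M f"
  shows "ext_integral M (\<lambda>x. ereal (f x)) = ereal (\<integral>x. f x \<partial>M)"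
proof -
  have fin: "(\<integral>\<^sup>+x. ennreal (f x) \<partial>M) < top" "(\<integral>\<^sup>+x. ennreal (- f x) \<partial>M) < top"
    using f by (auto simp: real_integrable_def less_top)
  obtain a where a: "0 \<le> a" "(\<integral>\<^sup>+x. ennreal (f x) \<partial>M) = ennreal a" using fin(1) by (cases "\<integral>\<^sup>+x. ennreal (f x) \<partial>M") auto
  obtain b where b: "0 \<le> b" "(\<integral>\<^sup>+x. ennreal (- f x) \<partial>M) = ennreal b" using fin(2) by (cases "\<integral>\<^sup>+x. ennreal (- f x) \<partial>M") auto
  have "e2ennreal (ereal r) = ennreal r" for r by (simp add: ennreal.abs_eq e2ennreal_def ennreal_def)
  then have "ext_integral M (\<lambda>x. ereal (f x)) = enn2ereal (ennreal a) - enn2ereal (ennreal b)"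
    unfolding ext_integral_def uminus_ereal.simps by (simp add: a(2) b(2))
  also have "\<dots> = ereal (a - b)" using a(1) b(1) by (simp add: enn2ereal_ennreal)
  also have "a - b = (\<integral>x. f x \<partial>M)" by (simp add: real_lebesgue_integral_def[OF f] a b)
  finally show ?thesis .
qed

lemma ext_integral_not_integrable:
  fixes f :: "'a \<Rightarrow> real"
  assumes f: "f \<in> borel_measurable M" "\<not> integrable M f" and fin: "(\<integral>\<^sup>+x. ennreal (f x) \<partial>M) < top"
  shows "ext_integral M (\<lambda>x. ereal (f x)) = - \<infinity>"
proof -
  have "(\<integral>\<^sup>+x. ennreal (- f x) \<partial>M) = top"
    using f fin by (auto simp: real_integrable_def)
  moreover obtain a where a: "0 \<le> a" "(\<integral>\<^sup>+x. ennreal (f x) \<partial>M) = ennreal a" using fin by (cases "\<integral>\<^sup>+x. ennreal (f x) \<partial>M") auto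
  moreover have "e2ennreal (ereal r) = ennreal r" for r by (simp add: e2ennreal_def ennreal_def)
  ultimately show ?thesis
    unfolding ext_integral_def uminus_ereal.simps by (simp add: enn2ereal_ennreal)
qed

context expanding_system
begin

section \<open>Invariant measures and their weights on fibres\<close>

lemma X0_nonempty: "X0 \<noteq> {}"
proof -
  obtain x where "x \<in> X" using X_nonempty by auto
  then obtain t where "t \<in> fib (Suc 0) x" using preimage_exists by blast
  then show ?thesis by (auto simp: fib_1)
qed

lemma X0_borel [measurable]: "X0 \<in> sets borel"
  using open_X0 by simp

definition base :: 'a where "base = (SOME y. y \<in> X0)"

lemma base: "base \<in> X0"
  unfolding base_def using X0_nonempty by (simp add: some_in_eq)

text \<open>A Borel map on the whole space that agrees with \<open>T\<close> on \<open>X0\<close>,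
  so that \<open>distr\<close> applies. Invariant measures do not see the complement of
  \<open>X0\<close>.\<close>

definition T' :: "'a \<Rightarrow> 'a" where "T' y = (if y \<in> X0 then T y else base)"

lemma T'_measurable [measurable]: "T' \<in> borel \<rightarrow>\<^sub>M borel"
proof (rule measurableI)
  fix A :: "'a set" assume A: "A \<in> sets borel"
  have "T' -` A \<inter> space borel = {y \<in> X0. T y \<in> A} \<union> (if base \<in> A then UNIV - X0 else {})"
    by (auto simp: T'_def split: if_splits)
  then show "T' -` A \<inter> space borel \<in> sets borel"
    using vimage_borel[OF A] X0_borel by (auto intro!: sets.Un)
qed simp

lemma invariantD:
  assumes "\<nu> \<in> invariant_measures X X0 T"
  shows "prob_space \<nu>" "sets \<nu> = sets borel" "AE x in \<nu>. x \<in> X0" "distr \<nu> borel T' = \<nu>"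
proof -
  show p: "prob_space \<nu>" and s: "sets \<nu> = sets borel" using assms by (auto simp: invariant_measures_def prob_measures_def)
  interpret prob_space \<nu> by fact
  note [measurable_cong] = s
  have sp: "space \<nu> = UNIV" using sets_eq_imp_space_eq[OF s] by simp
  have inv: "emeasure \<nu> {y \<in> X0. T y \<in> B} = emeasure \<nu> B" if "B \<in> sets borel" "B \<subseteq> X" for B
    using assms that by (auto simp: invariant_measures_def)
  have X: "emeasure \<nu> (UNIV - X) = 0" using assms by (simp add: invariant_measures_def prob_measures_def)
  have "UNIV - X \<in> null_sets \<nu>" by (rule null_setsI[OF X]) (simp add: s)
  then have AEX: "AE x in \<nu>. x \<in> X" using AE_not_in by fastforce
  \<comment> \<open>\<open>X0\<close> is the full preimage of \<open>X\<close> under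
    \<open>T\<close>, so invariance gives it the mass of \<open>X\<close>.\<close>
  have "emeasure \<nu> X0 = emeasure \<nu> {y \<in> X0. T y \<in> X}" using T_into by (intro arg_cong[where f="emeasure \<nu>"]) auto
  also have "\<dots> = emeasure \<nu> X" by (rule inv) auto
  also have "\<dots> = 1"
  proof -
    have "emeasure \<nu> X = emeasure \<nu> (space \<nu>)"
      using AEX s sp by (intro emeasure_eq_AE) auto
    then show ?thesis by (simp add: emeasure_space_1)
  qed
  finally have "prob X0 = 1" by (simp add: emeasure_eq_measure)
  then show AE0: "AE x in \<nu>. x \<in> X0" using s by (subst prob_eq_1[symmetric]) auto
  show "distr \<nu> borel T' = \<nu>"
  proof (rule measure_eqI)
    fix B assume "B \<in> sets (distr \<nu> borel T')"
    then have B[measurable]: "B \<in> sets borel" by simp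
    note [measurable] = vimage_borel[OF B]
    have "emeasure (distr \<nu> borel T') B = emeasure \<nu> (T' -` B \<inter> space \<nu>)"
      by (rule emeasure_distr) auto
    also have "\<dots> = emeasure \<nu> {y \<in> X0. T y \<in> B \<inter> X}"
    proof (rule emeasure_eq_AE)
      show "AE x in \<nu>. x \<in> T' -` B \<inter> space \<nu> \<longleftrightarrow> x \<in> {y \<in> X0. T y \<in> B \<inter> X}"
        using AE0 by eventually_elim (use T_into in \<open>auto simp: T'_def sp\<close>)
      show "T' -` B \<inter> space \<nu> \<in> sets \<nu>" by measurable
      show "{y \<in> X0. T y \<in> B \<inter> X} \<in> sets \<nu>" using vimage_borel[of "B \<inter> X"] s by simp
    qed
    also have "\<dots> = emeasure \<nu> (B \<inter> X)" by (rule inv) auto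
    also have "\<dots> = emeasure \<nu> B"
      using AEX s by (intro emeasure_eq_AE) auto
    finally show "emeasure (distr \<nu> borel T') B = emeasure \<nu> B" .
  qed (simp add: s)
qed

lemma invariant_nn_integral:
  assumes \<nu>: "\<nu> \<in> invariant_measures X X0 T" and G: "G \<in> borel_measurable borel"
  shows "(\<integral>\<^sup>+y. G (T y) * indicator X0 y \<partial>\<nu>) = (\<integral>\<^sup>+x. G x \<partial>\<nu>)"
proof -
  note [measurable_cong] = invariantD(2)[OF \<nu>]
  have "(\<integral>\<^sup>+x. G x \<partial>\<nu>) = (\<integral>\<^sup>+y. G (T' y) \<partial>\<nu>)"
    using G by (subst invariantD(4)[OF \<nu>, symmetric]) (auto intro: nn_integral_distr)
  also have "\<dots> = (\<integral>\<^sup>+y. G (T y) * indicator X0 y \<partial>\<nu>)"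
  proof (rule nn_integral_cong_AE)
    show "AE y in \<nu>. G (T' y) = G (T y) * indicator X0 y"
      using invariantD(3)[OF \<nu>] by eventually_elim (simp add: T'_def)
  qed
  finally show ?thesis by simp
qed

lemma invariant_AE:
  assumes \<nu>: "\<nu> \<in> invariant_measures X X0 T" and Q: "AE x in \<nu>. Q x"
  shows "AE y in \<nu>. Q (T y)"
proof -
  note [measurable_cong] = invariantD(2)[OF \<nu>]
  have "AE x in distr \<nu> borel T'. Q x" by (subst invariantD(4)[OF \<nu>]) (rule Q)
  then have "AE y in \<nu>. Q (T' y)" by (rule AE_distrD[rotated]) simp
  then show ?thesis using invariantD(3)[OF \<nu>] by eventually_elim (simp add: T'_def)
qed

text \<open>\<open>p y\<close> plays the role of the conditional probability of \<open>y\<close>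
  within the fibre of \<open>T y\<close>: the dual operator with weight \<open>p\<close> fixes
  \<open>\<nu>\<close>.\<close>

definition weights :: "'a measure \<Rightarrow> ('a \<Rightarrow> ennreal) \<Rightarrow> bool" where
  "weights \<nu> p \<longleftrightarrow> p \<in> borel_measurable borel \<and>
    (\<forall>F\<in>borel_measurable borel. (\<integral>\<^sup>+x. NL (\<lambda>y. p y * F y) x \<partial>\<nu>) = (\<integral>\<^sup>+x. F x \<partial>\<nu>))"

text \<open>\<open>T\<close> is invertible on \<open>piece i\<close>, and the image of
  \<open>\<nu>\<close> restricted to this piece is dominated by the image of \<open>\<nu>\<close>,
  which is \<open>\<nu>\<close>. Its Radon-Nikodym density, read at \<open>T y\<close>, is the
  weight of \<open>y\<close>.\<close>

lemma weights_exist: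
  assumes \<nu>: "\<nu> \<in> invariant_measures X X0 T"
  shows "\<exists>p. weights \<nu> p"
proof -
  interpret prob_space \<nu> by (rule invariantD(1)[OF \<nu>])
  note s = invariantD(2)[OF \<nu>]
  note [measurable_cong] = s
  have sp: "space \<nu> = UNIV" using sets_eq_imp_space_eq[OF s] by simp
  define \<mu> where "\<mu> i = distr (density \<nu> (indicator (piece i))) borel T'" for i
  define g where "g i = RN_deriv \<nu> (\<mu> i)" for i
  have s\<mu>: "sets (\<mu> i) = sets \<nu>" for i by (simp add: \<mu>_def s)
  have g_meas [measurable]: "g i \<in> borel_measurable borel" for i
    unfolding g_def using borel_measurable_RN_deriv[of \<nu> "\<mu> i"] by (simp add: measurable_cong_sets[OF s refl])
  have ac: "absolutely_continuous \<nu> (\<mu> i)" for i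
    unfolding absolutely_continuous_def
  proof
    fix N assume N: "N \<in> null_sets \<nu>"
    then have [measurable]: "N \<in> sets borel" using s by auto
    have "emeasure (\<mu> i) N = emeasure (density \<nu> (indicator (piece i))) (T' -` N)"
      unfolding \<mu>_def by (subst emeasure_distr) (auto simp: sp)
    also have "\<dots> = (\<integral>\<^sup>+y. indicator (piece i) y * indicator (T' -` N) y \<partial>\<nu>)"
      using measurable_sets[OF T'_measurable, of N] by (intro emeasure_density) (auto simp: s)
    also have "\<dots> \<le> (\<integral>\<^sup>+y. indicator (T' -` N) y \<partial>\<nu>)"
      by (intro nn_integral_mono) (auto simp: indicator_def)
    also have "\<dots> = emeasure \<nu> (T' -` N)"
      using measurable_sets[OF T'_measurable, of N] by (intro nn_integral_indicator) (auto simp: s)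
    also have "\<dots> = emeasure (distr \<nu> borel T') N" by (subst emeasure_distr) (auto simp: sp)
    also have "\<dots> = 0" using N invariantD(4)[OF \<nu>] by auto
    finally show "N \<in> null_sets (\<mu> i)" using s\<mu> s by (auto intro!: null_setsI)
  qed
  have dens: "density \<nu> (g i) = \<mu> i" for i unfolding g_def by (rule density_RN_deriv[OF ac s\<mu>])
  define p where "p y = (\<Sum>i. indicator (piece i) y * (g i (T y) * indicator X0 y))" for y
  have p_meas: "p \<in> borel_measurable borel"
  proof -
    have [measurable]: "(\<lambda>y. g i (T y) * indicator X0 y) \<in> borel_measurable borel" for i
      by (rule vimage_T_measurable[OF g_meas])
    show ?thesis unfolding p_def[abs_def] by measurable
  qed
  have p_piece: "p y = g i (T y)" if y: "y \<in> piece i" for y i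
  proof -
    have "indicator (piece j) y * (g j (T y) * indicator X0 y) = (if j = i then g i (T y) else 0)" for j
    proof (cases "j = i")
      case True
      then show ?thesis using y piece_sub by (auto simp: indicator_def)
    next
      case False
      then have "y \<notin> piece j" using y disj_piece unfolding disjoint_family_on_def by blast
      then show ?thesis using False by simp
    qed
    then show ?thesis unfolding p_def using suminf_finite[of "{i}" "\<lambda>j. if j = i then g i (T y) else 0"] by simp
  qed
  have "(\<integral>\<^sup>+x. NL (\<lambda>y. p y * F y) x \<partial>\<nu>) = (\<integral>\<^sup>+x. F x \<partial>\<nu>)" if F[measurable]: "F \<in> borel_measurable borel" for F
  proof -
    define G where "G i x = F (sct i x) * indicator (T ` piece i) x" for i x
    have G_meas [measurable]: "G i \<in> borel_measurable borel" for i
      unfolding G_def[abs_def] by (rule sct_comp_measurable[OF F])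
    have "(\<integral>\<^sup>+x. F x \<partial>\<nu>) = (\<integral>\<^sup>+y. (\<Sum>i. indicator (piece i) y * F y) \<partial>\<nu>)"
    proof (rule nn_integral_cong_AE)
      show "AE y in \<nu>. F y = (\<Sum>i. indicator (piece i) y * F y)"
        using invariantD(3)[OF \<nu>]
      proof eventually_elim
        case (elim y)
        then show ?case using suminf_indicator[OF disj_piece, of y] UN_piece
          by (simp add: ennreal_suminf_multc)
      qed
    qed
    also have "\<dots> = (\<Sum>i. \<integral>\<^sup>+y. indicator (piece i) y * F y \<partial>\<nu>)"
      by (rule nn_integral_suminf) measurable
    also have "\<dots> = (\<Sum>i. \<integral>\<^sup>+x. g i x * G i x \<partial>\<nu>)"
    proof (rule suminf_cong)
      fix i
      have "(\<integral>\<^sup>+y. indicator (piece i) y * F y \<partial>\<nu>) = (\<integral>\<^sup>+y. indicator (piece i) y * G i (T' y) \<partial>\<nu>)"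
        using piece_sub by (intro nn_integral_cong) (auto simp: indicator_def G_def T'_def sct_T)
      also have "\<dots> = (\<integral>\<^sup>+y. G i (T' y) \<partial>density \<nu> (indicator (piece i)))"
        by (rule nn_integral_density[symmetric]) measurable
      also have "\<dots> = (\<integral>\<^sup>+x. G i x \<partial>\<mu> i)"
        unfolding \<mu>_def by (rule nn_integral_distr[symmetric]) measurable
      also have "\<dots> = (\<integral>\<^sup>+x. g i x * G i x \<partial>\<nu>)"
        unfolding dens[symmetric] by (rule nn_integral_density) measurable
      finally show "(\<integral>\<^sup>+y. indicator (piece i) y * F y \<partial>\<nu>) = (\<integral>\<^sup>+x. g i x * G i x \<partial>\<nu>)" .
    qed
    also have "\<dots> = (\<integral>\<^sup>+x. (\<Sum>i. g i x * G i x) \<partial>\<nu>)"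
      by (rule nn_integral_suminf[symmetric]) measurable
    also have "\<dots> = (\<integral>\<^sup>+x. NL (\<lambda>y. p y * F y) x \<partial>\<nu>)"
    proof (intro nn_integral_cong)
      fix x
      have "g i x * G i x = p (sct i x) * F (sct i x) * indicator (T ` piece i) x" for i
      proof (cases "x \<in> T ` piece i")
        case True
        then obtain y where "y \<in> piece i" "x = T y" by blast
        then show ?thesis using p_piece[of y i] sct_T[of y i] by (simp add: G_def)
      qed (simp add: G_def)
      then show "(\<Sum>i. g i x * G i x) = NL (\<lambda>y. p y * F y) x" by (simp add: NL_sections)
    qed
    finally show ?thesis by simp
  qed
  then show ?thesis using p_meas by (auto simp: weights_def)
qed

lemma weights_m: "weights m gw"
  unfolding weights_def using transfer_m gw_measurable by blast

context
  fixes \<nu> p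
  assumes \<nu>: "\<nu> \<in> invariant_measures X X0 T" and p: "weights \<nu> p"
begin

lemma sets_\<nu> [measurable_cong]: "sets \<nu> = sets borel"
  by (rule invariantD(2)[OF \<nu>])

lemma space_\<nu>: "space \<nu> = UNIV"
  using sets_eq_imp_space_eq[OF sets_\<nu>] by simp

lemma p_meas [measurable]: "p \<in> borel_measurable borel"
  using p by (simp add: weights_def)

lemma p_int: "F \<in> borel_measurable borel \<Longrightarrow> (\<integral>\<^sup>+x. NL (\<lambda>y. p y * F y) x \<partial>\<nu>) = (\<integral>\<^sup>+x. F x \<partial>\<nu>)"
  using p by (simp add: weights_def)

text \<open>Testing the weights with functions of \<open>T y\<close> gives, by invariance, the
  integral of \<open>NL p\<close> over every Borel set.\<close>

lemma p_total: "AE x in \<nu>. NL p x = 1"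
proof -
  interpret prob_space \<nu> by (rule invariantD(1)[OF \<nu>])
  show ?thesis
  proof (rule density_unique_finite_measure)
    fix B assume "B \<in> sets \<nu>"
    then have [measurable]: "B \<in> sets borel" by (simp add: sets_\<nu>)
    have iB: "(indicator B :: 'a \<Rightarrow> ennreal) \<in> borel_measurable borel" by measurable
    have [measurable]: "(\<lambda>y. indicator B (T y) * indicator X0 y :: ennreal) \<in> borel_measurable borel"
      by (rule vimage_T_measurable[OF iB])
    have "(\<integral>\<^sup>+x. NL p x * indicator B x \<partial>\<nu>) = (\<integral>\<^sup>+x. NL (\<lambda>y. p y * (indicator B (T y) * indicator X0 y)) x \<partial>\<nu>)"
    proof (rule nn_integral_cong)
      fix x
      have "NL (\<lambda>y. p y * (indicator B (T y) * indicator X0 y)) x = NL (\<lambda>y. indicator B (T y) * p y) x"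
        by (rule NL_cong) (simp add: mult.commute)
      also have "\<dots> = indicator B x * NL p x" by (rule NL_pull_out)
      finally show "NL p x * indicator B x = NL (\<lambda>y. p y * (indicator B (T y) * indicator X0 y)) x"
        by (simp only: mult.commute)
    qed
    also have "\<dots> = (\<integral>\<^sup>+y. indicator B (T y) * indicator X0 y \<partial>\<nu>)" by (rule p_int) measurable
    also have "\<dots> = (\<integral>\<^sup>+x. 1 * indicator B x \<partial>\<nu>)" by (subst invariant_nn_integral[OF \<nu> iB]) simp
    finally show "(\<integral>\<^sup>+x. NL p x * indicator B x \<partial>\<nu>) = (\<integral>\<^sup>+x. 1 * indicator B x \<partial>\<nu>)" .
  qed auto
qed

lemma p_total_T: "AE y in \<nu>. NL p (T y) = 1"
  by (rule invariant_AE[OF \<nu> p_total])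

lemma p_pos: "AE y in \<nu>. 0 < p y"
proof -
  let ?Z = "{y. p y = 0}"
  have [measurable]: "?Z \<in> sets borel" by measurable
  have "NL (\<lambda>y. p y * indicator ?Z y) x = 0" for x
  proof -
    have "NL (\<lambda>y. p y * indicator ?Z y) x = NL (\<lambda>y. 0) x" by (rule NL_cong) (simp add: indicator_def)
    then show ?thesis by (simp add: NL_def)
  qed
  then have "emeasure \<nu> ?Z = 0" using p_int[of "indicator ?Z"] by (simp add: sets_\<nu>)
  then have "?Z \<in> null_sets \<nu>" by (intro null_setsI) (simp_all add: sets_\<nu>)
  then have "AE y in \<nu>. y \<notin> ?Z" by (rule AE_not_in)
  then show ?thesis by (auto simp: zero_less_iff_neq_zero)
qed

lemma p_le_NL: "y \<in> X0 \<Longrightarrow> p y \<le> NL p (T y)"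
  unfolding NL_def by (rule nn_integral_ge_point) (simp add: fib_1)

lemma p_le_1: "AE y in \<nu>. p y \<le> 1"
  using p_total_T invariantD(3)[OF \<nu>] by eventually_elim (use p_le_NL in force)

section \<open>Conditional probabilities along fibres\<close>

abbreviation "R \<equiv> restrict_space (borel :: 'a measure) X0"
abbreviation "FF \<equiv> vimage_algebra X0 T (restrict_space borel X)"
abbreviation "M0 \<equiv> restrict_space \<nu> X0"

lemma sets_R: "A \<in> sets R \<longleftrightarrow> A \<subseteq> X0 \<and> A \<in> sets borel"
  by (simp add: sets_restrict_space_iff)

lemma sets_M0: "sets M0 = sets R"
  by (rule sets_restrict_space_cong[OF sets_\<nu>])

lemma space_M0: "space M0 = X0"
  by (simp add: space_restrict_space space_\<nu>)

lemma AE_M0: "(AE y in M0. Q y) \<longleftrightarrow> (AE y in \<nu>. Q y)"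
proof -
  have "(AE y in M0. Q y) \<longleftrightarrow> (AE y in \<nu>. y \<in> X0 \<longrightarrow> Q y)"
    by (rule AE_restrict_space_iff) (simp add: space_\<nu> sets_\<nu>)
  also have "\<dots> \<longleftrightarrow> (AE y in \<nu>. Q y)"
    using invariantD(3)[OF \<nu>] by (auto elim: eventually_elim2)
  finally show ?thesis .
qed

lemma nn_integral_M0: "(\<integral>\<^sup>+y. f y \<partial>M0) = (\<integral>\<^sup>+y. f y * indicator X0 y \<partial>\<nu>)"
  by (rule nn_integral_restrict_space) (simp add: space_\<nu> sets_\<nu>)

lemma prob_M0: "prob_space M0"
proof (rule prob_spaceI)
  interpret prob_space \<nu> by (rule invariantD(1)[OF \<nu>])
  have "emeasure M0 (space M0) = emeasure \<nu> X0"
    by (simp add: space_M0 emeasure_restrict_space space_\<nu> sets_\<nu>)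
  also have "\<dots> = emeasure \<nu> (space \<nu>)"
    using invariantD(3)[OF \<nu>] by (intro emeasure_eq_AE) (auto simp: space_\<nu> sets_\<nu>)
  finally show "emeasure M0 (space M0) = 1" by (simp add: emeasure_space_1)
qed

lemma T_FF: "T \<in> FF \<rightarrow>\<^sub>M restrict_space borel X"
  by (rule measurable_vimage_algebra1) (use T_into in \<open>auto simp: space_restrict_space\<close>)

lemma sets_FF: "C \<in> sets FF \<longleftrightarrow> (\<exists>B\<in>sets borel. B \<subseteq> X \<and> C = {y \<in> X0. T y \<in> B})"
proof -
  have "sets FF = {T -` B \<inter> X0 | B. B \<in> sets (restrict_space borel X)}"
    by (rule sets_vimage_algebra2) (use T_into in \<open>auto simp: space_restrict_space\<close>)
  moreover have "T -` B \<inter> X0 = {y \<in> X0. T y \<in> B}" for B by auto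
  ultimately show ?thesis by (auto simp: sets_restrict_space_iff)
qed

lemma FF_sub: "finite_measure_subalgebra M0 FF"
proof -
  interpret prob_space M0 by (rule prob_M0)
  show ?thesis
  proof
    show "subalgebra M0 FF"
      unfolding subalgebra_def
    proof (intro conjI subsetI)
      fix C assume "C \<in> sets FF"
      then obtain B where "B \<in> sets borel" "C = {y \<in> X0. T y \<in> B}" using iffD1[OF sets_FF] by blast
      then show "C \<in> sets M0" unfolding sets_M0 sets_R using vimage_borel[of B] by auto
    qed (simp add: space_M0)
  qed
qed

text \<open>The fibre of \<open>T y\<close> with the weights \<open>p\<close>. Where they do not sum
  to 1, a null set by \<open>p_total_T\<close>, a point mass is substituted, because
  \<open>prob_algebra\<close> demands a probability measure at every point.\<close>

definition ker :: "'a \<Rightarrow> 'a measure" where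
  "ker y = (if NL p (T y) = 1 then distr (density (count_space (fib (Suc 0) (T y))) p) R id else return R base)"

lemma emeasure_ker:
  assumes A: "A \<in> sets R"
  shows "emeasure (ker y) A = (if NL p (T y) = 1 then NL (\<lambda>z. p z * indicator A z) (T y) else indicator A base)"
proof (cases "NL p (T y) = 1")
  case True
  have id: "id \<in> density (count_space (fib (Suc 0) (T y))) p \<rightarrow>\<^sub>M R"
    by (auto simp: measurable_def fib_1 space_restrict_space)
  have "emeasure (ker y) A = emeasure (density (count_space (fib (Suc 0) (T y))) p) (A \<inter> fib (Suc 0) (T y))"
    unfolding ker_def using True A by (simp add: emeasure_distr[OF id])
  also have "\<dots> = (\<integral>\<^sup>+z. p z * indicator (A \<inter> fib (Suc 0) (T y)) z \<partial>count_space (fib (Suc 0) (T y)))"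
    by (rule emeasure_density) auto
  also have "\<dots> = NL (\<lambda>z. p z * indicator A z) (T y)"
    unfolding NL_def by (intro nn_integral_cong) (simp add: indicator_def)
  finally show ?thesis using True by simp
next
  case False
  then show ?thesis using A by (simp add: ker_def)
qed

lemma sets_ker: "sets (ker y) = sets R"
  by (simp add: ker_def)

lemma prob_ker: "prob_space (ker y)"
proof (rule prob_spaceI)
  have sp: "space (ker y) = X0" using sets_eq_imp_space_eq[OF sets_ker] by (simp add: space_restrict_space)
  have "NL (\<lambda>z. p z * indicator X0 z) (T y) = NL p (T y)" by (rule NL_cong) simp
  then show "emeasure (ker y) (space (ker y)) = 1"
    unfolding sp using base by (subst emeasure_ker) (auto simp: sets_R)
qed

text \<open>The kernel depends on \<open>y\<close> through \<open>T y\<close> only. As Borel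
  functions of \<open>T y\<close> its values are measurable for the pullback sigma-algebra.\<close>

lemma emeasure_ker_comp:
  assumes A: "A \<in> sets R"
  shows "\<exists>G. G \<in> borel_measurable borel \<and> (\<forall>y. emeasure (ker y) A = G (T y)) \<and>
    (AE x in \<nu>. G x = NL (\<lambda>z. p z * indicator A z) x)"
proof -
  have [measurable]: "A \<in> sets borel" using A by (simp add: sets_R)
  let ?G = "\<lambda>x. if NL p x = 1 then NL (\<lambda>z. p z * indicator A z) x else indicator A base"
  have "?G \<in> borel_measurable borel" by measurable
  moreover have "AE x in \<nu>. ?G x = NL (\<lambda>z. p z * indicator A z) x"
    using p_total by eventually_elim simp
  ultimately show ?thesis using emeasure_ker[OF A] by (intro exI[of _ ?G]) simp
qed

lemma ker_cond_probs: "cond_probs X X0 T \<nu> ker"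
  unfolding cond_probs_def Let_def
proof (intro conjI ballI)
  have FFm: "(\<lambda>y. emeasure (ker y) A) \<in> borel_measurable FF" if A: "A \<in> sets R" for A
  proof -
    obtain G where G: "G \<in> borel_measurable borel" "\<And>y. emeasure (ker y) A = G (T y)"
      using emeasure_ker_comp[OF A] by blast
    show ?thesis unfolding G(2)
      by (rule measurable_compose[OF T_FF measurable_restrict_space1[OF G(1)]])
  qed
  show "ker \<in> FF \<rightarrow>\<^sub>M prob_algebra R"
    by (intro measurable_prob_algebraI measurable_subprob_algebra prob_ker sets_ker FFm
        prob_space_imp_subprob_space)
  interpret FS: finite_measure_subalgebra M0 FF by (rule FF_sub)
  fix A assume "A \<in> sets M0"
  then have A: "A \<in> sets R" by (simp add: sets_M0)
  then have [measurable]: "A \<in> sets borel" by (simp add: sets_R)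
  obtain G where G[measurable]: "G \<in> borel_measurable borel" and GT: "\<And>y. emeasure (ker y) A = G (T y)"
    and GN: "AE x in \<nu>. G x = NL (\<lambda>z. p z * indicator A z) x"
    using emeasure_ker_comp[OF A] by blast
  have "AE y in M0. emeasure (ker y) A = nn_cond_exp M0 FF (\<lambda>y. ennreal (indicator A y)) y"
  proof (rule FS.nn_cond_exp_charact)
    show "(\<lambda>y. emeasure (ker y) A) \<in> borel_measurable FF" by (rule FFm[OF A])
    show "(\<lambda>y. ennreal (indicator A y)) \<in> borel_measurable M0"
      by (rule measurable_restrict_space1) measurable
    fix C assume "C \<in> sets FF"
    then obtain B where B: "B \<in> sets borel" "B \<subseteq> X" and C: "C = {y \<in> X0. T y \<in> B}" by (auto simp: sets_FF)
    note [measurable] = B(1)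
    have C_meas [measurable]: "C \<in> sets borel" unfolding C by (rule vimage_borel[OF B(1)])
    have "(\<integral>\<^sup>+y\<in>C. emeasure (ker y) A \<partial>M0) = (\<integral>\<^sup>+y. (indicator B (T y) * G (T y)) * indicator X0 y \<partial>\<nu>)"
      unfolding nn_integral_M0 GT by (intro nn_integral_cong) (auto simp: C indicator_def)
    also have "\<dots> = (\<integral>\<^sup>+x. indicator B x * G x \<partial>\<nu>)"
      by (rule invariant_nn_integral[OF \<nu>, of "\<lambda>x. indicator B x * G x"]) measurable
    also have "\<dots> = (\<integral>\<^sup>+x. NL (\<lambda>y. p y * (indicator A y * indicator C y)) x \<partial>\<nu>)"
    proof (rule nn_integral_cong_AE)
      show "AE x in \<nu>. indicator B x * G x = NL (\<lambda>y. p y * (indicator A y * indicator C y)) x"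
        using GN
      proof eventually_elim
        case (elim x)
        have "NL (\<lambda>y. p y * (indicator A y * indicator C y)) x = NL (\<lambda>y. indicator B (T y) * (p y * indicator A y)) x"
          by (rule NL_cong) (simp add: C indicator_def)
        also have "\<dots> = indicator B x * NL (\<lambda>y. p y * indicator A y) x" by (rule NL_pull_out)
        finally show ?case using elim by simp
      qed
    qed
    also have "\<dots> = (\<integral>\<^sup>+y. indicator A y * indicator C y \<partial>\<nu>)" by (rule p_int) measurable
    also have "\<dots> = (\<integral>\<^sup>+y\<in>C. ennreal (indicator A y) \<partial>M0)"
      unfolding nn_integral_M0 using C by (intro nn_integral_cong) (auto simp: indicator_def)
    finally show "(\<integral>\<^sup>+y\<in>C. ennreal (indicator A y) \<partial>M0) = (\<integral>\<^sup>+y\<in>C. emeasure (ker y) A \<partial>M0)" by simp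
  qed
  \<comment> \<open>\<open>real_cond_exp\<close> is the difference of the conditional expectations
    of the positive and the negative part; for an indicator the latter is 0.\<close>
  moreover have "AE y in M0. 0 = nn_cond_exp M0 FF (\<lambda>y. ennreal (- indicator A y)) y"
  proof (rule FS.nn_cond_exp_charact)
    show "(\<lambda>y. ennreal (- indicator A y)) \<in> borel_measurable M0"
      by (rule measurable_restrict_space1) measurable
    have "ennreal (- indicator A y) = 0" for y by (simp add: indicator_def ennreal_neg)
    then show "(\<integral>\<^sup>+y\<in>C. ennreal (- indicator A y) \<partial>M0) = (\<integral>\<^sup>+y\<in>C. 0 \<partial>M0)" for C by simp
  qed simp
  ultimately show "AE y in M0. measure (ker y) A = real_cond_exp M0 FF (indicator A) y"
    by eventually_elim (simp add: real_cond_exp_def measure_def)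
qed

text \<open>\<open>cond_information\<close> uses an arbitrarily chosen system, so all systems must
  give \<open>{y}\<close> the same mass almost everywhere. Outside a null set two systems agree on
  countably many balls, and these determine the mass of a point.\<close>

lemma cond_probs_point:
  assumes \<kappa>: "cond_probs X X0 T \<nu> \<kappa>"
  shows "AE y in \<nu>. measure (\<kappa> y) {y} = enn2real (p y)"
proof -
  have \<kappa>1: "\<kappa> \<in> FF \<rightarrow>\<^sub>M prob_algebra R"
    and \<kappa>2: "\<And>A. A \<in> sets M0 \<Longrightarrow> AE y in M0. measure (\<kappa> y) A = real_cond_exp M0 FF (indicator A) y"
    using \<kappa> unfolding cond_probs_def Let_def by auto
  have ker2: "AE y in M0. measure (ker y) A = real_cond_exp M0 FF (indicator A) y" if "A \<in> sets M0" for A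
    using ker_cond_probs that unfolding cond_probs_def Let_def by auto
  have "\<forall>k. \<exists>E. finite E \<and> E \<subseteq> X \<and> (\<forall>x :: 'a. \<exists>e\<in>E. dist e x < inverse (real (Suc k)))"
  proof
    fix k :: nat
    have "0 < inverse (real (Suc k))" by simp
    then show "\<exists>E. finite E \<and> E \<subseteq> X \<and> (\<forall>x :: 'a. \<exists>e\<in>E. dist e x < inverse (real (Suc k)))"
      by (metis finite_net)
  qed
  then obtain E :: "nat \<Rightarrow> 'a set" where E: "\<And>k. finite (E k)" "\<And>k x. \<exists>e\<in>E k. dist e x < inverse (real (Suc k))"
    using choice[of "\<lambda>k E. finite E \<and> E \<subseteq> X \<and> (\<forall>x :: 'a. \<exists>e\<in>E. dist e x < inverse (real (Suc k)))"] by blast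
  have "AE y in M0. \<forall>k. \<forall>e\<in>E k. measure (\<kappa> y) (ball e (inverse (real (Suc k))) \<inter> X0)
      = measure (ker y) (ball e (inverse (real (Suc k))) \<inter> X0)"
  proof (subst AE_all_countable, intro allI AE_ball_countable' countable_finite E)
    fix k e
    have "ball e (inverse (real (Suc k))) \<inter> X0 \<in> sets M0" by (simp add: sets_M0 sets_R)
    from \<kappa>2[OF this] ker2[OF this]
    show "AE y in M0. measure (\<kappa> y) (ball e (inverse (real (Suc k))) \<inter> X0)
      = measure (ker y) (ball e (inverse (real (Suc k))) \<inter> X0)" by eventually_elim simp
  qed
  then have "AE y in \<nu>. \<forall>k. \<forall>e\<in>E k. measure (\<kappa> y) (ball e (inverse (real (Suc k))) \<inter> X0)
      = measure (ker y) (ball e (inverse (real (Suc k))) \<inter> X0)" by (simp only: AE_M0)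
  then show ?thesis using p_total_T invariantD(3)[OF \<nu>]
  proof eventually_elim
    case (elim y)
    have "y \<in> space FF" using elim(3) by simp
    then have "\<kappa> y \<in> space (prob_algebra R)" using \<kappa>1 by (rule measurable_space[rotated])
    then have k: "prob_space (\<kappa> y)" "sets (\<kappa> y) = sets R" by (auto simp: space_prob_algebra)
    have f: "finite_measure (\<kappa> y)" "finite_measure (ker y)"
      using k(1) prob_ker by (auto simp: prob_space_def)
    have "measure (\<kappa> y) {y} = measure (ker y) {y}"
      using elim(1)
      by (intro antisym finite_measures_singleton_le[OF f k(2) sets_ker X0_borel elim(3) E(2)]
          finite_measures_singleton_le[OF f(2,1) sets_ker k(2) X0_borel elim(3) E(2)]) auto
    also have "\<dots> = enn2real (p y)"
    proof -
      have "NL (\<lambda>z. p z * indicator {y} z) (T y) = p y"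
      proof -
        have "NL (\<lambda>z. p z * indicator {y} z) (T y) = (\<integral>\<^sup>+z. p z \<partial>count_space {y})"
          unfolding NL_def using elim(3)
          by (subst nn_integral_count_space_eq[where B="{y}"]) (auto simp: fib_1 nn_integral_count_space_finite)
        then show ?thesis by (simp add: nn_integral_count_space_finite)
      qed
      then show ?thesis
        using emeasure_ker[of "{y}" y] elim(2,3) by (simp add: measure_def sets_R)
    qed
    finally show ?case .
  qed
qed

lemma info_energy_weights:
  "info_energy X X0 T \<phi> \<nu> = ext_integral M0 (\<lambda>y. ereal (- ln (enn2real (p y)) + \<phi> y))"
  unfolding info_energy_def
proof (rule ext_integral_cong_AE)
  have "cond_probs X X0 T \<nu> (SOME \<kappa>. cond_probs X X0 T \<nu> \<kappa>)"
    by (rule someI[where P="cond_probs X X0 T \<nu>", OF ker_cond_probs])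
  from cond_probs_point[OF this]
  have "AE y in \<nu>. cond_information X X0 T \<nu> y + ereal (\<phi> y) = ereal (- ln (enn2real (p y)) + \<phi> y)"
    using p_pos p_le_1
  proof eventually_elim
    case (elim y)
    have "enn2real (p y) \<noteq> 0"
      using elim(2,3) by (metis enn2real_eq_0_iff ennreal_one_less_top le_less_trans less_irrefl)
    then show ?case using elim(1) by (simp add: cond_information_def Let_def)
  qed
  then show "AE y in M0. cond_information X X0 T \<nu> y + ereal (\<phi> y) = ereal (- ln (enn2real (p y)) + \<phi> y)"
    by (simp only: AE_M0)
qed

lemma phi_meas_M0 [measurable]: "\<phi> \<in> borel_measurable M0"
proof -
  have "continuous_on X0 \<phi>" using adm by (simp add: admissible_def)
  then have "\<phi> \<in> borel_measurable R" by (rule borel_measurable_continuous_on_restrict)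
  then show ?thesis by (simp add: measurable_cong_sets[OF sets_M0 refl])
qed

lemma T_meas_M0 [measurable]: "T \<in> M0 \<rightarrow>\<^sub>M borel"
proof -
  have "T \<in> R \<rightarrow>\<^sub>M borel" by (rule borel_measurable_continuous_on_restrict[OF contT])
  then show ?thesis by (simp add: measurable_cong_sets[OF sets_M0 refl])
qed

lemma borel_M0: "f \<in> borel_measurable borel \<Longrightarrow> f \<in> borel_measurable M0"
  by (rule measurable_restrict_space1) (simp add: measurable_cong_sets[OF sets_\<nu> refl])

section \<open>The entropy inequality and the case of equality\<close>

definition cob :: "'a \<Rightarrow> real" where "cob y = ln (h (T y)) - ln (h y)"

text \<open>\<open>ln h\<close> is continuous on a compact space, hence integrable, and by
  invariance its composition with \<open>T\<close> has the same integral.\<close>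

lemma cob_integral: "integrable M0 cob" "(\<integral>y. cob y \<partial>M0) = 0"
proof -
  interpret \<nu>: prob_space \<nu> by (rule invariantD(1)[OF \<nu>])
  have cl: "continuous_on UNIV (\<lambda>x. ln (h x))"
    using mix.h_pos by (intro continuous_on_ln mix.h_cont) (auto simp: less_imp_neq[symmetric])
  have lm[measurable]: "(\<lambda>x. ln (h x)) \<in> borel_measurable borel" by (rule cont_borel[OF cl])
  have i: "integrable \<nu> (\<lambda>x. ln (h x))"
    by (rule integrable_continuous_compact[OF compact_UNIV \<nu>.finite_measure_axioms sets_\<nu> cl])
  have "integrable (distr \<nu> borel T') (\<lambda>x. ln (h x))" using i by (simp add: invariantD(4)[OF \<nu>])
  then have iT: "integrable \<nu> (\<lambda>y. ln (h (T' y)))" by (subst (asm) integrable_distr_eq) auto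
  have eqT: "(\<integral>y. ln (h (T' y)) \<partial>\<nu>) = (\<integral>x. ln (h x) \<partial>\<nu>)"
    using integral_distr[of T' \<nu> borel "\<lambda>x. ln (h x)"] by (simp add: invariantD(4)[OF \<nu>])
  have X0s: "X0 \<inter> space \<nu> \<in> sets \<nu>" by (simp add: space_\<nu> sets_\<nu>)
  have cobM: "cob \<in> borel_measurable M0" unfolding cob_def[abs_def]
    using measurable_compose[OF T_meas_M0 lm] borel_M0[OF lm] by (intro borel_measurable_diff) auto
  have indm: "(\<lambda>y. indicator X0 y *\<^sub>R cob y) \<in> borel_measurable \<nu>"
    using cobM by (subst (asm) borel_measurable_restrict_space_iff[OF X0s])
  have ae: "AE y in \<nu>. indicator X0 y *\<^sub>R cob y = ln (h (T' y)) - ln (h y)"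
    using invariantD(3)[OF \<nu>] by eventually_elim (simp add: cob_def T'_def)
  have id: "integrable \<nu> (\<lambda>y. ln (h (T' y)) - ln (h y))" using i iT by simp
  have "integrable \<nu> (\<lambda>y. indicator X0 y *\<^sub>R cob y)"
    using integrable_cong_AE[OF indm borel_measurable_integrable[OF id] ae] id by simp
  then show "integrable M0 cob" by (subst integrable_restrict_space[OF X0s])
  have "(\<integral>y. cob y \<partial>M0) = (\<integral>y. indicator X0 y *\<^sub>R cob y \<partial>\<nu>)"
    by (rule integral_restrict_space[OF X0s])
  also have "\<dots> = (\<integral>y. ln (h (T' y)) - ln (h y) \<partial>\<nu>)"
    by (rule integral_cong_AE[OF indm borel_measurable_integrable[OF id] ae])
  finally show "(\<integral>y. cob y \<partial>M0) = 0" using i iT eqT by simp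
qed

definition quot :: "'a \<Rightarrow> real" where "quot y = exp (psi y) / enn2real (p y)"

lemma quot_props: "AE y in M0. 0 < quot y \<and> - ln (enn2real (p y)) + \<phi> y = ln (quot y) + ln lam + cob y"
  unfolding AE_M0 using p_pos p_le_1
proof eventually_elim
  case (elim y)
  have q: "0 < enn2real (p y)"
    using elim by (metis enn2real_positive_iff ennreal_one_less_top le_less_trans)
  then have "ln (quot y) = psi y - ln (enn2real (p y))" by (simp add: quot_def ln_div)
  then show ?case using q by (simp add: quot_def psi_def cob_def)
qed

lemma quot_meas [measurable]: "quot \<in> borel_measurable M0"
proof -
  have lm: "(\<lambda>x. ln (h x)) \<in> borel_measurable borel" by measurable
  have [measurable]: "(\<lambda>y. ln (h (T y))) \<in> borel_measurable M0" "(\<lambda>y. ln (h y)) \<in> borel_measurable M0"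
    "(\<lambda>y. enn2real (p y)) \<in> borel_measurable M0"
    using measurable_compose[OF T_meas_M0 lm] borel_M0[OF lm] borel_M0[of "\<lambda>y. enn2real (p y)"] by auto
  show ?thesis unfolding quot_def[abs_def] psi_def by measurable
qed

text \<open>By the defining equation of the weights, the integral of \<open>exp psi / p\<close> is
  the integral of fibre sums of \<open>exp psi\<close> over points where \<open>p\<close> is
  positive and finite. Since \<open>exp psi\<close> sums to 1 on each full fibre, this is at most
  1.\<close>

lemma quot_integral: "integrable M0 quot" "(\<integral>y. quot y \<partial>M0) \<le> 1"
proof -
  interpret \<nu>: prob_space \<nu> by (rule invariantD(1)[OF \<nu>])
  have q0: "0 \<le> quot y" for y by (simp add: quot_def)
  have "(\<integral>\<^sup>+y. ennreal (quot y) \<partial>M0) = (\<integral>\<^sup>+y. gw y * inverse (p y) \<partial>\<nu>)"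
    unfolding nn_integral_M0
  proof (rule nn_integral_cong_AE)
    show "AE y in \<nu>. ennreal (quot y) * indicator X0 y = gw y * inverse (p y)"
      using p_pos p_le_1 invariantD(3)[OF \<nu>]
    proof eventually_elim
      case (elim y)
      obtain r where r: "p y = ennreal r" "0 < r"
        using elim(1,2) by (cases "p y") (auto simp: top_unique)
      have "0 \<le> exp (\<phi> y) * h y / (lam * h (T y))" unfolding exp_psi[symmetric] by simp
      then show ?case using elim(3) r
        by (simp add: quot_def gw_eq exp_psi inverse_ennreal divide_inverse ennreal_mult')
    qed
  qed
  also have "\<dots> = (\<integral>\<^sup>+x. NL (\<lambda>y. p y * (gw y * inverse (p y))) x \<partial>\<nu>)"
    by (rule p_int[symmetric]) measurable
  also have "\<dots> \<le> (\<integral>\<^sup>+x. 1 \<partial>\<nu>)"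
  proof (rule nn_integral_mono_AE)
    have "AE x in \<nu>. x \<in> X" using invariantD(3)[OF \<nu>] by eventually_elim (use X0_sub in auto)
    then show "AE x in \<nu>. NL (\<lambda>y. p y * (gw y * inverse (p y))) x \<le> 1"
    proof eventually_elim
      case (elim x)
      have "NL (\<lambda>y. p y * (gw y * inverse (p y))) x \<le> NL gw x"
      proof (rule NL_mono)
        fix y
        have "p y * inverse (p y) \<le> 1"
        \<comment> \<open>In both exceptional cases the product is 0, because 0 times infinity is 0
          in \<open>ennreal\<close>.\<close>
        proof (cases "p y = 0 \<or> p y = top")
          case False
          then have "p y * inverse (p y) = 1" by (simp add: divide_ennreal_def[symmetric] ennreal_divide_self less_top)
          then show ?thesis by simp
        qed auto
        then have "gw y * (p y * inverse (p y)) \<le> gw y * 1" by (rule mult_left_mono) simp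
        then show "p y * (gw y * inverse (p y)) \<le> gw y" by (simp add: mult_ac)
      qed
      then show ?case using NL_gw[OF elim] by simp
    qed
  qed
  also have "\<dots> = 1" by (simp add: \<nu>.emeasure_space_1)
  finally have le: "(\<integral>\<^sup>+y. ennreal (quot y) \<partial>M0) \<le> 1" .
  show i: "integrable M0 quot"
    using le q0 by (intro integrableI_nonneg) (auto intro: le_less_trans)
  show "(\<integral>y. quot y \<partial>M0) \<le> 1"
    using le nn_integral_eq_integral[OF i] q0 by simp
qed

lemma info_energy_quot: "info_energy X X0 T \<phi> \<nu> = ext_integral M0 (\<lambda>y. ereal (ln (quot y) + ln lam + cob y))"
  unfolding info_energy_weights
  by (rule ext_integral_cong_AE) (use quot_props in \<open>auto elim: eventually_mono\<close>)

lemma info_energy_le: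
  "info_energy X X0 T \<phi> \<nu> \<le> ereal (ln lam) \<and>
    (info_energy X X0 T \<phi> \<nu> = ereal (ln lam) \<longrightarrow> (AE y in \<nu>. quot y = 1))"
proof -
  interpret M0: prob_space M0 by (rule prob_M0)
  let ?f = "\<lambda>y. ln (quot y) + ln lam + cob y"
  have cm [measurable]: "cob \<in> borel_measurable M0" by (rule borel_measurable_integrable[OF cob_integral(1)])
  have fm: "?f \<in> borel_measurable M0" by measurable
  have pos: "AE y in M0. 0 < quot y" using quot_props by (rule eventually_mono) auto
  have up: "AE y in M0. ln (quot y) \<le> quot y - 1" using pos
  proof eventually_elim
    case (elim y)
    then show ?case by (rule ln_le_minus_one)
  qed
  show ?thesis
  proof (cases "integrable M0 ?f")
    case True
    have il: "integrable M0 (\<lambda>y. ln (quot y))"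
    proof -
      have "integrable M0 (\<lambda>y. ?f y - (ln lam + cob y))" using True cob_integral(1) by (intro Bochner_Integration.integrable_diff) auto
      then show ?thesis by simp
    qed
    have "(\<integral>y. ?f y \<partial>M0) = (\<integral>y. ln (quot y) \<partial>M0) + ln lam"
      using il cob_integral M0.prob_space by (simp add: space_M0)
    then have e: "info_energy X X0 T \<phi> \<nu> = ereal ((\<integral>y. ln (quot y) \<partial>M0) + ln lam)"
      unfolding info_energy_quot by (simp add: ext_integral_real[OF True])
    have iq: "integrable M0 (\<lambda>y. quot y - 1 - ln (quot y))" using il quot_integral(1) by simp
    have nn: "AE y in M0. 0 \<le> quot y - 1 - ln (quot y)" using up by eventually_elim simp
    have iv: "(\<integral>y. quot y - 1 - ln (quot y) \<partial>M0) = (\<integral>y. quot y \<partial>M0) - 1 - (\<integral>y. ln (quot y) \<partial>M0)"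
      using il quot_integral(1) M0.prob_space by (simp add: space_M0)
    have "0 \<le> (\<integral>y. quot y - 1 - ln (quot y) \<partial>M0)" by (rule integral_nonneg_AE[OF nn])
    then have "(\<integral>y. ln (quot y) \<partial>M0) \<le> 0" using iv quot_integral(2) by simp
    moreover have "AE y in \<nu>. quot y = 1" if z: "(\<integral>y. ln (quot y) \<partial>M0) = 0"
    proof -
      have "(\<integral>y. quot y - 1 - ln (quot y) \<partial>M0) = 0"
        using iv quot_integral(2) z \<open>0 \<le> (\<integral>y. quot y - 1 - ln (quot y) \<partial>M0)\<close> by linarith
      then have "AE y in M0. quot y - 1 - ln (quot y) = 0"
        by (simp add: integral_nonneg_eq_0_iff_AE[OF iq nn])
      then have "AE y in M0. quot y = 1"
        using pos
      proof eventually_elim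
        case (elim y)
        then have "ln (quot y) = quot y - 1" by simp
        then show ?case using elim(2) by (rule ln_eq_minus_one[rotated])
      qed
      then show ?thesis by (simp only: AE_M0)
    qed
    ultimately show ?thesis unfolding e by auto
  next
    \<comment> \<open>The positive part of the integrand is dominated by an integrable function, so
      failure of integrability comes from the negative part and the value is
      \<open>- \<infinity>\<close>.\<close>
    case False
    have "(\<integral>\<^sup>+y. ennreal (?f y) \<partial>M0) < top"
    proof -
      have ib: "integrable M0 (\<lambda>y. quot y + \<bar>ln lam\<bar> + \<bar>cob y\<bar>)" using quot_integral(1) cob_integral(1) by auto
      have "(\<integral>\<^sup>+y. ennreal (?f y) \<partial>M0) \<le> (\<integral>\<^sup>+y. ennreal (quot y + \<bar>ln lam\<bar> + \<bar>cob y\<bar>) \<partial>M0)"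
      proof (rule nn_integral_mono_AE)
        show "AE y in M0. ennreal (?f y) \<le> ennreal (quot y + \<bar>ln lam\<bar> + \<bar>cob y\<bar>)"
          using up
        proof eventually_elim
          case (elim y)
          then have "?f y \<le> quot y + \<bar>ln lam\<bar> + \<bar>cob y\<bar>" by linarith
          then show ?case by (rule ennreal_leI)
        qed
      qed
      also have "\<dots> < top"
        using ib by (auto simp: real_integrable_def less_top)
      finally show ?thesis .
    qed
    then have "info_energy X X0 T \<phi> \<nu> = - \<infinity>"
      unfolding info_energy_quot by (rule ext_integral_not_integrable[OF fm False])
    then show ?thesis by simp
  qed
qed

lemma quot_one_imp_gw:
  assumes "AE y in \<nu>. quot y = 1"
  shows "AE y in \<nu>. gw y = p y"
  using assms p_pos p_le_1 invariantD(3)[OF \<nu>]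
proof eventually_elim
  case (elim y)
  obtain r where r: "p y = ennreal r" "0 < r"
    using elim(2,3) by (cases "p y") (auto simp: top_unique)
  then have "exp (psi y) = r" using elim(1) by (simp add: quot_def)
  then show ?case using elim(4) r by (simp add: gw_eq exp_psi)
qed

text \<open>Equality of \<open>gw\<close> and \<open>p\<close> almost everywhere does not exclude
  fibre points with \<open>p = 0 < gw\<close>. So at first the integral of \<open>f\<close> is only
  bounded by that of \<open>P f\<close>. Applied to \<open>B - f\<close>, where \<open>P\<close>
  fixes constants, this becomes an equality, and the iterates of \<open>P\<close> converge to the
  integral against \<open>m\<close>.\<close>

lemma equilibrium_unique:
  assumes eq: "AE y in \<nu>. gw y = p y"
  shows "\<nu> = m"
proof -
  interpret \<nu>: prob_space \<nu> by (rule invariantD(1)[OF \<nu>])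
  let ?G = "{y. gw y = p y}"
  have G[measurable]: "?G \<in> sets borel" by measurable
  have le: "(\<integral>\<^sup>+x. F x \<partial>\<nu>) \<le> (\<integral>\<^sup>+x. NL (\<lambda>y. gw y * F y) x \<partial>\<nu>)" if [measurable]: "F \<in> borel_measurable borel" for F
  proof -
    have "(\<integral>\<^sup>+x. F x \<partial>\<nu>) = (\<integral>\<^sup>+x. F x * indicator ?G x \<partial>\<nu>)"
      using eq by (intro nn_integral_cong_AE) (auto elim!: eventually_mono)
    also have "\<dots> = (\<integral>\<^sup>+x. NL (\<lambda>y. p y * (F y * indicator ?G y)) x \<partial>\<nu>)"
      by (rule p_int[symmetric]) measurable
    also have "\<dots> \<le> (\<integral>\<^sup>+x. NL (\<lambda>y. gw y * F y) x \<partial>\<nu>)"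
      by (intro nn_integral_mono NL_mono) (auto simp: indicator_def)
    finally show ?thesis .
  qed
  have int: "integrable \<nu> f" if "continuous_on UNIV f" for f :: "'a \<Rightarrow> real"
    by (rule integrable_continuous_compact[OF compact_UNIV \<nu>.finite_measure_axioms sets_\<nu> that])
  have AEX: "AE x in \<nu>. x \<in> X" using invariantD(3)[OF \<nu>] by eventually_elim (use X0_sub in auto)
  have leP: "(\<integral>x. f x \<partial>\<nu>) \<le> (\<integral>x. P f x \<partial>\<nu>)"
    if f: "continuous_on UNIV f" "\<And>x. 0 \<le> f x" for f
  proof -
    have fm: "(\<lambda>x. ennreal (f x)) \<in> borel_measurable borel" using cont_borel[OF f(1)] by measurable
    have c: "continuous_on UNIV (\<lambda>y. h y * f y)" by (intro continuous_intros mix.h_cont f)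
    have hf: "0 \<le> h y * f y" for y using f(2) mix.h_pos by (simp add: less_imp_le)
    have "ennreal (\<integral>x. f x \<partial>\<nu>) = (\<integral>\<^sup>+x. ennreal (f x) \<partial>\<nu>)"
      using nn_integral_eq_integral[OF int[OF f(1)]] f(2) by simp
    also have "\<dots> \<le> (\<integral>\<^sup>+x. NL (\<lambda>y. gw y * ennreal (f y)) x \<partial>\<nu>)" by (rule le[OF fm])
    also have "\<dots> = (\<integral>\<^sup>+x. ennreal (P f x) \<partial>\<nu>)"
    proof (rule nn_integral_cong_AE)
      show "AE x in \<nu>. NL (\<lambda>y. gw y * ennreal (f y)) x = ennreal (P f x)"
        using AEX
      proof eventually_elim
        case (elim x)
        have "NL (\<lambda>y. gw y * ennreal (f y)) x = NL (\<lambda>y. ennreal (inverse (lam * h x)) * (wt y * ennreal (h y * f y))) x"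
          using f(2) mix.h_pos by (intro NL_cong) (simp add: gw_def mult_ac ennreal_mult less_imp_le)
        also have "\<dots> = ennreal (inverse (lam * h x)) * ennreal (L (\<lambda>y. h y * f y) x)"
          unfolding NL_cmult W1_eq_NL[symmetric] L_eq[OF c elim] transfer_sum_eq_W[OF c hf elim] ..
        also have "\<dots> = ennreal (P f x)"
          using mix.h_pos[of x] mix.lam_pos L_nonneg[OF c hf, of x]
          by (simp add: P_def ennreal_mult[symmetric] divide_inverse mult.commute)
        finally show ?case .
      qed
    qed
    also have "\<dots> = ennreal (\<integral>x. P f x \<partial>\<nu>)"
      using nn_integral_eq_integral[OF int[OF P_cont[OF f(1)]]] P_nonneg[OF f] by simp
    finally show ?thesis
      using P_nonneg[OF f] by (subst (asm) ennreal_le_iff) (auto intro: Bochner_Integration.integral_nonneg)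
  qed
  have eqP: "(\<integral>x. P f x \<partial>\<nu>) = (\<integral>x. f x \<partial>\<nu>)"
    if f: "continuous_on UNIV f" "\<And>x. 0 \<le> f x" for f
  proof (rule antisym)
    obtain B where B: "0 < B" "\<And>x. \<bar>f x\<bar> \<le> B" using bounded_cont[OF f(1)] by blast
    have c: "continuous_on UNIV (\<lambda>x. B - f x)" by (intro continuous_intros f)
    have "B - f x \<ge> 0" for x using B(2)[of x] by linarith
    from leP[OF c this] have 1: "(\<integral>x. B - f x \<partial>\<nu>) \<le> (\<integral>x. P (\<lambda>x. B - f x) x \<partial>\<nu>)" .
    have cB: "P (\<lambda>_. B) x = B" for x
      using mix.h_pos[of x] mix.lam_pos L_scale[OF mix.h_cont, of B] by (simp add: P_def mult.commute mix.L_h)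
    have "P (\<lambda>x. B - f x) x = B - P f x" for x
      using P_add[OF f(1) c, of x] cB[of x] by simp
    then show "(\<integral>x. P f x \<partial>\<nu>) \<le> (\<integral>x. f x \<partial>\<nu>)"
      using 1 int[OF f(1)] int[OF P_cont[OF f(1)]] \<nu>.prob_space by simp
  qed (rule leP[OF f])
  have itn: "0 \<le> (P ^^ n) f x" if f: "continuous_on UNIV f" "\<And>x. 0 \<le> f x" for f n x
    by (induction n arbitrary: x) (auto intro!: P_nonneg P_it_cont f)
  have itP: "(\<integral>x. (P ^^ n) f x \<partial>\<nu>) = (\<integral>x. f x \<partial>\<nu>)" if f: "continuous_on UNIV f" "\<And>x. 0 \<le> f x" for f n
    by (induction n) (simp_all add: eqP[OF P_it_cont[OF f(1)] itn[OF f]])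
  show ?thesis
  proof (rule measure_eqI_continuous[OF compact_UNIV \<nu>.finite_measure_axioms finite_m sets_\<nu> sets_m])
    fix f :: "'a \<Rightarrow> real" assume f: "continuous_on UNIV f" "\<And>x. 0 \<le> f x"
    have "(\<lambda>n. \<integral>x. (P ^^ n) f x \<partial>\<nu>) \<longlonglongrightarrow> (\<integral>x. (\<integral>x. f x \<partial>m) \<partial>\<nu>)"
      by (rule integral_uniform_limit[OF compact_UNIV \<nu>.finite_measure_axioms sets_\<nu> P_it_cont[OF f(1)] P_it_limit[OF f(1)]])
    then show "(\<integral>x. f x \<partial>\<nu>) = (\<integral>x. f x \<partial>m)"
      unfolding itP[OF f] by (simp add: LIMSEQ_const_iff \<nu>.prob_space)
  qed
qed

end

text \<open>The weights of \<open>m\<close> are \<open>gw\<close>, so \<open>quot\<close> is 1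
  almost everywhere, and only \<open>ln lam\<close> and a coboundary of integral 0 remain.\<close>

lemma info_energy_m: "info_energy X X0 T \<phi> m = ereal (ln lam)"
proof -
  note W = m_invariant weights_m
  interpret M0: prob_space "restrict_space m X0" by (rule prob_M0[OF W])
  have "AE y in restrict_space m X0. ln (quot gw y) + ln lam + cob y = ln lam + cob y"
    unfolding AE_M0[OF W] using AE_X0(2)
  proof eventually_elim
    case (elim y)
    have "0 \<le> exp (\<phi> y) * h y / (lam * h (T y))" unfolding exp_psi[symmetric] by simp
    then have "quot gw y = 1"
      using elim by (simp add: quot_def[OF W] gw_eq exp_psi[symmetric])
    then show ?case by simp
  qed
  then have "info_energy X X0 T \<phi> m = ext_integral (restrict_space m X0) (\<lambda>y. ereal (ln lam + cob y))"
    unfolding info_energy_quot[OF W] by (intro ext_integral_cong_AE) (auto elim: eventually_mono)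
  also have "\<dots> = ereal (\<integral>y. ln lam + cob y \<partial>restrict_space m X0)"
    using cob_integral(1)[OF W] by (intro ext_integral_real) auto
  also have "(\<integral>y. ln lam + cob y \<partial>restrict_space m X0) = ln lam"
    using cob_integral[OF W] M0.prob_space by (simp add: space_M0[OF W])
  finally show ?thesis .
qed

theorem variational:
  "ereal (ln lam) = (SUP \<nu>\<in>invariant_measures X X0 T. info_energy X X0 T \<phi> \<nu>)"
  "\<forall>\<nu>\<in>invariant_measures X X0 T. info_energy X X0 T \<phi> \<nu> = ereal (ln lam) \<longleftrightarrow> \<nu> = m"
proof -
  have le: "info_energy X X0 T \<phi> \<nu> \<le> ereal (ln lam)" if \<nu>: "\<nu> \<in> invariant_measures X X0 T" for \<nu>
    using weights_exist[OF \<nu>] info_energy_le[OF \<nu>] by blast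
  show "ereal (ln lam) = (SUP \<nu>\<in>invariant_measures X X0 T. info_energy X X0 T \<phi> \<nu>)"
  proof (rule antisym)
    show "ereal (ln lam) \<le> (SUP \<nu>\<in>invariant_measures X X0 T. info_energy X X0 T \<phi> \<nu>)"
      using m_invariant info_energy_m by (intro SUP_upper2[of m]) auto
  qed (use le in \<open>auto intro: SUP_least\<close>)
  show "\<forall>\<nu>\<in>invariant_measures X X0 T. info_energy X X0 T \<phi> \<nu> = ereal (ln lam) \<longleftrightarrow> \<nu> = m"
  proof (intro ballI iffI)
    fix \<nu> assume \<nu>: "\<nu> \<in> invariant_measures X X0 T" and e: "info_energy X X0 T \<phi> \<nu> = ereal (ln lam)"
    obtain p where p: "weights \<nu> p" using weights_exist[OF \<nu>] by blast
    have "AE y in \<nu>. quot p y = 1" using info_energy_le[OF \<nu> p] e by blast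
    then show "\<nu> = m" by (rule equilibrium_unique[OF \<nu> p quot_one_imp_gw[OF \<nu> p]])
  qed (simp add: info_energy_m)
qed

end

theorem theorem1p2:
  fixes X X0 :: "'a::metric_space set"
    and T :: "'a \<Rightarrow> 'a"
    and \<phi> :: "'a \<Rightarrow> real"
    and \<delta> \<delta>N :: real
    and N :: nat
  assumes "compact (UNIV :: 'a set)"
    and "open X" and "closure X = UNIV"
    and "open X0" and "X0 \<subseteq> X" and "X \<subseteq> closure X0"
    and "continuous_on X0 T" and "T ` X0 \<subseteq> X"
    and "admissible X X0 T \<phi> \<delta>"
    and "N \<ge> 1" and "\<delta>N > 0"
    and "uniform_covering X (T ^^ N) (iter_dom X X0 T N) \<delta>N"
    and "cond_1c_star X X0 T N \<delta>N"
    and "cond_1g X X0 T \<phi> N \<delta>N"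
    and "cond_1e X X0 T N"
  shows
    "\<exists>\<mu> lam h.
      \<comment> \<open>(1)\<close>
      (\<mu> \<in> prob_measures X \<and> lam > 0 \<and> dual_eigen X X0 T \<phi> lam \<mu> \<and>
       is_jacobian X0 T \<mu> (\<lambda>y. lam * exp (- \<phi> y)) \<and>
       (\<forall>lam' \<mu>'. lam' > 0 \<and> \<mu>' \<in> prob_measures X \<and> dual_eigen X X0 T \<phi> lam' \<mu>'
                 \<longrightarrow> lam' = lam \<and> \<mu>' = \<mu>)) \<and>
      \<comment> \<open>(2)\<close>
      (continuous_on UNIV h \<and> (\<forall>x. h x > 0) \<and> (\<integral>x. h x \<partial>\<mu>) = 1 \<and>
       transfer_op X X0 T \<phi> h = (\<lambda>x. lam * h x)) \<and>
      \<comment> \<open>(3)\<close>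
      ((\<forall>x\<in>X. \<forall>x'\<in>X. dist x x' < \<delta>N \<longrightarrow>
          h x \<le> exp (enn2real (distortion X X0 T \<phi> N \<delta>N x x')) * h x') \<and>
       (\<forall>h'. continuous_on UNIV h' \<and> (\<forall>x. h' x > 0) \<and> (\<integral>x. h' x \<partial>\<mu>) = 1 \<and>
             transfer_op X X0 T \<phi> h' = (\<lambda>x. lam * h' x) \<and>
             (\<forall>x\<in>X. \<forall>x'\<in>X. dist x x' < \<delta>N \<longrightarrow>
                h' x \<le> exp (enn2real (distortion X X0 T \<phi> N \<delta>N x x')) * h' x')
             \<longrightarrow> h' = h)) \<and>
      \<comment> \<open>(4)\<close>
      (\<forall>f. continuous_on UNIV f \<longrightarrow>
         uniform_limit UNIV (\<lambda>n x. (transfer_op X X0 T \<phi> ^^ n) f x / lam ^ n)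
           (\<lambda>x. h x * (\<integral>z. f z \<partial>\<mu>)) sequentially) \<and>
      \<comment> \<open>(5)--(7), with m the measure with density h\<close>
      (let m = density \<mu> (\<lambda>x. ennreal (h x));
           \<psi> = (\<lambda>y. \<phi> y - ln lam + ln (h y) - ln (h (T y)))
       in
         (m \<in> invariant_measures X X0 T \<and> gibbs X X0 T \<delta> N \<delta>N \<phi> m \<and>
          dual_eigen X X0 T \<psi> 1 m) \<and>
         (is_pressure X X0 T \<phi> (pressure X X0 T \<phi>) \<and> ln lam = pressure X X0 T \<phi> \<and>
          ereal (ln lam) = (SUP \<nu>\<in>invariant_measures X X0 T. info_energy X X0 T \<phi> \<nu>) \<and>
          (\<forall>\<nu>\<in>invariant_measures X X0 T.
             info_energy X X0 T \<phi> \<nu> = ereal (ln lam) \<longleftrightarrow> \<nu> = m)) \<and>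
         ((\<forall>U. open U \<and> U \<noteq> {} \<longrightarrow> emeasure \<mu> U > 0 \<and> emeasure m U > 0) \<and>
          \<comment> \<open>the one-point space carries only the point mass\<close>
          ((\<forall>p. X \<noteq> {p}) \<longrightarrow> (\<forall>x. emeasure \<mu> {x} = 0 \<and> emeasure m {x} = 0))))"
proof -
  interpret expanding_system X X0 T \<phi> \<delta> \<delta>N N
    by unfold_locales (use assms in auto)
  have limit: "uniform_limit UNIV (\<lambda>n x. (L ^^ n) f x / lam ^ n) (\<lambda>x. h x * (\<integral>z. f z \<partial>mu)) sequentially"
    if "continuous_on UNIV f" for f
    using mix.it_limit[OF that] by (simp add: J_eq[OF that])
  have psi: "psi = (\<lambda>y. \<phi> y - ln lam + ln (h y) - ln (h (T y)))"
    by (simp add: fun_eq_iff psi_def)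
  show ?thesis
    unfolding Let_def
  proof (intro exI[of _ mu] exI[of _ lam] exI[of _ h], unfold m_def[symmetric] psi[symmetric],
      intro conjI allI impI ballI)
    show "mu \<in> prob_measures X" by (rule mu_prob_measures)
    show "lam > 0" by (rule mix.lam_pos)
    show "dual_eigen X X0 T \<phi> lam mu" by (rule dual_eigen_mu)
    show "is_jacobian X0 T mu (\<lambda>y. lam * exp (- \<phi> y))" by (rule jacobian_mu)
    show "continuous_on UNIV h" by (rule mix.h_cont)
    show "h x > 0" for x by (rule mix.h_pos)
    show "(\<integral>x. h x \<partial>mu) = 1" by (rule integral_mu_h)
    show "L h = (\<lambda>x. lam * h x)" by (rule mix.L_h)
    show "h x \<le> exp (enn2real (distortion X X0 T \<phi> N \<delta>N x x')) * h x'"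
      if "x \<in> X" "x' \<in> X" "dist x x' < \<delta>N" for x x'
      using h_distortion[OF that] by (simp add: Cd_def)
    show "m \<in> invariant_measures X X0 T" by (rule m_invariant)
    show "gibbs X X0 T \<delta> N \<delta>N \<phi> m" by (rule gibbs_m)
    show "dual_eigen X X0 T psi 1 m" by (rule dual_eigen_m)
    show "is_pressure X X0 T \<phi> (pressure X X0 T \<phi>)" by (rule pressure(1))
    show "ln lam = pressure X X0 T \<phi>" by (simp add: pressure(2))
    show "ereal (ln lam) = (SUP \<nu>\<in>invariant_measures X X0 T. info_energy X X0 T \<phi> \<nu>)"
      by (rule variational)
    show "info_energy X X0 T \<phi> \<nu> = ereal (ln lam) \<longleftrightarrow> \<nu> = m" if "\<nu> \<in> invariant_measures X X0 T" for \<nu>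
      using variational(2) that by blast
  qed (use eigen_unique h_unique limit emeasure_pos no_atoms in auto)
qed

end
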